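(* Let $\Gamma$ be a connected graph with an essential vertex and let $i\ge 0$ be such that $\Delta^i_\Gamma>1$. For any prime $p$ and $k$ sufficiently large, the order of the $p$-torsion subgroup of $H_i(B_k(\Gamma);\mathbb{Z})$ is equal to $p^{f(k)}$, where $f(k)\in\mathbb{Q}[k]$ is a polynomial of degree strictly less than $\Delta^i_\Gamma-1$.
   Context: A graph is a finite $1$-dimensional CW complex; its $0$-cells are its vertices and its open $1$-cells its edges. The degree (valence) $d(w)$ of a vertex $w$ is the number of components of the complement of $w$ in a small neighborhood of $w$; $w$ is essential if $d(w)\geq 3$. For a graph $\Gamma$, $B_k(\Gamma)=\{(x_1,\dots,x_k)\in\Gamma^k : x_a\neq x_b \text{ if } a\neq b\}/\Sigma_k$ is the $k$th unordered configuration space. For a set $W$ of essential vertices, $\Delta^W_\Gamma$ is the number of connected components of the complement of $W$ in $\Gamma$, and $\Delta^i_\Gamma=\max_{|W|=i}\Delta^W_\Gamma$, the maximum over sets $W$ of essential vertices of cardinality $i$. The $p$-torsion subgroup of an abelian group is, as usual, the subgroup of all elements whose order is a power of $p$. *)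

theory Defs
  imports
    "HOL-Homology.Homology"
    "HOL-Algebra.Multiplicative_Group"
    "HOL-Combinatorics.Permutations"
    "HOL-Computational_Algebra.Polynomial"
    "HOL-Computational_Algebra.Primes"
begin

text \<open>
  A finite CW complex of dimension at most 1 on the space \<open>X\<close>, with 0-cells \<open>V\<close> and open 1-cells
  \<open>E\<close>. Closure-finiteness and the weak topology need no separate clause: since there are finitely
  many cells and \<open>X\<close> is Hausdorff, both hold automatically, and \<open>V\<close> is discrete. Loops and multiple
  edges are allowed.
\<close>

definition graph :: "'a topology \<Rightarrow> 'a set \<Rightarrow> 'a set set \<Rightarrow> bool" where
  "graph X V E \<longleftrightarrow>
     Hausdorff_space X \<and> finite V \<and> finite E \<and>
     V \<subseteq> topspace X \<and> \<Union>E = topspace X - V \<and> disjoint E \<and>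
     (\<forall>e\<in>E. \<exists>c :: real \<Rightarrow> 'a.
        continuous_map (top_of_set {0..1}) X c \<and> c 0 \<in> V \<and> c 1 \<in> V \<and>
        embedding_map (top_of_set {0<..<1}) X c \<and> c ` {0<..<1} = e)"

text \<open>
  ``A small neighborhood'' is read as: every sufficiently small connected open neighborhood. In a
  graph, such a neighborhood is a union of half-open intervals glued at \<open>w\<close>, one for each end of an
  edge at \<open>w\<close>, so the number exists and is unique; a loop contributes 2. Without the
  connectedness requirement the number would depend on the neighborhood.
\<close>

definition valence :: "'a topology \<Rightarrow> 'a \<Rightarrow> nat" where
  "valence X w = (THE d. \<exists>N. openin X N \<and> w \<in> N \<and>
     (\<forall>U. openin X U \<and> connectedin X U \<and> w \<in> U \<and> U \<subseteq> N \<longrightarrow>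
        card (connected_components_of (subtopology X (U - {w}))) = d))"

definition essential_vertices :: "'a topology \<Rightarrow> 'a set \<Rightarrow> 'a set" where
  "essential_vertices X V = {w \<in> V. 3 \<le> valence X w}"

definition num_components_compl :: "'a topology \<Rightarrow> 'a set \<Rightarrow> nat" where
  "num_components_compl X W = card (connected_components_of (subtopology X (topspace X - W)))"

text \<open>
  For a nonempty finite set of natural numbers \<open>Sup\<close> is the maximum; it is \<open>0\<close> for the empty set,
  that is, when there are fewer than \<open>i\<close> essential vertices.
\<close>

definition max_components_compl :: "'a topology \<Rightarrow> 'a set \<Rightarrow> nat \<Rightarrow> nat" where
  "max_components_compl X V i =
     Sup {num_components_compl X W | W. W \<subseteq> essential_vertices X V \<and> finite W \<and> card W = i}"

definition quotient_topology :: "'a topology \<Rightarrow> ('a \<Rightarrow> 'b) \<Rightarrow> 'b topology" where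
  "quotient_topology X q =
     topology (\<lambda>U. U \<subseteq> q ` topspace X \<and> openin X {x \<in> topspace X. q x \<in> U})"

lemma openin_quotient_topology:
  "openin (quotient_topology X q) U \<longleftrightarrow>
     U \<subseteq> q ` topspace X \<and> openin X {x \<in> topspace X. q x \<in> U}"
proof -
  have "istopology (\<lambda>U. U \<subseteq> q ` topspace X \<and> openin X {x \<in> topspace X. q x \<in> U})"
    unfolding istopology_def
  proof (intro conjI allI impI)
    fix S T
    assume S: "S \<subseteq> q ` topspace X \<and> openin X {x \<in> topspace X. q x \<in> S}"
      and T: "T \<subseteq> q ` topspace X \<and> openin X {x \<in> topspace X. q x \<in> T}"
    show "S \<inter> T \<subseteq> q ` topspace X" using S by blast
    have "{x \<in> topspace X. q x \<in> S \<inter> T} = {x \<in> topspace X. q x \<in> S} \<inter> {x \<in> topspace X. q x \<in> T}"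
      by blast
    then show "openin X {x \<in> topspace X. q x \<in> S \<inter> T}" using S T by (simp add: openin_Int)
  next
    fix K
    assume K: "\<forall>S\<in>K. S \<subseteq> q ` topspace X \<and> openin X {x \<in> topspace X. q x \<in> S}"
    show "\<Union>K \<subseteq> q ` topspace X" using K by blast
    have "{x \<in> topspace X. q x \<in> \<Union>K} = (\<Union>S\<in>K. {x \<in> topspace X. q x \<in> S})"
      by blast
    moreover have "openin X (\<Union>S\<in>K. {x \<in> topspace X. q x \<in> S})"
      by (rule openin_Union) (use K in blast)
    ultimately show "openin X {x \<in> topspace X. q x \<in> \<Union>K}" by (simp only:)
  qed
  then show ?thesis
    unfolding quotient_topology_def by (simp only: topology_inverse')
qed

lemma topspace_quotient_topology [simp]: "topspace (quotient_topology X q) = q ` topspace X"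
proof
  show "topspace (quotient_topology X q) \<subseteq> q ` topspace X"
    using openin_topspace[of "quotient_topology X q"]
    by (simp only: openin_quotient_topology)
  have "{x \<in> topspace X. q x \<in> q ` topspace X} = topspace X" by blast
  then have "openin (quotient_topology X q) (q ` topspace X)"
    by (simp add: openin_quotient_topology)
  then show "q ` topspace X \<subseteq> topspace (quotient_topology X q)"
    by (rule openin_subset)
qed

lemma quotient_map_quotient_topology: "quotient_map X (quotient_topology X q) q"
  unfolding quotient_map_def openin_quotient_topology topspace_quotient_topology by blast

definition ordered_config :: "nat \<Rightarrow> 'a topology \<Rightarrow> (nat \<Rightarrow> 'a) topology" where
  "ordered_config k X = subtopology (product_topology (\<lambda>_. X) {..<k}) {x. inj_on x {..<k}}"

definition perm_orbit :: "nat \<Rightarrow> (nat \<Rightarrow> 'a) \<Rightarrow> (nat \<Rightarrow> 'a) set" where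
  "perm_orbit k x = {x \<circ> \<sigma> | \<sigma>. \<sigma> permutes {..<k}}"

definition unordered_config :: "nat \<Rightarrow> 'a topology \<Rightarrow> (nat \<Rightarrow> 'a) set topology" where
  "unordered_config k X = quotient_topology (ordered_config k X) (perm_orbit k)"

text \<open>\<open>group.ord G x\<close> is \<open>0\<close> for elements of infinite order, so these are excluded.\<close>

definition torsion_part :: "nat \<Rightarrow> ('a, 'b) monoid_scheme \<Rightarrow> 'a set" where
  "torsion_part p G = {x \<in> carrier G. \<exists>n. group.ord G x = p ^ n}"

end

theory Submission
  imports Defs
begin

text \<open>
  For an edge \<open>e\<close>, let \<open>F e\<close> put one point between any two consecutive points of a configuration on \<open>e\<close>
  (the ends of \<open>e\<close> included) and forget the old points on \<open>e\<close>, up to a reparametrisation supported in the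
  middle of \<open>e\<close>. These maps commute, so the homology of all unordered configuration spaces together is a
  graded module over the polynomial ring in the edges, and so is the homology of the spaces of
  configurations that avoid a set \<open>W\<close> of vertices.

  Let \<open>v\<close> be a vertex outside \<open>W\<close>. A configuration that avoids \<open>W\<close> avoids \<open>v\<close> as well, or it has a unique
  point closest to \<open>v\<close>. The sets \<open>Q\<close> and \<open>N\<close> of such configurations are open; forgetting the closest point
  turns \<open>N \<inter> Q\<close> into one copy, for each half-edge at \<open>v\<close>, of the configurations that avoid \<open>W\<close> and \<open>v\<close>,
  and \<open>N \<inter> Q \<rightarrow> N\<close> is onto in homology. So the homology for \<open>W\<close> in degree \<open>n\<close> is controlled by that for
  \<open>insert v W\<close> in degrees \<open>n\<close> and \<open>n - 1\<close>. When all vertices are avoided, the components are contractible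
  and the module is cyclic. By induction the modules are Noetherian. Moreover, on configurations that avoid
  \<open>v\<close>, all \<open>F e\<close> with \<open>e\<close> at \<open>v\<close> are homotopic to adding the point \<open>v\<close>; by the same induction, for
  distinct vertices \<open>v\<^sub>1, \<dots>, v\<^sub>i\<close> the product of the \<open>F e\<^sub>j - F e\<^sub>j'\<close> with \<open>e\<^sub>j, e\<^sub>j'\<close> at \<open>v\<^sub>j\<close> kills the
  torsion of \<open>H\<^sub>i\<close>.

  Hence the \<open>p\<close>-torsion of \<open>H\<^sub>i\<close> is filtered by modules on which the operators at all but fewer than \<open>i\<close>
  essential vertices coincide. If \<open>W\<close> is the set of the exceptions, only as many operators remain as there
  are components of the complement of \<open>W\<close>, and since \<open>W\<close> has fewer than \<open>i\<close> elements these are fewer than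
  the maximal number for \<open>i\<close> vertices. The Hilbert polynomial gives the claim.
\<close>

section \<open>Noetherian graded modules\<close>

text \<open>The coefficients are integral, so a polynomial for the order of the
  \<open>p\<close>-torsion presupposes that this torsion is finite in each weight. The Noetherian
  property provides that, for all subquotients of the filtration at once. The reparametrisation
  makes the algebra strict: an operator changes a configuration only in the middle third of its
  edge, while closeness to a vertex is measured in the outer thirds. Hence the operators commute as
  maps of spaces, and commute with forgetting the closest point, so all comparison maps respect the
  operators already on chains. The torsion bound starts in degree 0, where there is no torsion; each
  further degree costs one more difference of operators, since what comes from configurations
  avoiding \<open>v\<close> is killed by such a difference at \<open>v\<close>. The strict
  inequality at the end is combinatorial. Once bivalent vertices are gone, connectedness gives an
  edge from a removed vertex to an essential vertex that is still present. Removing the latter too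
  isolates this edge as a component of its own, and this component is not counted before.\<close>

definition asub :: "'m::ab_group_add set \<Rightarrow> bool" where
  "asub A \<longleftrightarrow> 0 \<in> A \<and> (\<forall>x\<in>A. \<forall>y\<in>A. x - y \<in> A)"

definition addf :: "('m::ab_group_add \<Rightarrow> 'n::ab_group_add) \<Rightarrow> bool" where
  "addf f \<longleftrightarrow> (\<forall>x y. f (x - y) = f x - f y)"

lemma asub_0: "asub A \<Longrightarrow> 0 \<in> A"
  and asub_diff: "asub A \<Longrightarrow> x \<in> A \<Longrightarrow> y \<in> A \<Longrightarrow> x - y \<in> A"
  by (auto simp: asub_def)

lemma asub_uminus: assumes "asub A" "x \<in> A" shows "- x \<in> A"
  using asub_diff[OF assms(1) asub_0[OF assms(1)] assms(2)] by simp

lemma asub_add: assumes "asub A" "x \<in> A" "y \<in> A" shows "x + y \<in> A"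
  using asub_diff[OF assms(1,2) asub_uminus[OF assms(1,3)]] by simp

lemma asub_sum: "asub A \<Longrightarrow> (\<And>i. i \<in> I \<Longrightarrow> f i \<in> A) \<Longrightarrow> sum f I \<in> A"
  by (induction I rule: infinite_finite_induct) (simp_all add: asub_0 asub_add)

lemma asub_cmul: "asub A \<Longrightarrow> x \<in> A \<Longrightarrow> frag_cmul n x \<in> A"
  by (rule frag_closure_minus_cmul[where P="\<lambda>x. x \<in> A"]) (simp_all add: asub_def)

lemma addf_diff: "addf f \<Longrightarrow> f (x - y) = f x - f y"
  unfolding addf_def by blast

lemma addf_0: assumes "addf f" shows "f 0 = 0"
  using addf_diff[OF assms, of 0 0] by simp

lemma addf_uminus: assumes "addf f" shows "f (- x) = - f x"
  using addf_diff[OF assms, of 0 x] addf_0[OF assms] by simp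

lemma addf_add: assumes "addf f" shows "f (x + y) = f x + f y"
  using addf_diff[OF assms, of x "- y"] addf_uminus[OF assms, of y] by simp

lemma addf_id: "addf (\<lambda>x. x)"
  by (simp add: addf_def)

lemma addf_funpow: "addf (f :: 'm::ab_group_add \<Rightarrow> 'm) \<Longrightarrow> addf (f ^^ j)"
  by (induction j) (auto simp: addf_def)

lemma addf_comp: "addf f \<Longrightarrow> addf g \<Longrightarrow> addf (\<lambda>x. f (g x))"
  by (simp add: addf_def)

lemma addf_cmul:
  fixes f :: "('z \<Rightarrow>\<^sub>0 int) \<Rightarrow> ('y \<Rightarrow>\<^sub>0 int)"
  assumes f: "addf f" shows "f (frag_cmul n x) = frag_cmul n (f x)"
proof -
  have nn: "f (frag_cmul (int m) x) = frag_cmul (int m) (f x)" for m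
  proof (induction m)
    case 0 show ?case by (simp add: addf_0[OF f])
  next
    case (Suc m)
    have eq: "frag_cmul (int (Suc m)) y = y + frag_cmul (int m) y" for y :: "'z \<Rightarrow>\<^sub>0 int"
      by (simp only: of_nat_Suc frag_cmul_distrib frag_cmul_one)
    have eq': "frag_cmul (int (Suc m)) y = y + frag_cmul (int m) y" for y :: "'y \<Rightarrow>\<^sub>0 int"
      by (simp only: of_nat_Suc frag_cmul_distrib frag_cmul_one)
    show ?case by (simp only: eq eq' addf_add[OF f] Suc.IH)
  qed
  show ?thesis
  proof (cases "n \<ge> 0")
    case True then show ?thesis using nn[of "nat n"] by simp
  next
    case False
    then have n: "n = - int (nat (- n))" by simp
    have "f (- frag_cmul (int (nat (- n))) x) = - frag_cmul (int (nat (- n))) (f x)"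
      by (simp only: addf_uminus[OF f] nn)
    then show ?thesis by (simp only: minus_frag_cmul flip: n)
  qed
qed

lemma asub_vimage: "addf f \<Longrightarrow> asub A \<Longrightarrow> asub C \<Longrightarrow> asub {x \<in> C. f x \<in> A}"
  unfolding asub_def by (simp add: addf_0[of f] addf_diff[of f])

lemma asub_plus:
  assumes "asub A" "asub B" shows "asub {x + y | x y. x \<in> A \<and> y \<in> B}"
  unfolding asub_def
proof (intro conjI ballI)
  show "0 \<in> {x + y | x y. x \<in> A \<and> y \<in> B}"
    using asub_0[OF assms(1)] asub_0[OF assms(2)] by force
next
  fix u v assume "u \<in> {x + y | x y. x \<in> A \<and> y \<in> B}" "v \<in> {x + y | x y. x \<in> A \<and> y \<in> B}"
  then obtain a b c d where "u = a + b" "v = c + d" "a \<in> A" "b \<in> B" "c \<in> A" "d \<in> B"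
    by blast
  then have "u - v = (a - c) + (b - d)" "a - c \<in> A" "b - d \<in> B"
    using asub_diff[OF assms(1)] asub_diff[OF assms(2)] by simp_all
  then show "u - v \<in> {x + y | x y. x \<in> A \<and> y \<in> B}" by blast
qed

lemma asub_image: assumes f: "addf f" and A: "asub A" shows "asub (f ` A)"
  unfolding asub_def
proof (intro conjI ballI)
  show "0 \<in> f ` A" using addf_0[OF f] asub_0[OF A] by (metis image_eqI)
  fix u v assume "u \<in> f ` A" "v \<in> f ` A"
  then obtain x y where "u = f x" "v = f y" "x \<in> A" "y \<in> A" by blast
  then show "u - v \<in> f ` A"
    using addf_diff[OF f, of x y] asub_diff[OF A, of x y] by (metis image_eqI)
qed

text \<open>A graded module over the polynomial ring with variables \<open>E\<close> is encoded as a quotient \<open>A / B\<close> of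
  families of subgroups of one ambient group: \<open>A k / B k\<close> is its part of degree \<open>k\<close>, and \<open>\<phi> e\<close> maps
  degree \<open>k\<close> to degree \<open>Suc k\<close>.\<close>

definition submod :: "('e \<Rightarrow> 'm \<Rightarrow> 'm::ab_group_add) \<Rightarrow> 'e set \<Rightarrow> (nat \<Rightarrow> 'm set) \<Rightarrow> bool" where
  "submod \<phi> E N \<longleftrightarrow> (\<forall>k. asub (N k)) \<and> (\<forall>e\<in>E. \<forall>k. \<forall>x\<in>N k. \<phi> e x \<in> N (Suc k))"

text \<open>The ascending chain condition takes the place of finite generation because it passes to
  submodules and quotients at once, with the ambient group and the operators left as they
  are.\<close>

definition noeth :: "('e \<Rightarrow> 'm \<Rightarrow> 'm::ab_group_add) \<Rightarrow> 'e set \<Rightarrow> (nat \<Rightarrow> 'm set) \<Rightarrow> (nat \<Rightarrow> 'm set) \<Rightarrow> bool" where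
  "noeth \<phi> E A B \<longleftrightarrow> (\<forall>N. incseq N \<and> (\<forall>j. submod \<phi> E (N j) \<and> B \<le> N j \<and> N j \<le> A)
      \<longrightarrow> (\<exists>j0. \<forall>j\<ge>j0. N j = N j0))"

lemma submodI:
  "(\<And>k. asub (N k)) \<Longrightarrow> (\<And>e k x. e \<in> E \<Longrightarrow> x \<in> N k \<Longrightarrow> \<phi> e x \<in> N (Suc k)) \<Longrightarrow> submod \<phi> E N"
  by (auto simp: submod_def)

lemma submod_asub: "submod \<phi> E N \<Longrightarrow> asub (N k)"
  and submod_act: "submod \<phi> E N \<Longrightarrow> e \<in> E \<Longrightarrow> x \<in> N k \<Longrightarrow> \<phi> e x \<in> N (Suc k)"
  by (auto simp: submod_def)

lemma submod_subset: "submod \<phi> E N \<Longrightarrow> E' \<subseteq> E \<Longrightarrow> submod \<phi> E' N"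
  by (auto simp: submod_def)

lemma noethD:
  assumes "noeth \<phi> E A B" "incseq N" "\<And>j. submod \<phi> E (N j)" "\<And>j. B \<le> N j" "\<And>j. N j \<le> A"
  shows "\<exists>j0. \<forall>j\<ge>j0. N j = N j0"
  using assms unfolding noeth_def by blast

lemma le_gradedD: "B \<le> (A :: nat \<Rightarrow> 'm set) \<Longrightarrow> x \<in> B k \<Longrightarrow> x \<in> A k"
  by (auto simp: le_fun_def)

text \<open>Exactness in the middle of \<open>A1 / B1\<close>, \<open>A / B\<close>,
  \<open>A2 / B2\<close> suffices: a chain in \<open>A / B\<close> is controlled by its preimages
  under \<open>f\<close> and its images under \<open>g\<close>. The operators of the three modules
  may differ, as they do for chains of adjacent degrees.\<close>

lemma noeth_middle:
  assumes N1: "noeth \<phi>1 E A1 B1" and N2: "noeth \<phi>2 E A2 B2"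
    and A1: "submod \<phi>1 E A1" and B2: "submod \<phi>2 E B2" and BA: "B1 \<le> A1" "B2 \<le> A2"
    and add: "addf f" "addf g" "\<And>e. e \<in> E \<Longrightarrow> addf (\<phi>2 e)"
    and fA: "\<And>k x. x \<in> A1 k \<Longrightarrow> f x \<in> A k"
    and fB: "\<And>k x. x \<in> B1 k \<Longrightarrow> f x \<in> B k"
    and fphi: "\<And>e k x. e \<in> E \<Longrightarrow> x \<in> A1 k \<Longrightarrow> f (\<phi>1 e x) = \<phi> e (f x)"
    and gA: "\<And>k x. x \<in> A k \<Longrightarrow> g x \<in> A2 k"
    and gphi: "\<And>e k x. e \<in> E \<Longrightarrow> x \<in> A k \<Longrightarrow> g (\<phi> e x) = \<phi>2 e (g x)"
    and ex: "\<And>k x. x \<in> A k \<Longrightarrow> g x \<in> B2 k \<Longrightarrow> \<exists>a\<in>A1 k. x - f a \<in> B k"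
    and asA2: "\<And>k. asub (A2 k)"
  shows "noeth \<phi> E A B"
  unfolding noeth_def
proof (intro allI impI, elim conjE)
  fix N
  assume inc: "incseq N" and N: "\<forall>j. submod \<phi> E (N j) \<and> B \<le> N j \<and> N j \<le> A"
  have sub: "submod \<phi> E (N j)" "B \<le> N j" "N j \<le> A" for j using N by auto
  have incN: "x \<in> N i k \<Longrightarrow> i \<le> j \<Longrightarrow> x \<in> N j k" for i j k x
    using inc by (meson incseqD le_gradedD)
  define P where "P j k = {a \<in> A1 k. f a \<in> N j k}" for j k
  define Q where "Q j k = {x + b | x b. x \<in> g ` N j k \<and> b \<in> B2 k}" for j k
  have "\<exists>j1. \<forall>j\<ge>j1. P j = P j1"
  proof (rule noethD[OF N1])
    show "incseq P" unfolding incseq_def le_fun_def P_def using incN by auto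
    show "submod \<phi>1 E (P j)" for j
    proof (rule submodI)
      show "asub (P j k)" for k
        unfolding P_def by (rule asub_vimage[OF add(1) submod_asub[OF sub(1)] submod_asub[OF A1]])
      show "\<phi>1 e x \<in> P j (Suc k)" if "e \<in> E" "x \<in> P j k" for e k x
        using that fphi[of e x k] submod_act[OF sub(1)] submod_act[OF A1] unfolding P_def by simp
    qed
    show "B1 \<le> P j" for j
    proof (rule le_funI, rule subsetI)
      fix k x assume "x \<in> B1 k"
      then show "x \<in> P j k"
        unfolding P_def using le_gradedD[OF BA(1)] le_gradedD[OF sub(2)] fB by blast
    qed
    show "P j \<le> A1" for j unfolding P_def le_fun_def by auto
  qed
  then obtain j1 where j1: "\<And>j. j \<ge> j1 \<Longrightarrow> P j = P j1" by blast
  have "\<exists>j2. \<forall>j\<ge>j2. Q j = Q j2"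
  proof (rule noethD[OF N2])
    show "incseq Q" unfolding incseq_def le_fun_def Q_def using incN by blast
    show "submod \<phi>2 E (Q j)" for j
    proof (rule submodI)
      show "asub (Q j k)" for k unfolding Q_def
        by (intro asub_plus asub_image add submod_asub[OF sub(1)] submod_asub[OF B2])
      fix e k x assume e: "e \<in> E" "x \<in> Q j k"
      then obtain y b where "x = g y + b" "y \<in> N j k" "b \<in> B2 k" unfolding Q_def by blast
      moreover have "g (\<phi> e y) = \<phi>2 e (g y)" using gphi e(1) \<open>y \<in> N j k\<close> le_gradedD[OF sub(3)] by blast
      ultimately have "\<phi>2 e x = g (\<phi> e y) + \<phi>2 e b" by (simp add: addf_add[OF add(3)[OF e(1)]])
      moreover have "\<phi> e y \<in> N j (Suc k)" "\<phi>2 e b \<in> B2 (Suc k)"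
        using submod_act[OF sub(1) e(1) \<open>y \<in> N j k\<close>] submod_act[OF B2 e(1) \<open>b \<in> B2 k\<close>] by auto
      ultimately show "\<phi>2 e x \<in> Q j (Suc k)" unfolding Q_def by blast
    qed
    show "B2 \<le> Q j" for j
    proof (rule le_funI, rule subsetI)
      fix k x assume "x \<in> B2 k"
      moreover have "0 \<in> g ` N j k"
        using asub_0[OF submod_asub[OF sub(1)]] addf_0[OF add(2)] by force
      ultimately show "x \<in> Q j k" unfolding Q_def by force
    qed
    show "Q j \<le> A2" for j
    proof (rule le_funI, rule subsetI)
      fix k x assume "x \<in> Q j k"
      then obtain y b where "x = g y + b" "y \<in> N j k" "b \<in> B2 k" unfolding Q_def by blast
      then show "x \<in> A2 k"
        using gA[OF le_gradedD[OF sub(3)]] le_gradedD[OF BA(2)] asub_add[OF asA2] by simp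
    qed
  qed
  then obtain j2 where j2: "\<And>j. j \<ge> j2 \<Longrightarrow> Q j = Q j2" by blast
  show "\<exists>j0. \<forall>j\<ge>j0. N j = N j0"
  proof (intro exI allI impI)
    fix j assume j: "max j1 j2 \<le> j"
    let ?m = "max j1 j2"
    show "N j = N ?m"
    proof (rule antisym)
      show "N ?m \<le> N j" using inc j by (simp add: incseqD)
      \<comment> \<open>Subtract from \<open>x\<close> an element \<open>y\<close> of the earlier
        stage with the same image modulo \<open>B2\<close>. By exactness the difference comes from
        some \<open>a\<close>, and \<open>a\<close> lies in a preimage that has already
        stabilised.\<close>
      show "N j \<le> N ?m"
      proof (rule le_funI, rule subsetI)
        fix k x assume x: "x \<in> N j k"
        have "g x \<in> Q j k" unfolding Q_def using x asub_0[OF submod_asub[OF B2]] by force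
        then have "g x \<in> Q ?m k" using j2[of j] j2[of ?m] j by simp
        then obtain y b where y: "g x = g y + b" "y \<in> N ?m k" "b \<in> B2 k" unfolding Q_def by blast
        have yj: "y \<in> N j k" using y(2) incN j by blast
        have "g (x - y) \<in> B2 k" using y by (simp add: addf_diff[OF add(2)])
        moreover have xy: "x - y \<in> N j k" using x yj by (simp add: asub_diff submod_asub[OF sub(1)])
        ultimately obtain a where a: "a \<in> A1 k" "x - y - f a \<in> B k"
          using ex le_gradedD[OF sub(3)] by blast
        have "f a \<in> N j k"
        proof -
          have "f a = (x - y) - (x - y - f a)" by simp
          then show ?thesis using xy le_gradedD[OF sub(2)] a(2)
            by (metis asub_diff submod_asub[OF sub(1)])
        qed
        then have "a \<in> P j k" using a unfolding P_def by simp
        then have "a \<in> P ?m k" using j1[of j] j1[of ?m] j by simp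
        then have fa: "f a \<in> N ?m k" unfolding P_def by simp
        have "x = y + (f a + (x - y - f a))" by simp
        then show "x \<in> N ?m k"
          using y(2) fa le_gradedD[OF sub(2) a(2)] by (metis asub_add submod_asub[OF sub(1)])
      qed
    qed
  qed
qed

lemma noeth_refl: "noeth \<phi> E A A"
  unfolding noeth_def
proof (intro allI impI)
  fix N assume "incseq N \<and> (\<forall>j. submod \<phi> E (N j) \<and> A \<le> N j \<and> N j \<le> A)"
  then have "N j = A" for j by (blast intro: antisym)
  then show "\<exists>j0. \<forall>j\<ge>j0. N j = N j0" by simp
qed

lemma noeth_mono:
  assumes "noeth \<phi> E A B" "B \<le> B'" "A' \<le> A" shows "noeth \<phi> E A' B'"
  unfolding noeth_def
proof (intro allI impI, elim conjE)
  fix N assume "incseq N" "\<forall>j. submod \<phi> E (N j) \<and> B' \<le> N j \<and> N j \<le> A'"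
  then show "\<exists>j0. \<forall>j\<ge>j0. N j = N j0"
    using assms(2,3) by (intro noethD[OF assms(1)]) (auto intro: order_trans)
qed

lemma noeth_ext:
  assumes "noeth \<phi> E A C" "noeth \<phi> E C B" "submod \<phi> E C" "B \<le> C" "C \<le> A"
    "\<And>k. asub (A k)" "\<And>k. asub (B k)" "\<And>e. e \<in> E \<Longrightarrow> addf (\<phi> e)"
  shows "noeth \<phi> E A B"
proof (rule noeth_middle[where f="\<lambda>x. x" and g="\<lambda>x. x", OF assms(2,1,3,3,4,5)])
  show "\<exists>a\<in>C k. x - a \<in> B k" if "x \<in> C k" for x k
    using that asub_0[OF assms(7)] by (metis diff_self)
qed (assumption | rule assms addf_id order_refl refl le_gradedD[OF assms(5)] le_gradedD[OF assms(4)])+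

text \<open>\<open>noeth_middle\<close> with the zero module \<open>B / B\<close> on the left: a map
  that is injective on quotients reflects the chain condition.\<close>

lemma noeth_inj:
  assumes "noeth \<phi>2 E A2 B2" "submod \<phi>2 E B2" "B2 \<le> A2" "submod \<phi> E B"
    "addf g" "\<And>e. e \<in> E \<Longrightarrow> addf (\<phi>2 e)" "\<And>k. asub (A2 k)"
    and gA: "\<And>k x. x \<in> A k \<Longrightarrow> g x \<in> A2 k" and BA: "B \<le> A"
    and gphi: "\<And>e k x. e \<in> E \<Longrightarrow> x \<in> A k \<Longrightarrow> g (\<phi> e x) = \<phi>2 e (g x)"
    and inj: "\<And>k x. x \<in> A k \<Longrightarrow> g x \<in> B2 k \<Longrightarrow> x \<in> B k"
  shows "noeth \<phi> E A B"
proof (rule noeth_middle[where f="\<lambda>x. x" and g=g and ?A1.0=B and ?B1.0=B and ?\<phi>1.0=\<phi>, OF noeth_refl assms(1)])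
  show "\<exists>a\<in>B k. x - a \<in> B k" if "x \<in> A k" "g x \<in> B2 k" for x k
    using inj[OF that] asub_0[OF submod_asub[OF assms(4)]] by (metis diff_self)
qed (assumption | rule assms addf_id submod_asub[OF assms(4)] order_refl refl le_gradedD[OF BA])+

text \<open>\<open>noeth_middle\<close> with the zero module \<open>A / A\<close> on the
  right.\<close>

lemma noeth_surj:
  assumes "noeth \<phi>1 E A1 B1" "submod \<phi>1 E A1" "B1 \<le> A1" "submod \<phi> E A"
    "addf f" "\<And>e. e \<in> E \<Longrightarrow> addf (\<phi> e)"
    and fA: "\<And>k x. x \<in> A1 k \<Longrightarrow> f x \<in> A k"
    and fB: "\<And>k x. x \<in> B1 k \<Longrightarrow> f x \<in> B k"
    and fphi: "\<And>e k x. e \<in> E \<Longrightarrow> x \<in> A1 k \<Longrightarrow> f (\<phi>1 e x) = \<phi> e (f x)"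
    and ex: "\<And>k x. x \<in> A k \<Longrightarrow> \<exists>a\<in>A1 k. x - f a \<in> B k"
  shows "noeth \<phi> E A B"
  by (rule noeth_middle[where f=f and g="\<lambda>x. x" and ?A2.0=A and ?B2.0=A and ?\<phi>2.0=\<phi>, OF assms(1) noeth_refl])
     (assumption | rule assms addf_id submod_asub[OF assms(4)] order_refl refl)+

text \<open>The maps \<open>g h\<close> together embed \<open>A / B\<close> in a finite power of
  \<open>A2 / B2\<close>. Instead of forming that power, the proof inserts the common kernel
  \<open>C\<close> of all maps but one: \<open>A / C\<close> is covered by induction, and
  \<open>C / B\<close> embeds in a single copy.\<close>

lemma noeth_joint_inj:
  assumes "finite H"
    "\<And>h. h \<in> H \<Longrightarrow> noeth \<phi>2 E A2 B2" "submod \<phi>2 E B2" "B2 \<le> A2" "submod \<phi> E A"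
    and "\<And>h. h \<in> H \<Longrightarrow> addf (g h)" "\<And>e. e \<in> E \<Longrightarrow> addf (\<phi>2 e)" "\<And>k. asub (A2 k)"
    and "\<And>e. e \<in> E \<Longrightarrow> addf (\<phi> e)"
    and "\<And>h k x. h \<in> H \<Longrightarrow> x \<in> A k \<Longrightarrow> g h x \<in> A2 k"
    and "\<And>h k x. h \<in> H \<Longrightarrow> x \<in> B k \<Longrightarrow> g h x \<in> B2 k"
    and "\<And>h e k x. h \<in> H \<Longrightarrow> e \<in> E \<Longrightarrow> x \<in> A k \<Longrightarrow> g h (\<phi> e x) = \<phi>2 e (g h x)"
    and "\<And>k x. x \<in> A k \<Longrightarrow> (\<And>h. h \<in> H \<Longrightarrow> g h x \<in> B2 k) \<Longrightarrow> x \<in> B k"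
    and "submod \<phi> E B" "B \<le> A"
  shows "noeth \<phi> E A B"
  using assms
proof (induction H arbitrary: B rule: finite_induct)
  case empty
  have "x \<in> B k" if "x \<in> A k" for x k by (rule empty(12)) (use that in auto)
  then have "A = B" by (intro antisym empty(14)) (auto simp: le_fun_def)
  then show ?case by (simp add: noeth_refl)
next
  case (insert h H)
  define C where "C k = {x \<in> A k. \<forall>h'\<in>H. g h' x \<in> B2 k}" for k
  have asB2: "asub (B2 k)" for k using insert.prems(2) by (simp add: submod_asub)
  have asA: "asub (A k)" for k using insert.prems(4) by (simp add: submod_asub)
  have C: "submod \<phi> E C"
  proof (rule submodI)
    show "asub (C k)" for k
    proof -
      have "addf (g h')" if "h' \<in> H" for h' using insert.prems(5) that by blast
      then have "g h' 0 = 0" "g h' (x - y) = g h' x - g h' y" if "h' \<in> H" for h' x y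
        using that by (blast intro: addf_0 addf_diff)+
      then show ?thesis
        unfolding C_def asub_def
        by (simp add: asub_0[OF asA] asub_0[OF asB2] asub_diff[OF asA] asub_diff[OF asB2])
    qed
    show "\<phi> e x \<in> C (Suc k)" if "e \<in> E" "x \<in> C k" for e k x
    proof -
      have "g h' (\<phi> e x) = \<phi>2 e (g h' x)" if "h' \<in> H" for h'
        by (rule insert.prems(11)) (use that \<open>e \<in> E\<close> \<open>x \<in> C k\<close> in \<open>auto simp: C_def\<close>)
      with that show ?thesis
        using submod_act[OF insert.prems(4)] submod_act[OF insert.prems(2)] unfolding C_def by simp
    qed
  qed
  have BC: "B \<le> C"
    using insert.prems(14) insert.prems(10) unfolding C_def le_fun_def by (simp add: subset_eq)
  have CA: "C \<le> A" unfolding C_def le_fun_def by auto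
  have N2: "noeth \<phi>2 E A2 B2" using insert.prems by blast
  have 1: "noeth \<phi> E A C"
  proof (rule insert.IH)
    show "\<And>h. h \<in> H \<Longrightarrow> noeth \<phi>2 E A2 B2" by (simp add: N2)
    show "x \<in> C k" if "x \<in> A k" "\<And>h. h \<in> H \<Longrightarrow> g h x \<in> B2 k" for k x
      using that unfolding C_def by simp
    show "g h x \<in> B2 k" if "h \<in> H" "x \<in> C k" for h k x using that unfolding C_def by simp
    show "submod \<phi>2 E B2" "B2 \<le> A2" "submod \<phi> E A" by fact+
    show "addf (g h)" if "h \<in> H" for h using insert.prems(5) that by blast
    show "\<And>e. e \<in> E \<Longrightarrow> addf (\<phi>2 e)" "\<And>k. asub (A2 k)" "\<And>e. e \<in> E \<Longrightarrow> addf (\<phi> e)" by fact+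
    show "g h x \<in> A2 k" if "h \<in> H" "x \<in> A k" for h k x using insert.prems(9) that by blast
    show "g h (\<phi> e x) = \<phi>2 e (g h x)" if "h \<in> H" "e \<in> E" "x \<in> A k" for h e k x
      using insert.prems(11) that by blast
  qed (rule C CA)+
  have 2: "noeth \<phi> E C B"
  proof (rule noeth_inj[where g="g h", OF N2 insert.prems(2,3)])
    show "submod \<phi> E B" by fact
    show "addf (g h)" using insert.prems(5) by blast
    show "\<And>e. e \<in> E \<Longrightarrow> addf (\<phi>2 e)" by fact
    show "\<And>k. asub (A2 k)" by fact
    show "g h x \<in> A2 k" if "x \<in> C k" for k x using that insert.prems(9) unfolding C_def by blast
    show "B \<le> C" by fact
    show "g h (\<phi> e x) = \<phi>2 e (g h x)" if "e \<in> E" "x \<in> C k" for e k x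
      using that insert.prems(11) unfolding C_def by blast
    show "x \<in> B k" if "x \<in> C k" "g h x \<in> B2 k" for k x
      by (rule insert.prems(12)) (use that in \<open>auto simp: C_def\<close>)
  qed
  show ?case
    by (rule noeth_ext[OF 1 2 C BC CA asA submod_asub[OF insert.prems(13)]]) (rule insert.prems(8))
qed

text \<open>Forgetting a point lowers the weight by one. Shifting the target, with the zero module
  in weight 0, turns such a map into one that preserves weights.\<close>

lemma noeth_shift:
  fixes A B :: "nat \<Rightarrow> 'm::ab_group_add set"
  assumes "noeth \<phi> E A B" and asub0: "asub (B 0)" and B: "\<And>e x. e \<in> E \<Longrightarrow> \<phi> e 0 = 0"
  shows "noeth \<phi> E (\<lambda>k. case k of 0 \<Rightarrow> {0} | Suc j \<Rightarrow> A j) (\<lambda>k. case k of 0 \<Rightarrow> {0} | Suc j \<Rightarrow> B j)"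
  unfolding noeth_def
proof (intro allI impI, elim conjE)
  fix N assume inc: "incseq N" and N: "\<forall>j. submod \<phi> E (N j) \<and> (\<lambda>k. case k of 0 \<Rightarrow> {0} | Suc j \<Rightarrow> B j) \<le> N j \<and> N j \<le> (\<lambda>k. case k of 0 \<Rightarrow> {0} | Suc j \<Rightarrow> A j)"
  have N2: "(\<lambda>k. case k of 0 \<Rightarrow> {0} | Suc j \<Rightarrow> B j) \<le> N j" "N j \<le> (\<lambda>k. case k of 0 \<Rightarrow> {0} | Suc j \<Rightarrow> A j)" for j
    using N by simp_all
  have N1: "(case k of 0 \<Rightarrow> {0} | Suc i \<Rightarrow> B i) \<subseteq> N j k" "N j k \<subseteq> (case k of 0 \<Rightarrow> {0} | Suc i \<Rightarrow> A i)" for j k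
    using le_funD[OF N2(1)[of j], of k] le_funD[OF N2(2)[of j], of k] by simp_all
  have 0: "N j 0 = {0}" for j
    using N1[where k=0 and j=j] by auto
  have "\<exists>j0. \<forall>j\<ge>j0. (\<lambda>k. N j (Suc k)) = (\<lambda>k. N j0 (Suc k))"
  proof (rule noethD[OF assms(1)])
    show "incseq (\<lambda>j k. N j (Suc k))" using inc by (auto simp: incseq_def le_fun_def)
    show "submod \<phi> E (\<lambda>k. N j (Suc k))" for j
    proof -
      have "submod \<phi> E (N j)" using N by blast
      then show ?thesis unfolding submod_def by blast
    qed
    show "B \<le> (\<lambda>k. N j (Suc k))" "(\<lambda>k. N j (Suc k)) \<le> A" for j
      using N1[where j=j and k="Suc k" for k] unfolding le_fun_def nat.case by blast+
  qed
  then obtain j0 where j0: "\<And>j. j \<ge> j0 \<Longrightarrow> (\<lambda>k. N j (Suc k)) = (\<lambda>k. N j0 (Suc k))" by blast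
  have "N j = N j0" if "j \<ge> j0" for j
  proof
    fix k show "N j k = N j0 k"
      using 0[of j] 0[of j0] fun_cong[OF j0[OF that], of "k - 1"] by (cases k) simp_all
  qed
  then show "\<exists>j0. \<forall>j\<ge>j0. N j = N j0" by blast
qed

text \<open>Polynomials in \<psi> of degree less than \<open>j\<close> with coefficients in
  \<open>D\<close>, taken in weight \<open>k\<close>. The coefficient of \<open>\<psi> ^^ i\<close>
  has weight \<open>k - i\<close>, so it has to vanish for \<open>i > k\<close>, where truncated
  subtraction would give a wrong weight.\<close>

primrec pfil :: "('m::ab_group_add \<Rightarrow> 'm) \<Rightarrow> (nat \<Rightarrow> 'm set) \<Rightarrow> nat \<Rightarrow> nat \<Rightarrow> 'm set" where
  "pfil \<psi> D 0 k = {0}"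
| "pfil \<psi> D (Suc j) k =
     {(\<psi> ^^ j) a + y | a y. y \<in> pfil \<psi> D j k \<and> (if j \<le> k then a \<in> D (k - j) else a = 0)}"

lemma pfil_SucI:
  "y \<in> pfil \<psi> D j k \<Longrightarrow> (if j \<le> k then a \<in> D (k - j) else a = 0) \<Longrightarrow> (\<psi> ^^ j) a + y \<in> pfil \<psi> D (Suc j) k"
  unfolding pfil.simps by blast

lemma pfil_SucE:
  assumes "x \<in> pfil \<psi> D (Suc j) k"
  obtains a y where "x = (\<psi> ^^ j) a + y" "y \<in> pfil \<psi> D j k" "if j \<le> k then a \<in> D (k - j) else a = 0"
  using assms unfolding pfil.simps by blast

lemma asub_pfil:
  assumes psi: "addf \<psi>" and D: "\<And>k. asub (D k)"
  shows "asub (pfil \<psi> D j k)"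
proof (induction j)
  case 0 show ?case by (simp add: asub_def)
next
  case (Suc j)
  note fp = addf_funpow[OF psi, of j]
  have if0: "if j \<le> k then 0 \<in> D (k - j) else (0::'a) = 0" using asub_0[OF D] by simp
  show ?case unfolding asub_def
  proof (intro conjI ballI)
    have "(\<psi> ^^ j) 0 + 0 \<in> pfil \<psi> D (Suc j) k"
      by (rule pfil_SucI[OF asub_0[OF Suc.IH] if0])
    then show "0 \<in> pfil \<psi> D (Suc j) k" by (simp add: addf_0[OF fp])
    fix u v assume "u \<in> pfil \<psi> D (Suc j) k" "v \<in> pfil \<psi> D (Suc j) k"
    then obtain a y b z where u: "u = (\<psi> ^^ j) a + y" "y \<in> pfil \<psi> D j k" "if j \<le> k then a \<in> D (k - j) else a = 0"
      and v: "v = (\<psi> ^^ j) b + z" "z \<in> pfil \<psi> D j k" "if j \<le> k then b \<in> D (k - j) else b = 0"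
      by (metis pfil_SucE)
    have "u - v = (\<psi> ^^ j) (a - b) + (y - z)"
      using addf_diff[OF fp, of a b] u v by simp
    moreover have "(\<psi> ^^ j) (a - b) + (y - z) \<in> pfil \<psi> D (Suc j) k"
      by (rule pfil_SucI[OF asub_diff[OF Suc.IH u(2) v(2)]])
         (use u(3) v(3) asub_diff[OF D[of "k - j"], of a b] in \<open>simp split: if_splits\<close>)
    ultimately show "u - v \<in> pfil \<psi> D (Suc j) k" by simp
  qed
qed

lemma pfil_Suc_mono:
  assumes psi: "addf \<psi>" and D: "\<And>k. asub (D k)" and y: "y \<in> pfil \<psi> D j k"
  shows "y \<in> pfil \<psi> D (Suc j) k"
proof -
  have "(\<psi> ^^ j) 0 + y \<in> pfil \<psi> D (Suc j) k"
    by (rule pfil_SucI[OF y]) (use asub_0[OF D] in simp)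
  then show ?thesis by (simp add: addf_0[OF addf_funpow[OF psi]])
qed

lemma pfil_mono:
  assumes "addf \<psi>" "\<And>k. asub (D k)" "y \<in> pfil \<psi> D i k" "i \<le> j"
  shows "y \<in> pfil \<psi> D j k"
  using assms(4,3) by (induction rule: dec_induct) (auto intro: pfil_Suc_mono[OF assms(1,2)] simp del: pfil.simps)

lemma pfil_step:
  assumes psi: "addf \<psi>" and D: "\<And>k. asub (D k)" and y: "y \<in> pfil \<psi> D j k"
  shows "\<psi> y \<in> pfil \<psi> D (Suc j) (Suc k)"
  using y
proof (induction j arbitrary: y)
  case 0
  have "0 \<in> pfil \<psi> D (Suc 0) (Suc k)" by (rule asub_0[OF asub_pfil[OF psi D]])
  then show ?case using 0 addf_0[OF psi] by simp
next
  case (Suc j)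
  obtain a z where y: "y = (\<psi> ^^ j) a + z" "z \<in> pfil \<psi> D j k" "if j \<le> k then a \<in> D (k - j) else a = 0"
    using Suc.prems by (rule pfil_SucE)
  have "\<psi> y = (\<psi> ^^ Suc j) a + \<psi> z" using y by (simp add: addf_add[OF psi])
  moreover have "(\<psi> ^^ Suc j) a + \<psi> z \<in> pfil \<psi> D (Suc (Suc j)) (Suc k)"
    by (rule pfil_SucI[OF Suc.IH[OF y(2)]]) (use y(3) in simp)
  ultimately show ?case by simp
qed

lemma pfil_act:
  assumes psi: "addf \<psi>" and D: "\<And>k. asub (D k)" and y: "y \<in> pfil \<psi> D j k"
    and t: "addf \<theta>" "\<And>k x. x \<in> D k \<Longrightarrow> \<theta> x \<in> D (Suc k)"
    and comm: "\<And>k x i. x \<in> D k \<Longrightarrow> \<theta> ((\<psi> ^^ i) x) = (\<psi> ^^ i) (\<theta> x)"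
  shows "\<theta> y \<in> pfil \<psi> D j (Suc k)"
  using y
proof (induction j arbitrary: y)
  case 0 then show ?case using addf_0[OF t(1)] by simp
next
  case (Suc j)
  obtain a z where y: "y = (\<psi> ^^ j) a + z" "z \<in> pfil \<psi> D j k" "if j \<le> k then a \<in> D (k - j) else a = 0"
    using Suc.prems by (rule pfil_SucE)
  show ?case
  proof (cases "j \<le> k")
    case True
    have "\<theta> y = (\<psi> ^^ j) (\<theta> a) + \<theta> z"
      using y comm[of a "k - j" j] True addf_add[OF t(1)] by simp
    moreover have "(\<psi> ^^ j) (\<theta> a) + \<theta> z \<in> pfil \<psi> D (Suc j) (Suc k)"
      by (rule pfil_SucI[OF Suc.IH[OF y(2)]]) (use y(3) t(2)[of a "k - j"] True in \<open>simp add: Suc_diff_le\<close>)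
    ultimately show ?thesis by simp
  next
    case False
    then have "y = z" using y(1,3) addf_0[OF addf_funpow[OF psi], of j] by simp
    then show ?thesis using pfil_Suc_mono[where D=D, OF psi D Suc.IH[OF y(2)]] by (simp only:)
  qed
qed

text \<open>The proof of Hilbert's basis theorem, for a module generated over \<open>D\<close> by
  the powers of one new operator. Representations as polynomials in that operator need not be
  unique, so a leading coefficient is a property of a chosen representation.\<close>

lemma noeth_adjoin:
  fixes \<phi> :: "'e \<Rightarrow> 'm \<Rightarrow> 'm::ab_group_add"
  assumes add: "\<And>e'. e' \<in> insert e E \<Longrightarrow> addf (\<phi> e')"
    and A: "submod \<phi> (insert e E) A" and B: "submod \<phi> (insert e E) B" and D: "submod \<phi> E D"
    and BD: "B \<le> D" and DA: "D \<le> A" and N: "noeth \<phi> E D B"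
    and comm: "\<And>e' k x. e' \<in> E \<Longrightarrow> x \<in> A k \<Longrightarrow> \<phi> e' (\<phi> e x) = \<phi> e (\<phi> e' x)"
    and gen: "\<And>k x. x \<in> A k \<Longrightarrow> \<exists>j. x \<in> pfil (\<phi> e) D j k"
  shows "noeth \<phi> (insert e E) A B"
  unfolding noeth_def
proof (intro allI impI, elim conjE)
  fix N :: "nat \<Rightarrow> nat \<Rightarrow> 'm set"
  assume inc: "incseq N" and N': "\<forall>j. submod \<phi> (insert e E) (N j) \<and> B \<le> N j \<and> N j \<le> A"
  let ?\<psi> = "\<phi> e"
  have sub: "submod \<phi> (insert e E) (N j)" "B \<le> N j" "N j \<le> A" for j using N' by simp_all
  have incN: "x \<in> N i k \<Longrightarrow> i \<le> j \<Longrightarrow> x \<in> N j k" for i j k x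
    using inc by (meson incseqD le_gradedD)
  have psi: "addf ?\<psi>" using add by simp
  have asD: "asub (D k)" and asA: "asub (A k)" and asN: "asub (N m k)" for k m
    using D A sub(1) by (auto intro: submod_asub)
  have Apsi: "\<phi> e x \<in> A (Suc k)" if "x \<in> A k" for x k by (rule submod_act[OF A _ that]) simp
  have pwA: "(?\<psi> ^^ i) x \<in> A (l + i)" if "x \<in> A l" for x i l
    using that by (induction i) (simp_all add: Apsi)
  have comm': "\<phi> e' ((?\<psi> ^^ i) x) = (?\<psi> ^^ i) (\<phi> e' x)" if "e' \<in> E" "x \<in> A k" for e' i k x
  proof (induction i)
    case (Suc i)
    then show ?case using comm[OF that(1) pwA[OF that(2), of i]] by simp
  qed simp
  let ?G = "pfil ?\<psi> D"
  have asG: "asub (?G j k)" for j k by (rule asub_pfil[OF psi asD])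
  \<comment> \<open>Leading coefficients of the elements of \<open>N m\<close> that have a
    representation of degree at most \<open>j\<close>. They are indexed by their own weight
    \<open>k\<close>, while the element has weight \<open>k + j\<close>.\<close>
  define L where "L m j k = {a \<in> D k. \<exists>y\<in>?G j (k + j). (?\<psi> ^^ j) a + y \<in> N m (k + j)}" for m j k
  have Lsub: "submod \<phi> E (L m j)" for m j
  proof (rule submodI)
    fix k
    note fp = addf_funpow[OF psi, of j]
    show "asub (L m j k)" unfolding asub_def
    proof (intro conjI ballI)
      show "0 \<in> L m j k" unfolding L_def
        using asub_0[OF asD] asub_0[OF asG] asub_0[OF asN]
        by (auto simp: addf_0[OF fp] simp del: pfil.simps intro!: bexI[of _ 0])
      fix a b assume "a \<in> L m j k" "b \<in> L m j k"
      then obtain y z where y: "a \<in> D k" "y \<in> ?G j (k + j)" "(?\<psi> ^^ j) a + y \<in> N m (k + j)"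
        and z: "b \<in> D k" "z \<in> ?G j (k + j)" "(?\<psi> ^^ j) b + z \<in> N m (k + j)" unfolding L_def by blast
      have "(?\<psi> ^^ j) (a - b) + (y - z) = ((?\<psi> ^^ j) a + y) - ((?\<psi> ^^ j) b + z)"
        using addf_diff[OF fp, of a b] by simp
      then have "(?\<psi> ^^ j) (a - b) + (y - z) \<in> N m (k + j)" using asub_diff[OF asN y(3) z(3)] by (simp only:)
      then show "a - b \<in> L m j k" unfolding L_def
        using asub_diff[OF asD y(1) z(1)] asub_diff[OF asG y(2) z(2)] by blast
    qed
  next
    fix e' k a assume e': "e' \<in> E" and "a \<in> L m j k"
    then obtain y where y: "a \<in> D k" "y \<in> ?G j (k + j)" "(?\<psi> ^^ j) a + y \<in> N m (k + j)"
      unfolding L_def by blast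
    have ad: "addf (\<phi> e')" using add e' by simp
    have "\<phi> e' ((?\<psi> ^^ j) a + y) = (?\<psi> ^^ j) (\<phi> e' a) + \<phi> e' y"
      using comm'[OF e' le_gradedD[OF DA y(1)], of j] addf_add[OF ad] by simp
    moreover have "\<phi> e' ((?\<psi> ^^ j) a + y) \<in> N m (Suc (k + j))"
      by (rule submod_act[OF sub(1) _ y(3)]) (use e' in simp)
    moreover have "\<phi> e' y \<in> ?G j (Suc (k + j))"
      by (rule pfil_act[where D=D, OF psi asD y(2) ad submod_act[OF D e'] comm'[OF e' le_gradedD[OF DA]]])
    ultimately show "\<phi> e' a \<in> L m j (Suc k)" unfolding L_def
      using submod_act[OF D e' y(1)] by auto
  qed
  have LB: "B \<le> L m j" for m j
  proof (rule le_funI, rule subsetI)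
    fix k x assume x: "x \<in> B k"
    have "(?\<psi> ^^ j) x \<in> B (k + j)"
      by (induction j) (use x submod_act[OF B, of e] in simp_all)
    then have "(?\<psi> ^^ j) x + 0 \<in> N m (k + j)" using le_gradedD[OF sub(2)] by simp
    then show "x \<in> L m j k" unfolding L_def
      using le_gradedD[OF BD x] asub_0[OF asG] by blast
  qed
  have LD: "L m j \<le> D" for m j unfolding L_def le_fun_def by blast
  have Lj: "L m j \<le> L m (Suc j)" for m j
  proof (rule le_funI, rule subsetI)
    fix k a assume "a \<in> L m j k"
    then obtain y where y: "a \<in> D k" "y \<in> ?G j (k + j)" "(?\<psi> ^^ j) a + y \<in> N m (k + j)"
      unfolding L_def by blast
    have "?\<psi> ((?\<psi> ^^ j) a + y) \<in> N m (Suc (k + j))"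
      by (rule submod_act[OF sub(1) _ y(3)]) simp
    then have "(?\<psi> ^^ Suc j) a + ?\<psi> y \<in> N m (k + Suc j)" using addf_add[OF psi] by simp
    moreover have "?\<psi> y \<in> ?G (Suc j) (k + Suc j)"
      using pfil_step[where D=D, OF psi asD y(2)] by simp
    ultimately show "a \<in> L m (Suc j) k" unfolding L_def using y(1) by blast
  qed
  have Ljj: "L m i \<le> L m j" if "i \<le> j" for m i j
    using lift_Suc_mono_le[of "L m", OF Lj that] .
  have Lm: "L m j \<le> L m' j" if "m \<le> m'" for m m' j
    unfolding L_def le_fun_def using incN[OF _ that] by blast
  \<comment> \<open>\<open>L\<close> grows in both indices. The diagonal chain settles all degrees
    from \<open>m0\<close> on; the finitely many smaller degrees are then treated one by
    one.\<close>
  have "\<exists>m0. \<forall>m\<ge>m0. L m m = L m0 m0"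
  proof (rule noethD[OF N])
    show "incseq (\<lambda>m. L m m)"
    proof (rule incseq_SucI)
      fix m have "L m m \<le> L (Suc m) m" by (rule Lm) simp
      also have "\<dots> \<le> L (Suc m) (Suc m)" by (rule Lj)
      finally show "L m m \<le> L (Suc m) (Suc m)" .
    qed
  qed (rule Lsub LB LD)+
  then obtain m0 where m0: "\<And>m. m \<ge> m0 \<Longrightarrow> L m m = L m0 m0" by blast
  have "\<exists>m1. \<forall>m\<ge>m1. L m j = L m1 j" for j
  proof (rule noethD[OF N])
    show "incseq (\<lambda>m. L m j)" unfolding incseq_def using Lm by blast
  qed (rule Lsub LB LD)+
  then obtain m1 where m1: "\<And>j m. m \<ge> m1 j \<Longrightarrow> L m j = L (m1 j) j" by metis
  define M where "M = Max (insert m0 (m1 ` {..<m0}))"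
  have M: "m0 \<le> M" "\<And>j. j < m0 \<Longrightarrow> m1 j \<le> M" unfolding M_def by auto
  have stab: "L m j \<le> L M j" if "m \<ge> M" for m j
  proof (cases "j < m0")
    case True
    then show ?thesis using m1[of j m] m1[of j M] M(2)[OF True] that by simp
  next
    case False
    let ?x = "max m j"
    have "L m j \<le> L ?x ?x" using Lm[of m ?x j] Ljj[of j ?x ?x] by (meson order_trans max.cobounded1 max.cobounded2)
    also have "\<dots> = L m0 m0" using m0[of ?x] False by simp
    also have "\<dots> \<le> L M j" using Lm[OF M(1), of m0] Ljj[of m0 j M] False by (meson order_trans not_less)
    finally show ?thesis .
  qed
  \<comment> \<open>Induction on the degree: the leading coefficient of \<open>x\<close> also occurs
    in \<open>N M\<close>, and subtracting the corresponding element of \<open>N M\<close> lowers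
    the degree.\<close>
  have key: "x \<in> N M k" if "m \<ge> M" "x \<in> N m k" "x \<in> ?G j k" for m x k j
    using that(2,3)
  proof (induction j arbitrary: x)
    case 0 then show ?case using asub_0[OF asN] by simp
  next
    case (Suc j)
    obtain a y where y: "x = (?\<psi> ^^ j) a + y" "y \<in> ?G j k" "if j \<le> k then a \<in> D (k - j) else a = 0"
      using Suc.prems(2) by (rule pfil_SucE)
    show ?case
    proof (cases "j \<le> k")
      case False
      then have "x = y" using y addf_0[OF addf_funpow[OF psi], of j] by simp
      then show ?thesis using Suc y by simp
    next
      case True
      then have "a \<in> L m j (k - j)" unfolding L_def using y Suc.prems(1) by auto
      then have "a \<in> L M j (k - j)" using le_gradedD[OF stab[OF that(1)]] by blast
      then obtain y' where y': "y' \<in> ?G j k" "(?\<psi> ^^ j) a + y' \<in> N M k"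
        unfolding L_def using True by auto
      have eq: "y - y' = x - ((?\<psi> ^^ j) a + y')" using y(1) by simp
      have "y - y' \<in> N m k" unfolding eq by (rule asub_diff[OF asN Suc.prems(1) incN[OF y'(2) that(1)]])
      then have "y - y' \<in> N M k" by (rule Suc.IH[OF _ asub_diff[OF asG y(2) y'(1)]])
      then have "((?\<psi> ^^ j) a + y') + (y - y') \<in> N M k" using asub_add[OF asN y'(2)] by blast
      then show ?thesis using y(1) by simp
    qed
  qed
  show "\<exists>j0. \<forall>j\<ge>j0. N j = N j0"
  proof (intro exI allI impI antisym)
    fix m assume m: "M \<le> m"
    then show "N M \<le> N m" using inc by (simp add: incseqD)
    show "N m \<le> N M"
    proof (rule le_funI, rule subsetI)
      fix k x assume x: "x \<in> N m k"
      then obtain j where "x \<in> ?G j k" using gen le_gradedD[OF sub(3)] by blast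
      then show "x \<in> N M k" using key[OF m x] by blast
    qed
  qed
qed

section \<open>Subgroups of the integers, and cyclic modules\<close>

lemma int_subgroup_principal:
  assumes "asub (I :: int set)"
  obtains d where "d \<in> I" "\<And>z. z \<in> I \<longleftrightarrow> d dvd z"
proof (cases "I = {0}")
  case True then show ?thesis using that[of 0] by simp
next
  case False
  then obtain z where z: "z \<in> I" "z \<noteq> 0" using asub_0[OF assms] by blast
  have mult: "c * x \<in> I" if "x \<in> I" for c x
  proof -
    have "int n * x \<in> I" for n
      by (induction n) (use asub_0[OF assms] asub_add[OF assms] that in \<open>simp_all add: algebra_simps\<close>)
    then have *: "\<bar>c\<bar> * x \<in> I" by (metis zero_le_imp_eq_int abs_ge_zero)
    then show ?thesis using asub_uminus[OF assms *] by (cases "c \<ge> 0") simp_all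
  qed
  let ?P = "\<lambda>n. n > 0 \<and> int n \<in> I"
  have "sgn z * z = \<bar>z\<bar>" by (simp add: sgn_mult_abs abs_sgn)
  then have "\<bar>z\<bar> \<in> I" using mult[OF z(1), of "sgn z"] by metis
  then have "?P (nat \<bar>z\<bar>)" using z(2) by simp
  then have d: "?P (LEAST n. ?P n)" by (rule LeastI)
  let ?d = "LEAST n. ?P n"
  show ?thesis
  proof (rule that[of "int ?d"])
    show "int ?d \<in> I" using d by simp
    fix x show "x \<in> I \<longleftrightarrow> int ?d dvd x"
    proof
      assume "x \<in> I"
      then have "x - (x div int ?d) * int ?d \<in> I" using asub_diff[OF assms] mult d by blast
      then have m: "x mod int ?d \<in> I" by (simp add: minus_div_mult_eq_mod)
      have "x mod int ?d < int ?d" "x mod int ?d \<ge> 0" using d by simp_all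
      then have "nat (x mod int ?d) < ?d" by linarith
      then have "\<not> ?P (nat (x mod int ?d))" by (rule not_less_Least)
      then have "x mod int ?d = 0" using m \<open>x mod int ?d \<ge> 0\<close> by auto
      then show "int ?d dvd x" by (rule mod_0_imp_dvd)
    next
      assume "int ?d dvd x" then show "x \<in> I" using mult[of "int ?d"] d by (auto simp: dvd_def mult.commute)
    qed
  qed
qed

lemma int_subgroup_acc:
  assumes "\<And>j. asub (I j :: int set)" "incseq I"
  shows "\<exists>j0. \<forall>j\<ge>j0. I j = I j0"
proof -
  have inc: "z \<in> I i \<Longrightarrow> i \<le> j \<Longrightarrow> z \<in> I j" for z i j using assms(2) by (meson incseqD subsetD)
  have "asub (\<Union>j. I j)"
    unfolding asub_def
  proof (intro conjI ballI)
    show "0 \<in> (\<Union>j. I j)" using asub_0[OF assms(1)] by blast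
    fix x y assume "x \<in> (\<Union>j. I j)" "y \<in> (\<Union>j. I j)"
    then obtain i j where "x \<in> I i" "y \<in> I j" by blast
    then have "x \<in> I (max i j)" "y \<in> I (max i j)" using inc by auto
    then show "x - y \<in> (\<Union>j. I j)" using asub_diff[OF assms(1)] by blast
  qed
  then obtain d where d: "d \<in> (\<Union>j. I j)" "\<And>z. z \<in> (\<Union>j. I j) \<longleftrightarrow> d dvd z"
    using int_subgroup_principal by metis
  then obtain j0 where j0: "d \<in> I j0" by blast
  obtain d' where d': "\<And>z. z \<in> I j0 \<longleftrightarrow> d' dvd z"
    using int_subgroup_principal[OF assms(1)] by metis
  have "I j = I j0" if "j \<ge> j0" for j
  proof
    show "I j0 \<subseteq> I j" using inc that by blast
    show "I j \<subseteq> I j0"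
    proof
      fix z assume "z \<in> I j"
      then have "d dvd z" using d(2) by blast
      then show "z \<in> I j0" using d' j0 dvd_trans by blast
    qed
  qed
  then show ?thesis by blast
qed

text \<open>The submodule generated by \<open>g\<close>, in weight 0, over \<open>B\<close>. The set
  of operators is a parameter, so that operators can be adjoined one at a time.\<close>

inductive mgen :: "('e \<Rightarrow> 'm \<Rightarrow> 'm::ab_group_add) \<Rightarrow> (nat \<Rightarrow> 'm set) \<Rightarrow> 'm \<Rightarrow> 'e set \<Rightarrow> nat \<Rightarrow> 'm \<Rightarrow> bool"
  for \<phi> B g E where
  mgen_gen: "mgen \<phi> B g E 0 g"
| mgen_base: "x \<in> B k \<Longrightarrow> mgen \<phi> B g E k x"
| mgen_diff: "mgen \<phi> B g E k x \<Longrightarrow> mgen \<phi> B g E k y \<Longrightarrow> mgen \<phi> B g E k (x - y)"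
| mgen_act: "mgen \<phi> B g E k x \<Longrightarrow> e \<in> E \<Longrightarrow> mgen \<phi> B g E (Suc k) (\<phi> e x)"

lemma submod_mgen:
  assumes "\<And>k. asub (B k)" shows "submod \<phi> E (\<lambda>k. Collect (mgen \<phi> B g E k))"
  by (rule submodI) (auto simp: asub_def intro: mgen.intros asub_0[OF assms])

lemma mgen_mono: "mgen \<phi> B g E k x \<Longrightarrow> E \<subseteq> E' \<Longrightarrow> mgen \<phi> B g E' k x"
  by (induction rule: mgen.induct) (auto intro: mgen.intros)

text \<open>The operators are adjoined one at a time by the basis theorem; without operators the
  chain condition is that of the integers. The module \<open>A\<close> is there to express
  commutation: operators on chains commute on chains in actual configuration spaces, and nothing is
  known about other chains.\<close>

lemma noeth_cyclic:
  fixes \<phi> :: "'e \<Rightarrow> ('c \<Rightarrow>\<^sub>0 int) \<Rightarrow> ('c \<Rightarrow>\<^sub>0 int)"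
  assumes "finite E" and add: "\<And>e. e \<in> E \<Longrightarrow> addf (\<phi> e)"
    and A: "submod \<phi> E A" and B: "submod \<phi> E B" and BA: "B \<le> A" and g: "g \<in> A 0"
    and comm: "\<And>e e' k x. e \<in> E \<Longrightarrow> e' \<in> E \<Longrightarrow> x \<in> A k \<Longrightarrow> \<phi> e' (\<phi> e x) = \<phi> e (\<phi> e' x)"
  shows "noeth \<phi> E (\<lambda>k. Collect (mgen \<phi> B g E k)) B"
  using assms
proof (induction E rule: finite_induct)
  case empty
  have asB: "asub (B k)" for k using B by (rule submod_asub)
  \<comment> \<open>Without operators nothing leaves weight 0, so the quotient by \<open>B\<close>
    is a cyclic group in weight 0 and zero in all other weights.\<close>
  have form: "\<exists>z. \<exists>b\<in>B k. x = (if k = 0 then frag_cmul z g else 0) + b" if "mgen \<phi> B g {} k x" for k x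
    using that
  proof (induction rule: mgen.induct)
    case mgen_gen show ?case using asub_0[OF asB] by (intro exI[of _ 1] bexI[of _ 0]) auto
  next
    case (mgen_base x k) then show ?case by (intro exI[of _ 0] bexI[of _ x]) auto
  next
    case (mgen_diff k x y)
    then obtain z b z' b' where "x = (if k = 0 then frag_cmul z g else 0) + b" "b \<in> B k"
      "y = (if k = 0 then frag_cmul z' g else 0) + b'" "b' \<in> B k" by blast
    then show ?case using asub_diff[OF asB, of b k b']
      by (intro exI[of _ "z - z'"] bexI[of _ "b - b'"]) (auto simp: frag_cmul_diff_distrib)
  qed auto
  show ?case unfolding noeth_def
  proof (intro allI impI, elim conjE)
    fix N assume inc: "incseq N" and N': "\<forall>j. submod \<phi> {} (N j) \<and> B \<le> N j \<and> N j \<le> (\<lambda>k. Collect (mgen \<phi> B g {} k))"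
    have sub: "submod \<phi> {} (N j)" "B \<le> N j" "N j \<le> (\<lambda>k. Collect (mgen \<phi> B g {} k))" for j using N' by simp_all
    have asN: "asub (N m k)" for m k using sub(1) by (rule submod_asub)
    have incN: "x \<in> N i k \<Longrightarrow> i \<le> j \<Longrightarrow> x \<in> N j k" for i j k x
      using inc by (meson incseqD le_gradedD)
    define I where "I j = {z. frag_cmul z g \<in> N j 0}" for j
    have "\<exists>j0. \<forall>j\<ge>j0. I j = I j0"
    proof (rule int_subgroup_acc)
      show "incseq I" unfolding incseq_def I_def using incN by blast
      show "asub (I j)" for j unfolding asub_def I_def
        using asub_0[OF asN] asub_diff[OF asN] by (auto simp: frag_cmul_diff_distrib)
    qed
    then obtain j0 where j0: "\<And>j. j \<ge> j0 \<Longrightarrow> I j = I j0" by blast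
    have "N j = N j0" if "j \<ge> j0" for j
    proof (rule antisym)
      show "N j0 \<le> N j" using inc that by (simp add: incseqD)
      show "N j \<le> N j0"
      proof (rule le_funI, rule subsetI)
        fix k x assume x: "x \<in> N j k"
        then have "mgen \<phi> B g {} k x" using le_gradedD[OF sub(3)] by blast
        then obtain z b where b: "b \<in> B k" "x = (if k = 0 then frag_cmul z g else 0) + b" using form by blast
        have bN: "b \<in> N i k" for i using le_gradedD[OF sub(2) b(1)] .
        show "x \<in> N j0 k"
        proof (cases "k = 0")
          case False then show ?thesis using b bN by simp
        next
          case True
          have "frag_cmul z g \<in> N j 0" using asub_diff[OF asN x bN] b(2) True by simp
          then have "frag_cmul z g \<in> N j0 0" using j0[OF that] unfolding I_def by blast
          then show ?thesis using asub_add[OF asN _ bN[of j0]] b(2) True by simp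
        qed
      qed
    qed
    then show "\<exists>j0. \<forall>j\<ge>j0. N j = N j0" by blast
  qed
next
  case (insert e E)
  let ?M = "\<lambda>E k. Collect (mgen \<phi> B g E k)"
  have addE: "addf (\<phi> e')" if "e' \<in> E" for e' using insert.prems(1) that by simp
  have BE: "submod \<phi> E B" and AE: "submod \<phi> E A"
    using insert.prems by (auto intro: submod_subset)
  have IH: "noeth \<phi> E (?M E) B"
    by (rule insert.IH[OF addE AE BE insert.prems(4,5) insert.prems(6)]) auto
  have asB: "asub (B k)" for k using insert.prems(3) by (rule submod_asub)
  have asM: "asub (?M E k)" for E k by (rule submod_asub[OF submod_mgen[OF asB]])
  have psi: "addf (\<phi> e)" using insert.prems(1) by simp
  have Mle: "x \<in> A k" if "mgen \<phi> B g (insert e E) k x" for k x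
    using that
  proof (induction rule: mgen.induct)
    case (mgen_act k x e') then show ?case using submod_act[OF insert.prems(2)] by blast
  qed (use insert.prems(5) le_gradedD[OF insert.prems(4)] asub_diff[OF submod_asub[OF insert.prems(2)]] in auto)
  have ME: "x \<in> A k" if "mgen \<phi> B g E k x" for k x by (rule Mle[OF mgen_mono[OF that]]) auto
  have comm: "\<phi> e' (\<phi> e x) = \<phi> e (\<phi> e' x)" if "e' \<in> E" "x \<in> A k" for e' k x
    by (rule insert.prems(6)[OF _ _ that(2)]) (use that(1) in auto)
  have Apsi: "\<phi> e x \<in> A (Suc k)" if "x \<in> A k" for x k by (rule submod_act[OF insert.prems(2) _ that]) simp
  have pwA: "(\<phi> e ^^ i) x \<in> A (l + i)" if "x \<in> A l" for x i l
    using that by (induction i) (simp_all add: Apsi)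
  have comm': "\<phi> e' ((\<phi> e ^^ i) x) = (\<phi> e ^^ i) (\<phi> e' x)" if "e' \<in> E" "x \<in> A k" for e' i k x
  proof (induction i)
    case (Suc i)
    then show ?case using comm[OF that(1) pwA[OF that(2), of i]] by simp
  qed simp
  show ?case
  proof (rule noeth_adjoin[where D="?M E"])
    show "addf (\<phi> e')" if "e' \<in> insert e E" for e' using insert.prems(1)[OF that] .
    show "submod \<phi> (insert e E) (?M (insert e E))" by (rule submod_mgen[OF asB])
    show "submod \<phi> E (?M E)" by (rule submod_mgen[OF asB])
    show "B \<le> ?M E" by (auto simp: le_fun_def intro: mgen_base)
    show "?M E \<le> ?M (insert e E)" by (auto simp: le_fun_def intro: mgen_mono)
    show "\<phi> e' (\<phi> e x) = \<phi> e (\<phi> e' x)" if "e' \<in> E" "x \<in> ?M (insert e E) k" for e' k x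
      using comm[OF that(1) Mle] that(2) by blast
    show "\<exists>j. x \<in> pfil (\<phi> e) (?M E) j k" if x: "x \<in> ?M (insert e E) k" for k x
    proof -
      have one: "\<exists>j. x \<in> pfil (\<phi> e) (?M E) j k" if "mgen \<phi> B g E k x" for k x
      proof -
        have "((\<phi> e) ^^ 0) x + 0 \<in> pfil (\<phi> e) (?M E) (Suc 0) k"
          by (rule pfil_SucI) (use that in simp_all)
        then show ?thesis by (intro exI[of _ "Suc 0"]) (simp del: pfil.simps)
      qed
      have "mgen \<phi> B g (insert e E) k x" using x by simp
      then show ?thesis
      proof (induction rule: mgen.induct)
        case mgen_gen show ?case by (rule one[OF mgen.mgen_gen])
      next
        case (mgen_base x k) then show ?case by (intro one mgen.mgen_base)
      next
        case (mgen_diff k x y)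
        then obtain i j where "x \<in> pfil (\<phi> e) (?M E) i k" "y \<in> pfil (\<phi> e) (?M E) j k" by blast
        then have "x \<in> pfil (\<phi> e) (?M E) (max i j) k" "y \<in> pfil (\<phi> e) (?M E) (max i j) k"
          using pfil_mono[where D="?M E", OF psi asM] by (meson max.cobounded1 max.cobounded2)+
        then show ?case using asub_diff[OF asub_pfil[where D="?M E", OF psi asM]] by blast
      next
        case (mgen_act k x e')
        then obtain j where j: "x \<in> pfil (\<phi> e) (?M E) j k" by blast
        show ?case
        proof (cases "e' = e")
          case True then show ?thesis using pfil_step[where D="?M E", OF psi asM j] by blast
        next
          case False
          then have e': "e' \<in> E" using mgen_act by simp
          have "\<phi> e' x \<in> pfil (\<phi> e) (?M E) j (Suc k)"
            by (rule pfil_act[where D="?M E", OF psi asM j addE[OF e']])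
               (use e' ME in \<open>auto intro: mgen.mgen_act comm'\<close>)
          then show ?thesis by blast
        qed
      qed
    qed
  qed (rule insert.prems IH)+
qed

section \<open>Hilbert functions of torsion modules\<close>

definition adcoset :: "'m::ab_group_add set \<Rightarrow> 'm \<Rightarrow> 'm set" where
  "adcoset B x = {y. y - x \<in> B}"

definition quo :: "'m::ab_group_add set \<Rightarrow> 'm set \<Rightarrow> 'm set set" where
  "quo A B = adcoset B ` A"

lemma adcoset_eq_iff: assumes "asub B" shows "adcoset B x = adcoset B y \<longleftrightarrow> x - y \<in> B"
proof
  assume "adcoset B x = adcoset B y"
  moreover have "x \<in> adcoset B x" using asub_0[OF assms] by (simp add: adcoset_def)
  ultimately show "x - y \<in> B" by (simp add: adcoset_def)
next
  assume d: "x - y \<in> B"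
  have "z - x \<in> B \<longleftrightarrow> z - y \<in> B" for z
  proof
    assume "z - x \<in> B" then show "z - y \<in> B" using asub_add[OF assms _ d] by fastforce
  next
    assume "z - y \<in> B" then show "z - x \<in> B" using asub_diff[OF assms _ d] by fastforce
  qed
  then show "adcoset B x = adcoset B y" by (simp add: adcoset_def)
qed

lemma card_image_cong_kernel:
  assumes "\<And>x y. x \<in> A \<Longrightarrow> y \<in> A \<Longrightarrow> g x = g y \<longleftrightarrow> h x = h y"
  shows "\<exists>f. bij_betw f (g ` A) (h ` A)"
proof -
  define r where "r X = (SOME x. x \<in> A \<and> g x = X)" for X
  have r: "r X \<in> A \<and> g (r X) = X" if "X \<in> g ` A" for X
    unfolding r_def by (rule someI_ex) (use that in blast)
  have "bij_betw (\<lambda>X. h (r X)) (g ` A) (h ` A)"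
  proof (rule bij_betwI')
    show "h (r X) = h (r Y) \<longleftrightarrow> X = Y" if "X \<in> g ` A" "Y \<in> g ` A" for X Y
      using r[OF that(1)] r[OF that(2)] assms[of "r X" "r Y"] by simp
    show "h (r X) \<in> h ` A" if "X \<in> g ` A" for X using r[OF that] by blast
    show "\<exists>X\<in>g ` A. y = h (r X)" if "y \<in> h ` A" for y
    proof -
      obtain x where x: "x \<in> A" "y = h x" using \<open>y \<in> h ` A\<close> by blast
      have "g x \<in> g ` A" using x(1) by blast
      then have "h x = h (r (g x))" using r[of "g x"] x(1) assms[of x "r (g x)"] by simp
      then show ?thesis using x by blast
    qed
  qed
  then show ?thesis by blast
qed

lemma quo_self: assumes "asub B" shows "quo B B = {adcoset B 0}"
proof -
  have "adcoset B x = adcoset B 0" if "x \<in> B" for x using that by (simp add: adcoset_eq_iff[OF assms])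
  then have "adcoset B ` B = (\<lambda>_. adcoset B 0) ` B" by (rule image_cong[OF refl])
  then show ?thesis unfolding quo_def using asub_0[OF assms] by (simp only: image_constant)
qed

text \<open>Lagrange's theorem through representatives: \<open>r\<close> and \<open>s\<close> choose
  elements of the cosets, and a coset of \<open>B\<close> in \<open>A\<close> is split into its
  coset of \<open>C\<close> and the remaining part inside \<open>C\<close>.\<close>

lemma quo_mult:
  assumes as: "asub A" "asub B" "asub C" and sub: "B \<subseteq> C" "C \<subseteq> A"
  shows "\<exists>f. bij_betw f (quo A C \<times> quo C B) (quo A B)"
proof -
  define r where "r X = (SOME x. x \<in> A \<and> adcoset C x = X)" for X
  have r: "r X \<in> A \<and> adcoset C (r X) = X" if "X \<in> quo A C" for X
    unfolding r_def by (rule someI_ex) (use that in \<open>auto simp: quo_def\<close>)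
  define s where "s X = (SOME x. x \<in> C \<and> adcoset B x = X)" for X
  have s: "s X \<in> C \<and> adcoset B (s X) = X" if "X \<in> quo C B" for X
    unfolding s_def by (rule someI_ex) (use that in \<open>auto simp: quo_def\<close>)
  have "bij_betw (\<lambda>(X, Y). adcoset B (r X + s Y)) (quo A C \<times> quo C B) (quo A B)"
  proof (rule bij_betwI')
    fix P Q assume "P \<in> quo A C \<times> quo C B" "Q \<in> quo A C \<times> quo C B"
    then obtain X Y X' Y' where PQ: "P = (X, Y)" "Q = (X', Y')" "X \<in> quo A C" "Y \<in> quo C B" "X' \<in> quo A C" "Y' \<in> quo C B"
      by blast
    show "(case P of (X, Y) \<Rightarrow> adcoset B (r X + s Y)) = (case Q of (X, Y) \<Rightarrow> adcoset B (r X + s Y)) \<longleftrightarrow> P = Q"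
    proof
      assume "(case P of (X, Y) \<Rightarrow> adcoset B (r X + s Y)) = (case Q of (X, Y) \<Rightarrow> adcoset B (r X + s Y))"
      then have d: "(r X + s Y) - (r X' + s Y') \<in> B" by (simp add: PQ adcoset_eq_iff[OF as(2)])
      have "((r X + s Y) - (r X' + s Y')) - (s Y - s Y') \<in> C"
        using subsetD[OF sub(1) d] asub_diff[OF as(3)] s[OF PQ(4)] s[OF PQ(6)] by blast
      then have "r X - r X' \<in> C" by (simp add: algebra_simps)
      then have "adcoset C (r X) = adcoset C (r X')" by (simp only: adcoset_eq_iff[OF as(3)])
      then have X: "X = X'" using r[OF PQ(3)] r[OF PQ(5)] by simp
      then have "s Y - s Y' \<in> B" using d by simp
      then have "adcoset B (s Y) = adcoset B (s Y')" by (simp only: adcoset_eq_iff[OF as(2)])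
      then have "Y = Y'" using s[OF PQ(4)] s[OF PQ(6)] by simp
      then show "P = Q" using X PQ by simp
    qed (simp)
  next
    fix P assume "P \<in> quo A C \<times> quo C B"
    then obtain X Y where "P = (X, Y)" "X \<in> quo A C" "Y \<in> quo C B" by blast
    then show "(case P of (X, Y) \<Rightarrow> adcoset B (r X + s Y)) \<in> quo A B"
      using r[of X] s[of Y] sub asub_add[OF as(1)] by (auto simp: quo_def)
  next
    fix Z assume "Z \<in> quo A B"
    then obtain x where x: "x \<in> A" "Z = adcoset B x" by (auto simp: quo_def)
    let ?X = "adcoset C x"
    have X: "?X \<in> quo A C" using x by (auto simp: quo_def)
    have d: "x - r ?X \<in> C" using r[OF X] by (simp flip: adcoset_eq_iff[OF as(3)])
    let ?Y = "adcoset B (x - r ?X)"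
    have Y: "?Y \<in> quo C B" using d by (auto simp: quo_def)
    have "(x - r ?X) - s ?Y \<in> B" using s[OF Y] by (simp flip: adcoset_eq_iff[OF as(2)])
    then have "x - (r ?X + s ?Y) \<in> B" by (simp add: algebra_simps)
    then have "Z = adcoset B (r ?X + s ?Y)" using x by (simp add: adcoset_eq_iff[OF as(2)])
    then show "\<exists>P\<in>quo A C \<times> quo C B. Z = (case P of (X, Y) \<Rightarrow> adcoset B (r X + s Y))"
      using X Y by (intro bexI[of _ "(?X, ?Y)"]) auto
  qed
  then show ?thesis by blast
qed

definition ppow :: "nat \<Rightarrow> 'm::ab_group_add set \<Rightarrow> 'm set \<Rightarrow> bool" where
  "ppow p A B \<longleftrightarrow> finite (quo A B) \<and> (\<exists>a. card (quo A B) = p ^ a)"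

text \<open>Meaningful only under \<open>ppow p A B\<close>.\<close>

definition ell :: "nat \<Rightarrow> 'm::ab_group_add set \<Rightarrow> 'm set \<Rightarrow> nat" where
  "ell p A B = (SOME a. card (quo A B) = p ^ a)"

lemma card_quo: "ppow p A B \<Longrightarrow> card (quo A B) = p ^ ell p A B"
  unfolding ppow_def ell_def by (rule someI_ex) simp

lemma ppow_mult:
  assumes "asub A" "asub B" "asub C" "B \<subseteq> C" "C \<subseteq> A" "ppow p A C" "ppow p C B"
  shows "ppow p A B" "card (quo A B) = card (quo A C) * card (quo C B)"
proof -
  obtain f where f: "bij_betw f (quo A C \<times> quo C B) (quo A B)" using quo_mult[OF assms(1-5)] by blast
  have fin: "finite (quo A C)" "finite (quo C B)" using assms by (auto simp: ppow_def)
  show c: "card (quo A B) = card (quo A C) * card (quo C B)"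
    using bij_betw_same_card[OF f] by (simp add: card_cartesian_product)
  have "finite (quo A B)" using bij_betw_finite[OF f] fin by simp
  moreover have "card (quo A B) = p ^ (ell p A C + ell p C B)"
    using c card_quo[OF assms(6)] card_quo[OF assms(7)] by (simp add: power_add)
  ultimately show "ppow p A B" unfolding ppow_def by blast
qed

lemma ell_mult:
  assumes "asub A" "asub B" "asub C" "B \<subseteq> C" "C \<subseteq> A" "ppow p A C" "ppow p C B" "p > 1"
  shows "ell p A B = ell p A C + ell p C B"
proof -
  have "p ^ ell p A B = p ^ (ell p A C + ell p C B)"
    using ppow_mult[OF assms(1-7)] card_quo[OF assms(6)] card_quo[OF assms(7)] card_quo[of p A B]
    by (simp add: power_add)
  then show ?thesis using assms(8) by simp
qed

text \<open>The first isomorphism theorem: by the hypothesis on \<open>f\<close>, the kernel of the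
  map from \<open>A\<close> to cosets of \<open>B'\<close> is \<open>B\<close>.\<close>

lemma ell_image:
  assumes f: "addf f" and as: "asub A" "asub B" "asub B'"
    and k: "\<And>x. x \<in> A \<Longrightarrow> f x \<in> B' \<longleftrightarrow> x \<in> B"
  shows "ell p {x + b | x b. x \<in> f ` A \<and> b \<in> B'} B' = ell p A B"
proof -
  have "quo {x + b | x b. x \<in> f ` A \<and> b \<in> B'} B' = (\<lambda>x. adcoset B' (f x)) ` A"
  proof
    show "quo {x + b | x b. x \<in> f ` A \<and> b \<in> B'} B' \<subseteq> (\<lambda>x. adcoset B' (f x)) ` A"
    proof
      fix X assume "X \<in> quo {x + b | x b. x \<in> f ` A \<and> b \<in> B'} B'"
      then obtain x b where "X = adcoset B' (f x + b)" "x \<in> A" "b \<in> B'" by (auto simp: quo_def)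
      then have "X = adcoset B' (f x)" by (simp add: adcoset_eq_iff[OF as(3)])
      then show "X \<in> (\<lambda>x. adcoset B' (f x)) ` A" using \<open>x \<in> A\<close> by blast
    qed
    show "(\<lambda>x. adcoset B' (f x)) ` A \<subseteq> quo {x + b | x b. x \<in> f ` A \<and> b \<in> B'} B'"
      using asub_0[OF as(3)] by (force simp: quo_def)
  qed
  moreover have "\<exists>g. bij_betw g (adcoset B ` A) ((\<lambda>x. adcoset B' (f x)) ` A)"
  proof (rule card_image_cong_kernel)
    fix x y assume "x \<in> A" "y \<in> A"
    then show "adcoset B x = adcoset B y \<longleftrightarrow> adcoset B' (f x) = adcoset B' (f y)"
      using k[OF asub_diff[OF as(1)], of x y] by (simp add: adcoset_eq_iff as addf_diff[OF f])
  qed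
  ultimately have "card (quo {x + b | x b. x \<in> f ` A \<and> b \<in> B'} B') = card (quo A B)"
    unfolding quo_def by (elim exE) (simp add: bij_betw_same_card)
  then show ?thesis by (simp add: ell_def)
qed

text \<open>A subgroup of \<open>A\<close> that has \<open>p\<close>-power order modulo
  \<open>B\<close> and is not yet all of \<open>A\<close> can be enlarged by the factor
  \<open>p\<close>. Repeating this without end would violate the chain condition. No structure
  theorem for abelian groups enters.\<close>

lemma acc_imp_ppow:
  fixes A :: "('c \<Rightarrow>\<^sub>0 int) set"
  assumes p: "prime p" and as: "asub A" "asub B" "B \<subseteq> A"
    and tors: "\<And>x. x \<in> A \<Longrightarrow> \<exists>n. frag_cmul (int p ^ n) x \<in> B"
    and acc: "\<And>N. incseq N \<Longrightarrow> (\<And>j. asub (N j)) \<Longrightarrow> (\<And>j. B \<subseteq> N j) \<Longrightarrow> (\<And>j. N j \<subseteq> A)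
       \<Longrightarrow> \<exists>j0. \<forall>j\<ge>j0. N j = N j0"
  shows "ppow p A B"
proof (rule ccontr)
  assume neg: "\<not> ppow p A B"
  define good where "good C \<longleftrightarrow> asub C \<and> B \<subseteq> C \<and> C \<subseteq> A \<and> ppow p C B" for C
  have step: "\<exists>C'. good C' \<and> C \<subset> C'" if C: "good C" for C
  proof -
    have asC: "asub C" and BC: "B \<subseteq> C" and CA: "C \<subseteq> A" using C by (auto simp: good_def)
    have "C \<noteq> A" using C neg by (auto simp: good_def)
    then obtain x where x: "x \<in> A" "x \<notin> C" using C by (auto simp: good_def)
    let ?Q = "\<lambda>n. frag_cmul (int p ^ n) x \<in> C"
    have ex: "\<exists>n. ?Q n" using tors[OF x(1)] C by (auto simp: good_def)
    define n where "n = (LEAST n. ?Q n)"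
    have Qn: "?Q n" unfolding n_def using ex by (rule LeastI_ex)
    have n0: "n \<noteq> 0"
    proof
      assume "n = 0" then show False using Qn x by simp
    qed
    \<comment> \<open>By minimality of \<open>n\<close>, this multiple of \<open>x\<close> is
      outside \<open>C\<close>, while \<open>p\<close> times it is inside.\<close>
    define y where "y = frag_cmul (int p ^ (n - 1)) x"
    have yC: "y \<notin> C" unfolding y_def using not_less_Least[of "n - 1" ?Q] n0 unfolding n_def by simp
    have yA: "y \<in> A" unfolding y_def using asub_cmul[OF as(1) x(1)] .
    have "frag_cmul (int p) y = frag_cmul (int p ^ n) x" unfolding y_def
      using n0 by (cases n) simp_all
    then have py: "frag_cmul (int p) y \<in> C" using Qn by simp
    define C' where "C' = {c + frag_cmul z y | c z. c \<in> C}"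
    have asC': "asub C'" unfolding asub_def
    proof (intro conjI ballI)
      show "0 \<in> C'" unfolding C'_def using asub_0[OF asC] by force
      fix u v assume "u \<in> C'" "v \<in> C'"
      then obtain c z c' z' where u: "u = c + frag_cmul z y" "c \<in> C" and v: "v = c' + frag_cmul z' y" "c' \<in> C"
        unfolding C'_def by blast
      have "u - v = (c - c') + frag_cmul (z - z') y"
        unfolding u(1) v(1) frag_cmul_diff_distrib by (simp add: algebra_simps)
      then show "u - v \<in> C'" unfolding C'_def using asub_diff[OF asC u(2) v(2)] by blast
    qed
    have CC': "C \<subseteq> C'" unfolding C'_def by force
    have "0 + frag_cmul 1 y \<in> C'" unfolding C'_def using asub_0[OF asC] by blast
    then have yC': "y \<in> C'" by simp
    have C'A: "C' \<subseteq> A" unfolding C'_def using asub_add[OF as(1) subsetD[OF CA] asub_cmul[OF as(1) yA]] by blast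
    have q: "quo C' C = (\<lambda>j. adcoset C (frag_cmul (int j) y)) ` {..<p}"
    proof
      show "quo C' C \<subseteq> (\<lambda>j. adcoset C (frag_cmul (int j) y)) ` {..<p}"
      proof
        fix X assume "X \<in> quo C' C"
        then obtain c z where X: "X = adcoset C (c + frag_cmul z y)" "c \<in> C" unfolding quo_def C'_def by auto
        have "frag_cmul z y = frag_cmul (z div int p) (frag_cmul (int p) y) + frag_cmul (z mod int p) y"
          unfolding frag_cmul_cmul frag_cmul_distrib[symmetric] by simp
        then have "c + frag_cmul z y - frag_cmul (z mod int p) y = c + frag_cmul (z div int p) (frag_cmul (int p) y)"
          by simp
        also have "\<dots> \<in> C" using asub_add[OF asC X(2) asub_cmul[OF asC py]] .
        finally have "X = adcoset C (frag_cmul (int (nat (z mod int p))) y)"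
          using X adcoset_eq_iff[OF asC] prime_gt_0_nat[OF p] by simp
        moreover have "nat (z mod int p) < p"
          using prime_gt_0_nat[OF p] by (simp add: nat_less_iff)
        ultimately show "X \<in> (\<lambda>j. adcoset C (frag_cmul (int j) y)) ` {..<p}" by blast
      qed
      show "(\<lambda>j. adcoset C (frag_cmul (int j) y)) ` {..<p} \<subseteq> quo C' C"
        unfolding quo_def using asub_cmul[OF asC' yC'] by blast
    qed
    have inj: "inj_on (\<lambda>j. adcoset C (frag_cmul (int j) y)) {..<p}"
    proof (rule inj_onI)
      fix j j' assume j: "j \<in> {..<p}" "j' \<in> {..<p}" "adcoset C (frag_cmul (int j) y) = adcoset C (frag_cmul (int j') y)"
      let ?d = "int j - int j'"
      have d: "frag_cmul ?d y \<in> C" using j(3) unfolding adcoset_eq_iff[OF asC] by (simp add: frag_cmul_diff_distrib)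
      show "j = j'"
      proof (rule ccontr)
        assume "j \<noteq> j'"
        have "\<not> int p dvd ?d"
        proof
          assume "int p dvd ?d"
          then have "\<bar>int p\<bar> \<le> \<bar>?d\<bar>" by (rule dvd_imp_le_int[rotated]) (use \<open>j \<noteq> j'\<close> in simp)
          then show False using j by auto
        qed
        \<comment> \<open>Both \<open>p\<close> and \<open>?d\<close> carry \<open>y\<close> into
          \<open>C\<close>. If they are coprime, a Bezout combination puts \<open>y\<close> itself
          into \<open>C\<close>.\<close>
        then have "coprime (int p) ?d" using p by (simp add: prime_imp_coprime)
        then have "gcd (int p) ?d = 1" by (rule coprime_imp_gcd_eq_1)
        moreover obtain u v where "u * int p + v * ?d = gcd (int p) ?d"
          using bezout_int[of "int p" ?d] by blast
        ultimately have uv: "u * int p + v * ?d = 1" by simp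
        have "frag_cmul u (frag_cmul (int p) y) + frag_cmul v (frag_cmul ?d y) \<in> C"
          by (rule asub_add[OF asC asub_cmul[OF asC py] asub_cmul[OF asC d]])
        then have "y \<in> C" unfolding frag_cmul_cmul frag_cmul_distrib[symmetric] uv by simp
        then show False using yC by simp
      qed
    qed
    have "ppow p C' C" unfolding ppow_def q using card_image[OF inj] by (auto intro: exI[of _ 1])
    then have "ppow p C' B"
      using ppow_mult(1)[OF asC' as(2) asC BC CC'] C by (simp add: good_def)
    then have "good C'" using asC' BC CC' C'A by (auto simp: good_def)
    moreover have "C \<subset> C'" using CC' yC yC' by blast
    ultimately show ?thesis by blast
  qed
  have "quo B B = {adcoset B 0}" by (rule quo_self[OF as(2)])
  then have "ppow p B B" unfolding ppow_def by (auto intro: exI[of _ 0])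
  then have "good B" using as by (simp add: good_def)
  define f where "f = rec_nat B (\<lambda>_ C. SOME C'. good C' \<and> C \<subset> C')"
  have fS: "good (f (Suc n)) \<and> f n \<subset> f (Suc n)" if "good (f n)" for n
    using someI_ex[OF step[OF that]] by (simp add: f_def)
  have f1: "good (f n)" for n
  proof (induction n)
    case 0 show ?case using \<open>good B\<close> by (simp add: f_def)
  next
    case (Suc n) then show ?case using fS by blast
  qed
  have f: "good (f n)" "f n \<subset> f (Suc n)" for n using f1 fS[OF f1] by simp_all
  have "\<exists>j0. \<forall>j\<ge>j0. f j = f j0"
  proof (rule acc)
    show "incseq f" by (rule incseq_SucI) (rule psubset_imp_subset[OF f(2)])
  qed (use f(1) in \<open>simp_all add: good_def\<close>)
  then obtain j0 where j0: "\<forall>j\<ge>j0. f j = f j0" by blast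
  then have "f (Suc j0) = f j0" by (meson le_SucI order_refl)
  then show False using f(2)[of j0] by blast
qed

text \<open>Operators raise the weight. Hence a chain of subgroups in the single weight
  \<open>k\<close> becomes a chain of submodules when it is completed by \<open>B\<close> in lower
  and by \<open>A\<close> in higher weights.\<close>

lemma noeth_imp_ppow:
  fixes \<phi> :: "'e \<Rightarrow> ('c \<Rightarrow>\<^sub>0 int) \<Rightarrow> ('c \<Rightarrow>\<^sub>0 int)"
  assumes p: "prime p" and A: "submod \<phi> E A" and B: "submod \<phi> E B" and BA: "B \<le> A" and N: "noeth \<phi> E A B"
    and tors: "\<And>k x. x \<in> A k \<Longrightarrow> \<exists>n. frag_cmul (int p ^ n) x \<in> B k"
  shows "ppow p (A k) (B k)"
proof (rule acc_imp_ppow[OF p submod_asub[OF A] submod_asub[OF B] le_funD[OF BA] tors])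
  fix H assume inc: "incseq H" and as: "\<And>j::nat. asub (H j)" and sub: "\<And>j. B k \<subseteq> H j" "\<And>j. H j \<subseteq> A k"
  define M where "M j l = (if l < k then B l else if l = k then H j else A l)" for j l
  have "\<exists>j0. \<forall>j\<ge>j0. M j = M j0"
  proof (rule noethD[OF N])
    show "incseq M" unfolding incseq_def le_fun_def M_def using inc by (auto simp: incseq_def)
    show "submod \<phi> E (M j)" for j
    proof (rule submodI)
      show "asub (M j l)" for l unfolding M_def using as submod_asub[OF A] submod_asub[OF B] by simp
      fix e l x assume e: "e \<in> E" and x: "x \<in> M j l"
      consider "l < k" "Suc l < k" | "l < k" "Suc l = k" | "l = k" | "l > k" by linarith
      then show "\<phi> e x \<in> M j (Suc l)"
      proof cases
        case 1 then show ?thesis using x submod_act[OF B e, of x l] by (simp add: M_def)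
      next
        case 2 then show ?thesis using x submod_act[OF B e, of x l] sub(1) by (auto simp: M_def)
      next
        case 3 then show ?thesis using x submod_act[OF A e, of x l] sub(2) by (auto simp: M_def)
      next
        case 4 then show ?thesis using x submod_act[OF A e, of x l] by (simp add: M_def)
      qed
    qed
    show "B \<le> M j" for j unfolding M_def le_fun_def using sub(1) le_funD[OF BA] by auto
    show "M j \<le> A" for j unfolding M_def le_fun_def using sub(2) le_funD[OF BA] by auto
  qed
  then obtain j0 where "\<And>j. j \<ge> j0 \<Longrightarrow> M j = M j0" by blast
  note j0 = this
  have "H j = H j0" if "j \<ge> j0" for j using fun_cong[OF j0[OF that], of k] by (simp add: M_def)
  then show "\<exists>j0. \<forall>j\<ge>j0. H j = H j0" by blast
qed

section \<open>Eventually polynomial functions and Hilbert polynomials\<close>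

definition polyev :: "nat \<Rightarrow> (nat \<Rightarrow> nat) \<Rightarrow> bool" where
  "polyev d g \<longleftrightarrow> (\<exists>f::rat poly. (f = 0 \<or> degree f < d) \<and> (\<forall>\<^sub>F k in sequentially. of_nat (g k) = poly f (of_nat k)))"

lemma polyev_add:
  assumes "polyev d g" "polyev d h" shows "polyev d (\<lambda>k. g k + h k)"
proof -
  obtain f1 f2 :: "rat poly" where f: "f1 = 0 \<or> degree f1 < d" "f2 = 0 \<or> degree f2 < d"
    "\<forall>\<^sub>F k in sequentially. of_nat (g k) = poly f1 (of_nat k)"
    "\<forall>\<^sub>F k in sequentially. of_nat (h k) = poly f2 (of_nat k)"
    using assms unfolding polyev_def by blast
  have "f1 + f2 = 0 \<or> degree (f1 + f2) < d"
    using f(1,2) degree_add_less[of f1 d f2] by (cases "f1 = 0"; cases "f2 = 0") simp_all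
  moreover have "\<forall>\<^sub>F k in sequentially. of_nat (g k + h k) = poly (f1 + f2) (of_nat k)"
    using f(3,4) by eventually_elim simp
  ultimately show ?thesis unfolding polyev_def by blast
qed

lemma polyev_mono: "polyev d g \<Longrightarrow> d \<le> d' \<Longrightarrow> polyev d' g"
  unfolding polyev_def using order_less_le_trans by blast

text \<open>The difference of \<open>c / (n + 1)\<close> times the power \<open>n + 1\<close> of the
  variable has leading term \<open>c\<close> in degree \<open>n\<close>. Subtracting it lowers the
  degree of \<open>h\<close>, and induction finishes.\<close>

lemma poly_antidifference_ex:
  fixes h :: "rat poly"
  assumes "h = 0 \<or> degree h < n"
  shows "\<exists>F. (F = 0 \<or> degree F < Suc n) \<and> pcompose F [:1, 1:] - F = h"
  using assms
proof (induction n arbitrary: h)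
  case 0 then show ?case by (intro exI[of _ 0]) auto
next
  case (Suc n)
  define c where "c = coeff h n"
  define F0 :: "rat poly" where "F0 = monom (c / of_nat (Suc n)) (Suc n)"
  define r where "r = h - (pcompose F0 [:1, 1:] - F0)"
  have pc: "pcompose F0 [:1, 1:] = smult (c / of_nat (Suc n)) ([:1, 1:] ^ Suc n)"
  proof -
    have "pcompose ([:0, 1:] ^ m) [:1, 1:] = [:1, 1::rat:] ^ m" for m
      by (induction m) (simp_all add: pcompose_mult pcompose_pCons pcompose_1)
    then show ?thesis unfolding F0_def by (simp add: monom_altdef pcompose_smult del: power_Suc)
  qed
  have rr: "r = h - (smult (c / of_nat (Suc n)) ([:1, 1:] ^ Suc n) - monom (c / of_nat (Suc n)) (Suc n))"
    unfolding r_def pc unfolding F0_def by (rule refl)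
  have co: "coeff ([:1, 1::rat:] ^ Suc n) i = of_nat (Suc n choose i)" if "i \<le> Suc n" for i
    using coeff_linear_poly_power[OF that, of 1 1] by simp
  have cr: "coeff r i = 0" if i: "i \<ge> n" for i
  proof -
    consider "i = n" | "i = Suc n" | "i > Suc n" using i by linarith
    then show ?thesis
    proof cases
      case 1
      then show ?thesis using co[of n] by (simp add: rr c_def del: power_Suc)
    next
      case 2
      have "coeff h (Suc n) = 0" using Suc.prems by (auto intro: coeff_eq_0)
      then show ?thesis using 2 co[of "Suc n"] by (simp add: rr del: power_Suc)
    next
      case 3
      have "coeff h i = 0" using Suc.prems 3 by (auto intro: coeff_eq_0)
      moreover have "coeff ([:1, 1::rat:] ^ Suc n) i = 0"
        by (rule coeff_eq_0) (use 3 degree_power_le[of "[:1, 1::rat:]" "Suc n"] in \<open>simp del: power_Suc\<close>)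
      ultimately show ?thesis using 3 by (simp add: rr del: power_Suc)
    qed
  qed
  have "r = 0 \<or> degree r < n"
    using cr[of "degree r"] leading_coeff_neq_0[of r] by (cases "degree r < n") auto
  then obtain F1 where F1: "F1 = 0 \<or> degree F1 < Suc n" "pcompose F1 [:1, 1:] - F1 = r"
    using Suc.IH by blast
  have "degree F0 < Suc (Suc n)" unfolding F0_def using degree_monom_le le_imp_less_Suc by blast
  then have "degree (F0 + F1) < Suc (Suc n)" using F1(1) degree_add_less[of F0 "Suc (Suc n)" F1] by auto
  moreover have "pcompose (F0 + F1) [:1, 1:] - (F0 + F1) = h"
    using F1(2) by (simp add: pcompose_add r_def algebra_simps)
  ultimately show ?case by blast
qed

text \<open>The relation says that the increment of \<open>g\<close> at \<open>k\<close> is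
  \<open>b (Suc k) - a k\<close>, written without subtraction of natural numbers. The function is
  recovered from an antidifference and one constant, fixed at a weight from which on
  \<open>a\<close> and \<open>b\<close> are polynomial.\<close>

lemma polyev_of_difference:
  assumes a: "polyev n a" and b: "polyev n b"
    and eq: "\<And>k. g (Suc k) + a k = b (Suc k) + g k"
  shows "polyev (Suc n) g"
proof -
  obtain f1 f2 :: "rat poly" where f: "f1 = 0 \<or> degree f1 < n" "f2 = 0 \<or> degree f2 < n"
    and e1: "\<forall>\<^sub>F k in sequentially. of_nat (a k) = poly f1 (of_nat k)"
    and e2: "\<forall>\<^sub>F k in sequentially. of_nat (b k) = poly f2 (of_nat k)"
    using a b unfolding polyev_def by blast
  define h where "h = pcompose f2 [:1, 1:] - f1"
  have "h = 0 \<or> degree h < n"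
  proof -
    have "pcompose f2 [:1, 1:] = 0 \<or> degree (pcompose f2 [:1, 1:]) < n"
      using f(2) by (auto simp: degree_pcompose)
    then show ?thesis unfolding h_def using f(1) degree_diff_less[of "pcompose f2 [:1,1:]" n f1]
      by (cases "pcompose f2 [:1, 1:] = 0"; cases "f1 = 0") simp_all
  qed
  then obtain F where F: "F = 0 \<or> degree F < Suc n" "pcompose F [:1, 1:] - F = h"
    using poly_antidifference_ex by blast
  have PF: "poly F (of_nat (Suc k)) = poly F (of_nat k) + poly h (of_nat k)" for k
    by (simp flip: F(2) add: poly_pcompose algebra_simps)
  obtain k0 where k0: "\<And>k. k \<ge> k0 \<Longrightarrow> of_nat (a k) = poly f1 (of_nat k)" "\<And>k. k \<ge> k0 \<Longrightarrow> of_nat (b k) = poly f2 (of_nat k)"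
    using eventually_conj[OF e1 e2] unfolding eventually_sequentially by blast
  have st: "(of_nat (g (Suc k)) :: rat) - of_nat (g k) = poly h (of_nat k)" if "k \<ge> k0" for k
  proof -
    have "(of_nat (g (Suc k)) :: rat) + of_nat (a k) = of_nat (b (Suc k)) + of_nat (g k)"
      using eq[of k] by (metis of_nat_add)
    then show ?thesis using k0(1)[OF that] k0(2)[of "Suc k"] that
      by (simp add: h_def poly_pcompose algebra_simps)
  qed
  define G where "G = F + [:of_nat (g k0) - poly F (of_nat k0):]"
  have "of_nat (g k) = poly G (of_nat k)" if "k \<ge> k0" for k
    using that
  proof (induction rule: dec_induct)
    case base then show ?case by (simp add: G_def)
  next
    case (step k)
    then show ?case using st[of k] PF[of k] by (simp add: G_def algebra_simps)
  qed
  then have "\<forall>\<^sub>F k in sequentially. of_nat (g k) = poly G (of_nat k)" unfolding eventually_sequentially by blast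
  moreover have "degree G < Suc n" unfolding G_def using F(1) degree_add_less[of F "Suc n" "[:of_nat (g k0) - poly F (of_nat k0):]"] by auto
  ultimately show ?thesis unfolding polyev_def by blast
qed

text \<open>The Hilbert-Serre argument with length replaced by the exponent of \<open>p\<close>.
  Multiplication by one operator has kernel \<open>K / B\<close> and cokernel \<open>A / I\<close>;
  it is zero on both, so they are modules over the remaining operators. Comparing the exponents
  gives the increment of the function.\<close>

lemma hilbert_poly:
  fixes \<phi> :: "'e \<Rightarrow> ('c \<Rightarrow>\<^sub>0 int) \<Rightarrow> ('c \<Rightarrow>\<^sub>0 int)"
  assumes "finite E" and p: "prime p" and "\<And>e. e \<in> E \<Longrightarrow> addf (\<phi> e)"
    and "submod \<phi> E A" "submod \<phi> E B" "B \<le> A" "noeth \<phi> E A B"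
    and "\<And>e e' k x. e \<in> E \<Longrightarrow> e' \<in> E \<Longrightarrow> x \<in> A k \<Longrightarrow> \<phi> e' (\<phi> e x) = \<phi> e (\<phi> e' x)"
    and "\<And>k x. x \<in> A k \<Longrightarrow> \<exists>n. frag_cmul (int p ^ n) x \<in> B k"
  shows "polyev (card E) (\<lambda>k. ell p (A k) (B k))"
  using assms(1,3-)
proof (induction E arbitrary: A B rule: finite_induct)
  case empty
  have asA: "asub (A k)" and asB: "asub (B k)" for k using empty by (auto intro: submod_asub)
  \<comment> \<open>With no operators every family of subgroups is a submodule. Stabilisation of
    this chain of truncations means that almost all weights of \<open>A / B\<close> vanish.\<close>
  define N where "N j k = (if k < j then A k else B k)" for j k
  have "\<exists>j0. \<forall>j\<ge>j0. N j = N j0"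
  proof (rule noethD[OF empty(5)])
    show "incseq N" unfolding incseq_def le_fun_def N_def using le_funD[OF empty(4)] by auto
    show "submod \<phi> {} (N j)" for j by (rule submodI) (simp_all add: N_def asA asB)
    show "B \<le> N j" "N j \<le> A" for j unfolding N_def le_fun_def using le_funD[OF empty(4)] by auto
  qed
  then obtain j0 where j0: "\<And>j. j \<ge> j0 \<Longrightarrow> N j = N j0" by blast
  have "ell p (A k) (B k) = 0" if "k \<ge> j0" for k
  proof -
    have "A k = B k" using fun_cong[OF j0[of "Suc k"], of k] that by (simp add: N_def)
    moreover have "ppow p (A k) (B k)"
      by (rule noeth_imp_ppow[OF p empty(2,3,4,5,7)])
    ultimately have "p ^ ell p (A k) (B k) = 1" using card_quo[of p "A k" "B k"] quo_self[OF asB] by simp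
    then show ?thesis using prime_gt_1_nat[OF p] by simp
  qed
  then have "\<forall>\<^sub>F k in sequentially. of_nat (ell p (A k) (B k)) = poly (0 :: rat poly) (of_nat k)"
    unfolding eventually_sequentially by auto
  then show ?case unfolding polyev_def by blast
next
  case (insert e E)
  let ?E = "insert e E"
  have asA: "asub (A k)" and asB: "asub (B k)" for k using insert.prems by (auto intro: submod_asub)
  have psi: "addf (\<phi> e)" using insert.prems(1) by simp
  have BA: "B k \<subseteq> A k" for k using le_funD[OF insert.prems(4)] .
  define K where "K k = {x \<in> A k. \<phi> e x \<in> B (Suc k)}" for k
  \<comment> \<open>The image of the operator together with \<open>B\<close>. No element of weight 0
    is an image, so weight 0 is just \<open>B 0\<close>.\<close>
  define I where "I k = (case k of 0 \<Rightarrow> B 0 | Suc j \<Rightarrow> {x + b | x b. x \<in> \<phi> e ` A j \<and> b \<in> B (Suc j)})" for k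
  have asK: "asub (K k)" for k unfolding K_def by (rule asub_vimage[OF psi asB asA])
  have asI: "asub (I k)" for k unfolding I_def
    by (cases k) (simp_all only: nat.case asB asub_plus[OF asub_image[OF psi asA] asB])
  have Ae: "\<phi> e' x \<in> A (Suc k)" if "e' \<in> ?E" "x \<in> A k" for e' x k using submod_act[OF insert.prems(2) that] .
  have Be: "\<phi> e' x \<in> B (Suc k)" if "e' \<in> ?E" "x \<in> B k" for e' x k using submod_act[OF insert.prems(3) that] .
  have comm: "\<phi> e' (\<phi> e x) = \<phi> e (\<phi> e' x)" if "e' \<in> ?E" "x \<in> A k" for e' k x
    using insert.prems(6)[OF _ that] by simp
  have Ksub: "submod \<phi> ?E K"
  proof (rule submodI)
    show "asub (K k)" for k by (rule asK)
    show "\<phi> e' x \<in> K (Suc k)" if "e' \<in> ?E" "x \<in> K k" for e' k x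
    proof -
      have x: "x \<in> A k" "\<phi> e x \<in> B (Suc k)" using that(2) by (auto simp: K_def)
      have "\<phi> e (\<phi> e' x) \<in> B (Suc (Suc k))" using Be[OF that(1) x(2)] comm[OF that(1) x(1)] by simp
      then show ?thesis using Ae[OF that(1) x(1)] by (simp add: K_def)
    qed
  qed
  have BK: "B \<le> K" unfolding le_fun_def K_def using BA Be by auto
  have KA: "K \<le> A" unfolding le_fun_def K_def by auto
  have BI: "B \<le> I"
  proof (rule le_funI, rule subsetI)
    fix k x assume x: "x \<in> B k"
    show "x \<in> I k"
    proof (cases k)
      case (Suc j)
      have "\<phi> e 0 + x \<in> I k" unfolding I_def Suc nat.case using asub_0[OF asA] x Suc by blast
      then show ?thesis by (simp add: addf_0[OF psi])
    qed (use x in \<open>simp add: I_def\<close>)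
  qed
  have IA: "I \<le> A"
  proof (rule le_funI, rule subsetI)
    fix k x assume x: "x \<in> I k"
    show "x \<in> A k"
    proof (cases k)
      case 0 then show ?thesis using x BA by (auto simp: I_def)
    next
      case (Suc j)
      then obtain y b where "x = \<phi> e y + b" "y \<in> A j" "b \<in> B (Suc j)" using x by (auto simp: I_def)
      then have "\<phi> e y \<in> A k" "b \<in> A k" using Ae[of e y j] BA Suc by auto
      then show ?thesis using asub_add[OF asA] \<open>x = _\<close> by simp
    qed
  qed
  have eI: "\<phi> e x \<in> I (Suc k)" if "x \<in> A k" for x k
  proof -
    have "\<phi> e x + 0 \<in> I (Suc k)" unfolding I_def nat.case using that asub_0[OF asB] by blast
    then show ?thesis by simp
  qed
  have Isub: "submod \<phi> ?E I"
  proof (rule submodI)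
    show "asub (I k)" for k by (rule asI)
    show "\<phi> e' x \<in> I (Suc k)" if e': "e' \<in> ?E" and x: "x \<in> I k" for e' k x
    proof (cases k)
      case 0
      then have "x \<in> B k" using x by (simp add: I_def)
      then show ?thesis by (rule le_gradedD[OF BI Be[OF e']])
    next
      case (Suc j)
      then obtain y b where y: "x = \<phi> e y + b" "y \<in> A j" "b \<in> B (Suc j)" using x by (auto simp: I_def)
      have "\<phi> e' x = \<phi> e (\<phi> e' y) + \<phi> e' b"
        using addf_add[OF insert.prems(1)[OF e']] comm[OF e' y(2)] y(1) by simp
      moreover have "\<phi> e (\<phi> e' y) \<in> I (Suc k)" using eI[OF Ae[OF e' y(2)]] Suc by simp
      moreover have "\<phi> e' b \<in> I (Suc k)" using le_gradedD[OF BI Be[OF e' y(3)]] Suc by simp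
      ultimately show ?thesis using asub_add[OF asI] by simp
    qed
  qed
  \<comment> \<open>If the operator \<open>e\<close> maps \<open>A'\<close> into \<open>B'\<close>,
    every family between them that is stable under \<open>E\<close> is automatically stable under
    \<open>e\<close>. So the chain condition survives when \<open>e\<close> is dropped.\<close>
  have lift: "noeth \<phi> E A' B'" if N: "noeth \<phi> ?E A' B'" and e0: "\<And>k x. x \<in> A' k \<Longrightarrow> \<phi> e x \<in> B' (Suc k)" for A' B'
    unfolding noeth_def
  proof (intro allI impI, elim conjE)
    fix N assume inc: "incseq N" and N': "\<forall>j. submod \<phi> E (N j) \<and> B' \<le> N j \<and> N j \<le> A'"
    have sub: "submod \<phi> E (N j)" "B' \<le> N j" "N j \<le> A'" for j using N' by simp_all
    show "\<exists>j0. \<forall>j\<ge>j0. N j = N j0"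
    proof (rule noethD[OF N inc])
      show "submod \<phi> ?E (N j)" for j
      proof (rule submodI)
        show "asub (N j k)" for k by (rule submod_asub[OF sub(1)])
        show "\<phi> e' x \<in> N j (Suc k)" if "e' \<in> ?E" "x \<in> N j k" for e' k x
        proof (cases "e' = e")
          case True
          then show ?thesis using e0 le_gradedD[OF sub(3) that(2)] le_gradedD[OF sub(2)] by blast
        next
          case False
          then show ?thesis using submod_act[OF sub(1) _ that(2)] that(1) by blast
        qed
      qed
    qed (rule sub)+
  qed
  have N1: "noeth \<phi> ?E K B" by (rule noeth_mono[OF insert.prems(5) order_refl KA])
  have N2: "noeth \<phi> ?E A I" by (rule noeth_mono[OF insert.prems(5) BI order_refl])
  have t1: "\<exists>n. frag_cmul (int p ^ n) x \<in> B k" if "x \<in> K k" for x k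
    using insert.prems(7) le_gradedD[OF KA that] .
  have t2: "\<exists>n. frag_cmul (int p ^ n) x \<in> I k" if "x \<in> A k" for x k
    using insert.prems(7)[OF that] by (elim exE) (rule exI, erule le_gradedD[OF BI])
  have commE: "\<phi> e' (\<phi> e'' x) = \<phi> e'' (\<phi> e' x)" if "e'' \<in> E" "e' \<in> E" "x \<in> A k" for e'' e' k x
    using insert.prems(6)[of e'' e' x k] that by simp
  have PK: "polyev (card E) (\<lambda>k. ell p (K k) (B k))"
  proof (rule insert.IH)
    show "noeth \<phi> E K B" by (rule lift[OF N1]) (simp add: K_def)
    show "addf (\<phi> e')" if "e' \<in> E" for e' using insert.prems(1) that by simp
    show "\<phi> e' (\<phi> e'' x) = \<phi> e'' (\<phi> e' x)" if "e'' \<in> E" "e' \<in> E" "x \<in> K k" for e'' e' k x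
      using commE[OF that(1,2) le_gradedD[OF KA that(3)]] .
  qed (assumption | rule BK t1 submod_subset[OF Ksub subset_insertI] submod_subset[OF insert.prems(3) subset_insertI])+
  have PI: "polyev (card E) (\<lambda>k. ell p (A k) (I k))"
  proof (rule insert.IH)
    show "noeth \<phi> E A I" by (rule lift[OF N2]) (rule eI)
    show "addf (\<phi> e')" if "e' \<in> E" for e' using insert.prems(1) that by simp
    show "\<phi> e' (\<phi> e'' x) = \<phi> e'' (\<phi> e' x)" if "e'' \<in> E" "e' \<in> E" "x \<in> A k" for e'' e' k x
      using commE[OF that] .
  qed (assumption | rule IA t2 submod_subset[OF Isub subset_insertI] submod_subset[OF insert.prems(2) subset_insertI])+
  have pKB: "ppow p (K k) (B k)" for k by (rule noeth_imp_ppow[OF p Ksub insert.prems(3) BK N1 t1])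
  have pAI: "ppow p (A k) (I k)" for k by (rule noeth_imp_ppow[OF p insert.prems(2) Isub IA N2 t2])
  have pAK: "ppow p (A k) (K k)" for k
    by (rule noeth_imp_ppow[OF p insert.prems(2) Ksub KA noeth_mono[OF insert.prems(5) BK order_refl]])
       (drule insert.prems(7), erule exE, rule exI, erule le_gradedD[OF BK])
  have pIB: "ppow p (I k) (B k)" for k
    by (rule noeth_imp_ppow[OF p Isub insert.prems(3) BI noeth_mono[OF insert.prems(5) order_refl IA]])
       (rule insert.prems(7), erule le_gradedD[OF IA])
  have "polyev (Suc (card E)) (\<lambda>k. ell p (A k) (B k))"
  proof (rule polyev_of_difference[OF PK PI])
    fix k
    have "ell p (I (Suc k)) (B (Suc k)) = ell p (A k) (K k)"
      unfolding I_def nat.case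
      by (rule ell_image[OF psi asA asK asB]) (simp add: K_def)
    moreover have "ell p (A (Suc k)) (B (Suc k)) = ell p (A (Suc k)) (I (Suc k)) + ell p (I (Suc k)) (B (Suc k))"
      by (rule ell_mult[OF asA asB asI le_funD[OF BI] le_funD[OF IA] pAI pIB prime_gt_1_nat[OF p]])
    moreover have "ell p (A k) (B k) = ell p (A k) (K k) + ell p (K k) (B k)"
      by (rule ell_mult[OF asA asB asK le_funD[OF BK] le_funD[OF KA] pAK pKB prime_gt_1_nat[OF p]])
    ultimately show "ell p (A (Suc k)) (B (Suc k)) + ell p (K k) (B k) = ell p (A (Suc k)) (I (Suc k)) + ell p (A k) (B k)"
      by simp
  qed
  then show ?case using insert.hyps by simp
qed

section \<open>Modules killed by products of differences of operators\<close>

primrec pk :: "('e \<Rightarrow> 'm \<Rightarrow> 'm::ab_group_add) \<Rightarrow> ('e \<times> 'e) list \<Rightarrow> 'm \<Rightarrow> 'm" where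
  "pk \<phi> [] x = x"
| "pk \<phi> (q # qs) x = pk \<phi> qs (\<phi> (fst q) x - \<phi> (snd q) x)"

lemma pk_append: "pk \<phi> (ps @ qs) x = pk \<phi> qs (pk \<phi> ps x)"
  by (induction ps arbitrary: x) simp_all

text \<open>The list contains one pair of operators at each vertex of \<open>ws\<close>;
  \<open>pk\<close> applies the product of their differences, beginning with the first pair.\<close>

abbreviation along :: "('v \<Rightarrow> 'e set) \<Rightarrow> 'v list \<Rightarrow> ('e \<times> 'e) list \<Rightarrow> bool" where
  "along inc \<equiv> list_all2 (\<lambda>w q. fst q \<in> inc w \<and> snd q \<in> inc w)"

lemma addf_pk:
  assumes "along inc ws qs" "\<And>w e. w \<in> set ws \<Longrightarrow> e \<in> inc w \<Longrightarrow> addf (\<phi> e)"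
  shows "addf (pk \<phi> qs)"
  using assms
proof (induction rule: list_all2_induct)
  case Nil show ?case by (simp add: addf_def)
next
  case (Cons w ws q qs)
  have a: "addf (\<phi> (fst q))" "addf (\<phi> (snd q))" using Cons.hyps(1) Cons.prems by auto
  have "addf (pk \<phi> qs)" by (rule Cons.IH) (rule Cons.prems, auto)
  note b = addf_diff[OF this]
  show ?case unfolding addf_def
  proof (intro allI)
    fix x y
    have "\<phi> (fst q) (x - y) - \<phi> (snd q) (x - y) = (\<phi> (fst q) x - \<phi> (snd q) x) - (\<phi> (fst q) y - \<phi> (snd q) y)"
      using addf_diff[OF a(1), of x y] addf_diff[OF a(2), of x y] by simp
    then show "pk \<phi> (q # qs) (x - y) = pk \<phi> (q # qs) x - pk \<phi> (q # qs) y"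
      using b[of "\<phi> (fst q) x - \<phi> (snd q) x" "\<phi> (fst q) y - \<phi> (snd q) y"] by simp
  qed
qed

lemma pk_in:
  assumes "along inc ws qs" "submod \<phi> E N" "\<And>w. w \<in> set ws \<Longrightarrow> inc w \<subseteq> E" "x \<in> N k"
  shows "pk \<phi> qs x \<in> N (k + length ws)"
  using assms(1,3,4)
proof (induction arbitrary: x k rule: list_all2_induct)
  case Nil then show ?case by simp
next
  case (Cons w ws q qs)
  have "fst q \<in> E" "snd q \<in> E" using Cons.hyps(1) Cons.prems(1) by auto
  then have "\<phi> (fst q) x - \<phi> (snd q) x \<in> N (Suc k)"
    using submod_act[OF assms(2) _ Cons.prems(2)] asub_diff[OF submod_asub[OF assms(2)]] by simp
  then have "pk \<phi> qs (\<phi> (fst q) x - \<phi> (snd q) x) \<in> N (Suc k + length ws)"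
    by (rule Cons.IH[rotated]) (use Cons.prems(1) in simp)
  then show ?case by simp
qed

definition ahull :: "'m::ab_group_add set \<Rightarrow> 'm set" where
  "ahull X = \<Inter>{H. asub H \<and> X \<subseteq> H}"

lemma asub_ahull: "asub (ahull X)"
  unfolding ahull_def asub_def by blast

lemma ahull_incl: "x \<in> X \<Longrightarrow> x \<in> ahull X"
  unfolding ahull_def by blast

lemma ahull_least: "X \<subseteq> H \<Longrightarrow> asub H \<Longrightarrow> ahull X \<subseteq> H"
  unfolding ahull_def by blast

definition killed :: "('e \<Rightarrow> 'm \<Rightarrow> 'm::ab_group_add) \<Rightarrow> ('v \<Rightarrow> 'e set) \<Rightarrow> 'v list \<Rightarrow> (nat \<Rightarrow> 'm set) \<Rightarrow> (nat \<Rightarrow> 'm set) \<Rightarrow> bool" where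
  "killed \<phi> inc ws N B \<longleftrightarrow> (\<forall>qs k. \<forall>x\<in>N k. along inc ws qs \<longrightarrow> pk \<phi> qs x \<in> B (k + length ws))"

text \<open>This is \<open>B\<close> plus the product of \<open>N\<close> with the ideal generated
  by the differences of the operators in \<open>I\<close>. Since the operators commute and
  \<open>N\<close> is stable, the subgroup generated by the differences is already a submodule. On
  \<open>N\<close> modulo it, the operators in \<open>I\<close> coincide; it is itself killed by one
  factor less.\<close>

definition diffmod :: "('e \<Rightarrow> 'm \<Rightarrow> 'm::ab_group_add) \<Rightarrow> 'e set \<Rightarrow> (nat \<Rightarrow> 'm set) \<Rightarrow> (nat \<Rightarrow> 'm set) \<Rightarrow> nat \<Rightarrow> 'm set" where
  "diffmod \<phi> I N B k = (case k of 0 \<Rightarrow> B 0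
     | Suc j \<Rightarrow> ahull (B (Suc j) \<union> {\<phi> e x - \<phi> e' x | e e' x. e \<in> I \<and> e' \<in> I \<and> x \<in> N j}))"

lemma diffmod_props:
  assumes add: "\<And>e. e \<in> E \<Longrightarrow> addf (\<phi> e)" and I: "I \<subseteq> E"
    and N: "submod \<phi> E N" and B: "submod \<phi> E B" and BN: "B \<le> N"
    and comm: "\<And>e e' k x. e \<in> E \<Longrightarrow> e' \<in> E \<Longrightarrow> x \<in> N k \<Longrightarrow> \<phi> e' (\<phi> e x) = \<phi> e (\<phi> e' x)"
  shows "submod \<phi> E (diffmod \<phi> I N B)" "B \<le> diffmod \<phi> I N B" "diffmod \<phi> I N B \<le> N"
    "\<And>e e' k x. e \<in> I \<Longrightarrow> e' \<in> I \<Longrightarrow> x \<in> N k \<Longrightarrow> \<phi> e x - \<phi> e' x \<in> diffmod \<phi> I N B (Suc k)"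
proof -
  let ?D = "diffmod \<phi> I N B"
  have asN: "asub (N k)" and asB: "asub (B k)" for k using N B by (auto intro: submod_asub)
  have asD: "asub (?D k)" for k unfolding diffmod_def using asB asub_ahull by (cases k) simp_all
  show BD: "B \<le> ?D" unfolding le_fun_def diffmod_def by (auto split: nat.split intro: ahull_incl)
  show gen: "\<phi> e x - \<phi> e' x \<in> ?D (Suc k)" if "e \<in> I" "e' \<in> I" "x \<in> N k" for e e' k x
    unfolding diffmod_def nat.case by (rule ahull_incl) (use that in blast)
  show "?D \<le> N"
  proof (rule le_funI)
    fix k show "?D k \<subseteq> N k"
    proof (cases k)
      case 0 then show ?thesis using le_funD[OF BN] by (simp add: diffmod_def)
    next
      case (Suc j)
      have "\<phi> e x - \<phi> e' x \<in> N (Suc j)" if "e \<in> I" "e' \<in> I" "x \<in> N j" for e e' x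
        using that I submod_act[OF N] asub_diff[OF asN] by blast
      then show ?thesis unfolding diffmod_def Suc nat.case
        by (intro ahull_least asN) (use le_funD[OF BN, of "Suc j"] in blast)
    qed
  qed
  show "submod \<phi> E ?D"
  proof (rule submodI)
    show "asub (?D k)" for k by (rule asD)
    fix e0 k x assume e0: "e0 \<in> E" and x: "x \<in> ?D k"
    show "\<phi> e0 x \<in> ?D (Suc k)"
    proof (cases k)
      case 0
      then have "x \<in> B k" using x by (simp add: diffmod_def)
      then show ?thesis by (rule le_gradedD[OF BD submod_act[OF B e0]])
    next
      case (Suc j)
      let ?X = "B (Suc j) \<union> {\<phi> e x - \<phi> e' x | e e' x. e \<in> I \<and> e' \<in> I \<and> x \<in> N j}"
      have "ahull ?X \<subseteq> {y \<in> UNIV. \<phi> e0 y \<in> ?D (Suc k)}"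
      proof (rule ahull_least)
        show "asub {y \<in> UNIV. \<phi> e0 y \<in> ?D (Suc k)}"
          by (rule asub_vimage[OF add[OF e0] asD]) (simp add: asub_def)
        show "?X \<subseteq> {y \<in> UNIV. \<phi> e0 y \<in> ?D (Suc k)}"
        proof
          fix y assume "y \<in> ?X"
          then consider "y \<in> B (Suc j)" | e e' z where "y = \<phi> e z - \<phi> e' z" "e \<in> I" "e' \<in> I" "z \<in> N j" by blast
          then show "y \<in> {y \<in> UNIV. \<phi> e0 y \<in> ?D (Suc k)}"
          proof cases
            case 1
            then show ?thesis using submod_act[OF B e0] le_gradedD[OF BD] Suc by blast
          next
            case 2
            have "\<phi> e0 y = \<phi> e (\<phi> e0 z) - \<phi> e' (\<phi> e0 z)"
              using addf_diff[OF add[OF e0]] comm[OF subsetD[OF I 2(2)] e0 2(4)] comm[OF subsetD[OF I 2(3)] e0 2(4)] 2(1)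
              by simp
            then show ?thesis using gen[OF 2(2,3) submod_act[OF N e0 2(4)]] Suc by simp
          qed
        qed
      qed
      then show ?thesis using x unfolding diffmod_def Suc nat.case by blast
    qed
  qed
qed

text \<open>Modulo \<open>B\<close>, the elements of \<open>diffmod\<close> are sums of differences
  at \<open>w\<close>. The factor for \<open>w\<close> has thus been applied already, and the
  factors for \<open>ws\<close> do the rest.\<close>

lemma killed_diffmod:
  assumes add: "\<And>e. e \<in> E \<Longrightarrow> addf (\<phi> e)" and inc: "\<And>v. v \<in> set (w # ws) \<Longrightarrow> inc v \<subseteq> E"
    and B: "submod \<phi> E B" and k: "killed \<phi> inc (w # ws) N B"
  shows "killed \<phi> inc ws (diffmod \<phi> (inc w) N B) B"
  unfolding killed_def
proof (intro allI ballI impI)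
  fix qs k x assume x: "x \<in> diffmod \<phi> (inc w) N B k" and qs: "along inc ws qs"
  have Bpk: "pk \<phi> qs y \<in> B (l + length ws)" if "y \<in> B l" for y l
    by (rule pk_in[OF qs B _ that]) (use inc in simp)
  show "pk \<phi> qs x \<in> B (k + length ws)"
  proof (cases k)
    case 0
    then have "x \<in> B k" using x by (simp add: diffmod_def)
    then show ?thesis by (rule Bpk)
  next
    case (Suc j)
    let ?X = "B (Suc j) \<union> {\<phi> e x - \<phi> e' x | e e' x. e \<in> inc w \<and> e' \<in> inc w \<and> x \<in> N j}"
    have "ahull ?X \<subseteq> {y \<in> UNIV. pk \<phi> qs y \<in> B (k + length ws)}"
    proof (rule ahull_least)
      have ad: "addf (pk \<phi> qs)" by (rule addf_pk[OF qs]) (use add inc in auto)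
      show "asub {y \<in> UNIV. pk \<phi> qs y \<in> B (k + length ws)}"
        by (rule asub_vimage[OF ad submod_asub[OF B]]) (simp add: asub_def)
      show "?X \<subseteq> {y \<in> UNIV. pk \<phi> qs y \<in> B (k + length ws)}"
      proof
        fix y assume "y \<in> ?X"
        then consider "y \<in> B (Suc j)" | e e' z where "y = \<phi> e z - \<phi> e' z" "e \<in> inc w" "e' \<in> inc w" "z \<in> N j" by blast
        then show "y \<in> {y \<in> UNIV. pk \<phi> qs y \<in> B (k + length ws)}"
        proof cases
          case 1 then show ?thesis using Bpk Suc by blast
        next
          case 2
          have "along inc (w # ws) ((e, e') # qs)" using qs 2 by simp
          then have "pk \<phi> ((e, e') # qs) z \<in> B (j + length (w # ws))"
            using k 2(4) unfolding killed_def by blast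
          then show ?thesis using 2(1) Suc by simp
        qed
      qed
    qed
    then show ?thesis using x unfolding diffmod_def Suc nat.case by blast
  qed
qed

text \<open>\<open>N / B\<close> is filtered by submodules on whose quotients the operators at more and more
  vertices coincide, until few enough distinct operators are left.\<close>

lemma polyev_of_killed:
  fixes \<phi> :: "'e \<Rightarrow> ('c \<Rightarrow>\<^sub>0 int) \<Rightarrow> ('c \<Rightarrow>\<^sub>0 int)"
  assumes "finite E" and p: "prime p" and add: "\<And>e. e \<in> E \<Longrightarrow> addf (\<phi> e)"
    and T: "submod \<phi> E T" and B: "submod \<phi> E B" and BT: "B \<le> T" and noe: "noeth \<phi> E T B"
    and comm: "\<And>e e' k x. e \<in> E \<Longrightarrow> e' \<in> E \<Longrightarrow> x \<in> T k \<Longrightarrow> \<phi> e' (\<phi> e x) = \<phi> e (\<phi> e' x)"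
    and tors: "\<And>k x. x \<in> T k \<Longrightarrow> \<exists>n. frag_cmul (int p ^ n) x \<in> B k"
    and Vs: "finite Vs" and inc: "\<And>v. v \<in> Vs \<Longrightarrow> inc v \<subseteq> E"
    and kill: "\<And>ws. distinct ws \<Longrightarrow> set ws \<subseteq> Vs \<Longrightarrow> length ws = i \<Longrightarrow> killed \<phi> inc ws T B"
    and few: "\<And>U. U \<subseteq> Vs \<Longrightarrow> card (Vs - U) < i \<Longrightarrow>
       \<exists>R\<subseteq>E. card R \<le> d \<and> (\<forall>e\<in>E. \<exists>r\<in>R. (e, r) \<in> (\<Union>u\<in>U. inc u \<times> inc u)\<^sup>*)"
  shows "polyev d (\<lambda>k. ell p (T k) (B k))"
proof -
  \<comment> \<open>Generalised to a subquotient on which the operators at each vertex of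
    \<open>U\<close> coincide. The induction enlarges \<open>U\<close> until fewer than
    \<open>i\<close> vertices remain outside it.\<close>
  have main: "polyev d (\<lambda>k. ell p (N k) (B' k))"
    if U: "U \<subseteq> Vs" and N: "submod \<phi> E N" "submod \<phi> E B'" "B \<le> B'" "B' \<le> N" "N \<le> T"
      and eqU: "\<And>u e e' k x. u \<in> U \<Longrightarrow> e \<in> inc u \<Longrightarrow> e' \<in> inc u \<Longrightarrow> x \<in> N k \<Longrightarrow> \<phi> e x - \<phi> e' x \<in> B' (Suc k)"
    for U N B'
    using that
  proof (induction "card (Vs - U)" arbitrary: U N B' rule: less_induct)
    case less
    note U = less.prems(1) and N = less.prems(2) and B' = less.prems(3) and BB' = less.prems(4)
      and B'N = less.prems(5) and NT = less.prems(6) and eqU = less.prems(7)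
    have asB': "asub (B' k)" for k using B' by (rule submod_asub)
    have tN: "\<exists>n. frag_cmul (int p ^ n) x \<in> B' k" if "x \<in> N k" for x k
      using tors[OF le_gradedD[OF NT that]] by (elim exE) (rule exI, erule le_gradedD[OF BB'])
    have noeN: "noeth \<phi> E N B'" by (rule noeth_mono[OF noe BB' NT])
    show ?case
    proof (cases "card (Vs - U) < i")
      case True
      obtain R where R: "R \<subseteq> E" "card R \<le> d" "\<And>e. e \<in> E \<Longrightarrow> \<exists>r\<in>R. (e, r) \<in> (\<Union>u\<in>U. inc u \<times> inc u)\<^sup>*"
        using few[OF U True] by blast
      have eq: "\<phi> e x - \<phi> r x \<in> B' (Suc k)" if "(e, r) \<in> (\<Union>u\<in>U. inc u \<times> inc u)\<^sup>*" "x \<in> N k" for e r x k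
        using that(1)
      proof (induction rule: rtrancl_induct)
        case base show ?case using asub_0[OF asB'] by simp
      next
        case (step r s)
        then have "\<phi> r x - \<phi> s x \<in> B' (Suc k)" using eqU that(2) by blast
        then show ?case using asub_add[OF asB' step.IH] by fastforce
      qed
      \<comment> \<open>Modulo \<open>B'\<close> every operator agrees with one in \<open>R\<close>.
        Hence the families stable under \<open>R\<close> are those stable under \<open>E\<close>,
        and \<open>R\<close> has at most \<open>d\<close> members.\<close>
      have "noeth \<phi> R N B'" unfolding noeth_def
      proof (intro allI impI, elim conjE)
        fix M assume incM: "incseq M" and M': "\<forall>j. submod \<phi> R (M j) \<and> B' \<le> M j \<and> M j \<le> N"
        have M: "submod \<phi> R (M j)" "B' \<le> M j" "M j \<le> N" for j using M' by simp_all
        have asM: "asub (M j k)" for j k by (rule submod_asub[OF M(1)])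
        show "\<exists>j0. \<forall>j\<ge>j0. M j = M j0"
        proof (rule noethD[OF noeN incM _ M(2,3)])
          show "submod \<phi> E (M j)" for j
          proof (rule submodI[OF asM])
            fix e k x assume e: "e \<in> E" and x: "x \<in> M j k"
            obtain r where r: "r \<in> R" "(e, r) \<in> (\<Union>u\<in>U. inc u \<times> inc u)\<^sup>*" using R(3)[OF e] by blast
            have "\<phi> e x - \<phi> r x \<in> M j (Suc k)"
              using eq[OF r(2) le_gradedD[OF M(3) x]] le_gradedD[OF M(2)] by blast
            moreover have "\<phi> r x \<in> M j (Suc k)" by (rule submod_act[OF M(1) r(1) x])
            ultimately show "\<phi> e x \<in> M j (Suc k)" using asub_add[OF asM] by fastforce
          qed
        qed
      qed
      then have "polyev (card R) (\<lambda>k. ell p (N k) (B' k))"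
      proof (rule hilbert_poly[OF finite_subset[OF R(1) \<open>finite E\<close>] p, rotated 4])
        show "addf (\<phi> e)" if "e \<in> R" for e using add that R(1) by blast
        show "submod \<phi> R N" "submod \<phi> R B'" using N B' R(1) by (auto intro: submod_subset)
        show "\<phi> e' (\<phi> e x) = \<phi> e (\<phi> e' x)" if "e \<in> R" "e' \<in> R" "x \<in> N k" for e e' k x
          using comm[OF _ _ le_gradedD[OF NT that(3)]] that R(1) by blast
      qed (rule B'N tN | assumption)+
      then show ?thesis using R(2) by (rule polyev_mono)
    next
      case False
      obtain W where W: "W \<subseteq> Vs - U" "card W = i" "finite W"
        using obtain_subset_with_card_n[of i "Vs - U"] False by auto
      obtain ws where ws: "set ws = W" "distinct ws" using finite_distinct_list[OF W(3)] by blast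
      have len: "length ws = i" using ws W(2) distinct_card by fastforce
      have kT: "killed \<phi> inc ws T B" using kill[OF ws(2) _ len] ws(1) W(1) by blast
      have kN: "killed \<phi> inc ws N B'" unfolding killed_def
      proof (intro allI ballI impI)
        fix qs k x assume "x \<in> N k" "along inc ws qs"
        then have "pk \<phi> qs x \<in> B (k + length ws)"
          using kT le_gradedD[OF NT] unfolding killed_def by blast
        then show "pk \<phi> qs x \<in> B' (k + length ws)" by (rule le_gradedD[OF BB'])
      qed
      \<comment> \<open>Inner induction on the list of vertices. In \<open>M / ?D\<close> the
        operators at \<open>w\<close> coincide as well, so the outer induction applies with
        \<open>insert w U\<close>; and \<open>?D / B'\<close> is killed by the shorter list.\<close>
      have "polyev d (\<lambda>k. ell p (M k) (B' k))"
        if "set ws' \<subseteq> Vs - U" "killed \<phi> inc ws' M B'" "submod \<phi> E M" "B' \<le> M" "M \<le> N" for ws' M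
        using that
      proof (induction ws' arbitrary: M)
        case Nil
        have "M k = B' k" for k
        proof
          show "M k \<subseteq> B' k"
          proof
            fix x assume "x \<in> M k"
            then show "x \<in> B' k"
              using Nil.prems(2)[unfolded killed_def, THEN spec[of _ "[]"], THEN spec, THEN bspec] by simp
          qed
          show "B' k \<subseteq> M k" using le_funD[OF Nil.prems(4)] .
        qed
        moreover have "ell p (B' k) (B' k) = 0" for k
        proof -
          have "ppow p (B' k) (B' k)" unfolding ppow_def quo_self[OF asB'] by (auto intro: exI[of _ 0])
          then have "p ^ ell p (B' k) (B' k) = 1" using card_quo[of p "B' k" "B' k"] by (simp add: quo_self[OF asB'])
          then show ?thesis using prime_gt_1_nat[OF p] by simp
        qed
        ultimately show ?case unfolding polyev_def by (intro exI[of _ 0]) simp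
      next
        case (Cons w ws')
        let ?D = "diffmod \<phi> (inc w) M B'"
        have wV: "w \<in> Vs - U" using Cons.prems(1) by simp
        have MT: "x \<in> T k" if "x \<in> M k" for x k using le_gradedD[OF NT le_gradedD[OF Cons.prems(5) that]] .
        have Mc: "\<phi> e' (\<phi> e x) = \<phi> e (\<phi> e' x)" if "e \<in> E" "e' \<in> E" "x \<in> M k" for e e' k x
          using comm[OF that(1,2) MT[OF that(3)]] .
        have incw: "inc w \<subseteq> E" using inc wV by blast
        have D: "submod \<phi> E ?D" "B' \<le> ?D" "?D \<le> M"
          and D4: "\<And>e e' k x. e \<in> inc w \<Longrightarrow> e' \<in> inc w \<Longrightarrow> x \<in> M k \<Longrightarrow> \<phi> e x - \<phi> e' x \<in> ?D (Suc k)"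
          by (rule diffmod_props[OF add incw Cons.prems(3) B' Cons.prems(4) Mc]; assumption)+
        have kD: "killed \<phi> inc ws' ?D B'"
          by (rule killed_diffmod[OF add _ B' Cons.prems(2)]) (use inc Cons.prems(1) in auto)
        have P1: "polyev d (\<lambda>k. ell p (?D k) (B' k))"
          by (rule Cons.IH[OF _ kD D(1) D(2) order_trans[OF D(3) Cons.prems(5)]]) (use Cons.prems(1) in simp)
        have P2: "polyev d (\<lambda>k. ell p (M k) (?D k))"
        proof (rule less.hyps[of "insert w U"])
          have "Vs - insert w U \<subset> Vs - U" using wV by blast
          then show "card (Vs - insert w U) < card (Vs - U)" using Vs by (simp add: psubset_card_mono)
          show "insert w U \<subseteq> Vs" using wV U by blast
          show "B \<le> ?D" by (rule order_trans[OF BB' D(2)])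
          show "M \<le> T" by (rule order_trans[OF Cons.prems(5) NT])
          show "\<phi> e x - \<phi> e' x \<in> ?D (Suc k)" if "u \<in> insert w U" "e \<in> inc u" "e' \<in> inc u" "x \<in> M k" for u e e' k x
          proof (cases "u = w")
            case True then show ?thesis using D4 that by simp
          next
            case False
            then have "\<phi> e x - \<phi> e' x \<in> B' (Suc k)"
              using eqU[of u e e' x k] that le_gradedD[OF Cons.prems(5)] by blast
            then show ?thesis by (rule le_gradedD[OF D(2)])
          qed
        qed (rule Cons.prems D)+
        have tM: "\<exists>n. frag_cmul (int p ^ n) x \<in> ?D k" if "x \<in> M k" for x k
          using tN[OF le_gradedD[OF Cons.prems(5) that]] by (elim exE) (rule exI, erule le_gradedD[OF D(2)])
        have tD: "\<exists>n. frag_cmul (int p ^ n) x \<in> B' k" if "x \<in> ?D k" for x k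
          using tN[OF le_gradedD[OF Cons.prems(5) le_gradedD[OF D(3) that]]] .
        have p1: "ppow p (M k) (?D k)" for k
          by (rule noeth_imp_ppow[OF p Cons.prems(3) D(1) D(3) noeth_mono[OF noeN D(2) Cons.prems(5)] tM])
        have p2: "ppow p (?D k) (B' k)" for k
          by (rule noeth_imp_ppow[OF p D(1) B' D(2) noeth_mono[OF noeN order_refl order_trans[OF D(3) Cons.prems(5)]] tD])
        have "ell p (M k) (B' k) = ell p (M k) (?D k) + ell p (?D k) (B' k)" for k
          by (rule ell_mult[OF submod_asub[OF Cons.prems(3)] asB' submod_asub[OF D(1)] le_funD[OF D(2)] le_funD[OF D(3)] p1 p2 prime_gt_1_nat[OF p]])
        then show ?case using polyev_add[OF P2 P1] by simp
      qed
      from this[OF _ kN N B'N order_refl] show ?thesis using ws(1) W(1) by blast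
    qed
  qed
  show ?thesis by (rule main[of "{}" T B]) (use T B BT in auto)
qed

section \<open>Singular chains\<close>

lemma subtopology_restrict': "subtopology X (topspace X \<inter> S) = subtopology X S"
  by (metis subtopology_subtopology subtopology_topspace)

lemma asub_relcycle: "asub {c. singular_relcycle n X S c}"
  by (simp add: asub_def singular_relcycle_diff)

lemma asub_relboundary: "asub {c. singular_relboundary n X S c}"
  by (simp add: asub_def singular_relboundary_diff)

lemma addf_chain_map: "addf (chain_map n f)"
  by (simp add: addf_def chain_map_diff)

lemma addf_chain_boundary: "addf (chain_boundary n)"
  by (simp add: addf_def chain_boundary_diff)

lemma singular_chain_sub_mono:
  "singular_chain p (subtopology X S) c \<Longrightarrow> S \<subseteq> T \<Longrightarrow> singular_chain p (subtopology X T) c"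
  by (rule singular_chain_mono)

text \<open>The excised set is \<open>P - N\<close>. It is closed in \<open>P\<close> because
  \<open>N\<close> is open there, and it lies in the open set \<open>Q\<close> because
  \<open>N\<close> and \<open>Q\<close> cover \<open>P\<close>. Both halves of excision are put on
  the level of chains, where the operators act.\<close>

lemma excision_rel:
  assumes NP: "N \<subseteq> P" and QP: "Q \<subseteq> P" and PNQ: "P \<subseteq> N \<union> Q"
    and oN: "openin (subtopology X P) (topspace X \<inter> N)" and oQ: "openin (subtopology X P) (topspace X \<inter> Q)"
  shows excision_rel_surj: "singular_relcycle n (subtopology X P) Q c \<Longrightarrow>
      \<exists>c'. singular_relcycle n (subtopology X N) (N \<inter> Q) c' \<and> singular_relboundary n (subtopology X P) Q (c - c')"
    and excision_rel_inj: "singular_relcycle n (subtopology X N) (N \<inter> Q) c \<Longrightarrow>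
      singular_relboundary n (subtopology X P) Q c \<Longrightarrow> singular_relboundary n (subtopology X N) (N \<inter> Q) c"
proof -
  let ?Y = "subtopology X P"
  define U where "U = topspace X \<inter> P - N"
  define S where "S = topspace X \<inter> P"
  define T where "T = topspace X \<inter> Q"
  have tY: "topspace ?Y = S" by (simp add: S_def)
  have "U = topspace ?Y - (topspace X \<inter> N)" by (auto simp: U_def)
  then have "closedin ?Y U" using closedin_diff[OF closedin_topspace oN] by simp
  then have cU: "?Y closure_of U = U" by (simp add: closure_of_eq)
  have iT: "?Y interior_of T = T" using oQ by (simp add: interior_of_eq T_def)
  have UT: "U \<subseteq> T" using PNQ by (auto simp: U_def T_def)
  have X: "?Y closure_of U \<subseteq> ?Y interior_of T" using cU iT UT by simp
  have TS: "T \<subseteq> S" using QP by (auto simp: T_def S_def)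
  have e1: "subtopology ?Y S = ?Y" using tY by (metis subtopology_topspace)
  have "P \<inter> (S - U) = topspace X \<inter> N" using NP by (auto simp: S_def U_def)
  then have e2: "subtopology ?Y (S - U) = subtopology X N"
    by (simp add: subtopology_subtopology subtopology_restrict')
  have e3: "T - U = topspace (subtopology X N) \<inter> (N \<inter> Q)" using NP QP by (auto simp: T_def U_def)
  have e4: "T = topspace ?Y \<inter> Q" using QP by (auto simp: T_def)
  show "\<exists>c'. singular_relcycle n (subtopology X N) (N \<inter> Q) c' \<and> singular_relboundary n (subtopology X P) Q (c - c')"
    if c: "singular_relcycle n (subtopology X P) Q c"
  proof -
    have "singular_relcycle n (subtopology ?Y S) T c"
      unfolding e1 unfolding e4 singular_relcycle_restrict using c .
    then obtain c' where "singular_relcycle n (subtopology ?Y (S - U)) (T - U) c'"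
      "homologous_rel n (subtopology ?Y S) T c c'"
      using excised_relcycle_exists[OF X TS] by blast
    then have "singular_relcycle n (subtopology X N) (N \<inter> Q) c'" "singular_relboundary n ?Y Q (c - c')"
      unfolding e1 e2 unfolding e3 homologous_rel_def unfolding e4 singular_relcycle_restrict singular_relboundary_restrict by auto
    then show ?thesis by blast
  qed
  show "singular_relboundary n (subtopology X N) (N \<inter> Q) c"
    if c: "singular_relcycle n (subtopology X N) (N \<inter> Q) c" and b: "singular_relboundary n (subtopology X P) Q c"
  proof -
    let ?N = "subtopology ?Y (S - U)" and ?P = "subtopology ?Y S"
    have c': "singular_relcycle n ?N (T - U) c" unfolding e2 unfolding e3 singular_relcycle_restrict using c .
    have b': "singular_relboundary n ?P T c" unfolding e1 unfolding e4 singular_relboundary_restrict using b .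
    \<comment> \<open>The isomorphism of homology groups is turned into a statement on chains by
      comparing the classes of \<open>c\<close> and of 0.\<close>
    have iso: "hom_induced n ?N (T - U) ?P T id \<in> iso (relative_homology_group n ?N (T - U)) (relative_homology_group n ?P T)"
      by (rule homology_excision_axiom[OF X TS])
    have cont: "continuous_map ?N ?P id"
      by (meson Diff_subset continuous_map_from_subtopology_mono continuous_map_id)
    have h: "hom_induced n ?N (T - U) ?P T id (homologous_rel_set n ?N (T - U) a) = homologous_rel_set n ?P T a"
      if a: "singular_relcycle n ?N (T - U) a" for a
      using hom_induced_chain_map[OF cont _ a, of T] chain_map_ident[of n ?N a] a
      by (auto simp: singular_relcycle)
    have z: "singular_relcycle n ?N (T - U) 0" by simp
    have "homologous_rel n ?P T c 0" using b' by (simp add: homologous_rel_def)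
    then have "homologous_rel_set n ?P T c = homologous_rel_set n ?P T 0"
      by (rule homologous_rel_set_eq[THEN iffD2])
    then have "hom_induced n ?N (T - U) ?P T id (homologous_rel_set n ?N (T - U) c) = hom_induced n ?N (T - U) ?P T id (homologous_rel_set n ?N (T - U) 0)"
      using h[OF c'] h[OF z] by simp
    moreover have "homologous_rel_set n ?N (T - U) a \<in> carrier (relative_homology_group n ?N (T - U))"
      if "singular_relcycle n ?N (T - U) a" for a
      using that by (auto simp: carrier_relative_homology_group)
    moreover have "inj_on (hom_induced n ?N (T - U) ?P T id) (carrier (relative_homology_group n ?N (T - U)))"
      using iso by (simp add: iso_def bij_betw_def)
    ultimately have "homologous_rel_set n ?N (T - U) c = homologous_rel_set n ?N (T - U) 0"
      using c' z inj_onD by metis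
    then have "homologous_rel n ?N (T - U) c 0" by (rule homologous_rel_set_eq[THEN iffD1])
    then have "singular_relboundary n ?N (T - U) c" by (simp add: homologous_rel_def)
    then show ?thesis unfolding e2 unfolding e3 singular_relboundary_restrict .
  qed
qed

text \<open>The space of weight \<open>k\<close> is \<open>X k\<close>; one set \<open>A\<close> cuts out a subspace in every weight.\<close>

definition cyc :: "nat \<Rightarrow> (nat \<Rightarrow> 's topology) \<Rightarrow> 's set \<Rightarrow> nat \<Rightarrow> 's chain set" where
  "cyc n X A k = {c. singular_relcycle n (subtopology (X k) A) {} c}"

definition bdy :: "nat \<Rightarrow> (nat \<Rightarrow> 's topology) \<Rightarrow> 's set \<Rightarrow> nat \<Rightarrow> 's chain set" where
  "bdy n X A k = {c. singular_relboundary n (subtopology (X k) A) {} c}"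

definition rcyc :: "nat \<Rightarrow> (nat \<Rightarrow> 's topology) \<Rightarrow> 's set \<Rightarrow> 's set \<Rightarrow> nat \<Rightarrow> 's chain set" where
  "rcyc n X A S k = {c. singular_relcycle n (subtopology (X k) A) S c}"

definition rbdy :: "nat \<Rightarrow> (nat \<Rightarrow> 's topology) \<Rightarrow> 's set \<Rightarrow> 's set \<Rightarrow> nat \<Rightarrow> 's chain set" where
  "rbdy n X A S k = {c. singular_relboundary n (subtopology (X k) A) S c}"

abbreviation opr :: "nat \<Rightarrow> ('e \<Rightarrow> 's \<Rightarrow> 's) \<Rightarrow> 'e \<Rightarrow> 's chain \<Rightarrow> 's chain" where
  "opr n F \<equiv> \<lambda>e. chain_map n (F e)"

definition acts :: "'e set \<Rightarrow> ('e \<Rightarrow> 's \<Rightarrow> 's) \<Rightarrow> (nat \<Rightarrow> 's topology) \<Rightarrow> 's set \<Rightarrow> bool" where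
  "acts E F X A \<longleftrightarrow> (\<forall>e\<in>E. \<forall>k. continuous_map (subtopology (X k) A) (subtopology (X (Suc k)) A) (F e))"

lemma actsD: "acts E F X A \<Longrightarrow> e \<in> E \<Longrightarrow> continuous_map (subtopology (X k) A) (subtopology (X (Suc k)) A) (F e)"
  by (auto simp: acts_def)

lemma acts_subset:
  assumes "acts E F X P" "Q \<subseteq> P" "\<And>e k s. e \<in> E \<Longrightarrow> s \<in> topspace (X k) \<Longrightarrow> s \<in> Q \<Longrightarrow> F e s \<in> Q"
  shows "acts E F X Q"
  unfolding acts_def
proof (intro ballI allI)
  fix e k assume e: "e \<in> E"
  have "continuous_map (subtopology (X k) P) (X (Suc k)) (F e)"
    using actsD[OF assms(1) e, of k] by (simp add: continuous_map_in_subtopology)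
  then have "continuous_map (subtopology (X k) Q) (X (Suc k)) (F e)"
    using assms(2) continuous_map_from_subtopology_mono by blast
  then show "continuous_map (subtopology (X k) Q) (subtopology (X (Suc k)) Q) (F e)"
    using assms(3)[OF e] by (auto simp: continuous_map_in_subtopology)
qed

lemma submod_cyc: "acts E F X A \<Longrightarrow> submod (opr n F) E (cyc n X A)"
  unfolding cyc_def using singular_relcycle_chain_map[OF _ actsD, of n X _ A "{}" _ E F _ "{}"]
  by (intro submodI asub_relcycle) auto

lemma submod_bdy: "acts E F X A \<Longrightarrow> submod (opr n F) E (bdy n X A)"
  unfolding bdy_def using singular_relboundary_chain_map[OF _ actsD, of n X _ A "{}" _ E F _ "{}"]
  by (intro submodI asub_relboundary) auto

lemma submod_rcyc:
  assumes "acts E F X A" "\<And>e k s. e \<in> E \<Longrightarrow> s \<in> topspace (X k) \<Longrightarrow> s \<in> S \<Longrightarrow> F e s \<in> S"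
  shows "submod (opr n F) E (rcyc n X A S)"
proof (intro submodI)
  show "asub (rcyc n X A S k)" for k unfolding rcyc_def by (rule asub_relcycle)
  fix e k x assume e: "e \<in> E" and "x \<in> rcyc n X A S k"
  then have "singular_relcycle n (subtopology (X k) A) (topspace (subtopology (X k) A) \<inter> S) x"
    unfolding singular_relcycle_restrict by (simp add: rcyc_def)
  then have "singular_relcycle n (subtopology (X (Suc k)) A) S (chain_map n (F e) x)"
    by (rule singular_relcycle_chain_map[OF _ actsD[OF assms(1) e]]) (use assms(2)[OF e] in auto)
  then show "chain_map n (F e) x \<in> rcyc n X A S (Suc k)" by (simp add: rcyc_def)
qed

lemma submod_rbdy:
  assumes "acts E F X A" "\<And>e k s. e \<in> E \<Longrightarrow> s \<in> topspace (X k) \<Longrightarrow> s \<in> S \<Longrightarrow> F e s \<in> S"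
  shows "submod (opr n F) E (rbdy n X A S)"
proof (intro submodI)
  show "asub (rbdy n X A S k)" for k unfolding rbdy_def by (rule asub_relboundary)
  fix e k x assume e: "e \<in> E" and "x \<in> rbdy n X A S k"
  then have "singular_relboundary n (subtopology (X k) A) (topspace (subtopology (X k) A) \<inter> S) x"
    unfolding singular_relboundary_restrict by (simp add: rbdy_def)
  then have "singular_relboundary n (subtopology (X (Suc k)) A) S (chain_map n (F e) x)"
    by (rule singular_relboundary_chain_map[OF _ actsD[OF assms(1) e]]) (use assms(2)[OF e] in auto)
  then show "chain_map n (F e) x \<in> rbdy n X A S (Suc k)" by (simp add: rbdy_def)
qed

lemma bdy_le_cyc: "bdy n X A \<le> cyc n X A"
  by (auto simp: le_fun_def bdy_def cyc_def singular_relboundary_imp_relcycle)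

lemma rbdy_le_rcyc: "rbdy n X A S \<le> rcyc n X A S"
  by (auto simp: le_fun_def rbdy_def rcyc_def singular_relboundary_imp_relcycle)

lemma cyc_imp_chain: "c \<in> cyc n X A k \<Longrightarrow> singular_chain n (subtopology (X k) A) c"
  by (simp add: cyc_def singular_cycle)

lemma rcyc_imp_chain: "c \<in> rcyc n X A S k \<Longrightarrow> singular_chain n (subtopology (X k) A) c"
  by (simp add: rcyc_def singular_relcycle)

lemma cyc_mono: "A \<subseteq> A' \<Longrightarrow> c \<in> cyc n X A k \<Longrightarrow> c \<in> cyc n X A' k"
  unfolding cyc_def using singular_cycle_mono by blast

lemma bdy_mono: "A \<subseteq> A' \<Longrightarrow> c \<in> bdy n X A k \<Longrightarrow> c \<in> bdy n X A' k"
  unfolding bdy_def using singular_boundary_mono by blast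

lemma homotopic_cyc:
  assumes "homotopic_with (\<lambda>_. True) (subtopology (X k) A) (subtopology (X l) A') f g" "c \<in> cyc n X A k"
  shows "chain_map n f c - chain_map n g c \<in> bdy n X A' l"
proof -
  have "homotopic_with (\<lambda>h. h \<in> {} \<rightarrow> {}) (subtopology (X k) A) (subtopology (X l) A') f g"
    using assms(1) by simp
  then show ?thesis
    using homotopic_imp_homologous_rel_chain_maps[of "{}" "{}" "subtopology (X k) A" "subtopology (X l) A'" f g n c] assms(2)
    by (simp add: cyc_def bdy_def homologous_rel_def)
qed

lemma opr_comm:
  assumes "singular_chain n (subtopology (X k) A) c"
    "\<And>s. s \<in> topspace (X k) \<Longrightarrow> s \<in> A \<Longrightarrow> f (g s) = g' (f' s)"
  shows "chain_map n f (chain_map n g c) = chain_map n g' (chain_map n f' c)"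
proof -
  have "chain_map n (f \<circ> g) c = chain_map n (g' \<circ> f') c"
    by (rule chain_map_eq[OF assms(1)]) (use assms(2) in simp)
  then show ?thesis by (simp add: chain_map_compose)
qed

text \<open>The two claims are proved together: the boundary commutes with the operators on singular
  chains, so each factor needs to know that what the previous factors produced is one.\<close>

lemma boundary_pk:
  assumes F: "acts E F X A" and "along inc ws qs" "\<And>w. w \<in> set ws \<Longrightarrow> inc w \<subseteq> E"
    and "singular_chain n (subtopology (X k) A) c"
  shows "chain_boundary n (pk (opr n F) qs c) = pk (opr (n - Suc 0) F) qs (chain_boundary n c)
     \<and> singular_chain n (subtopology (X (k + length ws)) A) (pk (opr n F) qs c)"
  using assms(2-)
proof (induction arbitrary: k c rule: list_all2_induct)
  case Nil then show ?case by simp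
next
  case (Cons w ws q qs)
  let ?d = "chain_map n (F (fst q)) c - chain_map n (F (snd q)) c"
  have q: "fst q \<in> E" "snd q \<in> E" using Cons.hyps(1) Cons.prems(1) by auto
  have sc: "singular_chain n (subtopology (X (Suc k)) A) ?d"
    using singular_chain_chain_map[OF Cons.prems(2) actsD[OF F q(1)]]
      singular_chain_chain_map[OF Cons.prems(2) actsD[OF F q(2)]] by (rule singular_chain_diff)
  have "chain_boundary n ?d = chain_map (n - Suc 0) (F (fst q)) (chain_boundary n c) - chain_map (n - Suc 0) (F (snd q)) (chain_boundary n c)"
    by (simp add: chain_boundary_diff chain_boundary_chain_map[OF Cons.prems(2)])
  moreover have "chain_boundary n (pk (opr n F) qs ?d) = pk (opr (n - Suc 0) F) qs (chain_boundary n ?d)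
     \<and> singular_chain n (subtopology (X (Suc k + length ws)) A) (pk (opr n F) qs ?d)"
    by (rule Cons.IH[OF _ sc]) (use Cons.prems(1) in simp)
  ultimately show ?case by simp
qed

text \<open>A piece \<open>N\<close> whose homology comes from \<open>N \<inter> Q\<close>: in its presence the exact sequence
  of the pair gives \<open>H\<^sub>n Q \<rightarrow> H\<^sub>n P \<rightarrow> H\<^sub>n\<^sub>-\<^sub>1 (N \<inter> Q)\<close>, exact in the middle.\<close>

locale collar =
  fixes E :: "'e set" and F :: "'e \<Rightarrow> 's \<Rightarrow> 's" and X :: "nat \<Rightarrow> 's topology" and P Q N :: "'s set" and r :: "'s \<Rightarrow> 's"
  assumes actP: "acts E F X P"
    and FQ: "\<And>e k s. e \<in> E \<Longrightarrow> s \<in> topspace (X k) \<Longrightarrow> s \<in> Q \<Longrightarrow> F e s \<in> Q"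
    and FN: "\<And>e k s. e \<in> E \<Longrightarrow> s \<in> topspace (X k) \<Longrightarrow> s \<in> N \<Longrightarrow> F e s \<in> N"
    and NP: "N \<subseteq> P" and QP: "Q \<subseteq> P" and PNQ: "P \<subseteq> N \<union> Q"
    and oN: "\<And>k. openin (subtopology (X k) P) (topspace (X k) \<inter> N)"
    and oQ: "\<And>k. openin (subtopology (X k) P) (topspace (X k) \<inter> Q)"
    and r: "\<And>k. continuous_map (subtopology (X k) N) (subtopology (X k) (N \<inter> Q)) r"
    and rh: "\<And>k. homotopic_with (\<lambda>_. True) (subtopology (X k) N) (subtopology (X k) N) id r"
begin

lemma actQ: "acts E F X Q" by (rule acts_subset[OF actP QP FQ])
lemma actN: "acts E F X N" by (rule acts_subset[OF actP NP FN])
lemma actNQ: "acts E F X (N \<inter> Q)" by (rule acts_subset[OF actN]) (use FN FQ in auto)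

lemma sub_NQ: "subtopology (subtopology (X k) N) (N \<inter> Q) = subtopology (X k) (N \<inter> Q)"
  by (simp add: subtopology_subtopology)

text \<open>The connecting map is injective, because \<open>N \<inter> Q\<close> maps onto the
  homology of \<open>N\<close>: \<open>r\<close> moves any cycle of \<open>N\<close> into
  \<open>N \<inter> Q\<close> up to homotopy. In degree 0 the boundary vanishes, and
  \<open>c = 0\<close> serves in the proof.\<close>

lemma relboundary_of_boundary:
  assumes z: "z \<in> rcyc n X N (N \<inter> Q) k" and b: "chain_boundary n z \<in> bdy (n - Suc 0) X (N \<inter> Q) k"
  shows "z \<in> rbdy n X N (N \<inter> Q) k"
proof -
  have sz: "singular_chain n (subtopology (X k) N) z" using z by (rule rcyc_imp_chain)
  have "\<exists>c. singular_chain n (subtopology (X k) (N \<inter> Q)) c \<and> chain_boundary n c = chain_boundary n z"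
  proof (cases n)
    case 0 then show ?thesis by (intro exI[of _ 0]) (simp add: chain_boundary_def)
  next
    case (Suc m) then show ?thesis using b by (simp add: bdy_def singular_boundary)
  qed
  then obtain c where c: "singular_chain n (subtopology (X k) (N \<inter> Q)) c" "chain_boundary n c = chain_boundary n z"
    by blast
  have "z - c \<in> cyc n X N k"
    unfolding cyc_def singular_cycle mem_Collect_eq
    using singular_chain_diff[OF sz singular_chain_sub_mono[OF c(1)]] c(2) by (simp add: chain_boundary_diff)
  note zc = this
  have "chain_map n id (z - c) - chain_map n r (z - c) \<in> bdy n X N k" by (rule homotopic_cyc[OF rh zc])
  moreover have "chain_map n id (z - c) = z - c" by (rule chain_map_ident[OF cyc_imp_chain[OF zc]])
  ultimately obtain d where d: "singular_chain (Suc n) (subtopology (X k) N) d" "chain_boundary (Suc n) d = (z - c) - chain_map n r (z - c)"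
    by (auto simp: bdy_def singular_boundary)
  have "singular_chain n (subtopology (X k) (N \<inter> Q)) (c + chain_map n r (z - c))"
    by (rule singular_chain_add[OF c(1) singular_chain_chain_map[OF cyc_imp_chain[OF zc] r]])
  then have "singular_chain n (subtopology (subtopology (X k) N) (N \<inter> Q)) (c + chain_map n r (z - c))"
    by (simp only: sub_NQ)
  then show ?thesis unfolding rbdy_def mem_Collect_eq singular_relboundary
    using d by (intro exI[of _ d] exI[of _ "c + chain_map n r (z - c)"]) simp
qed

lemma boundary_rcyc: "z \<in> rcyc n X N (N \<inter> Q) k \<Longrightarrow> chain_boundary n z \<in> cyc (n - Suc 0) X (N \<inter> Q) k"
  using chain_boundary_boundary[of n "subtopology (X k) N" z] rcyc_imp_chain[of z n X N "N \<inter> Q" k]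
  unfolding rcyc_def cyc_def singular_relcycle singular_cycle sub_NQ by simp

lemma boundary_rbdy:
  assumes "z \<in> rbdy n X N (N \<inter> Q) k" shows "chain_boundary n z \<in> bdy (n - Suc 0) X (N \<inter> Q) k"
proof (cases n)
  case 0 then show ?thesis by (simp add: chain_boundary_def bdy_def)
next
  case (Suc m)
  obtain d e where "singular_chain (Suc n) (subtopology (X k) N) d" "singular_chain n (subtopology (X k) (N \<inter> Q)) e"
    "chain_boundary (Suc n) d + e = z"
    using assms unfolding rbdy_def singular_relboundary sub_NQ by blast
  then show ?thesis unfolding bdy_def mem_Collect_eq singular_boundary
    using chain_boundary_boundary_alt[of n "subtopology (X k) N" d] Suc
    by (intro exI[of _ e]) (auto simp: chain_boundary_add)
qed

text \<open>By excision the relative homology of \<open>(P, Q)\<close> is a quotient of that of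
  \<open>(N, N \<inter> Q)\<close>, which in turn embeds by the connecting map in the homology of
  \<open>N \<inter> Q\<close> one degree lower.\<close>

lemma noeth_rel:
  assumes "noeth (opr (n - Suc 0) F) E (cyc (n - Suc 0) X (N \<inter> Q)) (bdy (n - Suc 0) X (N \<inter> Q))"
  shows "noeth (opr n F) E (rcyc n X P Q) (rbdy n X P Q)"
proof (rule noeth_surj[where f="\<lambda>x. x" and ?A1.0="rcyc n X N (N \<inter> Q)" and ?B1.0="rbdy n X N (N \<inter> Q)" and ?\<phi>1.0="opr n F"])
  show N: "submod (opr n F) E (rcyc n X N (N \<inter> Q))"
    by (rule submod_rcyc[OF actN]) (use FN FQ in auto)
  show "noeth (opr n F) E (rcyc n X N (N \<inter> Q)) (rbdy n X N (N \<inter> Q))"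
  proof (rule noeth_inj[where g="chain_boundary n", OF assms])
    show "submod (opr n F) E (rbdy n X N (N \<inter> Q))"
      by (rule submod_rbdy[OF actN]) (use FN FQ in auto)
    show "asub (cyc (n - Suc 0) X (N \<inter> Q) k)" for k unfolding cyc_def by (rule asub_relcycle)
    show "chain_boundary n (opr n F e x) = opr (n - Suc 0) F e (chain_boundary n x)"
      if "x \<in> rcyc n X N (N \<inter> Q) k" for e k x
      by (rule chain_boundary_chain_map[OF rcyc_imp_chain[OF that]])
  qed (rule submod_bdy[OF actNQ] bdy_le_cyc rbdy_le_rcyc addf_chain_boundary addf_chain_map
      boundary_rcyc relboundary_of_boundary; assumption)+
  show "submod (opr n F) E (rcyc n X P Q)" by (rule submod_rcyc[OF actP FQ])
  have inj: "singular_relcycle n (subtopology (X k) N) (N \<inter> Q) x \<Longrightarrow> singular_relcycle n (subtopology (X k) P) Q x" for x k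
    using NP singular_chain_sub_mono unfolding singular_relcycle subtopology_subtopology
    by (metis Int_commute inf.absorb_iff2 inf_le2 QP Int_assoc)
  show "x \<in> rcyc n X P Q k" if "x \<in> rcyc n X N (N \<inter> Q) k" for k x
    using inj that by (simp add: rcyc_def)
  show "x \<in> rbdy n X P Q k" if x: "x \<in> rbdy n X N (N \<inter> Q) k" for k x
  proof -
    obtain d e where "singular_chain (Suc n) (subtopology (X k) N) d" "singular_chain n (subtopology (X k) (N \<inter> Q)) e"
      "chain_boundary (Suc n) d + e = x"
      using x unfolding rbdy_def singular_relboundary sub_NQ by blast
    moreover have "singular_chain n (subtopology (subtopology (X k) P) Q) e"
      using singular_chain_sub_mono[OF calculation(2), of "P \<inter> Q"] NP by (auto simp: subtopology_subtopology)
    ultimately show ?thesis unfolding rbdy_def mem_Collect_eq singular_relboundary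
      using singular_chain_sub_mono[OF _ NP] by blast
  qed
  show "\<exists>a\<in>rcyc n X N (N \<inter> Q) k. x - a \<in> rbdy n X P Q k" if "x \<in> rcyc n X P Q k" for k x
    using excision_rel_surj[OF NP QP PNQ oN[of k] oQ[of k], of n x] that unfolding rcyc_def rbdy_def by blast
qed (rule rbdy_le_rcyc addf_id addf_chain_map refl)+

text \<open>Exactness of the sequence of the pair at \<open>P\<close>: the part \<open>e\<close> in
  \<open>Q\<close> of a relative boundary is itself a cycle, because \<open>x\<close> is.\<close>

lemma cyc_rbdyD:
  assumes "x \<in> cyc n X P k" "x \<in> rbdy n X P Q k"
  shows "\<exists>a\<in>cyc n X Q k. x - a \<in> bdy n X P k"
proof -
  have sPQ: "subtopology (subtopology (X k) P) Q = subtopology (X k) Q"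
    using QP by (simp add: subtopology_subtopology Int_absorb1)
  obtain d e where d: "singular_chain (Suc n) (subtopology (X k) P) d" "singular_chain n (subtopology (X k) Q) e"
    "chain_boundary (Suc n) d + e = x"
    using assms(2) unfolding rbdy_def singular_relboundary sPQ by blast
  have "chain_boundary n e = 0"
    using d assms(1) chain_boundary_boundary_alt[OF d(1)] unfolding cyc_def singular_cycle mem_Collect_eq
    by (metis add_0 chain_boundary_add)
  then have "e \<in> cyc n X Q k" using d(2) by (simp add: cyc_def singular_cycle)
  moreover have "x - e \<in> bdy n X P k" using d by (auto simp: bdy_def singular_boundary)
  ultimately show ?thesis by blast
qed

lemma noeth_collar:
  assumes "noeth (opr n F) E (cyc n X Q) (bdy n X Q)"
    "noeth (opr (n - Suc 0) F) E (cyc (n - Suc 0) X (N \<inter> Q)) (bdy (n - Suc 0) X (N \<inter> Q))"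
  shows "noeth (opr n F) E (cyc n X P) (bdy n X P)"
proof (rule noeth_middle[where f="\<lambda>x. x" and g="\<lambda>x. x", OF assms(1) noeth_rel[OF assms(2)]])
  show "submod (opr n F) E (rbdy n X P Q)" by (rule submod_rbdy[OF actP FQ])
  show "x \<in> cyc n X P k" if "x \<in> cyc n X Q k" for k x using cyc_mono[OF QP that] .
  show "x \<in> bdy n X P k" if "x \<in> bdy n X Q k" for k x using bdy_mono[OF QP that] .
  show "x \<in> rcyc n X P Q k" if "x \<in> cyc n X P k" for k x
    using that unfolding cyc_def rcyc_def singular_cycle unfolding singular_relcycle by simp
  show "\<exists>a\<in>cyc n X Q k. x - a \<in> bdy n X P k" if "x \<in> cyc n X P k" "x \<in> rbdy n X P Q k" for k x
    by (rule cyc_rbdyD[OF that])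
  show "asub (rcyc n X P Q k)" for k unfolding rcyc_def by (rule asub_relcycle)
qed (rule submod_cyc[OF actQ] bdy_le_cyc rbdy_le_rcyc addf_id addf_chain_map refl)+

end

definition torskill :: "nat \<Rightarrow> ('e \<Rightarrow> 's \<Rightarrow> 's) \<Rightarrow> (nat \<Rightarrow> 's topology) \<Rightarrow> 's set \<Rightarrow> ('e \<times> 'e) list \<Rightarrow> bool" where
  "torskill n F X A qs \<longleftrightarrow> (\<forall>k. \<forall>x\<in>cyc n X A k. \<forall>m. m \<noteq> 0 \<longrightarrow> frag_cmul m x \<in> bdy n X A k
      \<longrightarrow> pk (opr n F) qs x \<in> bdy n X A (k + length qs))"

text \<open>A torsion class \<open>x\<close> is represented by a relative class \<open>z\<close>
  near the collar, whose boundary is a torsion class one degree lower. The product over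
  \<open>qs\<close> kills that boundary, hence \<open>z\<close> by injectivity of the connecting
  map. So it sends \<open>x\<close> into the image of the homology of \<open>Q\<close>, where the
  two operators \<open>F e\<close> and \<open>F e'\<close> are homotopic.\<close>

lemma (in collar) torskill_collar:
  assumes qs: "along inc ws qs" and inc: "\<And>w. w \<in> set ws \<Longrightarrow> inc w \<subseteq> E"
    and K: "torskill n F X (N \<inter> Q) qs"
    and e: "e \<in> E" "e' \<in> E"
    and hom: "\<And>k. homotopic_with (\<lambda>_. True) (subtopology (X k) Q) (subtopology (X (Suc k)) P) (F e) (F e')"
  shows "torskill (Suc n) F X P (qs @ [(e, e')])"
  unfolding torskill_def
proof (intro allI ballI impI)
  fix k x m assume x: "x \<in> cyc (Suc n) X P k" and m: "m \<noteq> 0" and mx: "frag_cmul m x \<in> bdy (Suc n) X P k"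
  let ?l = "k + length qs"
  have len: "length ws = length qs" using qs by (rule list_all2_lengthD)
  have sN: "submod (opr (Suc n) F) E (rbdy (Suc n) X N (N \<inter> Q))" "submod (opr (Suc n) F) E (rcyc (Suc n) X N (N \<inter> Q))"
    using submod_rbdy[OF actN, of "N \<inter> Q"] submod_rcyc[OF actN, of "N \<inter> Q"] FN FQ by auto
  have sP: "submod (opr (Suc n) F) E (rbdy (Suc n) X P Q)" by (rule submod_rbdy[OF actP FQ])
  have "singular_relcycle (Suc n) (subtopology (X k) P) Q x"
    using x unfolding cyc_def singular_cycle unfolding singular_relcycle by simp
  then obtain z where z: "z \<in> rcyc (Suc n) X N (N \<inter> Q) k" and xz: "x - z \<in> rbdy (Suc n) X P Q k"
    using excision_rel_surj[OF NP QP PNQ oN oQ] unfolding rcyc_def rbdy_def by blast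
  have asr: "asub (rbdy (Suc n) X P Q l)" for l by (rule submod_asub[OF sP])
  obtain d0 where "singular_chain (Suc (Suc n)) (subtopology (X k) P) d0" "chain_boundary (Suc (Suc n)) d0 = frag_cmul m x"
    using mx unfolding bdy_def singular_boundary by blast
  then have "frag_cmul m x \<in> rbdy (Suc n) X P Q k"
    unfolding rbdy_def mem_Collect_eq singular_relboundary by (intro exI[of _ d0] exI[of _ 0]) simp
  then have "frag_cmul m x - frag_cmul m (x - z) \<in> rbdy (Suc n) X P Q k"
    using asub_diff[OF asr _ asub_cmul[OF asr xz]] by blast
  moreover have "frag_cmul m x - frag_cmul m (x - z) = frag_cmul m z"
    using frag_cmul_distrib2[of m "x - z" z] by simp
  ultimately have "singular_relboundary (Suc n) (subtopology (X k) P) Q (frag_cmul m z)"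
    by (simp add: rbdy_def)
  \<comment> \<open>The injective half of excision: the multiple of \<open>z\<close> bounds relative
    to \<open>Q\<close> in \<open>P\<close>, hence already in \<open>N\<close>. This is what makes
    the boundary of \<open>z\<close> a torsion class.\<close>
  then have "frag_cmul m z \<in> rbdy (Suc n) X N (N \<inter> Q) k"
    using excision_rel_inj[OF NP QP PNQ oN oQ] singular_relcycle_cmul z unfolding rcyc_def rbdy_def by blast
  then have "chain_boundary (Suc n) (frag_cmul m z) \<in> bdy (Suc n - Suc 0) X (N \<inter> Q) k"
    by (rule boundary_rbdy)
  then have "frag_cmul m (chain_boundary (Suc n) z) \<in> bdy n X (N \<inter> Q) k"
    by (simp add: chain_boundary_cmul)
  moreover have "chain_boundary (Suc n) z \<in> cyc n X (N \<inter> Q) k" using boundary_rcyc[OF z] by simp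
  ultimately have "pk (opr n F) qs (chain_boundary (Suc n) z) \<in> bdy n X (N \<inter> Q) ?l"
    using K m unfolding torskill_def by blast
  then have "chain_boundary (Suc n) (pk (opr (Suc n) F) qs z) \<in> bdy (Suc n - Suc 0) X (N \<inter> Q) ?l"
    using boundary_pk[OF actN qs inc rcyc_imp_chain[OF z]] by simp
  moreover have "pk (opr (Suc n) F) qs z \<in> rcyc (Suc n) X N (N \<inter> Q) ?l"
    using pk_in[OF qs sN(2) inc z] len by simp
  ultimately have "pk (opr (Suc n) F) qs z \<in> rbdy (Suc n) X N (N \<inter> Q) ?l"
    using relboundary_of_boundary by blast
  then obtain d e0 where "singular_chain (Suc (Suc n)) (subtopology (X ?l) N) d" "singular_chain (Suc n) (subtopology (X ?l) (N \<inter> Q)) e0"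
      "chain_boundary (Suc (Suc n)) d + e0 = pk (opr (Suc n) F) qs z"
    unfolding rbdy_def singular_relboundary sub_NQ by blast
  moreover have "singular_chain (Suc n) (subtopology (subtopology (X ?l) P) Q) e0"
    using singular_chain_sub_mono[OF calculation(2), of "P \<inter> Q"] NP by (auto simp: subtopology_subtopology)
  ultimately have pz: "pk (opr (Suc n) F) qs z \<in> rbdy (Suc n) X P Q ?l"
    unfolding rbdy_def mem_Collect_eq singular_relboundary using singular_chain_sub_mono[OF _ NP] by blast
  have ad: "addf (pk (opr (Suc n) F) qs)" by (rule addf_pk[OF qs addf_chain_map])
  have "pk (opr (Suc n) F) qs (x - z) \<in> rbdy (Suc n) X P Q ?l"
    using pk_in[OF qs sP inc xz] len by simp
  then have "pk (opr (Suc n) F) qs x \<in> rbdy (Suc n) X P Q ?l"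
    using asub_add[OF asr _ pz] addf_diff[OF ad, of x z] by fastforce
  moreover have "pk (opr (Suc n) F) qs x \<in> cyc (Suc n) X P ?l"
    using pk_in[OF qs submod_cyc[OF actP] inc x] len by simp
  \<comment> \<open>The homotopy \<open>hom\<close> starts on \<open>Q\<close> alone, so the
    difference of operators is applied to \<open>a\<close>; the remaining part is already a boundary
    in \<open>P\<close>.\<close>
  ultimately obtain a where a: "a \<in> cyc (Suc n) X Q ?l" "pk (opr (Suc n) F) qs x - a \<in> bdy (Suc n) X P ?l"
    using cyc_rbdyD by blast
  let ?D = "\<lambda>y. chain_map (Suc n) (F e) y - chain_map (Suc n) (F e') y"
  have asb: "asub (bdy (Suc n) X P l)" for l unfolding bdy_def by (rule asub_relboundary)
  have "?D a \<in> bdy (Suc n) X P (Suc ?l)" by (rule homotopic_cyc[OF hom a(1)])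
  moreover have "?D (pk (opr (Suc n) F) qs x - a) \<in> bdy (Suc n) X P (Suc ?l)"
    using submod_act[OF submod_bdy[OF actP] e(1) a(2)] submod_act[OF submod_bdy[OF actP] e(2) a(2)]
    by (rule asub_diff[OF asb])
  ultimately have "?D (pk (opr (Suc n) F) qs x - a) + ?D a \<in> bdy (Suc n) X P (Suc ?l)"
    by (intro asub_add[OF asb])
  then have "?D (pk (opr (Suc n) F) qs x) \<in> bdy (Suc n) X P (Suc ?l)"
    by (simp add: chain_map_diff)
  then show "pk (opr (Suc n) F) (qs @ [(e, e')]) x \<in> bdy (Suc n) X P (k + length (qs @ [(e, e')]))"
    by (simp add: pk_append)
qed

text \<open>Replace every 0-simplex by a chosen one in its homology class and extend linearly to
  \<theta>. The ends of a 1-simplex have the same choice, so \<theta> kills boundaries, and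
  \<open>x - \<theta> x\<close> always bounds. If a nonzero multiple of \<open>x\<close> bounds,
  then \<theta> vanishes on it, hence on \<open>x\<close>, because chains are free.\<close>

lemma simplex_homologous_class_0:
  fixes X :: "'s topology"
  assumes x: "singular_relcycle 0 X {} x" and m: "m \<noteq> 0" and mx: "singular_relboundary 0 X {} (frag_cmul m x)"
  shows "singular_relboundary 0 X {} x"
proof -
  define r where "r f = (SOME g. homologous_rel 0 X {} (frag_of f) (frag_of g))" for f
  define \<theta> where "\<theta> = frag_extend (\<lambda>f. frag_of (r f))"
  have r: "homologous_rel 0 X {} (frag_of f) (frag_of (r f))" for f
  proof -
    have "\<exists>g. homologous_rel 0 X {} (frag_of f) (frag_of g)" by (rule exI[of _ f]) simp
    from someI_ex[OF this] show ?thesis by (simp only: r_def)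
  qed
  have r_eq: "r f = r g" if "homologous_rel 0 X {} (frag_of f) (frag_of g)" for f g
  proof -
    have "homologous_rel 0 X {} (frag_of f) = homologous_rel 0 X {} (frag_of g)"
      using that by (simp only: homologous_rel_eq)
    then show ?thesis by (simp add: r_def)
  qed
  have bd: "\<theta> (chain_boundary (Suc 0) d) = 0" if "singular_chain (Suc 0) X d" for d
    using that unfolding singular_chain_def
  proof (induction d rule: frag_induction)
    case zero show ?case by (simp add: \<theta>_def)
  next
    case (one f)
    have "chain_boundary (Suc 0) (frag_of f) = frag_of (singular_face (Suc 0) 0 f) - frag_of (singular_face (Suc 0) (Suc 0) f)"
      by (simp add: chain_boundary_of)
    moreover have "r (singular_face (Suc 0) 0 f) = r (singular_face (Suc 0) (Suc 0) f)"
      by (rule r_eq) (use one calculation in \<open>auto simp: homologous_rel_def singular_boundary singular_chain_of intro!: exI[of _ "frag_of f"]\<close>)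
    ultimately show ?case by (simp add: \<theta>_def frag_extend_diff)
  next
    case (diff a b) then show ?case by (simp add: \<theta>_def chain_boundary_diff frag_extend_diff)
  qed
  have sub: "singular_relboundary 0 X {} (c - \<theta> c)" for c
    using subset_UNIV
  proof (induction c rule: frag_induction)
    case zero show ?case by (simp add: \<theta>_def)
  next
    case (one f) then show ?case using r[of f] by (simp add: \<theta>_def homologous_rel_def)
  next
    case (diff a b)
    have eq: "(a - b) - \<theta> (a - b) = (a - \<theta> a) - (b - \<theta> b)" by (simp add: \<theta>_def frag_extend_diff)
    show ?case unfolding eq by (rule singular_relboundary_diff[OF diff])
  qed
  obtain d where d: "singular_chain (Suc 0) X d" "chain_boundary (Suc 0) d = frag_cmul m x"
    using mx unfolding singular_boundary by blast
  have "frag_cmul m (\<theta> x) = 0" using bd[OF d(1)] d(2) by (simp add: \<theta>_def frag_extend_cmul)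
  then have "\<theta> x = 0" using m by simp
  then show ?thesis using sub[of x] by simp
qed

lemma torskill_0: "torskill 0 F X A []"
  unfolding torskill_def cyc_def bdy_def using simplex_homologous_class_0 by auto

section \<open>Spaces that split into finitely many open pieces\<close>

definition rst :: "nat \<Rightarrow> 's set \<Rightarrow> 's chain \<Rightarrow> 's chain" where
  "rst n A = frag_extend (\<lambda>f. if f ` standard_simplex n \<subseteq> A then frag_of f else 0)"

lemma addf_rst: "addf (rst n A)"
  by (simp add: addf_def rst_def frag_extend_diff)

lemma face_image: 
  assumes "i \<le> Suc n" shows "singular_face (Suc n) i f ` standard_simplex n \<subseteq> f ` standard_simplex (Suc n)"
proof -
  have "simplical_face i x \<in> standard_simplex (Suc n)" if "x \<in> standard_simplex n" for x
    using simplical_face_in_standard_simplex[of "Suc n" i x] assms that by simp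
  then show ?thesis by (auto simp: singular_face_def)
qed

locale split_space =
  fixes Y :: "'s topology" and H :: "'h set" and A :: "'h \<Rightarrow> 's set"
  assumes fin: "finite H" and cover: "topspace Y \<subseteq> (\<Union>h\<in>H. A h)"
    and disj: "\<And>h h'. h \<in> H \<Longrightarrow> h' \<in> H \<Longrightarrow> h \<noteq> h' \<Longrightarrow> A h \<inter> A h' = {}"
    and op: "\<And>h. h \<in> H \<Longrightarrow> openin Y (topspace Y \<inter> A h)"
begin

lemma simplex_in_piece:
  assumes "singular_simplex n Y f" shows "\<exists>h\<in>H. f ` standard_simplex n \<subseteq> A h"
proof -
  let ?I = "f ` standard_simplex n"
  have f: "continuous_map (subtopology (powertop_real UNIV) (standard_simplex n)) Y f"
    using assms by (simp add: singular_simplex_def)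
  have "connectedin (subtopology (powertop_real UNIV) (standard_simplex n)) (standard_simplex n)"
    using connectedin_standard_simplex by (simp add: connectedin_subtopology)
  then have con: "connectedin Y ?I" by (rule connectedin_continuous_map_image[OF f])
  have sub: "?I \<subseteq> topspace Y" using con by (rule connectedin_subset_topspace)
  obtain p where p: "p \<in> standard_simplex n" using nonempty_standard_simplex by blast
  then obtain h where h: "h \<in> H" "f p \<in> A h" using sub cover by blast
  have "?I \<subseteq> A h"
  proof (rule ccontr)
    assume ne: "\<not> ?I \<subseteq> A h"
    let ?U = "topspace Y \<inter> A h" and ?V = "\<Union>h'\<in>H - {h}. topspace Y \<inter> A h'"
    have "openin Y ?U" using op h(1) by blast
    moreover have "openin Y ?V" by (rule openin_Union) (use op in blast)
    moreover have "?I \<subseteq> ?U \<union> ?V" using sub cover by blast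
    moreover have "?U \<inter> ?V \<inter> ?I = {}" using disj h(1) by blast
    moreover have "?U \<inter> ?I \<noteq> {}" using h p sub by blast
    moreover have "?V \<inter> ?I \<noteq> {}" using ne sub cover by blast
    ultimately show False using con unfolding connectedin by blast
  qed
  then show ?thesis using h by blast
qed

lemma piece_iff:
  assumes "h \<in> H" "h' \<in> H" "I \<subseteq> A h'" "I \<noteq> {}" shows "I \<subseteq> A h \<longleftrightarrow> h = h'"
  using disj[OF assms(1,2)] assms(3,4) by blast

lemma rst_of:
  assumes "h \<in> H" "h' \<in> H" "f ` standard_simplex n \<subseteq> A h'"
  shows "rst n (A h) (frag_of f) = (if h = h' then frag_of f else 0)"
  using piece_iff[OF assms] nonempty_standard_simplex[of n] by (simp add: rst_def)

text \<open>A simplex is connected, so it lies in one piece together with all its faces. This makes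
  \<open>rst\<close> commute with the boundary, which fails for restriction to an arbitrary
  set.\<close>

lemma rst_boundary:
  assumes h: "h \<in> H" and c: "singular_chain n Y c"
  shows "chain_boundary n (rst n (A h) c) = rst (n - Suc 0) (A h) (chain_boundary n c)"
proof (cases n)
  case 0 then show ?thesis by (simp add: chain_boundary_def rst_def)
next
  case (Suc m)
  show ?thesis using c unfolding singular_chain_def
  proof (induction c rule: frag_induction)
    case zero show ?case by (simp add: rst_def)
  next
    case (one f)
    then obtain h' where h': "h' \<in> H" "f ` standard_simplex n \<subseteq> A h'" using simplex_in_piece by blast
    have fc: "rst m (A h) (frag_of (singular_face n i f)) = (if h = h' then frag_of (singular_face n i f) else 0)"
      if "i \<le> n" for i
      by (rule rst_of[OF h h'(1)]) (use face_image[of i m f] h'(2) that Suc in blast)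
    have "rst m (A h) (chain_boundary n (frag_of f)) = (\<Sum>i\<le>n. frag_cmul ((-1) ^ i) (rst m (A h) (frag_of (singular_face n i f))))"
      using Suc by (simp add: chain_boundary_of rst_def frag_extend_sum frag_extend_cmul o_def del: sum.atMost_Suc frag_extend_of)
    also have "\<dots> = (\<Sum>i\<le>n. frag_cmul ((-1) ^ i) (if h = h' then frag_of (singular_face n i f) else 0))"
      using fc by (intro sum.cong) simp_all
    also have "\<dots> = (if h = h' then chain_boundary n (frag_of f) else 0)"
      using Suc by (simp add: chain_boundary_of del: sum.atMost_Suc)
    also have "\<dots> = chain_boundary n (rst n (A h) (frag_of f))"
      by (simp add: rst_of[OF h h'])
    finally show ?case using Suc by simp
  next
    case (diff a b)
    then show ?case
      using addf_diff[OF addf_rst[of n "A h"]] addf_diff[OF addf_rst[of "n - Suc 0" "A h"]]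
      by (simp add: chain_boundary_diff)
  qed
qed

lemma rst_chain: "singular_chain n Y c \<Longrightarrow> singular_chain n (subtopology Y (A h)) (rst n (A h) c)"
  unfolding rst_def
  by (rule singular_chain_extend) (auto simp: singular_chain_of singular_simplex_subtopology singular_chain_def)

lemma rst_sum:
  assumes "singular_chain n Y c" shows "(\<Sum>h\<in>H. rst n (A h) c) = c"
  using assms unfolding singular_chain_def
proof (induction c rule: frag_induction)
  case zero show ?case by (simp add: rst_def)
next
  case (one f)
  then obtain h' where h': "h' \<in> H" "f ` standard_simplex n \<subseteq> A h'" using simplex_in_piece by blast
  have "(\<Sum>h\<in>H. rst n (A h) (frag_of f)) = (\<Sum>h\<in>H. if h = h' then frag_of f else 0)"
    by (rule sum.cong) (simp_all add: rst_of[OF _ h'])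
  then show ?case using h'(1) fin by simp
next
  case (diff a b)
  have "(\<Sum>h\<in>H. rst n (A h) (a - b)) = (\<Sum>h\<in>H. rst n (A h) a) - (\<Sum>h\<in>H. rst n (A h) b)"
    by (simp add: addf_diff[OF addf_rst] sum_subtractf)
  then show ?case using diff by simp
qed

lemma rst_chain_map:
  assumes h: "h \<in> H" and c: "singular_chain n Y c"
    and Y': "split_space Y' H A" and f: "continuous_map Y Y' F"
    and FA: "\<And>h s. h \<in> H \<Longrightarrow> s \<in> topspace Y \<Longrightarrow> s \<in> A h \<Longrightarrow> F s \<in> A h"
  shows "rst n (A h) (chain_map n F c) = chain_map n F (rst n (A h) c)"
  using c unfolding singular_chain_def
proof (induction c rule: frag_induction)
  case zero show ?case by (simp add: rst_def)
next
  case (one g)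
  then obtain h' where h': "h' \<in> H" "g ` standard_simplex n \<subseteq> A h'" using simplex_in_piece by blast
  have g: "g ` standard_simplex n \<subseteq> topspace Y"
    using one by (auto simp: singular_simplex_def continuous_map_def Pi_iff)
  have "simplex_map n F g ` standard_simplex n \<subseteq> A h'"
    using h' g FA by (auto simp: simplex_map_def)
  then show ?case by (simp add: rst_of[OF h h'] rst_of[OF h h'(1)])
next
  case (diff a b)
  then show ?case by (simp add: addf_diff[OF addf_rst] chain_map_diff)
qed

end

text \<open>Here \<open>S\<close> is the collar with its centre left free. It splits into pieces
  \<open>A h\<close>, one for each half-edge; forgetting a point maps each piece to \<open>D\<close>
  in the next lower weight, and \<open>sec h\<close> puts a point back. That the operators commute
  strictly with \<open>rem\<close> makes the comparison one of modules.\<close>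

locale leaves =
  fixes E :: "'e set" and F :: "'e \<Rightarrow> 's \<Rightarrow> 's" and X :: "nat \<Rightarrow> 's topology" and S :: "'s set"
    and H :: "'h set" and A :: "'h \<Rightarrow> 's set" and D :: "'s set" and rem :: "'s \<Rightarrow> 's" and sec :: "'h \<Rightarrow> 's \<Rightarrow> 's"
  assumes actS: "acts E F X S" and actD: "acts E F X D"
    and FA: "\<And>h e k s. h \<in> H \<Longrightarrow> e \<in> E \<Longrightarrow> s \<in> topspace (X k) \<Longrightarrow> s \<in> A h \<Longrightarrow> F e s \<in> A h"
    and fin: "finite H" and AS: "\<And>h. h \<in> H \<Longrightarrow> A h \<subseteq> S"
    and cover: "\<And>k. topspace (X k) \<inter> S \<subseteq> (\<Union>h\<in>H. A h)"
    and disj: "\<And>h h'. h \<in> H \<Longrightarrow> h' \<in> H \<Longrightarrow> h \<noteq> h' \<Longrightarrow> A h \<inter> A h' = {}"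
    and op: "\<And>k h. h \<in> H \<Longrightarrow> openin (subtopology (X k) S) (topspace (X k) \<inter> A h)"
    and S0: "topspace (X 0) \<inter> S = {}"
    and rem: "\<And>k h. h \<in> H \<Longrightarrow> continuous_map (subtopology (X (Suc k)) (A h)) (subtopology (X k) D) rem"
    and remF: "\<And>e k s. e \<in> E \<Longrightarrow> s \<in> topspace (X k) \<Longrightarrow> s \<in> S \<Longrightarrow> rem (F e s) = F e (rem s)"
    and sec: "\<And>k h. h \<in> H \<Longrightarrow> continuous_map (subtopology (X k) D) (subtopology (X (Suc k)) (A h)) (sec h)"
    and hom: "\<And>k h. h \<in> H \<Longrightarrow> homotopic_with (\<lambda>_. True) (subtopology (X (Suc k)) (A h)) (subtopology (X (Suc k)) (A h)) id (sec h \<circ> rem)"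
begin

lemma sp: "split_space (subtopology (X k) S) H A"
proof
  show "openin (subtopology (X k) S) (topspace (subtopology (X k) S) \<inter> A h)" if "h \<in> H" for h
  proof -
    have "topspace (subtopology (X k) S) \<inter> A h = topspace (X k) \<inter> A h" using AS[OF that] by auto
    then show ?thesis using op[OF that] by simp
  qed
qed (use fin cover disj in auto)

definition cmp :: "nat \<Rightarrow> 'h \<Rightarrow> 's chain \<Rightarrow> 's chain" where
  "cmp n h c = chain_map n rem (rst n (A h) c)"

lemma addf_cmp: "addf (cmp n h)"
  unfolding cmp_def by (rule addf_comp[OF addf_chain_map addf_rst])

lemma subA: "h \<in> H \<Longrightarrow> subtopology (subtopology (X k) S) (A h) = subtopology (X k) (A h)"
  using AS by (simp add: subtopology_subtopology Int_absorb1)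

lemma rst_cyc:
  assumes h: "h \<in> H" and c: "c \<in> cyc n X S k" shows "rst n (A h) c \<in> cyc n X (A h) k"
proof -
  interpret s: split_space "subtopology (X k) S" H A by (rule sp)
  have sc: "singular_chain n (subtopology (X k) S) c" using c by (rule cyc_imp_chain)
  have "chain_boundary n (rst n (A h) c) = rst (n - Suc 0) (A h) 0"
    using s.rst_boundary[OF h sc] c by (simp add: cyc_def singular_cycle)
  then show ?thesis using s.rst_chain[OF sc, of h] addf_0[OF addf_rst] unfolding subA[OF h]
    by (simp add: cyc_def singular_cycle)
qed

lemma rst_bdy:
  assumes h: "h \<in> H" and c: "c \<in> bdy n X S k" shows "rst n (A h) c \<in> bdy n X (A h) k"
proof -
  interpret s: split_space "subtopology (X k) S" H A by (rule sp)
  obtain d where d: "singular_chain (Suc n) (subtopology (X k) S) d" "chain_boundary (Suc n) d = c"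
    using c by (auto simp: bdy_def singular_boundary)
  have "chain_boundary (Suc n) (rst (Suc n) (A h) d) = rst n (A h) c"
    using s.rst_boundary[OF h d(1)] d(2) by simp
  then show ?thesis using s.rst_chain[OF d(1), of h] unfolding subA[OF h]
    by (auto simp: bdy_def singular_boundary)
qed

lemma empty_0: "cyc n X S 0 = {0}"
  using S0 by (auto simp: cyc_def singular_cycle singular_chain_empty)

lemma cmp_cyc: assumes "h \<in> H" "c \<in> cyc n X S (Suc k)" shows "cmp n h c \<in> cyc n X D k"
  using singular_relcycle_chain_map[of n "subtopology (X (Suc k)) (A h)" "{}" _ "subtopology (X k) D" rem "{}"]
    rst_cyc[OF assms] rem[OF assms(1)] unfolding cmp_def cyc_def by simp

lemma cmp_bdy: assumes "h \<in> H" "c \<in> bdy n X S (Suc k)" shows "cmp n h c \<in> bdy n X D k"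
  using singular_relboundary_chain_map[of n "subtopology (X (Suc k)) (A h)" "{}" _ "subtopology (X k) D" rem "{}"]
    rst_bdy[OF assms] rem[OF assms(1)] unfolding cmp_def bdy_def by simp

lemma cmp_opr:
  assumes h: "h \<in> H" and e: "e \<in> E" and c: "singular_chain n (subtopology (X k) S) c"
  shows "cmp n h (opr n F e c) = opr n F e (cmp n h c)"
proof -
  interpret s: split_space "subtopology (X k) S" H A by (rule sp)
  have "rst n (A h) (chain_map n (F e) c) = chain_map n (F e) (rst n (A h) c)"
    by (rule s.rst_chain_map[OF h c sp actsD[OF actS e]]) (use FA[OF _ e] in auto)
  moreover have "chain_map n rem (chain_map n (F e) (rst n (A h) c)) = chain_map n (F e) (chain_map n rem (rst n (A h) c))"
  proof (rule opr_comm)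
    show "singular_chain n (subtopology (X k) (A h)) (rst n (A h) c)"
      using s.rst_chain[OF c, of h] unfolding subA[OF h] .
    show "rem (F e s) = F e (rem s)" if "s \<in> topspace (X k)" "s \<in> A h" for s
      using remF[OF e that(1)] that(2) AS[OF h] by blast
  qed
  ultimately show ?thesis by (simp add: cmp_def)
qed

text \<open>Up to homotopy \<open>sec h\<close> undoes \<open>rem\<close> on each piece, so a
  component whose image bounds in \<open>D\<close> bounds itself; the cycle is the sum of its
  components.\<close>

lemma cmp_inj:
  assumes c: "c \<in> cyc n X S (Suc k)" and "\<And>h. h \<in> H \<Longrightarrow> cmp n h c \<in> bdy n X D k"
  shows "c \<in> bdy n X S (Suc k)"
proof -
  interpret s: split_space "subtopology (X (Suc k)) S" H A by (rule sp)
  have "rst n (A h) c \<in> bdy n X S (Suc k)" if h: "h \<in> H" for h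
  proof -
    let ?z = "rst n (A h) c"
    have z: "?z \<in> cyc n X (A h) (Suc k)" by (rule rst_cyc[OF h c])
    have asb: "asub (bdy n X (A h) (Suc k))" unfolding bdy_def by (rule asub_relboundary)
    have "chain_map n id ?z - chain_map n (sec h \<circ> rem) ?z \<in> bdy n X (A h) (Suc k)"
      by (rule homotopic_cyc[OF hom[OF h] z])
    moreover have "chain_map n id ?z = ?z" by (rule chain_map_ident[OF cyc_imp_chain[OF z]])
    moreover have "chain_map n (sec h \<circ> rem) ?z = chain_map n (sec h) (cmp n h c)"
      by (simp add: chain_map_compose cmp_def)
    moreover have "chain_map n (sec h) (cmp n h c) \<in> bdy n X (A h) (Suc k)"
      using singular_relboundary_chain_map[of n "subtopology (X k) D" "{}" "cmp n h c" "subtopology (X (Suc k)) (A h)" "sec h" "{}"]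
        assms(2)[OF h] sec[OF h] unfolding bdy_def by simp
    ultimately have "?z \<in> bdy n X (A h) (Suc k)" using asub_add[OF asb] by (metis diff_add_cancel)
    then show ?thesis by (rule bdy_mono[OF AS[OF h]])
  qed
  then have "(\<Sum>h\<in>H. rst n (A h) c) \<in> bdy n X S (Suc k)"
    by (intro asub_sum) (simp_all add: bdy_def asub_relboundary)
  then show ?thesis using s.rst_sum[OF cyc_imp_chain[OF c]] by simp
qed

lemma noeth_leaves:
  assumes N: "noeth (opr n F) E (cyc n X D) (bdy n X D)"
  shows "noeth (opr n F) E (cyc n X S) (bdy n X S)"
proof -
  \<comment> \<open>Shifted by one, since a point is forgotten. In weight 0 the zero module matches
    the emptiness of \<open>S\<close> there.\<close>
  let ?A2 = "\<lambda>k. case k of 0 \<Rightarrow> {0} | Suc j \<Rightarrow> cyc n X D j"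
  let ?B2 = "\<lambda>k. case k of 0 \<Rightarrow> {0} | Suc j \<Rightarrow> bdy n X D j"
  have asC: "asub (cyc n X D k)" and asB: "asub (bdy n X D k)" for k
    unfolding cyc_def bdy_def by (rule asub_relcycle asub_relboundary)+
  have cmp0: "cmp n h x = 0" if "x \<in> cyc n X S 0" for h x
    using that addf_0[OF addf_cmp] unfolding empty_0 by simp
  show ?thesis
  proof (rule noeth_joint_inj[where g="cmp n" and ?\<phi>2.0="opr n F" and ?A2.0="?A2" and ?B2.0="?B2", OF fin])
    show "noeth (opr n F) E ?A2 ?B2" by (rule noeth_shift[OF N asB]) simp
    show "submod (opr n F) E ?B2"
    proof (rule submodI)
      show "asub (?B2 k)" for k using asB by (cases k) (simp_all add: asub_def)
      show "opr n F e x \<in> ?B2 (Suc k)" if "e \<in> E" "x \<in> ?B2 k" for e k x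
        using that asub_0[OF asB] submod_act[OF submod_bdy[OF actD] that(1)] by (cases k) auto
    qed
    show "?B2 \<le> ?A2" using bdy_le_cyc[of n X D] by (auto simp: le_fun_def split: nat.split)
    show "asub (?A2 k)" for k using asC by (cases k) (simp_all add: asub_def)
    show "cmp n h x \<in> ?A2 k" if "h \<in> H" "x \<in> cyc n X S k" for h k x
      using that cmp0 cmp_cyc by (cases k) auto
    show "cmp n h x \<in> ?B2 k" if "h \<in> H" "x \<in> bdy n X S k" for h k x
      using cmp0[OF le_gradedD[OF bdy_le_cyc], of x h] cmp_bdy[OF that(1), of x] that(2) by (cases k) auto
    show "cmp n h (opr n F e x) = opr n F e (cmp n h x)" if "h \<in> H" "e \<in> E" "x \<in> cyc n X S k" for h e k x
      by (rule cmp_opr[OF that(1,2) cyc_imp_chain[OF that(3)]])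
    show "x \<in> bdy n X S k" if "x \<in> cyc n X S k" "\<And>h. h \<in> H \<Longrightarrow> cmp n h x \<in> ?B2 k" for k x
    proof (cases k)
      case 0 then show ?thesis using that(1) empty_0 by (auto simp: bdy_def)
    next
      case (Suc j) then show ?thesis using cmp_inj that by simp
    qed
  qed (rule submod_cyc[OF actS] submod_bdy[OF actS] bdy_le_cyc addf_cmp addf_chain_map)+
qed

text \<open>The components commute with the operators and are jointly injective on homology, so a
  product that kills the torsion for \<open>D\<close> also kills it for \<open>S\<close>.\<close>

lemma torskill_leaves:
  assumes qs: "along inc ws qs" and inc: "\<And>w. w \<in> set ws \<Longrightarrow> inc w \<subseteq> E" and K: "torskill n F X D qs"
  shows "torskill n F X S qs"
  unfolding torskill_def
proof (intro allI ballI impI)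
  fix k x m assume x: "x \<in> cyc n X S k" and m: "m \<noteq> 0" and mx: "frag_cmul m x \<in> bdy n X S k"
  have ad: "addf (pk (opr n F) qs)" by (rule addf_pk[OF qs addf_chain_map])
  have len: "length ws = length qs" using qs by (rule list_all2_lengthD)
  show "pk (opr n F) qs x \<in> bdy n X S (k + length qs)"
  proof (cases k)
    case 0
    then have "x = 0" using x empty_0 by blast
    then show ?thesis using addf_0[OF ad] by (simp add: bdy_def)
  next
    case (Suc j)
    have pkc: "pk (opr n F) qs x \<in> cyc n X S (Suc (j + length qs))"
      using pk_in[OF qs submod_cyc[OF actS] inc x] len Suc by simp
    have comm: "cmp n h (pk (opr n F) qs x) = pk (opr n F) qs (cmp n h x)" if h: "h \<in> H" for h
    proof -
      have "cmp n h (pk (opr n F) qs y) = pk (opr n F) qs (cmp n h y)" if "y \<in> cyc n X S l" for y l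
        using qs inc that
      proof (induction arbitrary: y l rule: list_all2_induct)
        case (Cons w ws q qs)
        have q: "fst q \<in> E" "snd q \<in> E" using Cons.hyps(1) Cons.prems(1) by auto
        let ?d = "opr n F (fst q) y - opr n F (snd q) y"
        have "?d \<in> cyc n X S (Suc l)"
          using submod_act[OF submod_cyc[OF actS] q(1) Cons.prems(2)] submod_act[OF submod_cyc[OF actS] q(2) Cons.prems(2)]
          by (intro asub_diff) (simp_all add: cyc_def asub_relcycle)
        then have "cmp n h (pk (opr n F) qs ?d) = pk (opr n F) qs (cmp n h ?d)"
          by (rule Cons.IH[rotated]) (use Cons.prems(1) in simp)
        moreover have "cmp n h ?d = opr n F (fst q) (cmp n h y) - opr n F (snd q) (cmp n h y)"
          using addf_diff[OF addf_cmp] cmp_opr[OF h q(1) cyc_imp_chain[OF Cons.prems(2)]] cmp_opr[OF h q(2) cyc_imp_chain[OF Cons.prems(2)]]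
          by metis
        ultimately show ?case by simp
      qed simp
      then show ?thesis using x .
    qed
    have "pk (opr n F) qs x \<in> bdy n X S (Suc (j + length qs))"
    proof (rule cmp_inj[OF pkc])
      fix h assume h: "h \<in> H"
      have "frag_cmul m (cmp n h x) \<in> bdy n X D j"
        using cmp_bdy[OF h, of "frag_cmul m x" n j] mx addf_cmul[OF addf_cmp, of n h m x] Suc by simp
      then have "pk (opr n F) qs (cmp n h x) \<in> bdy n X D (j + length qs)"
        using K m cmp_cyc[OF h, of x n j] x Suc unfolding torskill_def by blast
      then show "cmp n h (pk (opr n F) qs x) \<in> bdy n X D (j + length qs)" using comm[OF h] by simp
    qed
    then show ?thesis using Suc by simp
  qed
qed

end

section \<open>Configurations as finite sets\<close>

text \<open>Configurations as sets of points rather than as orbits of maps. The topology is still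
  that of the quotient of \<open>ordered_config\<close>, and \<open>homeomorphic_uconf\<close>
  identifies the two models.\<close>

definition uconf :: "nat \<Rightarrow> 'a topology \<Rightarrow> 'a set topology" where
  "uconf k X = quotient_topology (ordered_config k X) (\<lambda>x. x ` {..<k})"

lemma topspace_ordered_config:
  "topspace (ordered_config k X) = {x \<in> {..<k} \<rightarrow>\<^sub>E topspace X. inj_on x {..<k}}"
  by (auto simp: ordered_config_def)

lemma ordering_exists:
  assumes "finite S" "card S = k" "S \<subseteq> topspace X"
  shows "\<exists>x \<in> topspace (ordered_config k X). x ` {..<k} = S"
proof -
  obtain f where f: "bij_betw f {..<k} S"
    using assms by (metis atLeast0LessThan ex_bij_betw_nat_finite)
  let ?x = "restrict f {..<k}"
  have "?x \<in> topspace (ordered_config k X)"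
    using f assms(3) by (auto simp: topspace_ordered_config bij_betw_def inj_on_def)
  moreover have "?x ` {..<k} = S" using f by (simp add: bij_betw_def)
  ultimately show ?thesis by blast
qed

lemma topspace_uconf: "topspace (uconf k X) = {S. S \<subseteq> topspace X \<and> finite S \<and> card S = k}"
proof
  show "topspace (uconf k X) \<subseteq> {S. S \<subseteq> topspace X \<and> finite S \<and> card S = k}"
    by (auto simp: uconf_def topspace_ordered_config card_image PiE_def Pi_def)
  show "{S. S \<subseteq> topspace X \<and> finite S \<and> card S = k} \<subseteq> topspace (uconf k X)"
  proof
    fix S assume "S \<in> {S. S \<subseteq> topspace X \<and> finite S \<and> card S = k}"
    then have "\<exists>x \<in> topspace (ordered_config k X). x ` {..<k} = S" by (intro ordering_exists) auto
    then show "S \<in> topspace (uconf k X)" unfolding uconf_def topspace_quotient_topology by blast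
  qed
qed

lemma quotient_uconf: "quotient_map (ordered_config k X) (uconf k X) (\<lambda>x. x ` {..<k})"
  unfolding uconf_def by (rule quotient_map_quotient_topology)

lemma openin_uconf:
  "openin (uconf k X) \<U> \<longleftrightarrow> \<U> \<subseteq> topspace (uconf k X) \<and> openin (ordered_config k X) {x \<in> topspace (ordered_config k X). x ` {..<k} \<in> \<U>}"
  unfolding uconf_def openin_quotient_topology topspace_quotient_topology ..

lemma continuous_coordinate: "a < k \<Longrightarrow> continuous_map (ordered_config k X) X (\<lambda>x. x a)"
  unfolding ordered_config_def
  by (intro continuous_map_from_subtopology continuous_map_product_projection) simp

lemma openin_coordinate:
  "a < k \<Longrightarrow> openin X U \<Longrightarrow> openin (ordered_config k X) {x \<in> topspace (ordered_config k X). x a \<in> U}"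
  by (rule openin_continuous_map_preimage[OF continuous_coordinate])

lemma openin_uconf_meet:
  assumes "openin X U" shows "openin (uconf k X) {S \<in> topspace (uconf k X). S \<inter> U \<noteq> {}}"
proof -
  have "{x \<in> topspace (ordered_config k X). x ` {..<k} \<in> {S \<in> topspace (uconf k X). S \<inter> U \<noteq> {}}}
     = (\<Union>a\<in>{..<k}. {x \<in> topspace (ordered_config k X). x a \<in> U})"
    by (auto simp: uconf_def)
  moreover have "openin (ordered_config k X) (\<Union>a\<in>{..<k}. {x \<in> topspace (ordered_config k X). x a \<in> U})"
    by (rule openin_Union) (use openin_coordinate[OF _ assms] in blast)
  ultimately show ?thesis unfolding openin_uconf by (metis (no_types, lifting) mem_Collect_eq subsetI)
qed

lemma openin_uconf_subset:
  assumes "openin X U" shows "openin (uconf k X) {S \<in> topspace (uconf k X). S \<subseteq> U}"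
proof -
  have eq: "{x \<in> topspace (ordered_config k X). x ` {..<k} \<in> {S \<in> topspace (uconf k X). S \<subseteq> U}}
     = (\<Inter>a\<in>{..<k}. {x \<in> topspace (ordered_config k X). x a \<in> U}) \<inter> topspace (ordered_config k X)"
    by (auto simp: uconf_def)
  have "openin (ordered_config k X) ((\<Inter>a\<in>{..<k}. {x \<in> topspace (ordered_config k X). x a \<in> U}) \<inter> topspace (ordered_config k X))"
    by (rule openin_INT) (use openin_coordinate[OF _ assms] in auto)
  then show ?thesis unfolding openin_uconf eq by blast
qed

lemma hausdorff_separate_finite:
  assumes X: "Hausdorff_space X" and S: "finite S" "S \<subseteq> topspace X"
  shows "\<exists>U. \<forall>s\<in>S. openin X (U s) \<and> s \<in> U s \<and> (\<forall>t\<in>S. s \<noteq> t \<longrightarrow> U s \<inter> U t = {})"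
proof -
  have "\<forall>p q. \<exists>u v. p \<in> topspace X \<and> q \<in> topspace X \<and> p \<noteq> q \<longrightarrow> openin X u \<and> openin X v \<and> p \<in> u \<and> q \<in> v \<and> u \<inter> v = {}"
    using X unfolding Hausdorff_space_def disjnt_def by meson
  then obtain u v where uv: "\<And>p q. p \<in> topspace X \<Longrightarrow> q \<in> topspace X \<Longrightarrow> p \<noteq> q \<Longrightarrow>
      openin X (u p q) \<and> openin X (v p q) \<and> p \<in> u p q \<and> q \<in> v p q \<and> u p q \<inter> v p q = {}"
    by metis
  define U where "U s = (\<Inter>t\<in>S - {s}. u s t \<inter> v t s) \<inter> topspace X" for s
  have "openin X (U s)" if "s \<in> S" for s
    unfolding U_def
  proof (rule openin_INT)
    fix t assume "t \<in> S - {s}"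
    then have "openin X (u s t)" "openin X (v t s)" using uv[of s t] uv[of t s] S(2) that by auto
    then show "openin X (u s t \<inter> v t s)" by blast
  qed (use S in simp)
  moreover have "s \<in> U s" if "s \<in> S" for s unfolding U_def using S that uv by auto
  moreover have "U s \<inter> U t = {}" if "s \<in> S" "t \<in> S" "s \<noteq> t" for s t
  proof -
    have "U s \<subseteq> u s t" "U t \<subseteq> v s t" unfolding U_def using that by auto
    then show ?thesis using uv[of s t] S that by blast
  qed
  ultimately show ?thesis by blast
qed

text \<open>Around the points of \<open>S0\<close> choose pairwise disjoint neighbourhoods. A set
  with equally many points that meets all of them has exactly one point in each, so nearby
  configurations arise by moving every point a little.\<close>

lemma uconf_nbhd:
  assumes X: "Hausdorff_space X" and S0: "S0 \<in> topspace (uconf k X)"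
    and W: "\<And>s. s \<in> S0 \<Longrightarrow> openin X (W s) \<and> s \<in> W s"
  obtains G where "openin (uconf k X) G" "S0 \<in> G"
    "\<And>S. S \<in> G \<Longrightarrow> \<exists>\<tau>. bij_betw \<tau> S0 S \<and> (\<forall>s\<in>S0. \<tau> s \<in> W s)"
proof -
  have S0': "S0 \<subseteq> topspace X" "finite S0" "card S0 = k" using S0 by (auto simp: topspace_uconf)
  obtain U where U: "\<And>s. s \<in> S0 \<Longrightarrow> openin X (U s)" "\<And>s. s \<in> S0 \<Longrightarrow> s \<in> U s"
     "\<And>s t. s \<in> S0 \<Longrightarrow> t \<in> S0 \<Longrightarrow> s \<noteq> t \<Longrightarrow> U s \<inter> U t = {}"
    using hausdorff_separate_finite[OF X S0'(2,1)] by metis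
  define G where "G = (\<Inter>s\<in>S0. {S \<in> topspace (uconf k X). S \<inter> (U s \<inter> W s) \<noteq> {}}) \<inter> topspace (uconf k X)"
  show ?thesis
  proof (rule that[of G])
    show "openin (uconf k X) G"
      unfolding G_def
    proof (rule openin_INT[OF S0'(2)], rule openin_uconf_meet)
      fix s assume "s \<in> S0"
      then show "openin X (U s \<inter> W s)" using U(1) W by blast
    qed
    show "S0 \<in> G" unfolding G_def using S0 U(2) W by auto
    fix S assume S: "S \<in> G"
    have "\<forall>s\<in>S0. \<exists>t. t \<in> S \<inter> (U s \<inter> W s)" using S unfolding G_def by blast
    then obtain \<tau> where \<tau>: "\<And>s. s \<in> S0 \<Longrightarrow> \<tau> s \<in> S \<inter> (U s \<inter> W s)" by metis
    have inj: "inj_on \<tau> S0" using \<tau> U(3) by (intro inj_onI) (metis IntD1 IntD2 disjoint_iff)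
    have fS: "finite S" "card S = k" using S unfolding G_def by (auto simp: topspace_uconf)
    have "\<tau> ` S0 = S"
      by (rule card_subset_eq[OF fS(1)]) (use \<tau> card_image[OF inj] fS S0' in auto)
    then show "\<exists>\<tau>. bij_betw \<tau> S0 S \<and> (\<forall>s\<in>S0. \<tau> s \<in> W s)"
      using inj \<tau> by (auto simp: bij_betw_def)
  qed
qed

text \<open>Lower semicontinuity of a set-valued map. It is stable under unions, also where the
  number of points in a part of a configuration varies and continuity into a fixed
  \<open>uconf k\<close> makes no sense.\<close>

definition lowc :: "'z topology \<Rightarrow> 'a topology \<Rightarrow> ('z \<Rightarrow> 'a set) \<Rightarrow> bool" where
  "lowc Z X g \<longleftrightarrow> (\<forall>U. openin X U \<longrightarrow> openin Z {z \<in> topspace Z. g z \<inter> U \<noteq> {}})"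

lemma lowcD: "lowc Z X g \<Longrightarrow> openin X U \<Longrightarrow> openin Z {z \<in> topspace Z. g z \<inter> U \<noteq> {}}"
  by (auto simp: lowc_def)

lemma lowc_Un: "lowc Z X f \<Longrightarrow> lowc Z X g \<Longrightarrow> lowc Z X (\<lambda>z. f z \<union> g z)"
proof -
  assume "lowc Z X f" "lowc Z X g"
  moreover have "{z \<in> topspace Z. (f z \<union> g z) \<inter> U \<noteq> {}} = {z \<in> topspace Z. f z \<inter> U \<noteq> {}} \<union> {z \<in> topspace Z. g z \<inter> U \<noteq> {}}" for U
    by blast
  ultimately show ?thesis unfolding lowc_def by auto
qed

lemma lowc_singleton: assumes "continuous_map Z X h" shows "lowc Z X (\<lambda>z. {h z})"
  unfolding lowc_def using openin_continuous_map_preimage[OF assms] by simp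

lemma lowc_continuous: assumes "continuous_map Z (uconf k X) g" shows "lowc Z X g"
  unfolding lowc_def
proof (intro allI impI)
  fix U assume "openin X U"
  from openin_continuous_map_preimage[OF assms openin_uconf_meet[OF this, of k]]
  show "openin Z {z \<in> topspace Z. g z \<inter> U \<noteq> {}}"
    using continuous_map_image_subset_topspace[OF assms] by (auto elim!: back_subst[of "openin Z"])
qed

text \<open>On configurations of a fixed size the topology is generated by the sets of configurations
  that meet a given open set.\<close>

lemma continuous_into_uconf:
  assumes X: "Hausdorff_space X" and low: "lowc Z X g"
    and g: "\<And>z. z \<in> topspace Z \<Longrightarrow> g z \<in> topspace (uconf k X)"
  shows "continuous_map Z (uconf k X) g"
  unfolding continuous_map_def
proof (intro conjI allI impI)
  show "g \<in> topspace Z \<rightarrow> topspace (uconf k X)" using g by blast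
  fix O' assume O': "openin (uconf k X) O'"
  show "openin Z {x \<in> topspace Z. g x \<in> O'}"
  proof (subst openin_subopen, intro ballI)
    fix z0 assume "z0 \<in> {x \<in> topspace Z. g x \<in> O'}"
    then have z0: "z0 \<in> topspace Z" "g z0 \<in> O'" by auto
    have S0: "g z0 \<subseteq> topspace X" "finite (g z0)" "card (g z0) = k" using g[OF z0(1)] by (auto simp: topspace_uconf)
    obtain x where x: "x \<in> topspace (ordered_config k X)" "x ` {..<k} = g z0"
      using ordering_exists[OF S0(2,3,1)] by blast
    have "openin (ordered_config k X) {x \<in> topspace (ordered_config k X). x ` {..<k} \<in> O'}"
      using O' unfolding openin_uconf by blast
    then obtain P where P: "openin (product_topology (\<lambda>_. X) {..<k}) P"
      "{x \<in> topspace (ordered_config k X). x ` {..<k} \<in> O'} = P \<inter> {x. inj_on x {..<k}}"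
      unfolding ordered_config_def openin_subtopology by blast
    have "x \<in> {x \<in> topspace (ordered_config k X). x ` {..<k} \<in> O'}" using x z0(2) by simp
    then have "x \<in> P" unfolding P(2) by simp
    then have "\<exists>B. finite {i \<in> {..<k}. B i \<noteq> topspace X} \<and> (\<forall>i\<in>{..<k}. openin X (B i)) \<and> x \<in> PiE {..<k} B \<and> PiE {..<k} B \<subseteq> P"
      using P(1)[unfolded openin_product_topology_alt] by (rule bspec[rotated])
    then obtain B where B: "\<And>i. i < k \<Longrightarrow> openin X (B i)" "x \<in> PiE {..<k} B" "PiE {..<k} B \<subseteq> P"
      by blast
    obtain U where U: "\<And>s. s \<in> g z0 \<Longrightarrow> openin X (U s)" "\<And>s. s \<in> g z0 \<Longrightarrow> s \<in> U s"
       "\<And>s t. s \<in> g z0 \<Longrightarrow> t \<in> g z0 \<Longrightarrow> s \<noteq> t \<Longrightarrow> U s \<inter> U t = {}"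
      using hausdorff_separate_finite[OF X S0(2,1)] by metis
    \<comment> \<open>The sets \<open>U (x i)\<close> are disjoint, so a configuration in
      \<open>T\<close> has exactly one point in each of them. These points form an ordering
      \<open>y\<close> of it inside the box \<open>B\<close>.\<close>
    define T where "T = (\<Inter>i\<in>{..<k}. {z \<in> topspace Z. g z \<inter> (B i \<inter> U (x i)) \<noteq> {}}) \<inter> topspace Z"
    have xg: "x i \<in> g z0" if "i < k" for i using x(2) that by blast
    have "openin Z T"
      unfolding T_def
    proof (rule openin_INT, simp, rule lowcD[OF low])
      fix i assume "i \<in> {..<k}"
      then show "openin X (B i \<inter> U (x i))" using B(1)[of i] U(1)[OF xg, of i] by blast
    qed
    moreover have "z0 \<in> T"
    proof -
      have "x i \<in> B i" if "i < k" for i using B(2) that by auto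
      then show ?thesis unfolding T_def using z0 xg U(2)[OF xg] by blast
    qed
    moreover have "T \<subseteq> {x \<in> topspace Z. g x \<in> O'}"
    proof
      fix z assume z: "z \<in> T"
      then have "\<forall>i\<in>{..<k}. \<exists>p. p \<in> g z \<inter> (B i \<inter> U (x i))" unfolding T_def by blast
      then obtain y where y: "\<And>i. i < k \<Longrightarrow> y i \<in> g z \<inter> (B i \<inter> U (x i))" by (metis lessThan_iff)
      let ?y = "restrict y {..<k}"
      have zt: "z \<in> topspace Z" using z by (simp add: T_def)
      have gz: "g z \<subseteq> topspace X" "finite (g z)" "card (g z) = k" using g[OF zt] by (auto simp: topspace_uconf)
      have xinj: "inj_on x {..<k}" using x(1) by (simp add: topspace_ordered_config)
      have inj: "inj_on ?y {..<k}"
      proof (rule inj_onI)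
        fix i j assume ij: "i \<in> {..<k}" "j \<in> {..<k}" "?y i = ?y j"
        then have "U (x i) \<inter> U (x j) \<noteq> {}" using y[of i] y[of j] by auto
        then have "x i = x j" using U(3)[OF xg xg] ij by blast
        then show "i = j" using xinj ij by (simp add: inj_on_def)
      qed
      have im: "?y ` {..<k} = g z"
        by (rule card_subset_eq[OF gz(2)]) (use y card_image[OF inj] gz in auto)
      have "?y \<in> PiE {..<k} B" using y by auto
      then have "?y \<in> P \<inter> {x. inj_on x {..<k}}" using B(3) inj by blast
      then have "?y ` {..<k} \<in> O'" using P(2) by blast
      then show "z \<in> {x \<in> topspace Z. g x \<in> O'}" using zt im by simp
    qed
    ultimately show "\<exists>T. openin Z T \<and> z0 \<in> T \<and> T \<subseteq> {x \<in> topspace Z. g x \<in> O'}" by blast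
  qed
qed

section \<open>The point of a configuration at which a function is smallest\<close>

definition minpt :: "('a \<Rightarrow> real) \<Rightarrow> 'a set \<Rightarrow> 'a" where
  "minpt \<delta> S = (THE z. z \<in> S \<and> (\<forall>y\<in>S - {z}. \<delta> z < \<delta> y))"

definition rmin :: "('a \<Rightarrow> real) \<Rightarrow> 'a set \<Rightarrow> 'a set" where
  "rmin \<delta> S = S - {minpt \<delta> S}"

text \<open>The cap \<rho> gives a value also to the empty configuration, and keeps every smaller
  parameter inside the range on which legs are defined.\<close>

definition mval :: "real \<Rightarrow> ('a \<Rightarrow> real) \<Rightarrow> 'a set \<Rightarrow> real" where
  "mval \<rho> \<delta> S = Min (insert \<rho> (\<delta> ` S))"

lemma minpt_eq:
  assumes "z \<in> S" "\<And>y. y \<in> S - {z} \<Longrightarrow> \<delta> z < \<delta> y" shows "minpt \<delta> S = z"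
  unfolding minpt_def
proof (rule the_equality)
  show "z \<in> S \<and> (\<forall>y\<in>S - {z}. \<delta> z < \<delta> y)" using assms by blast
  fix w assume w: "w \<in> S \<and> (\<forall>y\<in>S - {w}. \<delta> w < \<delta> y)"
  show "w = z"
  proof (rule ccontr)
    assume "w \<noteq> z"
    then have "\<delta> z < \<delta> w" "\<delta> w < \<delta> z" using w assms by auto
    then show False by simp
  qed
qed

definition umin :: "'a set \<Rightarrow> ('a \<Rightarrow> real) \<Rightarrow> real \<Rightarrow> 'a set set" where
  "umin Y \<delta> \<rho> = {S. S \<subseteq> Y \<and> (\<exists>z\<in>S. \<delta> z < \<rho> \<and> (\<forall>y\<in>S - {z}. \<delta> z < \<delta> y))}"

lemma umin_minpt:
  assumes "S \<in> umin Y \<delta> \<rho>"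
  shows "minpt \<delta> S \<in> S" "minpt \<delta> S \<in> Y" "\<delta> (minpt \<delta> S) < \<rho>" "\<And>y. y \<in> S \<Longrightarrow> y \<noteq> minpt \<delta> S \<Longrightarrow> \<delta> (minpt \<delta> S) < \<delta> y"
proof -
  obtain z where z: "z \<in> S" "\<delta> z < \<rho>" "\<forall>y\<in>S - {z}. \<delta> z < \<delta> y" "S \<subseteq> Y" using assms by (auto simp: umin_def)
  then have "minpt \<delta> S = z" by (intro minpt_eq) auto
  then show "minpt \<delta> S \<in> S" "minpt \<delta> S \<in> Y" "\<delta> (minpt \<delta> S) < \<rho>" "\<And>y. y \<in> S \<Longrightarrow> y \<noteq> minpt \<delta> S \<Longrightarrow> \<delta> (minpt \<delta> S) < \<delta> y"
    using z by auto
qed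

lemma uminI:
  "S \<subseteq> Y \<Longrightarrow> z \<in> S \<Longrightarrow> \<delta> z < \<rho> \<Longrightarrow> (\<And>y. y \<in> S \<Longrightarrow> y \<noteq> z \<Longrightarrow> \<delta> z < \<delta> y) \<Longrightarrow> S \<in> umin Y \<delta> \<rho>"
  by (auto simp: umin_def)

text \<open>Used in two situations: with the distance from a vertex and \<rho> equal to 1/3, and
  with the coordinate along an open edge and \<rho> equal to 1.\<close>

locale minimizer =
  fixes X :: "'a topology" and Y :: "'a set" and \<delta> :: "'a \<Rightarrow> real" and \<rho> :: real
  assumes haus: "Hausdorff_space X" and openY: "openin X Y" and cont: "continuous_map (subtopology X Y) euclideanreal \<delta>"
    and rho: "0 < \<rho>"
begin

lemma open_less: "openin X {p \<in> Y. \<delta> p < r}" and open_greater: "openin X {p \<in> Y. r < \<delta> p}"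
proof -
  have tY: "topspace (subtopology X Y) = Y" using openin_subset[OF openY] by auto
  have "openin (subtopology X Y) {p \<in> topspace (subtopology X Y). \<delta> p \<in> {..<r}}"
    "openin (subtopology X Y) {p \<in> topspace (subtopology X Y). \<delta> p \<in> {r<..}}"
    by (rule openin_continuous_map_preimage[OF cont]; simp)+
  then show "openin X {p \<in> Y. \<delta> p < r}" "openin X {p \<in> Y. r < \<delta> p}"
    using openin_open_subtopology[OF openY] unfolding tY by auto
qed

abbreviation "N \<equiv> umin Y \<delta> \<rho>"

text \<open>Pick a level \<open>r\<close> strictly between the smallest value and all others. Being
  below or above \<open>r\<close> is an open condition, so in nearby configurations the minimum is
  attained at the point that has moved from the old minimum.\<close>

lemma umin_nbhd:
  assumes S0: "S0 \<in> topspace (uconf k X)" "S0 \<in> N"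
    and W: "\<And>s. s \<in> S0 \<Longrightarrow> openin X (W s) \<and> s \<in> W s"
  obtains G where "openin (uconf k X) G" "S0 \<in> G" "G \<subseteq> N"
    "\<And>S. S \<in> G \<Longrightarrow> \<exists>\<tau>. bij_betw \<tau> S0 S \<and> (\<forall>s\<in>S0. \<tau> s \<in> W s) \<and> minpt \<delta> S = \<tau> (minpt \<delta> S0)"
proof -
  let ?z = "minpt \<delta> S0"
  note z = umin_minpt[OF S0(2)]
  have fS: "finite S0" "S0 \<subseteq> Y" using S0 by (auto simp: topspace_uconf umin_def)
  have "\<exists>r. \<delta> ?z < r \<and> r \<le> \<rho> \<and> (\<forall>y\<in>S0 - {?z}. r < \<delta> y)"
  proof -
    let ?M = "Min (insert \<rho> (\<delta> ` (S0 - {?z})))"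
    have "\<delta> ?z < ?M" using fS(1) z by (subst Min_gr_iff) auto
    moreover have "\<forall>y\<in>S0 - {?z}. ?M \<le> \<delta> y" "?M \<le> \<rho>" using fS(1) by auto
    ultimately show ?thesis by (intro exI[of _ "(\<delta> ?z + ?M) / 2"]) force
  qed
  then obtain r where r: "\<delta> ?z < r" "r \<le> \<rho>" "\<And>y. y \<in> S0 \<Longrightarrow> y \<noteq> ?z \<Longrightarrow> r < \<delta> y" by blast
  define W' where "W' s = W s \<inter> (if s = ?z then {p \<in> Y. \<delta> p < r} else {p \<in> Y. r < \<delta> p})" for s
  have W': "openin X (W' s) \<and> s \<in> W' s" if "s \<in> S0" for s
    unfolding W'_def using W[OF that] open_less[of r] open_greater[of r] r fS(2) that by auto
  obtain G where G: "openin (uconf k X) G" "S0 \<in> G"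
    "\<And>S. S \<in> G \<Longrightarrow> \<exists>\<tau>. bij_betw \<tau> S0 S \<and> (\<forall>s\<in>S0. \<tau> s \<in> W' s)"
    by (rule uconf_nbhd[OF haus S0(1) W']) blast+
  have main: "S \<in> N \<and> (\<exists>\<tau>. bij_betw \<tau> S0 S \<and> (\<forall>s\<in>S0. \<tau> s \<in> W s) \<and> minpt \<delta> S = \<tau> ?z)" if S: "S \<in> G" for S
  proof -
    obtain \<tau> where \<tau>: "bij_betw \<tau> S0 S" "\<And>s. s \<in> S0 \<Longrightarrow> \<tau> s \<in> W' s" using G(3)[OF S] by blast
    have im: "\<tau> ` S0 = S" and inj: "inj_on \<tau> S0" using \<tau>(1) by (auto simp: bij_betw_def)
    have 1: "\<delta> (\<tau> ?z) < r" "\<tau> ?z \<in> S" using \<tau>(2)[OF z(1)] im z(1) by (auto simp: W'_def)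
    have 2: "r < \<delta> y" if y: "y \<in> S" "y \<noteq> \<tau> ?z" for y
    proof -
      obtain s where "s \<in> S0" "y = \<tau> s" using y(1) im by blast
      then show ?thesis using \<tau>(2)[of s] y(2) by (auto simp: W'_def split: if_splits)
    qed
    have "S \<subseteq> Y"
    proof
      fix y assume "y \<in> S"
      then obtain s where "s \<in> S0" "y = \<tau> s" using im by blast
      then show "y \<in> Y" using \<tau>(2)[of s] by (simp add: W'_def split: if_splits)
    qed
    then have "S \<in> N" using 1 2 r(2) by (intro uminI[of S Y "\<tau> ?z"]) (auto intro: less_trans)
    moreover have "minpt \<delta> S = \<tau> ?z" by (rule minpt_eq) (use 1 2 in \<open>auto intro: less_trans\<close>)
    moreover have "\<forall>s\<in>S0. \<tau> s \<in> W s" using \<tau>(2) by (auto simp: W'_def)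
    ultimately show ?thesis using \<tau>(1) by blast
  qed
  show ?thesis by (rule that[OF G(1,2)]) (use main in blast)+
qed

lemma open_umin: "openin (uconf k X) (topspace (uconf k X) \<inter> N)"
proof (subst openin_subopen, intro ballI)
  fix S0 assume "S0 \<in> topspace (uconf k X) \<inter> N"
  then have S0: "S0 \<in> topspace (uconf k X)" "S0 \<in> N" by auto
  obtain G where "openin (uconf k X) G" "S0 \<in> G" "G \<subseteq> N"
    by (rule umin_nbhd[OF S0, of "\<lambda>_. topspace X"]) (use S0(1) in \<open>auto simp: topspace_uconf\<close>)
  then show "\<exists>T. openin (uconf k X) T \<and> S0 \<in> T \<and> T \<subseteq> topspace (uconf k X) \<inter> N"
    using openin_subset by blast
qed

lemma continuous_minpt: "continuous_map (subtopology (uconf k X) N) (subtopology X {p \<in> Y. \<delta> p < \<rho>}) (minpt \<delta>)"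
  unfolding continuous_map_in_subtopology
proof (intro conjI)
  show "minpt \<delta> \<in> topspace (subtopology (uconf k X) N) \<rightarrow> {p \<in> Y. \<delta> p < \<rho>}"
    using umin_minpt by fastforce
  show "continuous_map (subtopology (uconf k X) N) X (minpt \<delta>)"
    unfolding continuous_map_def
  proof (intro conjI allI impI)
    show "minpt \<delta> \<in> topspace (subtopology (uconf k X) N) \<rightarrow> topspace X"
      using umin_minpt(2) openin_subset[OF openY] by fastforce
    fix U assume U: "openin X U"
    show "openin (subtopology (uconf k X) N) {x \<in> topspace (subtopology (uconf k X) N). minpt \<delta> x \<in> U}"
    proof (subst openin_subopen, intro ballI)
      fix S0 assume "S0 \<in> {x \<in> topspace (subtopology (uconf k X) N). minpt \<delta> x \<in> U}"
      then have S0: "S0 \<in> topspace (uconf k X)" "S0 \<in> N" "minpt \<delta> S0 \<in> U" by auto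
      obtain G where G: "openin (uconf k X) G" "S0 \<in> G" "G \<subseteq> N"
        "\<And>S. S \<in> G \<Longrightarrow> \<exists>\<tau>. bij_betw \<tau> S0 S \<and> (\<forall>s\<in>S0. \<tau> s \<in> (if s = minpt \<delta> S0 then U else topspace X)) \<and> minpt \<delta> S = \<tau> (minpt \<delta> S0)"
        by (rule umin_nbhd[OF S0(1,2), of "\<lambda>s. if s = minpt \<delta> S0 then U else topspace X"])
           (use S0 U in \<open>auto simp: topspace_uconf\<close>)
      have "G \<subseteq> {x \<in> topspace (subtopology (uconf k X) N). minpt \<delta> x \<in> U}"
        using G(3,4) openin_subset[OF G(1)] umin_minpt(1)[OF S0(2)] by fastforce
      moreover have "openin (subtopology (uconf k X) N) G"
        using G(1,3) by (auto simp: openin_subtopology)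
      ultimately show "\<exists>T. openin (subtopology (uconf k X) N) T \<and> S0 \<in> T \<and> T \<subseteq> {x \<in> topspace (subtopology (uconf k X) N). minpt \<delta> x \<in> U}"
        using G(2) by blast
    qed
  qed
qed

lemma continuous_rmin: "continuous_map (subtopology (uconf (Suc k) X) N) (uconf k X) (rmin \<delta>)"
proof (rule continuous_into_uconf[OF haus])
  show "rmin \<delta> S \<in> topspace (uconf k X)" if "S \<in> topspace (subtopology (uconf (Suc k) X) N)" for S
    using that umin_minpt(1)[of S Y \<delta> \<rho>] by (auto simp: topspace_uconf rmin_def)
  show "lowc (subtopology (uconf (Suc k) X) N) X (rmin \<delta>)"
    unfolding lowc_def
  proof (intro allI impI, subst openin_subopen, intro ballI)
    let ?T = "subtopology (uconf (Suc k) X) N"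
    fix U S0 assume U: "openin X U" and "S0 \<in> {z \<in> topspace ?T. rmin \<delta> z \<inter> U \<noteq> {}}"
    then obtain p where S0: "S0 \<in> topspace (uconf (Suc k) X)" "S0 \<in> N" and p: "p \<in> S0" "p \<noteq> minpt \<delta> S0" "p \<in> U"
      by (auto simp: rmin_def)
    obtain G where G: "openin (uconf (Suc k) X) G" "S0 \<in> G" "G \<subseteq> N"
      "\<And>S. S \<in> G \<Longrightarrow> \<exists>\<tau>. bij_betw \<tau> S0 S \<and> (\<forall>s\<in>S0. \<tau> s \<in> (if s = p then U else topspace X)) \<and> minpt \<delta> S = \<tau> (minpt \<delta> S0)"
      by (rule umin_nbhd[OF S0, of "\<lambda>s. if s = p then U else topspace X"])
         (use S0 U p in \<open>auto simp: topspace_uconf\<close>)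
    have "rmin \<delta> S \<inter> U \<noteq> {}" if S: "S \<in> G" for S
    proof -
      obtain \<tau> where \<tau>: "bij_betw \<tau> S0 S" "\<tau> p \<in> U" "minpt \<delta> S = \<tau> (minpt \<delta> S0)"
        using G(4)[OF S] p by fastforce
      have "\<tau> p \<noteq> \<tau> (minpt \<delta> S0)" using \<tau>(1) p umin_minpt(1)[OF S0(2)] by (auto simp: bij_betw_def inj_on_def)
      then show ?thesis using \<tau> p by (auto simp: rmin_def bij_betw_def)
    qed
    then have "G \<subseteq> {z \<in> topspace ?T. rmin \<delta> z \<inter> U \<noteq> {}}" using G(3) openin_subset[OF G(1)] by auto
    moreover have "openin ?T G" using G(1,3) by (auto simp: openin_subtopology)
    ultimately show "\<exists>T. openin ?T T \<and> S0 \<in> T \<and> T \<subseteq> {z \<in> topspace ?T. rmin \<delta> z \<inter> U \<noteq> {}}" using G(2) by blast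
  qed
qed

lemma continuous_mval: "continuous_map (subtopology (uconf k X) {S. S \<subseteq> Y}) euclideanreal (mval \<rho> \<delta>)"
proof -
  let ?T = "subtopology (uconf k X) {S. S \<subseteq> Y}"
  have fin: "finite S" if "S \<in> topspace ?T" for S using that by (auto simp: topspace_uconf)
  have less: "mval \<rho> \<delta> S < a \<longleftrightarrow> \<rho> < a \<or> S \<inter> {p \<in> Y. \<delta> p < a} \<noteq> {}" if "S \<in> topspace ?T" for S a
    unfolding mval_def using fin[OF that] that by (subst Min_less_iff) auto
  have gr: "a < mval \<rho> \<delta> S \<longleftrightarrow> a < \<rho> \<and> S \<subseteq> {p \<in> Y. a < \<delta> p}" if "S \<in> topspace ?T" for S a
    unfolding mval_def using fin[OF that] that by (subst Min_gr_iff) auto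
  have op1: "openin ?T {S \<in> topspace ?T. mval \<rho> \<delta> S < a}" for a
  proof (cases "\<rho> < a")
    case True
    then have "{S \<in> topspace ?T. mval \<rho> \<delta> S < a} = topspace ?T" using less by blast
    then show ?thesis by (simp only: openin_topspace)
  next
    case False
    have "{S \<in> topspace ?T. mval \<rho> \<delta> S < a} = {S \<in> topspace (uconf k X). S \<inter> {p \<in> Y. \<delta> p < a} \<noteq> {}} \<inter> {S. S \<subseteq> Y}"
      using less False by auto
    then show ?thesis using openin_uconf_meet[OF open_less[of a], of k] unfolding openin_subtopology by blast
  qed
  have op2: "openin ?T {S \<in> topspace ?T. a < mval \<rho> \<delta> S}" for a
  proof (cases "a < \<rho>")
    case False
    then have "{S \<in> topspace ?T. a < mval \<rho> \<delta> S} = {}" using gr by blast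
    then show ?thesis by (simp only: openin_empty)
  next
    case True
    have "{S \<in> topspace ?T. a < mval \<rho> \<delta> S} = {S \<in> topspace (uconf k X). S \<subseteq> {p \<in> Y. a < \<delta> p}} \<inter> {S. S \<subseteq> Y}"
      using gr True by auto
    then show ?thesis using openin_uconf_subset[OF open_greater[of a], of k] unfolding openin_subtopology by blast
  qed
  show ?thesis
    unfolding continuous_map_upper_lower_semicontinuous_lt using op1 op2 by blast
qed

lemma mval_props: assumes "finite S" shows "mval \<rho> \<delta> S \<le> \<rho>" "\<And>p. p \<in> S \<Longrightarrow> mval \<rho> \<delta> S \<le> \<delta> p"
  "(\<And>p. p \<in> S \<Longrightarrow> a < \<delta> p) \<Longrightarrow> a < \<rho> \<Longrightarrow> a < mval \<rho> \<delta> S"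
  using assms unfolding mval_def by (auto simp: Min_gr_iff)

end

section \<open>Moving, adding and forgetting the closest point\<close>

lemma homotopicI:
  assumes "continuous_map (prod_topology (top_of_set {0..1::real}) X) Y h"
    "\<And>x. x \<in> topspace X \<Longrightarrow> h (0, x) = f x" "\<And>x. x \<in> topspace X \<Longrightarrow> h (1, x) = g x"
  shows "homotopic_with (\<lambda>_. True) X Y f g"
proof -
  have "(\<forall>x\<in>topspace X. h (0, x) = f x) \<and> (\<forall>x\<in>topspace X. h (1, x) = g x)" using assms(2,3) by blast
  then show ?thesis using assms(1) by (subst homotopic_with) (auto intro!: exI[of _ h])
qed

lemma continuous_insert:
  assumes "Hausdorff_space X" "continuous_map Z (uconf k X) g" "continuous_map Z X f"
    "\<And>z. z \<in> topspace Z \<Longrightarrow> f z \<notin> g z"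
  shows "continuous_map Z (uconf (Suc k) X) (\<lambda>z. insert (f z) (g z))"
proof (rule continuous_into_uconf[OF assms(1)])
  have "lowc Z X (\<lambda>z. {f z} \<union> g z)"
    by (intro lowc_Un lowc_singleton lowc_continuous[OF assms(2)] assms(3))
  then show "lowc Z X (\<lambda>z. insert (f z) (g z))" by simp
  fix z assume z: "z \<in> topspace Z"
  have "g z \<in> topspace (uconf k X)" "f z \<in> topspace X"
    using z assms(2,3) continuous_map_image_subset_topspace by blast+
  then show "insert (f z) (g z) \<in> topspace (uconf (Suc k) X)"
    using assms(4)[OF z] by (auto simp: topspace_uconf)
qed

lemma continuous_map_prod_fst: "continuous_map (prod_topology (top_of_set {0..1::real}) Z) euclideanreal fst"
  by (rule continuous_map_into_fulltopology[OF continuous_map_fst])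

lemma continuous_map_prod_snd: "continuous_map Z T f \<Longrightarrow> continuous_map (prod_topology W Z) T (\<lambda>z. f (snd z))"
  using continuous_map_compose[OF continuous_map_snd, of Z T f W] by (simp add: o_def)

context minimizer
begin

lemma rmin_props:
  assumes "S \<in> N" "finite S"
  shows "rmin \<delta> S \<subseteq> Y" "insert (minpt \<delta> S) (rmin \<delta> S) = S" "\<And>p. p \<in> rmin \<delta> S \<Longrightarrow> \<delta> (minpt \<delta> S) < \<delta> p"
    "\<delta> (minpt \<delta> S) < mval \<rho> \<delta> (rmin \<delta> S)"
proof -
  note m = umin_minpt[OF assms(1)]
  show "rmin \<delta> S \<subseteq> Y" using assms(1) by (auto simp: rmin_def umin_def)
  show "insert (minpt \<delta> S) (rmin \<delta> S) = S" using m(1) by (auto simp: rmin_def)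
  show *: "\<delta> (minpt \<delta> S) < \<delta> p" if "p \<in> rmin \<delta> S" for p using that m(4) by (auto simp: rmin_def)
  show "\<delta> (minpt \<delta> S) < mval \<rho> \<delta> (rmin \<delta> S)"
    by (rule mval_props(3)) (use assms * m in \<open>auto simp: rmin_def\<close>)
qed

text \<open>This is what \<open>mval\<close> is for: wherever a point is placed below it, that point
  becomes the unique closest one, and forgetting the closest point takes it away again.\<close>

lemma insert_umin:
  assumes "S' \<subseteq> Y" "finite S'" "q \<in> Y" "\<delta> q < mval \<rho> \<delta> S'"
  shows "q \<notin> S'" "insert q S' \<in> N" "minpt \<delta> (insert q S') = q" "rmin \<delta> (insert q S') = S'"
proof -
  have lt: "\<delta> q < \<delta> p" if "p \<in> S'" for p using mval_props(2)[OF assms(2) that] assms(4) by simp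
  then show q: "q \<notin> S'" by blast
  show "insert q S' \<in> N"
    by (rule uminI[of _ _ q]) (use assms lt mval_props(1)[OF assms(2)] in auto)
  show m: "minpt \<delta> (insert q S') = q" by (rule minpt_eq) (use lt in auto)
  show "rmin \<delta> (insert q S') = S'" using q m by (auto simp: rmin_def)
qed

lemma continuous_rmin_mval:
  assumes "A \<subseteq> N" shows "continuous_map (subtopology (uconf (Suc k) X) A) euclideanreal (\<lambda>S. mval \<rho> \<delta> (rmin \<delta> S))"
proof -
  have "continuous_map (subtopology (uconf (Suc k) X) A) (uconf k X) (rmin \<delta>)"
    using continuous_rmin assms continuous_map_from_subtopology_mono by blast
  then have "continuous_map (subtopology (uconf (Suc k) X) A) (subtopology (uconf k X) {S. S \<subseteq> Y}) (rmin \<delta>)"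
    unfolding continuous_map_in_subtopology using rmin_props(1) assms by (auto simp: topspace_uconf)
  from continuous_map_compose[OF this continuous_mval] show ?thesis by (simp add: o_def)
qed

lemma continuous_minpt': 
  assumes "A \<subseteq> N"
  shows "continuous_map (subtopology (uconf k X) A) (subtopology X Y) (minpt \<delta>)"
    "continuous_map (subtopology (uconf k X) A) euclideanreal (\<lambda>S. \<delta> (minpt \<delta> S))"
proof -
  have "continuous_map (subtopology (uconf k X) A) (subtopology X {p \<in> Y. \<delta> p < \<rho>}) (minpt \<delta>)"
    using continuous_minpt assms continuous_map_from_subtopology_mono by blast
  then show *: "continuous_map (subtopology (uconf k X) A) (subtopology X Y) (minpt \<delta>)"
    by (auto simp: continuous_map_in_subtopology)
  from continuous_map_compose[OF * cont] show "continuous_map (subtopology (uconf k X) A) euclideanreal (\<lambda>S. \<delta> (minpt \<delta> S))"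
    by (simp add: o_def)
qed

definition leg :: "(real \<Rightarrow> 'a) \<Rightarrow> 'a set set" where
  "leg c = {S \<in> N. minpt \<delta> S \<in> c ` {0<..<\<rho>}}"

definition pos :: "'a set set" where
  "pos = {S. S \<subseteq> Y \<and> (\<forall>p\<in>S. 0 < \<delta> p)}"

text \<open>Half of \<open>mval\<close> lies strictly above 0 on \<open>pos\<close>, strictly below
  \<rho> and strictly below all old points, and depends continuously on the configuration.\<close>

definition addpt :: "(real \<Rightarrow> 'a) \<Rightarrow> 'a set \<Rightarrow> 'a set" where
  "addpt c S = insert (c (mval \<rho> \<delta> S / 2)) S"

context
  fixes c :: "real \<Rightarrow> 'a"
  assumes c: "continuous_map (top_of_set {0<..<\<rho>}) (subtopology X Y) c"
    and dc: "\<And>t. 0 < t \<Longrightarrow> t < \<rho> \<Longrightarrow> \<delta> (c t) = t"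
begin

lemma c_in: "0 < t \<Longrightarrow> t < \<rho> \<Longrightarrow> c t \<in> Y"
  using c unfolding continuous_map_in_subtopology by (auto simp: Pi_iff)

lemma leg_sub: "leg c \<subseteq> N" by (auto simp: leg_def)

lemma leg_minpt: assumes "S \<in> leg c" shows "0 < \<delta> (minpt \<delta> S)" "\<delta> (minpt \<delta> S) < \<rho>" "c (\<delta> (minpt \<delta> S)) = minpt \<delta> S"
  using assms dc by (auto simp: leg_def)

lemma rmin_leg: "continuous_map (subtopology (uconf (Suc k) X) (leg c)) (subtopology (uconf k X) pos) (rmin \<delta>)"
  unfolding continuous_map_in_subtopology
proof
  show "continuous_map (subtopology (uconf (Suc k) X) (leg c)) (uconf k X) (rmin \<delta>)"
    using continuous_rmin leg_sub continuous_map_from_subtopology_mono by blast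
  show "rmin \<delta> \<in> topspace (subtopology (uconf (Suc k) X) (leg c)) \<rightarrow> pos"
  proof
    fix S assume S: "S \<in> topspace (subtopology (uconf (Suc k) X) (leg c))"
    then have S': "S \<in> leg c" "S \<in> N" "finite S" using leg_sub by (auto simp: topspace_uconf)
    have "0 < \<delta> p" if "p \<in> rmin \<delta> S" for p
      using rmin_props(3)[OF S'(2,3) that] leg_minpt(1)[OF S'(1)] by simp
    then show "rmin \<delta> S \<in> pos" using rmin_props(1)[OF S'(2,3)] by (auto simp: pos_def)
  qed
qed

lemma pos_mval: assumes "S \<in> pos" "finite S" shows "0 < mval \<rho> \<delta> S" "mval \<rho> \<delta> S / 2 < \<rho>" "mval \<rho> \<delta> S / 2 < mval \<rho> \<delta> S"
proof -
  show *: "0 < mval \<rho> \<delta> S" using assms mval_props(3)[of S 0] rho by (auto simp: pos_def)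
  show "mval \<rho> \<delta> S / 2 < \<rho>" using mval_props(1)[OF assms(2)] * by linarith
  show "mval \<rho> \<delta> S / 2 < mval \<rho> \<delta> S" using * by simp
qed

lemma addpt_leg: "continuous_map (subtopology (uconf k X) pos) (subtopology (uconf (Suc k) X) (leg c)) (addpt c)"
  unfolding continuous_map_in_subtopology
proof
  let ?Z = "subtopology (uconf k X) pos"
  have pZ: "S \<in> pos \<and> finite S \<and> S \<subseteq> Y" if "S \<in> topspace ?Z" for S using that by (auto simp: topspace_uconf pos_def)
  have m: "continuous_map ?Z euclideanreal (mval \<rho> \<delta>)"
    using continuous_mval by (rule continuous_map_from_subtopology_mono) (auto simp: pos_def)
  have "continuous_map ?Z (top_of_set {0<..<\<rho>}) (\<lambda>S. mval \<rho> \<delta> S / 2)"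
    unfolding continuous_map_in_subtopology
  proof
    show "continuous_map ?Z euclideanreal (\<lambda>S. mval \<rho> \<delta> S / 2)"
      using continuous_map_real_mult_right[OF m, of "1/2"] by simp
    show "(\<lambda>S. mval \<rho> \<delta> S / 2) \<in> topspace ?Z \<rightarrow> {0<..<\<rho>}"
      using pZ pos_mval by fastforce
  qed
  from continuous_map_compose[OF this c]
  have cm: "continuous_map ?Z X (\<lambda>S. c (mval \<rho> \<delta> S / 2))" by (simp add: o_def continuous_map_in_subtopology)
  have ins: "c (mval \<rho> \<delta> S / 2) \<notin> S \<and> addpt c S \<in> leg c" if "S \<in> topspace ?Z" for S
  proof -
    note p = pos_mval[OF conjunct1[OF pZ[OF that]] conjunct1[OF conjunct2[OF pZ[OF that]]]]
    have t: "0 < mval \<rho> \<delta> S / 2" "mval \<rho> \<delta> S / 2 < \<rho>" using p by simp_all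
    have "\<delta> (c (mval \<rho> \<delta> S / 2)) < mval \<rho> \<delta> S" using dc[OF t] p by simp
    note i = insert_umin[OF _ _ c_in[OF t] this]
    show ?thesis using i pZ[OF that] t unfolding leg_def addpt_def by auto
  qed
  show "continuous_map ?Z (uconf (Suc k) X) (addpt c)"
    unfolding addpt_def
    by (rule continuous_insert[OF haus continuous_map_from_subtopology[OF continuous_map_id, unfolded id_def] cm])
       (use ins in auto)
  show "addpt c \<in> topspace ?Z \<rightarrow> leg c" using ins by blast
qed

text \<open>The closest point slides along its leg by linear interpolation of its distance, from its
  own value to half of \<open>mval\<close> of the other points. Both values are below that
  \<open>mval\<close>, so the sliding point never meets another one and remains closest.\<close>

lemma homotopic_leg:
  "homotopic_with (\<lambda>_. True) (subtopology (uconf (Suc k) X) (leg c)) (subtopology (uconf (Suc k) X) (leg c)) id (addpt c \<circ> rmin \<delta>)"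
proof -
  let ?A = "subtopology (uconf (Suc k) X) (leg c)"
  let ?P = "prod_topology (top_of_set {0..1::real}) ?A"
  define pos' where "pos' z = (1 - fst z) * \<delta> (minpt \<delta> (snd z)) + fst z * (mval \<rho> \<delta> (rmin \<delta> (snd z)) / 2)" for z
  have legA: "snd z \<in> leg c \<and> snd z \<in> N \<and> finite (snd z) \<and> 0 \<le> fst z \<and> fst z \<le> 1" if "z \<in> topspace ?P" for z
    using that leg_sub by (auto simp: topspace_uconf)
  have bounds: "0 < pos' z \<and> pos' z < \<rho> \<and> pos' z < mval \<rho> \<delta> (rmin \<delta> (snd z))" if "z \<in> topspace ?P" for z
  proof -
    let ?a = "\<delta> (minpt \<delta> (snd z))" and ?m = "mval \<rho> \<delta> (rmin \<delta> (snd z))"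
    have z: "snd z \<in> leg c" "snd z \<in> N" "finite (snd z)" "0 \<le> fst z" "fst z \<le> 1" using legA[OF that] by auto
    have a: "0 < ?a" "?a < ?m" using leg_minpt(1)[OF z(1)] rmin_props(4)[OF z(2,3)] by auto
    have m: "?m \<le> \<rho>" by (rule mval_props(1)) (use z(3) in \<open>simp add: rmin_def\<close>)
    have "0 < pos' z" unfolding pos'_def using a z(4,5)
      by (cases "fst z = 1") (auto intro!: add_pos_nonneg)
    moreover have "pos' z \<le> (1 - fst z) * max ?a (?m / 2) + fst z * max ?a (?m / 2)"
      unfolding pos'_def using z(4,5) by (intro add_mono mult_left_mono) auto
    then have "pos' z \<le> max ?a (?m / 2)" by (simp add: algebra_simps)
    moreover have "max ?a (?m / 2) < ?m" using a by auto
    ultimately show ?thesis using m by auto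
  qed
  have contpos: "continuous_map ?P euclideanreal pos'"
    unfolding pos'_def
    by (intro continuous_map_add continuous_map_real_mult continuous_map_diff continuous_map_canonical_const
        continuous_map_prod_fst continuous_map_prod_snd[OF continuous_minpt'(2)[OF leg_sub]]
        continuous_map_real_mult_right[where c="1/2", simplified]
        continuous_map_prod_snd[OF continuous_rmin_mval[OF leg_sub]])
  have "continuous_map ?P (top_of_set {0<..<\<rho>}) pos'"
    unfolding continuous_map_in_subtopology using contpos bounds by auto
  from continuous_map_compose[OF this c]
  have cp: "continuous_map ?P X (\<lambda>z. c (pos' z))" by (simp add: o_def continuous_map_in_subtopology)
  have i: "c (pos' z) \<notin> rmin \<delta> (snd z) \<and> insert (c (pos' z)) (rmin \<delta> (snd z)) \<in> leg c" if z: "z \<in> topspace ?P" for z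
  proof -
    have z': "snd z \<in> N" "finite (snd z)" using legA[OF z] by auto
    have b: "0 < pos' z" "pos' z < \<rho>" "pos' z < mval \<rho> \<delta> (rmin \<delta> (snd z))" using bounds[OF z] by auto
    have "\<delta> (c (pos' z)) < mval \<rho> \<delta> (rmin \<delta> (snd z))" using dc b by simp
    note i = insert_umin[OF rmin_props(1)[OF z'] _ c_in[OF b(1,2)] this]
    have "finite (rmin \<delta> (snd z))" using z' by (simp add: rmin_def)
    then show ?thesis using i b unfolding leg_def by auto
  qed
  have "continuous_map ?P (uconf (Suc k) X) (\<lambda>z. insert (c (pos' z)) (rmin \<delta> (snd z)))"
  proof (rule continuous_insert[OF haus _ cp])
    have "continuous_map ?A (uconf k X) (rmin \<delta>)"
      using rmin_leg unfolding continuous_map_in_subtopology by blast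
    then show "continuous_map ?P (uconf k X) (\<lambda>z. rmin \<delta> (snd z))" by (rule continuous_map_prod_snd)
  qed (use i in auto)
  then have "continuous_map ?P ?A (\<lambda>z. insert (c (pos' z)) (rmin \<delta> (snd z)))"
    unfolding continuous_map_in_subtopology using i by blast
  then show ?thesis
  proof (rule homotopicI)
    fix S assume S: "S \<in> topspace ?A"
    then have S': "S \<in> leg c" "S \<in> N" "finite S" using leg_sub by (auto simp: topspace_uconf)
    show "insert (c (pos' (0, S))) (rmin \<delta> (snd (0::real, S))) = id S"
      using leg_minpt(3)[OF S'(1)] rmin_props(2)[OF S'(2,3)] by (simp add: pos'_def)
    show "insert (c (pos' (1, S))) (rmin \<delta> (snd (1::real, S))) = (addpt c \<circ> rmin \<delta>) S"
      by (simp add: pos'_def addpt_def)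
  qed
qed

end

text \<open>When \<open>{\<delta> < \<rho>}\<close> is a star with centre \<open>v\<close> and legs \<open>c h\<close>, the closest point can be
  moved through the centre to any fixed leg \<open>h0\<close>.\<close>

lemma homotopic_star:
  fixes c :: "'h \<Rightarrow> real \<Rightarrow> 'a" and k :: nat
  defines "A \<equiv> subtopology (uconf (Suc k) X) N"
  assumes c: "\<And>h. h \<in> H \<Longrightarrow> continuous_map (top_of_set {0..<\<rho>}) (subtopology X Y) (c h)"
    and dc: "\<And>h t. h \<in> H \<Longrightarrow> 0 \<le> t \<Longrightarrow> t < \<rho> \<Longrightarrow> \<delta> (c h t) = t"
    and c0: "\<And>h. h \<in> H \<Longrightarrow> c h 0 = v" and H: "finite H" "h0 \<in> H"
    and disj: "\<And>h h' t. h \<in> H \<Longrightarrow> h' \<in> H \<Longrightarrow> 0 < t \<Longrightarrow> t < \<rho> \<Longrightarrow> c h t = c h' t \<Longrightarrow> h = h'"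
    and star: "{p \<in> Y. \<delta> p < \<rho>} = (\<Union>h\<in>H. c h ` {0..<\<rho>})"
    and clo: "\<And>h. h \<in> H \<Longrightarrow> closedin (subtopology X {p \<in> Y. \<delta> p < \<rho>}) (c h ` {0..<\<rho>})"
  shows "continuous_map A (subtopology (uconf (Suc k) X) {S \<in> N. \<forall>p\<in>S. 0 < \<delta> p}) (addpt (c h0) \<circ> rmin \<delta>)
    \<and> homotopic_with (\<lambda>_. True) A A id (addpt (c h0) \<circ> rmin \<delta>)"
proof -
  let ?P = "prod_topology (top_of_set {0..1::real}) A"
  let ?St = "{p \<in> Y. \<delta> p < \<rho>}"
  let ?PS = "prod_topology (top_of_set {0..1::real}) (subtopology X ?St)"
  have inN: "S \<in> N" "finite S" "S \<in> topspace (uconf (Suc k) X)" if "S \<in> topspace A" for S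
    using that by (auto simp: topspace_uconf A_def)
  have StE: "\<exists>h\<in>H. p \<in> c h ` {0..<\<rho>}" if "p \<in> ?St" for p using that star by blast
  have St_eq: "p = c h (\<delta> p)" if "h \<in> H" "p \<in> c h ` {0..<\<rho>}" for p h using that dc by auto
  have d0: "0 \<le> \<delta> p" if "p \<in> ?St" for p using StE[OF that] dc by auto
  have mSt: "minpt \<delta> S \<in> ?St" if "S \<in> topspace A" for S
    using umin_minpt[OF inN(1)[OF that]] by blast
  have mv: "\<delta> (minpt \<delta> S) < mval \<rho> \<delta> (rmin \<delta> S)" "0 < mval \<rho> \<delta> (rmin \<delta> S)" "mval \<rho> \<delta> (rmin \<delta> S) \<le> \<rho>"
    if "S \<in> topspace A" for S
  proof -
    show *: "\<delta> (minpt \<delta> S) < mval \<rho> \<delta> (rmin \<delta> S)" by (rule rmin_props(4)[OF inN(1,2)[OF that]])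
    show "0 < mval \<rho> \<delta> (rmin \<delta> S)" using * d0[OF mSt[OF that]] by simp
    show "mval \<rho> \<delta> (rmin \<delta> S) \<le> \<rho>" by (rule mval_props(1)) (use inN(2)[OF that] in \<open>simp add: rmin_def\<close>)
  qed
  have cr: "continuous_map A (uconf k X) (rmin \<delta>)" unfolding A_def by (rule continuous_rmin)
  have cm: "continuous_map A euclideanreal (\<lambda>S. mval \<rho> \<delta> (rmin \<delta> S))" unfolding A_def by (rule continuous_rmin_mval) simp
  \<comment> \<open>Slides a point along its leg into the centre. The choice of the leg is
    immaterial because different legs meet at the centre only; continuity follows by pasting over
    the closed legs.\<close>
  define sl where "sl z = c (SOME h. h \<in> H \<and> snd z \<in> c h ` {0..<\<rho>}) ((1 - fst z) * \<delta> (snd z))" for z :: "real \<times> 'a"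
  have overlap: "c h ((1 - s) * \<delta> p) = c h' ((1 - s) * \<delta> p)"
    if "h \<in> H" "h' \<in> H" "p \<in> c h ` {0..<\<rho>}" "p \<in> c h' ` {0..<\<rho>}" for h h' p and s :: real
  proof (cases "\<delta> p = 0")
    case True then show ?thesis using c0 that by simp
  next
    case False
    have "0 \<le> \<delta> p" "\<delta> p < \<rho>" using that dc by auto
    then have "h = h'" using disj[OF that(1,2), of "\<delta> p"] St_eq[OF that(1,3)] St_eq[OF that(2,4)] False by auto
    then show ?thesis by simp
  qed
  have sl_eq: "sl z = c h ((1 - fst z) * \<delta> (snd z))" if h: "h \<in> H" "snd z \<in> c h ` {0..<\<rho>}" for z h
  proof -
    have "\<exists>h. h \<in> H \<and> snd z \<in> c h ` {0..<\<rho>}" using h by blast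
    from someI_ex[OF this] show ?thesis unfolding sl_def using overlap h by blast
  qed
  have slb: "0 \<le> (1 - s) * \<delta> p \<and> (1 - s) * \<delta> p \<le> \<delta> p \<and> (1 - s) * \<delta> p < \<rho>" if "0 \<le> s" "s \<le> 1" "p \<in> ?St" for s p
  proof -
    have "(1 - s) * \<delta> p \<le> 1 * \<delta> p" by (rule mult_right_mono) (use that d0 in auto)
    then show ?thesis using that d0[OF that(3)] by auto
  qed
  have contsl: "continuous_map ?PS (subtopology X Y) sl"
  proof (rule pasting_lemma_closed[where I=H and T="\<lambda>h. {0..1} \<times> c h ` {0..<\<rho>}" and f="\<lambda>h z. c h ((1 - fst z) * \<delta> (snd z))"])
    show "finite H" by fact
    show "closedin ?PS ({0..1} \<times> c h ` {0..<\<rho>})" if "h \<in> H" for h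
    proof -
      have "closedin (top_of_set {0..1::real}) {0..1}" using closedin_topspace[of "top_of_set {0..1::real}"] by simp
      then show ?thesis using clo[OF that] by (simp add: closedin_prod_Times_iff)
    qed
    fix h assume h: "h \<in> H"
    have "continuous_map (subtopology X ?St) euclideanreal \<delta>"
      using cont by (rule continuous_map_from_subtopology_mono) blast
    then have "continuous_map ?PS euclideanreal (\<lambda>z. (1 - fst z) * \<delta> (snd z))"
      by (intro continuous_map_real_mult continuous_map_diff continuous_map_canonical_const continuous_map_prod_fst continuous_map_prod_snd)
    then have "continuous_map ?PS (top_of_set {0..<\<rho>}) (\<lambda>z. (1 - fst z) * \<delta> (snd z))"
      unfolding continuous_map_in_subtopology using slb by auto
    from continuous_map_compose[OF this c[OF h]]
    show "continuous_map (subtopology ?PS ({0..1} \<times> c h ` {0..<\<rho>})) (subtopology X Y) (\<lambda>z. c h ((1 - fst z) * \<delta> (snd z)))"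
      by (intro continuous_map_from_subtopology) (simp add: o_def)
  next
    fix h h' z assume "h \<in> H" "h' \<in> H" "z \<in> topspace ?PS \<inter> {0..1} \<times> c h ` {0..<\<rho>} \<inter> {0..1} \<times> c h' ` {0..<\<rho>}"
    then show "c h ((1 - fst z) * \<delta> (snd z)) = c h' ((1 - fst z) * \<delta> (snd z))" by (intro overlap) (simp_all add: mem_Times_iff)
  next
    fix z assume z: "z \<in> topspace ?PS"
    then obtain h where "h \<in> H" "snd z \<in> c h ` {0..<\<rho>}" using StE[of "snd z"] by auto
    then show "\<exists>h. h \<in> H \<and> z \<in> {0..1} \<times> c h ` {0..<\<rho>} \<and> sl z = c h ((1 - fst z) * \<delta> (snd z))"
      using z sl_eq by (intro exI[of _ h]) (auto simp: mem_Times_iff)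
  qed
  have cmp: "continuous_map A (subtopology X ?St) (minpt \<delta>)" unfolding A_def by (rule continuous_minpt)
  have gen: "continuous_map ?P A (\<lambda>z. insert (q z) (rmin \<delta> (snd z)))"
    if q: "continuous_map ?P (subtopology X Y) q" and dq: "\<And>z. z \<in> topspace ?P \<Longrightarrow> \<delta> (q z) < mval \<rho> \<delta> (rmin \<delta> (snd z))" for q
  proof -
    have i: "q z \<notin> rmin \<delta> (snd z) \<and> insert (q z) (rmin \<delta> (snd z)) \<in> N" if z: "z \<in> topspace ?P" for z
    proof -
      have zA: "snd z \<in> topspace A" using z by auto
      have f: "finite (rmin \<delta> (snd z))" using inN(2)[OF zA] by (simp add: rmin_def)
      have "q z \<in> Y" using q z unfolding continuous_map_in_subtopology by blast
      then show ?thesis using insert_umin[OF rmin_props(1)[OF inN(1,2)[OF zA]] f _ dq[OF z]] by blast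
    qed
    have qX: "continuous_map ?P X q" using q unfolding continuous_map_in_subtopology by blast
    have "continuous_map ?P (uconf (Suc k) X) (\<lambda>z. insert (q z) (rmin \<delta> (snd z)))"
      by (rule continuous_insert[OF haus continuous_map_prod_snd[OF cr] qX]) (use i in blast)
    then show ?thesis unfolding A_def continuous_map_in_subtopology using i unfolding A_def by blast
  qed
  have zP: "snd z \<in> topspace A \<and> 0 \<le> fst z \<and> fst z \<le> 1" if "z \<in> topspace ?P" for z using that by auto
  \<comment> \<open>The closest point is drawn into the centre. Its distance can only decrease on
    the way, so it stays closest.\<close>
  have h1: "homotopic_with (\<lambda>_. True) A A id (\<lambda>S. insert v (rmin \<delta> S))"
  proof (rule homotopicI[where h="\<lambda>z. insert (sl (fst z, minpt \<delta> (snd z))) (rmin \<delta> (snd z))"])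
    show "continuous_map ?P A (\<lambda>z. insert (sl (fst z, minpt \<delta> (snd z))) (rmin \<delta> (snd z)))"
    proof (rule gen)
      have "continuous_map ?P ?PS (\<lambda>z. (fst z, minpt \<delta> (snd z)))"
        by (intro continuous_map_pairedI continuous_map_fst continuous_map_prod_snd cmp)
      from continuous_map_compose[OF this contsl]
      show "continuous_map ?P (subtopology X Y) (\<lambda>z. sl (fst z, minpt \<delta> (snd z)))" by (simp add: o_def)
      fix z assume "z \<in> topspace ?P"
      then have z: "snd z \<in> topspace A" "0 \<le> fst z" "fst z \<le> 1" using zP by auto
      obtain h where h: "h \<in> H" "minpt \<delta> (snd z) \<in> c h ` {0..<\<rho>}" using StE[OF mSt[OF z(1)]] by blast
      have b: "0 \<le> (1 - fst z) * \<delta> (minpt \<delta> (snd z))" "(1 - fst z) * \<delta> (minpt \<delta> (snd z)) \<le> \<delta> (minpt \<delta> (snd z))"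
        "(1 - fst z) * \<delta> (minpt \<delta> (snd z)) < \<rho>" using slb[OF z(2,3) mSt[OF z(1)]] by auto
      have "sl (fst z, minpt \<delta> (snd z)) = c h ((1 - fst z) * \<delta> (minpt \<delta> (snd z)))"
        using sl_eq[OF h(1), of "(fst z, minpt \<delta> (snd z))"] h(2) by simp
      then have "\<delta> (sl (fst z, minpt \<delta> (snd z))) = (1 - fst z) * \<delta> (minpt \<delta> (snd z))"
        using dc[OF h(1) b(1,3)] by simp
      then show "\<delta> (sl (fst z, minpt \<delta> (snd z))) < mval \<rho> \<delta> (rmin \<delta> (snd z))" using b(2) mv(1)[OF z(1)] by simp
    qed
    fix S assume S: "S \<in> topspace A"
    obtain h where h: "h \<in> H" "minpt \<delta> S \<in> c h ` {0..<\<rho>}" using StE[OF mSt[OF S]] by blast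
    have "sl (0, minpt \<delta> S) = minpt \<delta> S" using sl_eq[OF h(1), of "(0, minpt \<delta> S)"] h(2) St_eq[OF h] by simp
    then show "insert (sl (fst (0::real, S), minpt \<delta> (snd (0::real, S)))) (rmin \<delta> (snd (0::real, S))) = id S"
      using rmin_props(2)[OF inN(1,2)[OF S]] by simp
    have "sl (1, minpt \<delta> S) = v" using sl_eq[OF h(1), of "(1, minpt \<delta> S)"] h(2) c0[OF h(1)] by simp
    then show "insert (sl (fst (1::real, S), minpt \<delta> (snd (1::real, S)))) (rmin \<delta> (snd (1::real, S))) = insert v (rmin \<delta> S)"
      by simp
  qed
  \<comment> \<open>From the centre the point is pushed out along the fixed leg \<open>h0\<close>.
    The final configurations avoid the centre, as the target of the map requires.\<close>
  have h2: "homotopic_with (\<lambda>_. True) A A (\<lambda>S. insert v (rmin \<delta> S)) (addpt (c h0) \<circ> rmin \<delta>)"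
  proof (rule homotopicI[where h="\<lambda>z. insert (c h0 (fst z * (mval \<rho> \<delta> (rmin \<delta> (snd z)) / 2))) (rmin \<delta> (snd z))"])
    have b: "0 \<le> fst z * (mval \<rho> \<delta> (rmin \<delta> (snd z)) / 2) \<and> fst z * (mval \<rho> \<delta> (rmin \<delta> (snd z)) / 2) < \<rho>
        \<and> fst z * (mval \<rho> \<delta> (rmin \<delta> (snd z)) / 2) < mval \<rho> \<delta> (rmin \<delta> (snd z))" if z: "z \<in> topspace ?P" for z
    proof -
      let ?m = "mval \<rho> \<delta> (rmin \<delta> (snd z))"
      have z': "0 \<le> fst z" "fst z \<le> 1" "0 < ?m" "?m \<le> \<rho>" using zP[OF z] mv by auto
      have "fst z * (?m / 2) \<le> 1 * (?m / 2)" by (rule mult_right_mono) (use z' in auto)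
      moreover have "1 * (?m / 2) < \<rho>" "1 * (?m / 2) < ?m" using z' by auto
      ultimately show ?thesis using z'(1,3) by (meson divide_nonneg_nonneg le_less_trans less_imp_le mult_nonneg_nonneg zero_le_numeral)
    qed
    show "continuous_map ?P A (\<lambda>z. insert (c h0 (fst z * (mval \<rho> \<delta> (rmin \<delta> (snd z)) / 2))) (rmin \<delta> (snd z)))"
    proof (rule gen)
      have "continuous_map ?P euclideanreal (\<lambda>z. fst z * (mval \<rho> \<delta> (rmin \<delta> (snd z)) * (1 / 2)))"
        by (intro continuous_map_real_mult continuous_map_canonical_const continuous_map_prod_fst continuous_map_prod_snd[OF cm])
      then have "continuous_map ?P (top_of_set {0..<\<rho>}) (\<lambda>z. fst z * (mval \<rho> \<delta> (rmin \<delta> (snd z)) / 2))"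
        unfolding continuous_map_in_subtopology using b by auto
      from continuous_map_compose[OF this c[OF H(2)]]
      show "continuous_map ?P (subtopology X Y) (\<lambda>z. c h0 (fst z * (mval \<rho> \<delta> (rmin \<delta> (snd z)) / 2)))" by (simp add: o_def)
      fix z assume z: "z \<in> topspace ?P"
      show "\<delta> (c h0 (fst z * (mval \<rho> \<delta> (rmin \<delta> (snd z)) / 2))) < mval \<rho> \<delta> (rmin \<delta> (snd z))"
        using b[OF z] dc[OF H(2)] by simp
    qed
  qed (use c0[OF H(2)] in \<open>simp_all add: addpt_def\<close>)
  have hom: "homotopic_with (\<lambda>_. True) A A id (addpt (c h0) \<circ> rmin \<delta>)"
    by (rule homotopic_with_trans[OF h1 h2])
  have "continuous_map A A (addpt (c h0) \<circ> rmin \<delta>)"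
    using homotopic_with_imp_continuous_maps[OF hom] by blast
  moreover have "\<forall>p\<in>(addpt (c h0) \<circ> rmin \<delta>) S. 0 < \<delta> p" if S: "S \<in> topspace A" for S
  proof
    fix p assume "p \<in> (addpt (c h0) \<circ> rmin \<delta>) S"
    then consider "p = c h0 (mval \<rho> \<delta> (rmin \<delta> S) / 2)" | "p \<in> rmin \<delta> S" by (auto simp: addpt_def)
    then show "0 < \<delta> p"
    proof cases
      case 1 then show ?thesis using dc[OF H(2), of "mval \<rho> \<delta> (rmin \<delta> S) / 2"] mv(2,3)[OF S] by simp
    next
      case 2 then show ?thesis using rmin_props(3)[OF inN(1,2)[OF S] 2] d0[OF mSt[OF S]] by simp
    qed
  qed
  ultimately have "continuous_map A (subtopology (uconf (Suc k) X) {S \<in> N. \<forall>p\<in>S. 0 < \<delta> p}) (addpt (c h0) \<circ> rmin \<delta>)"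
    unfolding A_def continuous_map_in_subtopology by blast
  then show ?thesis using hom by blast
qed

end

section \<open>Configurations on an arc\<close>

definition gaps :: "real set \<Rightarrow> (real \<times> real) set" where
  "gaps A = {(a, b). a \<in> insert 0 A \<and> b \<in> insert 1 A \<and> a < b \<and> A \<inter> {a<..<b} = {}}"

definition coords :: "(real \<Rightarrow> 'a) \<Rightarrow> 'a set \<Rightarrow> real set" where
  "coords c S = {t \<in> {0<..<1}. c t \<in> S}"

text \<open>Between any two consecutive points on the arc \<open>c\<close> (its ends included) put one new point, and forget the
  old points in its interior.\<close>

definition ins :: "(real \<Rightarrow> 'a) \<Rightarrow> (real \<Rightarrow> real \<Rightarrow> real) \<Rightarrow> 'a set \<Rightarrow> 'a set" where
  "ins c \<omega> S = (S - c ` {0<..<1}) \<union> (\<lambda>(a, b). c (\<omega> a b)) ` gaps (coords c S)"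

lemma gaps_D:
  assumes "(a, b) \<in> gaps A" "A \<subseteq> {0<..<1}"
  shows "0 \<le> a" "a < b" "b \<le> 1" "a < 1" "0 < b" "a \<noteq> 0 \<Longrightarrow> a \<in> A" "b \<noteq> 1 \<Longrightarrow> b \<in> A" "\<And>t. t \<in> A \<Longrightarrow> t \<le> a \<or> b \<le> t"
  using assms by (auto simp: gaps_def)

lemma gaps_order:
  assumes A: "A \<subseteq> {0<..<1}" and "(a, b) \<in> gaps A" "(a', b') \<in> gaps A" "(a, b) \<noteq> (a', b')"
  shows "b \<le> a' \<or> b' \<le> a"
proof (cases a a' rule: linorder_cases)
  case less
  then have "a' \<in> A" using gaps_D[OF assms(2) A] gaps_D[OF assms(3) A] by auto
  then show ?thesis using gaps_D(8)[OF assms(2) A, of a'] less by auto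
next
  case greater
  then have "a \<in> A" using gaps_D[OF assms(2) A] gaps_D[OF assms(3) A] by auto
  then show ?thesis using gaps_D(8)[OF assms(3) A, of a] greater by auto
next
  case equal
  then have "b \<noteq> b'" using assms(4) by simp
  then consider "b < b'" | "b' < b" by linarith
  then show ?thesis
  proof cases
    case 1
    then have "b \<in> A" using gaps_D[OF assms(2) A] gaps_D[OF assms(3) A] by auto
    then show ?thesis using gaps_D(8)[OF assms(3) A, of b] gaps_D(2)[OF assms(2) A] 1 equal by auto
  next
    case 2
    then have "b' \<in> A" using gaps_D[OF assms(2) A] gaps_D[OF assms(3) A] by auto
    then show ?thesis using gaps_D(8)[OF assms(2) A, of b'] gaps_D(2)[OF assms(3) A] 2 equal by auto
  qed
qed

lemma gap_from:
  assumes A: "finite A" "A \<subseteq> {0<..<1}" and a: "a \<in> insert 0 A" shows "\<exists>b. (a, b) \<in> gaps A"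
proof -
  let ?B = "{t \<in> insert 1 A. a < t}"
  have B: "finite ?B" "1 \<in> ?B" using A a by auto
  have "Min ?B \<in> ?B" using B Min_in[of ?B] by blast
  moreover have "t \<notin> {a<..<Min ?B}" if "t \<in> A" for t
  proof
    assume t: "t \<in> {a<..<Min ?B}"
    then have "Min ?B \<le> t" using Min_le[OF B(1), of t] that by auto
    then show False using t by auto
  qed
  ultimately have "(a, Min ?B) \<in> gaps A" using a unfolding gaps_def by blast
  then show ?thesis by blast
qed

lemma gap_around:
  assumes A: "finite A" "A \<subseteq> {0<..<1}" and m: "0 < m" "m < 1" "m \<notin> A"
  obtains a b where "(a, b) \<in> gaps A" "a < m" "m < b"
proof -
  let ?L = "{t \<in> insert 0 A. t \<le> m}"
  have L: "finite ?L" "0 \<in> ?L" using A m by auto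
  have a: "Max ?L \<in> ?L" using L Max_in[of ?L] by blast
  obtain b where b: "(Max ?L, b) \<in> gaps A" using gap_from[OF A, of "Max ?L"] a by blast
  have "Max ?L < m" using a m by (metis (no_types, lifting) insert_iff le_less mem_Collect_eq)
  moreover have "m < b"
  proof (rule ccontr)
    assume nb: "\<not> m < b"
    then have "b \<in> A" using gaps_D[OF b A(2)] m(2) by force
    then have "b \<le> Max ?L" using Max_ge[OF L(1), of b] nb by auto
    then show False using gaps_D(2)[OF b A(2)] by simp
  qed
  ultimately show ?thesis using that b by blast
qed

text \<open>A gap is determined by its left end, which is 0 or a point of \<open>A\<close>. This
  count is why \<open>ins\<close> raises the number of points by exactly one.\<close>

lemma card_gaps:
  assumes A: "finite A" "A \<subseteq> {0<..<1}" shows "finite (gaps A)" "card (gaps A) = Suc (card A)"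
proof -
  have "inj_on fst (gaps A)"
  proof (rule inj_onI)
    fix p q assume pq: "p \<in> gaps A" "q \<in> gaps A" "fst p = fst q"
    obtain a b b' where e: "p = (a, b)" "q = (a, b')" using pq(3) by (metis prod.collapse)
    show "p = q"
    proof (rule ccontr)
      assume "p \<noteq> q"
      then have "b \<le> a \<or> b' \<le> a" using gaps_order[OF A(2), of a b a b'] pq e by blast
      then show False using gaps_D(2)[of a b A] gaps_D(2)[of a b' A] pq e A(2) by auto
    qed
  qed
  moreover have "fst ` gaps A = insert 0 A"
  proof
    show "fst ` gaps A \<subseteq> insert 0 A" by (auto simp: gaps_def)
    show "insert 0 A \<subseteq> fst ` gaps A" using gap_from[OF A] by force
  qed
  ultimately have b: "bij_betw fst (gaps A) (insert 0 A)" by (simp add: bij_betw_def)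
  show "finite (gaps A)" using bij_betw_finite[OF b] A by simp
  have "0 \<notin> A" using A by auto
  then show "card (gaps A) = Suc (card A)" using bij_betw_same_card[OF b] A by simp
qed

lemma tri_dist:
  fixes f :: "real \<times> real \<times> real \<Rightarrow> real"
  assumes "continuous_on UNIV f" "0 < \<eta>"
  obtains \<epsilon> where "0 < \<epsilon>" "\<And>s a b. \<bar>s - s0\<bar> < \<epsilon> \<Longrightarrow> \<bar>a - a0\<bar> < \<epsilon> \<Longrightarrow> \<bar>b - b0\<bar> < \<epsilon> \<Longrightarrow> \<bar>f (s, a, b) - f (s0, a0, b0)\<bar> < \<eta>"
proof -
  obtain d where d: "0 < d" "\<And>w. dist w (s0, a0, b0) < d \<Longrightarrow> dist (f w) (f (s0, a0, b0)) < \<eta>"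
    using assms unfolding continuous_on_iff by (metis UNIV_I)
  have le: "dist (x, y) (x', y') \<le> dist x x' + dist y y'" for x x' :: real and y y' :: "'b::metric_space"
    unfolding dist_Pair_Pair by (rule sqrt_sum_squares_le_sum) simp_all
  show ?thesis
  proof (rule that[of "d / 3"])
    show "0 < d / 3" using d by simp
    fix s a b assume "\<bar>s - s0\<bar> < d / 3" "\<bar>a - a0\<bar> < d / 3" "\<bar>b - b0\<bar> < d / 3"
    then have "dist (s, a, b) (s0, a0, b0) < d"
      using le[of s "(a, b)" s0 "(a0, b0)"] le[of a b a0 b0] by (simp add: dist_real_def)
    from d(2)[OF this] show "\<bar>f (s, a, b) - f (s0, a0, b0)\<bar> < \<eta>" by (simp add: dist_real_def)
  qed
qed

text \<open>The two ends may coincide, so loops are included.\<close>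

locale arc =
  fixes X :: "'a topology" and c :: "real \<Rightarrow> 'a"
  assumes haus: "Hausdorff_space X" and cont: "continuous_map (top_of_set {0..1}) X c"
    and inj: "inj_on c {0<..<1}" and ends: "c 0 \<notin> c ` {0<..<1}" "c 1 \<notin> c ` {0<..<1}"
    and op: "openin X (c ` {0<..<1})"
begin

lemma c_top: "0 \<le> t \<Longrightarrow> t \<le> 1 \<Longrightarrow> c t \<in> topspace X"
  using continuous_map_image_subset_topspace[OF cont] by auto

lemma closed_image: assumes "0 \<le> a" "b \<le> 1" shows "closedin X (c ` {a..b})"
proof -
  have "compactin (top_of_set {0..1}) {a..b}"
    using assms by (auto simp: compactin_subtopology)
  then show ?thesis using image_compactin[OF _ cont] compactin_imp_closedin[OF haus] by blast
qed

lemma open_image: assumes "0 \<le> a" "b \<le> 1" shows "openin X (c ` {a<..<b})"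
proof (cases "a < b")
  case ab: True
  have notin: "c t \<notin> c ` {0..a} \<union> c ` {b..1}" if t: "a < t" "t < b" for t
  proof
    assume "c t \<in> c ` {0..a} \<union> c ` {b..1}"
    then obtain r where r: "c t = c r" "r \<in> {0..a} \<union> {b..1}" by blast
    have r': "0 \<le> r" "r \<le> 1" "r \<noteq> t" using r(2) t ab assms by auto
    have t01: "t \<in> {0<..<1}" using t assms by auto
    then have "r \<noteq> 0" "r \<noteq> 1" using r(1) ends by (metis imageI)+
    then have "r \<in> {0<..<1}" using r' by auto
    then show False using inj_onD[OF inj r(1) t01] r' by simp
  qed
  have "c ` {a<..<b} = c ` {0<..<1} - (c ` {0..a} \<union> c ` {b..1})"
  proof
    show "c ` {a<..<b} \<subseteq> c ` {0<..<1} - (c ` {0..a} \<union> c ` {b..1})" 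
    proof
      fix p assume "p \<in> c ` {a<..<b}"
      then obtain t where t: "p = c t" "a < t" "t < b" by auto
      then show "p \<in> c ` {0<..<1} - (c ` {0..a} \<union> c ` {b..1})" using notin[OF t(2,3)] assms by auto
    qed
    show "c ` {0<..<1} - (c ` {0..a} \<union> c ` {b..1}) \<subseteq> c ` {a<..<b}"
    proof
      fix p assume p: "p \<in> c ` {0<..<1} - (c ` {0..a} \<union> c ` {b..1})"
      then obtain t where t: "p = c t" "0 < t" "t < 1" by auto
      have "\<not> t \<le> a" "\<not> b \<le> t" using p t by auto
      then show "p \<in> c ` {a<..<b}" using t by simp
    qed
  qed
  moreover have "openin X (c ` {0<..<1} - (c ` {0..a} \<union> c ` {b..1}))"
    using assms ab by (intro openin_diff op closedin_Un closed_image) auto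
  ultimately show ?thesis by simp
qed simp

lemma finite_coords: "finite S \<Longrightarrow> finite (coords c S)"
  unfolding coords_def by (rule finite_imageD[of c]) (auto intro: finite_subset[of _ S] inj_on_subset[OF inj])

lemma coords_sub: "coords c S \<subseteq> {0<..<1}"
  by (auto simp: coords_def)

lemma coords_image: "c ` coords c S = S \<inter> c ` {0<..<1}"
  by (auto simp: coords_def)

text \<open>Two kinds of points need an argument. A new point follows the ends of its gap, which
  move continuously. An old point at an end of the arc may move into the arc and is then forgotten;
  but the gap it leaves at that end is short, and the new point in this gap takes its place. Here it
  matters that \<omega> stays between the ends of the gap.\<close>

lemma ins_lowc:
  fixes Z :: "'z topology"
  assumes g: "continuous_map Z (uconf k X) g" and \<sigma>: "continuous_map Z euclideanreal \<sigma>"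
    and s01: "\<And>z. z \<in> topspace Z \<Longrightarrow> \<sigma> z \<in> {0..1}"
    and \<omega>: "continuous_on UNIV (\<lambda>(s, a, b). \<omega> s a b)"
    and bd: "\<And>s a b. 0 \<le> s \<Longrightarrow> s \<le> 1 \<Longrightarrow> a \<le> b \<Longrightarrow> a \<le> \<omega> s a b \<and> \<omega> s a b \<le> b"
  shows "lowc Z X (\<lambda>z. ins c (\<omega> (\<sigma> z)) (g z))"
  unfolding lowc_def
proof (intro allI impI, subst openin_subopen, intro ballI)
  fix U z0 assume U: "openin X U" and "z0 \<in> {z \<in> topspace Z. ins c (\<omega> (\<sigma> z)) (g z) \<inter> U \<noteq> {}}"
  then obtain p where z0: "z0 \<in> topspace Z" and p: "p \<in> ins c (\<omega> (\<sigma> z0)) (g z0)" "p \<in> U" by blast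
  let ?S0 = "g z0" and ?A = "\<lambda>z. coords c (g z)" and ?G = "{z \<in> topspace Z. ins c (\<omega> (\<sigma> z)) (g z) \<inter> U \<noteq> {}}"
  have fin: "finite (?A z)" if "z \<in> topspace Z" for z
    using continuous_map_image_subset_topspace[OF g] that by (intro finite_coords) (auto simp: topspace_uconf)
  have meet: "openin Z {z \<in> topspace Z. g z \<inter> V \<noteq> {}}" if "openin X V" for V
    using lowcD[OF lowc_continuous[OF g] that] .
  have avoid: "openin Z {z \<in> topspace Z. g z \<inter> K = {}}" if K: "closedin X K" for K
  proof -
    have "openin Z {z \<in> topspace Z. g z \<in> {S \<in> topspace (uconf k X). S \<subseteq> topspace X - K}}"
      by (rule openin_continuous_map_preimage[OF g openin_uconf_subset]) (use K in blast)
    moreover have "g z \<subseteq> topspace X \<and> g z \<in> topspace (uconf k X)" if "z \<in> topspace Z" for z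
      using continuous_map_image_subset_topspace[OF g] that by (auto simp: topspace_uconf)
    then have "{z \<in> topspace Z. g z \<in> {S \<in> topspace (uconf k X). S \<subseteq> topspace X - K}} = {z \<in> topspace Z. g z \<inter> K = {}}" by blast
    ultimately show ?thesis by simp
  qed
  have preU: "openin (top_of_set {0..1}) {t \<in> {0..1}. c t \<in> U}"
    using openin_continuous_map_preimage[OF cont U] by simp
  have nearU: "\<exists>\<eta>>0. \<forall>t\<in>{0..1}. \<bar>t - t0\<bar> < \<eta> \<longrightarrow> c t \<in> U" if "t0 \<in> {0..1}" "c t0 \<in> U" for t0
  proof -
    have "t0 \<in> {t \<in> {0..1}. c t \<in> U}" using that by simp
    then obtain \<eta> where "\<eta> > 0" "\<forall>t\<in>{0..1}. dist t t0 < \<eta> \<longrightarrow> t \<in> {t \<in> {0..1}. c t \<in> U}"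
      using preU[unfolded openin_euclidean_subtopology_iff] by meson
    then show ?thesis by (intro exI[of _ \<eta>]) (simp add: dist_real_def)
  qed
  show "\<exists>T. openin Z T \<and> z0 \<in> T \<and> T \<subseteq> ?G"
  proof (cases "p \<in> (\<lambda>(a, b). c (\<omega> (\<sigma> z0) a b)) ` gaps (?A z0)")
    case True
    then obtain a b where ab: "(a, b) \<in> gaps (?A z0)" "p = c (\<omega> (\<sigma> z0) a b)" by auto
    note gD = gaps_D[OF ab(1) coords_sub]
    let ?t0 = "\<omega> (\<sigma> z0) a b"
    have t0: "?t0 \<in> {0..1}" using bd[of "\<sigma> z0" a b] s01[OF z0] gD by auto
    obtain \<eta> where \<eta>: "\<eta> > 0" "\<And>t. t \<in> {0..1} \<Longrightarrow> \<bar>t - ?t0\<bar> < \<eta> \<Longrightarrow> c t \<in> U"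
      using nearU[OF t0] p(2) ab(2) by blast
    obtain \<epsilon>0 where \<epsilon>0: "0 < \<epsilon>0" "\<And>s a' b'. \<bar>s - \<sigma> z0\<bar> < \<epsilon>0 \<Longrightarrow> \<bar>a' - a\<bar> < \<epsilon>0 \<Longrightarrow> \<bar>b' - b\<bar> < \<epsilon>0 \<Longrightarrow> \<bar>\<omega> s a' b' - ?t0\<bar> < \<eta>"
      using tri_dist[OF \<omega> \<eta>(1), of "\<sigma> z0" a b] by auto
    \<comment> \<open>At most a third of the gap, so that its midpoint stays between the perturbed
      ends.\<close>
    define \<epsilon> where "\<epsilon> = min \<epsilon>0 ((b - a) / 3)"
    have \<epsilon>: "0 < \<epsilon>" "\<epsilon> \<le> \<epsilon>0" "3 * \<epsilon> \<le> b - a" using \<epsilon>0(1) gD(2) by (simp_all add: \<epsilon>_def min_def)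
    define near where "near x = (if x \<in> ?A z0 then {z \<in> topspace Z. g z \<inter> c ` {max 0 (x - \<epsilon>)<..<min 1 (x + \<epsilon>)} \<noteq> {}} else topspace Z)" for x
    have near: "openin Z (near x)" "z0 \<in> near x" for x
    proof -
      show "openin Z (near x)" unfolding near_def by (auto intro!: meet open_image)
      show "z0 \<in> near x"
      proof (cases "x \<in> ?A z0")
        case True
        then have "x \<in> {max 0 (x - \<epsilon>)<..<min 1 (x + \<epsilon>)}" "c x \<in> g z0" using \<epsilon> by (auto simp: coords_def)
        then show ?thesis using True z0 by (auto simp: near_def)
      qed (use z0 in \<open>simp add: near_def\<close>)
    qed
    \<comment> \<open>Configurations near \<open>g z0\<close> avoid this compact middle part of the
      gap and still have points near those ends of it that are points of the configuration. So their
      gap around the midpoint has both ends close to \<open>a\<close> and \<open>b\<close>.\<close>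
    let ?K = "c ` {a + \<epsilon>..b - \<epsilon>}"
    define T where "T = {z \<in> topspace Z. \<bar>\<sigma> z - \<sigma> z0\<bar> < \<epsilon>} \<inter> {z \<in> topspace Z. g z \<inter> ?K = {}} \<inter> near a \<inter> near b"
    have "openin Z {z \<in> topspace Z. \<sigma> z \<in> ball (\<sigma> z0) \<epsilon>}"
      by (rule openin_continuous_map_preimage[OF \<sigma>]) simp
    then have "openin Z {z \<in> topspace Z. \<bar>\<sigma> z - \<sigma> z0\<bar> < \<epsilon>}" by (simp add: dist_real_def abs_minus_commute)
    then have "openin Z T" unfolding T_def
      using avoid[OF closed_image[of "a + \<epsilon>" "b - \<epsilon>"]] near(1) gD \<epsilon> by (intro openin_Int) auto
    moreover have "z0 \<in> T"
    proof -
      have "g z0 \<inter> ?K = {}"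
      proof -
        have "c t \<notin> g z0" if "t \<in> {a + \<epsilon>..b - \<epsilon>}" for t
        proof
          assume "c t \<in> g z0"
          then have "t \<in> ?A z0" using that gD \<epsilon> by (auto simp: coords_def)
          then show False using gD(8)[of t] that \<epsilon> by auto
        qed
        then show ?thesis by blast
      qed
      then show ?thesis using z0 \<epsilon> near(2) by (simp add: T_def)
    qed
    moreover have "T \<subseteq> ?G"
    proof
      fix z assume z: "z \<in> T"
      then have zt: "z \<in> topspace Z" and sz: "\<bar>\<sigma> z - \<sigma> z0\<bar> < \<epsilon>" and zK: "g z \<inter> ?K = {}" and zn: "z \<in> near a" "z \<in> near b"
        by (auto simp: T_def)
      let ?m = "(a + b) / 2"
      have noA: "t \<notin> ?A z" if "t \<in> {a + \<epsilon>..b - \<epsilon>}" for t using zK that by (auto simp: coords_def)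
      have mK: "?m \<in> {a + \<epsilon>..b - \<epsilon>}" using \<epsilon> by auto
      obtain a' b' where ab': "(a', b') \<in> gaps (?A z)" "a' < ?m" "?m < b'"
        by (rule gap_around[OF fin[OF zt] coords_sub, of ?m]) (use gD noA[OF mK] in auto)
      note gD' = gaps_D[OF ab'(1) coords_sub]
      have "a' < a + \<epsilon>"
      proof (rule ccontr)
        assume "\<not> a' < a + \<epsilon>"
        then have "a' \<in> {a + \<epsilon>..b - \<epsilon>}" "a' \<noteq> 0" using ab'(2) mK gD(1) \<epsilon>(1) by auto
        then show False using noA gD'(6) by blast
      qed
      moreover have "b - \<epsilon> < b'"
      proof (rule ccontr)
        assume "\<not> b - \<epsilon> < b'"
        then have "b' \<in> {a + \<epsilon>..b - \<epsilon>}" "b' \<noteq> 1" using ab'(3) mK gD(3) \<epsilon>(1) by auto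
        then show False using noA gD'(7) by blast
      qed
      moreover have "a - \<epsilon> < a'"
      proof (cases "a \<in> ?A z0")
        case True
        then have "g z \<inter> c ` {max 0 (a - \<epsilon>)<..<min 1 (a + \<epsilon>)} \<noteq> {}" using zn(1) unfolding near_def by simp
        then obtain t where t: "t \<in> {max 0 (a - \<epsilon>)<..<min 1 (a + \<epsilon>)}" "c t \<in> g z" by blast
        then have "t \<in> ?A z" by (auto simp: coords_def)
        then have "t \<le> a' \<or> b' \<le> t" by (rule gD'(8))
        then show ?thesis using t(1) ab'(3) mK by auto
      next
        case False
        then have "a = 0" using gD(6) by blast
        then show ?thesis using gD'(1) \<epsilon>(1) by simp
      qed
      moreover have "b' < b + \<epsilon>"
      proof (cases "b \<in> ?A z0")
        case True
        then have "g z \<inter> c ` {max 0 (b - \<epsilon>)<..<min 1 (b + \<epsilon>)} \<noteq> {}" using zn(2) unfolding near_def by simp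
        then obtain t where t: "t \<in> {max 0 (b - \<epsilon>)<..<min 1 (b + \<epsilon>)}" "c t \<in> g z" by blast
        then have "t \<in> ?A z" by (auto simp: coords_def)
        then have "t \<le> a' \<or> b' \<le> t" by (rule gD'(8))
        then show ?thesis using t(1) ab'(2) mK by auto
      next
        case False
        then have "b = 1" using gD(7) by blast
        then show ?thesis using gD'(3) \<epsilon>(1) by simp
      qed
      ultimately have "\<bar>\<omega> (\<sigma> z) a' b' - ?t0\<bar> < \<eta>" using \<epsilon>0(2)[of "\<sigma> z" a' b'] sz \<epsilon>(2) by auto
      moreover have "\<omega> (\<sigma> z) a' b' \<in> {0..1}" using bd[of "\<sigma> z" a' b'] s01[OF zt] gD' by auto
      ultimately have "c (\<omega> (\<sigma> z) a' b') \<in> U" using \<eta>(2) by blast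
      then show "z \<in> ?G" using ab'(1) zt by (force simp: ins_def)
    qed
    ultimately show ?thesis by blast
  next
    case False
    then have p': "p \<in> g z0" "p \<notin> c ` {0<..<1}" using p(1) by (auto simp: ins_def)
    have "\<exists>\<eta>>0. \<forall>t\<in>{0..1}. \<bar>t - t0\<bar> < \<eta> \<longrightarrow> c t0 \<in> U \<longrightarrow> c t \<in> U" if "t0 \<in> {0..1}" for t0
      using nearU[OF that] by (cases "c t0 \<in> U") (auto intro: exI[of _ 1])
    from this[of 0] this[of 1] obtain \<eta>0 \<eta>1 where
      \<eta>01: "\<eta>0 > 0" "\<And>t. t \<in> {0..1} \<Longrightarrow> \<bar>t - 0\<bar> < \<eta>0 \<Longrightarrow> c 0 \<in> U \<Longrightarrow> c t \<in> U"
        "\<eta>1 > 0" "\<And>t. t \<in> {0..1} \<Longrightarrow> \<bar>t - 1\<bar> < \<eta>1 \<Longrightarrow> c 1 \<in> U \<Longrightarrow> c t \<in> U" by auto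
    define \<eta> where "\<eta> = min (1/2) (min \<eta>0 \<eta>1)"
    have \<eta>: "0 < \<eta>" "\<eta> \<le> 1/2" "\<And>t. 0 \<le> t \<Longrightarrow> t < \<eta> \<Longrightarrow> c 0 \<in> U \<Longrightarrow> c t \<in> U" "\<And>t. 1 - \<eta> < t \<Longrightarrow> t \<le> 1 \<Longrightarrow> c 1 \<in> U \<Longrightarrow> c t \<in> U"
      using \<eta>01 by (auto simp: \<eta>_def)
    \<comment> \<open>A neighbourhood of \<open>p\<close> that meets the arc at most near those ends
      that equal \<open>p\<close>. For a loop based at \<open>p\<close> both ends are kept.\<close>
    define V where "V = U - c ` {\<eta>..1 - \<eta>} - (if c 0 = p then {} else c ` {0..1/2}) - (if c 1 = p then {} else c ` {1/2..1})"
    have oV: "openin X V" unfolding V_def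
      using U \<eta> by (intro openin_diff) (auto intro: closed_image)
    have mid: "c t \<noteq> p" if "0 < t" "t < 1" for t using p'(2) that by force
    have half: "p \<notin> c ` {0..1/2}" if "c 0 \<noteq> p"
    proof
      assume "p \<in> c ` {0..1/2}"
      then obtain t where "0 \<le> t" "t \<le> 1/2" "p = c t" by auto
      then show False using mid[of t] that by (cases "t = 0") auto
    qed
    have half': "p \<notin> c ` {1/2..1}" if "c 1 \<noteq> p"
    proof
      assume "p \<in> c ` {1/2..1}"
      then obtain t where "1/2 \<le> t" "t \<le> 1" "p = c t" by auto
      then show False using mid[of t] that by (cases "t = 1") auto
    qed
    have "p \<notin> c ` {\<eta>..1 - \<eta>}" using p'(2) \<eta>(1) by force
    then have pV: "p \<in> V" unfolding V_def using p(2) half half' by auto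
    have "{z \<in> topspace Z. g z \<inter> V \<noteq> {}} \<subseteq> ?G"
    proof
      fix z assume "z \<in> {z \<in> topspace Z. g z \<inter> V \<noteq> {}}"
      then obtain q where zt: "z \<in> topspace Z" and q: "q \<in> g z" "q \<in> V" by blast
      note fA = fin[OF zt]
      show "z \<in> ?G"
      proof (cases "q \<in> c ` {0<..<1}")
        case False
        then show ?thesis using q zt by (auto simp: ins_def V_def)
      next
        case True
        then obtain t where t: "0 < t" "t < 1" "q = c t" by auto
        have tA: "t \<in> ?A z" using t q by (simp add: coords_def)
        have "t \<notin> {\<eta>..1 - \<eta>}" using q(2) t(3) by (auto simp: V_def)
        then consider "t < \<eta>" | "1 - \<eta> < t" using t by force
        then show ?thesis
        proof cases
          case 1
          have c0: "c 0 \<in> U"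
          proof (rule ccontr)
            assume "c 0 \<notin> U"
            then have "c 0 \<noteq> p" using p(2) by auto
            then show False using q(2) t 1 \<eta>(2) by (auto simp: V_def)
          qed
          obtain b where b: "(0, b) \<in> gaps (?A z)" using gap_from[OF fA coords_sub] by blast
          note gD = gaps_D[OF b coords_sub]
          have "b \<le> t" using gD(8)[OF tA] t by auto
          then have "0 \<le> \<omega> (\<sigma> z) 0 b" "\<omega> (\<sigma> z) 0 b < \<eta>" using bd[of "\<sigma> z" 0 b] s01[OF zt] gD 1 by auto
          then have "c (\<omega> (\<sigma> z) 0 b) \<in> U" using \<eta>(3) c0 by blast
          then show ?thesis using b zt by (force simp: ins_def)
        next
          case 2
          have c1: "c 1 \<in> U"
          proof (rule ccontr)
            assume "c 1 \<notin> U"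
            then have "c 1 \<noteq> p" using p(2) by auto
            then show False using q(2) t 2 \<eta>(2) by (auto simp: V_def)
          qed
          have ne: "?A z \<noteq> {}" using tA by blast
          let ?a = "Max (?A z)"
          have aA: "?a \<in> ?A z" using Max_in[OF fA ne] .
          obtain b where b: "(?a, b) \<in> gaps (?A z)" using gap_from[OF fA coords_sub] aA by blast
          note gD = gaps_D[OF b coords_sub]
          have "b = 1"
          proof (rule ccontr)
            assume "b \<noteq> 1"
            then have "b \<le> ?a" using gD(7) fA by simp
            then show False using gD(2) by simp
          qed
          moreover have "t \<le> ?a" using fA tA by simp
          ultimately have "1 - \<eta> < \<omega> (\<sigma> z) ?a b" "\<omega> (\<sigma> z) ?a b \<le> 1"
            using bd[of "\<sigma> z" ?a b] s01[OF zt] gD 2 by auto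
          then have "c (\<omega> (\<sigma> z) ?a b) \<in> U" using \<eta>(4) c1 by blast
          then show ?thesis using b zt by (force simp: ins_def)
        qed
      qed
    qed
    moreover have "z0 \<in> {z \<in> topspace Z. g z \<inter> V \<noteq> {}}" using z0 p'(1) pV by blast
    ultimately show ?thesis using meet[OF oV] by blast
  qed
qed

text \<open>The set \<open>T\<close> contains the parameters of the new points. It may contain an
  end of the arc, provided that the configuration does not occupy the corresponding vertex;
  injectivity of \<open>c\<close> on \<open>T\<close> excludes both ends of a loop at once.\<close>

lemma ins_conf:
  assumes S: "S \<in> topspace (uconf k X)" and T: "inj_on c T" "T \<subseteq> {0..1}"
    and \<omega>T: "\<And>a b. (a, b) \<in> gaps (coords c S) \<Longrightarrow> \<omega> a b \<in> T"
    and cT: "\<And>t. t \<in> T \<Longrightarrow> c t \<notin> S - c ` {0<..<1}"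
    and strict: "\<And>a b a' b'. (a, b) \<in> gaps (coords c S) \<Longrightarrow> (a', b') \<in> gaps (coords c S) \<Longrightarrow> b \<le> a' \<Longrightarrow> \<omega> a b < \<omega> a' b'"
  shows "ins c \<omega> S \<in> topspace (uconf (Suc k) X)"
proof -
  let ?A = "coords c S" and ?e = "c ` {0<..<1}"
  have S': "S \<subseteq> topspace X" "finite S" "card S = k" using S by (auto simp: topspace_uconf)
  have fA: "finite ?A" by (rule finite_coords[OF S'(2)])
  note g = card_gaps[OF fA coords_sub]
  have inj\<omega>: "inj_on (\<lambda>(a, b). \<omega> a b) (gaps ?A)"
  proof (rule inj_onI)
    fix p q assume pq: "p \<in> gaps ?A" "q \<in> gaps ?A" "(\<lambda>(a, b). \<omega> a b) p = (\<lambda>(a, b). \<omega> a b) q"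
    obtain a b a' b' where e: "p = (a, b)" "q = (a', b')" by (metis surj_pair)
    have gg: "(a, b) \<in> gaps ?A" "(a', b') \<in> gaps ?A" using pq e by simp_all
    show "p = q"
    proof (rule ccontr)
      assume "p \<noteq> q"
      then consider "b \<le> a'" | "b' \<le> a" using gaps_order[OF coords_sub, of a b S a' b'] pq e by blast
      then show False
      proof cases
        case 1 then show False using strict[OF gg 1] pq(3) e by simp
      next
        case 2 then show False using strict[OF gg(2,1) 2] pq(3) e by simp
      qed
    qed
  qed
  let ?I = "(\<lambda>(a, b). c (\<omega> a b)) ` gaps ?A"
  have I: "?I = c ` (\<lambda>(a, b). \<omega> a b) ` gaps ?A" by force
  have sub: "(\<lambda>(a, b). \<omega> a b) ` gaps ?A \<subseteq> T" using \<omega>T by auto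
  have "card ?I = card ((\<lambda>(a, b). \<omega> a b) ` gaps ?A)" unfolding I
    by (rule card_image[OF inj_on_subset[OF T(1) sub]])
  also have "\<dots> = Suc (card ?A)" using card_image[OF inj\<omega>] g(2) by simp
  finally have cI: "card ?I = Suc (card ?A)" .
  have "card (c ` ?A) = card ?A" by (rule card_image[OF inj_on_subset[OF inj coords_sub]])
  then have "card ?A = card (S \<inter> ?e)" by (simp add: coords_image)
  moreover have "card S = card (S - ?e) + card (S \<inter> ?e)"
    using S'(2) by (metis Diff_Diff_Int Diff_disjoint Int_Diff_Un card_Un_disjoint finite_Diff finite_Int inf_commute inf_sup_aci(5))
  moreover have "(S - ?e) \<inter> ?I = {}" using cT sub unfolding I by blast
  moreover have "finite ?I" using g(1) by simp
  ultimately have "card (ins c \<omega> S) = Suc k" unfolding ins_def using cI S' by (simp add: card_Un_disjoint)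
  moreover have "ins c \<omega> S \<subseteq> topspace X" 
  proof
    fix p assume "p \<in> ins c \<omega> S"
    then consider "p \<in> S" | t where "t \<in> T" "p = c t" unfolding ins_def I using sub by blast
    then show "p \<in> topspace X"
    proof cases
      case 2
      then have "t \<in> {0..1}" using T(2) by blast
      then show ?thesis using 2 c_top by simp
    qed (use S' in blast)
  qed
  moreover have "finite (ins c \<omega> S)" unfolding ins_def using g(1) S' by simp
  ultimately show ?thesis by (simp add: topspace_uconf)
qed

end

text \<open>The midpoint of the part of the gap between \<open>a\<close> and \<open>b\<close> that lies in the middle third, or the end of the
  gap closest to it. Hence inserting these points changes a configuration in the middle third only, and
  the resulting operators ignore the points near a vertex.\<close>

definition squeeze :: "real \<Rightarrow> real \<Rightarrow> real" where
  "squeeze a b = (max a (min b (1/3)) + max a (min b (2/3))) / 2"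

lemma squeeze_low: "a < b \<Longrightarrow> b \<le> 1/3 \<Longrightarrow> squeeze a b = b"
  and squeeze_high: "a < b \<Longrightarrow> 2/3 \<le> a \<Longrightarrow> squeeze a b = a"
  and squeeze_mid: "a < b \<Longrightarrow> a < 2/3 \<Longrightarrow> 1/3 < b \<Longrightarrow> squeeze a b = (max a (1/3) + min b (2/3)) / 2"
  by (auto simp: squeeze_def max_def min_def)

lemma squeeze_mid_bounds: "a < b \<Longrightarrow> a < 2/3 \<Longrightarrow> 1/3 < b \<Longrightarrow> 1/3 < squeeze a b \<and> squeeze a b < 2/3 \<and> a < squeeze a b \<and> squeeze a b < b"
  by (auto simp: squeeze_def max_def min_def)

lemma squeeze_between: "a \<le> b \<Longrightarrow> a \<le> squeeze a b \<and> squeeze a b \<le> b"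
  by (auto simp: squeeze_def max_def min_def)

lemma squeeze_strict: assumes "a < b" "b \<le> a'" "a' < b'" shows "squeeze a b < squeeze a' b'"
proof (cases "b \<le> 1/3")
  case True
  then show ?thesis using assms squeeze_low[of a b] squeeze_low[of a' b'] squeeze_mid_bounds[of a' b'] squeeze_high[of a' b']
    by (cases "b' \<le> 1/3"; cases "2/3 \<le> a'") auto
next
  case False
  then have "squeeze a b < b"
    using assms squeeze_high[of a b] squeeze_mid_bounds[of a b] by (cases "2/3 \<le> a") auto
  then show ?thesis using squeeze_between[of a' b'] assms by linarith
qed

lemma squeeze_open: assumes "a < b" "0 \<le> a" "b \<le> 1" shows "0 < squeeze a b" "squeeze a b < 1"
proof -
  consider "b \<le> 1/3" | "2/3 \<le> a" | "a < 2/3" "1/3 < b" by linarith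
  then have "0 < squeeze a b \<and> squeeze a b < 1"
    by cases (use assms squeeze_low[of a b] squeeze_high[of a b] squeeze_mid_bounds[of a b] in auto)
  then show "0 < squeeze a b" "squeeze a b < 1" by auto
qed

lemma squeeze_continuous: "continuous_on UNIV (\<lambda>(a, b). squeeze a b)"
  unfolding squeeze_def case_prod_unfold by (intro continuous_intros) auto

text \<open>Below the middle third \<open>squeeze\<close> returns the right end of a gap, above it
  the left end, so every old point there is reproduced exactly. What happens inside depends on the
  old points inside alone. The operator is therefore supported in the middle third.\<close>

lemma squeeze_gaps:
  assumes A: "finite A" "A \<subseteq> {0<..<1}"
  shows "(\<lambda>(a, b). squeeze a b) ` gaps A
     = (A - {1/3<..<2/3}) \<union> (\<lambda>(a, b). squeeze a b) ` gaps (A \<inter> {1/3<..<2/3})" (is "?L = ?R")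
proof
  show "?L \<subseteq> ?R"
  proof
    fix t assume "t \<in> ?L"
    then obtain a b where ab: "(a, b) \<in> gaps A" "t = squeeze a b" by auto
    note g = gaps_D[OF ab(1) A(2)]
    consider "b \<le> 1/3" | "2/3 \<le> a" | "a < 2/3" "1/3 < b" by linarith
    then show "t \<in> ?R"
    proof cases
      case 1 then show ?thesis using squeeze_low[OF g(2)] ab g(7) by simp
    next
      case 2 then show ?thesis using squeeze_high[OF g(2)] ab g(6) by simp
    next
      case 3
      \<comment> \<open>An end outside the middle third is replaced by the end of the arc on its
        side; \<open>squeeze\<close> does not see the change.\<close>
      let ?a = "if 1/3 < a then a else 0" and ?b = "if b < 2/3 then b else 1"
      have "(?a, ?b) \<in> gaps (A \<inter> {1/3<..<2/3})"
        unfolding gaps_def using g 3 by (auto; fastforce)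
      moreover have "squeeze ?a ?b = squeeze a b"
        using g(1-3) 3 by (subst (1 2) squeeze_mid) auto
      ultimately show ?thesis using ab by force
    qed
  qed
  show "?R \<subseteq> ?L"
  proof
    fix t assume "t \<in> ?R"
    then consider "t \<in> A" "t \<le> 1/3" | "t \<in> A" "2/3 \<le> t" | a b where "(a, b) \<in> gaps (A \<inter> {1/3<..<2/3})" "t = squeeze a b"
      by fastforce
    then show "t \<in> ?L"
    proof cases
      case 1
      let ?L = "{s \<in> insert 0 A. s < t}"
      have L: "finite ?L" "0 \<in> ?L" using A 1 by auto
      then have a: "Max ?L \<in> ?L" using Max_in[of ?L] by blast
      have "(Max ?L, t) \<in> gaps A"
      proof -
        have "s \<notin> {Max ?L<..<t}" if "s \<in> A" for s
        proof
          assume s: "s \<in> {Max ?L<..<t}"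
          then have "s \<le> Max ?L" using Max_ge[OF L(1), of s] that by simp
          then show False using s by simp
        qed
        then show ?thesis unfolding gaps_def using a 1 by blast
      qed
      moreover have "squeeze (Max ?L) t = t" using a 1 by (intro squeeze_low) auto
      ultimately show ?thesis by force
    next
      case 2
      then obtain b where b: "(t, b) \<in> gaps A" using gap_from[OF A, of t] by blast
      then show ?thesis using squeeze_high[OF gaps_D(2)[OF b A(2)]] 2 by force
    next
      case 3
      have A': "A \<inter> {1/3<..<2/3} \<subseteq> {0<..<1}" by auto
      note g = gaps_D[OF 3(1) A']
      have ab: "a < 2/3" "1/3 < b" using g(6,7) by force+
      \<comment> \<open>The midpoint of the visible part of the gap. The gap of the full set
        \<open>A\<close> around it has the same visible part.\<close>
      define m where "m = (max a (1/3) + min b (2/3)) / 2"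
      have m: "a < m" "m < b" "1/3 < m" "m < 2/3" using ab g(2) by (auto simp: m_def max_def min_def)
      have "m \<notin> A" using g(8)[of m] m by auto
      then obtain a' b' where ab': "(a', b') \<in> gaps A" "a' < m" "m < b'"
        using gap_around[OF A, of m] m by auto
      note g' = gaps_D[OF ab'(1) A(2)]
      have "max a' (1/3) = max a (1/3)"
      proof (rule antisym)
        have "a' \<le> a" if "1/3 < a'"
          using g(8)[of a'] g'(6) that ab'(2) m by auto
        then show "max a' (1/3) \<le> max a (1/3)" by (auto simp: max_def)
        have "a \<le> a'" if "1/3 < a"
          using g'(8)[of a] g(6) that m ab'(3) by auto
        then show "max a (1/3) \<le> max a' (1/3)" by (auto simp: max_def)
      qed
      moreover have "min b' (2/3) = min b (2/3)"
      proof (rule antisym)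
        have "b \<le> b'" if "b' < 2/3"
          using g(8)[of b'] g'(7) that ab'(3) m by auto
        then show "min b (2/3) \<le> min b' (2/3)" by (cases "b' < 2/3") auto
        have "b' \<le> b" if "b < 2/3"
          using g'(8)[of b] g(7) that m ab'(2) by auto
        then show "min b' (2/3) \<le> min b (2/3)" by (cases "b < 2/3") auto
      qed
      moreover have "a' < 2/3" "1/3 < b'" using ab' m by auto
      ultimately have "squeeze a' b' = squeeze a b"
        using squeeze_mid[OF g(2)] squeeze_mid[OF g'(2)] ab by simp
      then show ?thesis using ab'(1) 3(2) by force
    qed
  qed
qed

text \<open>Both requirements, positions in \<open>T\<close> and positions ordered like the gaps,
  are preserved by convex combinations when \<open>T\<close> is convex. Hence two such rules can be
  joined by straight lines.\<close>

definition spread :: "(real \<Rightarrow> real \<Rightarrow> real) \<Rightarrow> real set \<Rightarrow> real set \<Rightarrow> bool" where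
  "spread \<omega> T A \<longleftrightarrow> (\<forall>(a, b)\<in>gaps A. \<omega> a b \<in> T) \<and>
    (\<forall>(a, b)\<in>gaps A. \<forall>(a', b')\<in>gaps A. b \<le> a' \<longrightarrow> \<omega> a b < \<omega> a' b')"

definition blend :: "(real \<Rightarrow> real \<Rightarrow> real) \<Rightarrow> (real \<Rightarrow> real \<Rightarrow> real) \<Rightarrow> real \<Rightarrow> real \<Rightarrow> real \<Rightarrow> real" where
  "blend \<omega> \<omega>' s a b = (1 - s) * \<omega> a b + s * \<omega>' a b"

definition between :: "(real \<Rightarrow> real \<Rightarrow> real) \<Rightarrow> bool" where
  "between \<omega> \<longleftrightarrow> continuous_on UNIV (\<lambda>(a, b). \<omega> a b) \<and> (\<forall>a b. a \<le> b \<longrightarrow> a \<le> \<omega> a b \<and> \<omega> a b \<le> b)"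

lemma spread_blend:
  assumes T: "convex T" and s: "0 \<le> s" "s \<le> 1" and "spread \<omega> T A" "spread \<omega>' T A"
  shows "spread (blend \<omega> \<omega>' s) T A"
proof -
  have "blend \<omega> \<omega>' s a b \<in> T" if "(a, b) \<in> gaps A" for a b
  proof -
    have "\<omega> a b \<in> T" "\<omega>' a b \<in> T" using assms that by (auto simp: spread_def)
    from convexD[OF T this, of "1 - s" s] show ?thesis using s by (simp add: blend_def)
  qed
  moreover have "blend \<omega> \<omega>' s a b < blend \<omega> \<omega>' s a' b'" if "(a, b) \<in> gaps A" "(a', b') \<in> gaps A" "b \<le> a'" for a b a' b'
  proof -
    have lt: "\<omega> a b < \<omega> a' b'" "\<omega>' a b < \<omega>' a' b'" using assms that by (auto simp: spread_def)
    show ?thesis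
    proof (cases "s = 0")
      case True then show ?thesis using lt by (simp add: blend_def)
    next
      case False
      then have "s * \<omega>' a b < s * \<omega>' a' b'" using lt s by simp
      moreover have "(1 - s) * \<omega> a b \<le> (1 - s) * \<omega> a' b'" using lt s by (intro mult_left_mono) auto
      ultimately show ?thesis by (simp add: blend_def)
    qed
  qed
  ultimately show ?thesis by (auto simp: spread_def)
qed

lemma blend_continuous:
  assumes "between \<omega>" "between \<omega>'" shows "continuous_on UNIV (\<lambda>(s, a, b). blend \<omega> \<omega>' s a b)"
proof -
  have *: "continuous_on UNIV (\<lambda>z :: real \<times> real \<times> real. w (fst (snd z)) (snd (snd z)))" if "between w" for w
  proof -
    have "continuous_on UNIV (\<lambda>q. (\<lambda>(a, b). w a b) (snd q))" for q :: "real \<times> real \<times> real"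
      using that unfolding between_def by (intro continuous_on_compose2[of UNIV "\<lambda>(a, b). w a b" _ snd]) (auto intro: continuous_intros)
    then show ?thesis by (simp add: case_prod_unfold)
  qed
  show ?thesis unfolding blend_def case_prod_unfold
    by (intro continuous_intros * assms)
qed

lemma blend_between:
  assumes "between \<omega>" "between \<omega>'" "0 \<le> s" "s \<le> 1" "a \<le> b" shows "a \<le> blend \<omega> \<omega>' s a b \<and> blend \<omega> \<omega>' s a b \<le> b"
proof -
  have "(1 - s) * a + s * a \<le> (1 - s) * \<omega> a b + s * \<omega>' a b" "(1 - s) * \<omega> a b + s * \<omega>' a b \<le> (1 - s) * b + s * b"
    using assms by (intro add_mono mult_left_mono; auto simp: between_def)+
  then show ?thesis by (simp add: blend_def algebra_simps)
qed

lemma between_squeeze: "between squeeze"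
  using squeeze_continuous squeeze_between by (auto simp: between_def)

lemma between_fst: "between (\<lambda>a b. a)" and between_snd: "between (\<lambda>a b. b)"
  by (auto simp: between_def case_prod_unfold intro: continuous_intros)

lemma between_toward: "between (\<lambda>a b. max a (min b t))"
  unfolding between_def case_prod_unfold by (auto intro!: continuous_intros)

section \<open>The operator of an edge and its homotopies\<close>

context arc
begin

abbreviation "J \<equiv> c ` {1/3<..<2/3}"

text \<open>Linear interpolation between two rules for placing points in gaps. Adding a single point
  of the arc is also such a rule, see \<open>ins_fst\<close>, \<open>ins_snd\<close> and
  \<open>ins_toward\<close>, so this compares the operator with adding a point.\<close>

lemma homotopic_ins:
  assumes T: "inj_on c T" "T \<subseteq> {0..1}" "convex T"
    and cT: "\<And>S t. S \<in> C \<Longrightarrow> S \<in> topspace (uconf k X) \<Longrightarrow> t \<in> T \<Longrightarrow> c t \<notin> S - c ` {0<..<1}"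
    and btw: "between \<omega>" "between \<omega>'"
    and spr: "\<And>S. S \<in> C \<Longrightarrow> S \<in> topspace (uconf k X) \<Longrightarrow> spread \<omega> T (coords c S)"
      "\<And>S. S \<in> C \<Longrightarrow> S \<in> topspace (uconf k X) \<Longrightarrow> spread \<omega>' T (coords c S)"
    and C': "\<And>S \<omega>. S \<in> C \<Longrightarrow> S \<in> topspace (uconf k X) \<Longrightarrow> spread \<omega> T (coords c S) \<Longrightarrow> ins c \<omega> S \<in> C'"
  shows "homotopic_with (\<lambda>_. True) (subtopology (uconf k X) C) (subtopology (uconf (Suc k) X) C') (ins c \<omega>) (ins c \<omega>')"
proof (rule homotopicI[where h="\<lambda>z. ins c (blend \<omega> \<omega>' (fst z)) (snd z)"])
  let ?Z = "prod_topology (top_of_set {0..1::real}) (subtopology (uconf k X) C)"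
  have Z: "0 \<le> fst z" "fst z \<le> 1" "snd z \<in> C" "snd z \<in> topspace (uconf k X)" if "z \<in> topspace ?Z" for z
    using that by auto
  have g: "continuous_map ?Z (uconf k X) snd"
    by (rule continuous_map_into_fulltopology[OF continuous_map_snd])
  have s: "spread (blend \<omega> \<omega>' (fst z)) T (coords c (snd z))" if "z \<in> topspace ?Z" for z
    using Z[OF that] by (intro spread_blend T(3) spr)
  have low: "lowc ?Z X (\<lambda>z. ins c (blend \<omega> \<omega>' (fst z)) (snd z))"
    by (rule ins_lowc[OF g continuous_map_prod_fst _ blend_continuous[OF btw] blend_between[OF btw]]) (use Z in auto)
  have conf: "ins c (blend \<omega> \<omega>' (fst z)) (snd z) \<in> topspace (uconf (Suc k) X)" if z: "z \<in> topspace ?Z" for z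
    by (rule ins_conf[OF Z(4)[OF z] T(1,2)]) (use s[OF z] cT[OF Z(3,4)[OF z]] in \<open>auto simp: spread_def\<close>)
  show "continuous_map ?Z (subtopology (uconf (Suc k) X) C') (\<lambda>z. ins c (blend \<omega> \<omega>' (fst z)) (snd z))"
    unfolding continuous_map_in_subtopology
    using continuous_into_uconf[OF haus low conf] C'[OF Z(3,4) s] by blast
qed (simp_all add: blend_def[abs_def])

lemma fst_gaps: assumes A: "finite A" "A \<subseteq> {0<..<1}" shows "fst ` gaps A = insert 0 A"
proof
  show "fst ` gaps A \<subseteq> insert 0 A" by (auto simp: gaps_def)
  show "insert 0 A \<subseteq> fst ` gaps A"
  proof
    fix a assume "a \<in> insert 0 A"
    then obtain b where "(a, b) \<in> gaps A" using gap_from[OF A] by blast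
    from imageI[OF this, of fst] show "a \<in> fst ` gaps A" by simp
  qed
qed

lemma gap_to:
  assumes A: "finite A" "A \<subseteq> {0<..<1}" and b: "b \<in> insert 1 A" shows "\<exists>a. (a, b) \<in> gaps A"
proof -
  let ?L = "{s \<in> insert 0 A. s < b}"
  have L: "finite ?L" "0 \<in> ?L" using A b by auto
  then have a: "Max ?L \<in> ?L" using Max_in[of ?L] by blast
  have "s \<notin> {Max ?L<..<b}" if "s \<in> A" for s
  proof
    assume s: "s \<in> {Max ?L<..<b}"
    then have "s \<le> Max ?L" using Max_ge[OF L(1), of s] that by simp
    then show False using s by simp
  qed
  then have "(Max ?L, b) \<in> gaps A" unfolding gaps_def using a b by blast
  then show ?thesis by blast
qed

lemma snd_gaps: assumes A: "finite A" "A \<subseteq> {0<..<1}" shows "snd ` gaps A = insert 1 A"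
proof
  show "snd ` gaps A \<subseteq> insert 1 A" by (auto simp: gaps_def)
  show "insert 1 A \<subseteq> snd ` gaps A"
  proof
    fix b assume "b \<in> insert 1 A"
    then obtain a where "(a, b) \<in> gaps A" using gap_to[OF A] by blast
    from imageI[OF this, of snd] show "b \<in> snd ` gaps A" by simp
  qed
qed

text \<open>The left ends of the gaps are the old points on the arc and the parameter 0.\<close>

lemma ins_fst: assumes "finite S" shows "ins c (\<lambda>a b. a) S = insert (c 0) S"
proof -
  have "(\<lambda>(a, b). c a) ` gaps (coords c S) = c ` fst ` gaps (coords c S)" by force
  then show ?thesis unfolding ins_def fst_gaps[OF finite_coords[OF assms] coords_sub] by (auto simp: coords_image)
qed

lemma ins_snd: assumes "finite S" shows "ins c (\<lambda>a b. b) S = insert (c 1) S"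
proof -
  have "snd ` gaps (coords c S) = insert 1 (coords c S)"
    by (rule snd_gaps[OF finite_coords[OF assms] coords_sub])
  moreover have "(\<lambda>(a, b). c b) ` gaps (coords c S) = c ` snd ` gaps (coords c S)" by force
  ultimately show ?thesis unfolding ins_def by (auto simp: coords_image)
qed

text \<open>Every gap contributes its point closest to \<open>t\<close>: the right end for a gap to
  the left of \<open>t\<close>, the left end for a gap to the right, and \<open>t\<close> itself for
  the gap around it.\<close>

lemma ins_toward:
  assumes "finite S" "t \<notin> coords c S" "0 < t" "t < 1"
  shows "ins c (\<lambda>a b. max a (min b t)) S = insert (c t) S"
proof -
  let ?A = "coords c S"
  have f: "finite ?A" by (rule finite_coords[OF assms(1)])
  have "(\<lambda>(a, b). max a (min b t)) ` gaps ?A = insert t ?A"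
  proof
    show "(\<lambda>(a, b). max a (min b t)) ` gaps ?A \<subseteq> insert t ?A"
    proof safe
      fix a b assume ab: "(a, b) \<in> gaps ?A" "max a (min b t) \<notin> ?A"
      note g = gaps_D[OF ab(1) coords_sub]
      show "max a (min b t) = t"
        using ab(2) g(1,2,3,6,7) assms(3,4) by (auto simp: max_def min_def split: if_splits)
    qed
    show "insert t ?A \<subseteq> (\<lambda>(a, b). max a (min b t)) ` gaps ?A"
    proof
      fix s assume "s \<in> insert t ?A"
      then consider "s = t" | "s \<in> ?A" "s < t" | "s \<in> ?A" "t < s" using assms(2) by (cases "s < t") force+
      then obtain a b where "(a, b) \<in> gaps ?A" "max a (min b t) = s"
      proof cases
        case 1
        obtain a b where "(a, b) \<in> gaps ?A" "a < t" "t < b" by (rule gap_around[OF f coords_sub assms(3,4,2)])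
        then show ?thesis using 1 that by (auto simp: max_def min_def)
      next
        case 2
        obtain a where a: "(a, s) \<in> gaps ?A" using gap_to[OF f coords_sub, of s] 2 by blast
        then show ?thesis using gaps_D(2)[OF a coords_sub] 2 that by (auto simp: max_def min_def)
      next
        case 3
        obtain b where b: "(s, b) \<in> gaps ?A" using gap_from[OF f coords_sub, of s] 3 by blast
        then show ?thesis using gaps_D(2)[OF b coords_sub] 3 that by (auto simp: max_def min_def)
      qed
      then show "s \<in> (\<lambda>(a, b). max a (min b t)) ` gaps ?A" by force
    qed
  qed
  moreover have "(\<lambda>(a, b). c (max a (min b t))) ` gaps ?A = c ` (\<lambda>(a, b). max a (min b t)) ` gaps ?A" by force
  ultimately show ?thesis unfolding ins_def by (auto simp: coords_image)
qed

lemma spread_squeeze: assumes "{0<..<1} \<subseteq> T" shows "spread squeeze T (coords c S)"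
proof -
  have "squeeze a b \<in> T" if "(a, b) \<in> gaps (coords c S)" for a b
    using gaps_D[OF that coords_sub] squeeze_open[of a b] assms by auto
  moreover have "squeeze a b < squeeze a' b'" if "(a, b) \<in> gaps (coords c S)" "(a', b') \<in> gaps (coords c S)" "b \<le> a'" for a b a' b'
    using gaps_D[OF that(1) coords_sub] gaps_D[OF that(2) coords_sub] that(3) by (intro squeeze_strict)
  ultimately show ?thesis by (auto simp: spread_def)
qed

definition stab :: "'a set \<Rightarrow> 'a set" where "stab = ins c squeeze"

lemma stab_outside: assumes "finite S" shows "stab S - J = S - J"
  and stab_inside: "stab S \<inter> J = (\<lambda>(a, b). c (squeeze a b)) ` gaps (coords c S \<inter> {1/3<..<2/3})"
proof -
  let ?A = "coords c S" and ?I = "(\<lambda>(a, b). c (squeeze a b)) ` gaps (coords c S \<inter> {1/3<..<2/3})"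
  have f: "finite ?A" by (rule finite_coords[OF assms])
  have m: "(\<lambda>(a, b). c (squeeze a b)) ` G = c ` (\<lambda>(a, b). squeeze a b) ` G" for G by force
  have J: "J \<subseteq> c ` {0<..<1}" by (rule image_mono) auto
  have split: "(S - e) \<union> ((S \<inter> e - K) \<union> I) = (S - K) \<union> I" if "K \<subseteq> e" for e K I :: "'a set"
    using that by blast
  have "stab S = (S - c ` {0<..<1}) \<union> (c ` (?A - {1/3<..<2/3}) \<union> ?I)"
    unfolding stab_def ins_def m squeeze_gaps[OF f coords_sub] by (simp only: image_Un)
  also have "c ` (?A - {1/3<..<2/3}) = S \<inter> c ` {0<..<1} - J"
  proof -
    have "c ` (?A - {1/3<..<2/3}) = c ` ?A - c ` {1/3<..<2/3}"
    proof -
      have "inj_on c (?A \<union> {1/3<..<2/3})" by (rule inj_on_subset[OF inj]) (use coords_sub in auto)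
      then have inj': "inj_on c (?A \<union> {1/3<..<2/3})" .
      show ?thesis by (rule inj_on_image_set_diff[OF inj']) auto
    qed
    then show ?thesis by (simp add: coords_image)
  qed
  also note split[OF J]
  finally have eq: "stab S = (S - J) \<union> ?I" .
  have "?I \<subseteq> J"
  proof -
    have "squeeze a b \<in> {1/3<..<2/3}" if "(a, b) \<in> gaps (?A \<inter> {1/3<..<2/3})" for a b
    proof -
      have "?A \<inter> {1/3<..<2/3} \<subseteq> {0<..<1}" by auto
      note g = gaps_D[OF that this]
      have "a < 2/3" "1/3 < b" using g(6,7) by force+
      then show ?thesis using squeeze_mid_bounds[OF g(2)] by simp
    qed
    then show ?thesis by force
  qed
  moreover have "P = (S - K) \<union> I \<Longrightarrow> I \<subseteq> K \<Longrightarrow> P - K = S - K \<and> P \<inter> K = I" for P K I :: "'a set"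
    by blast
  ultimately show "stab S - J = S - J" "stab S \<inter> J = ?I" using eq by (simp_all only:)
qed

lemma stab_inside_cong: assumes "finite S" "finite S'" "S \<inter> J = S' \<inter> J" shows "stab S \<inter> J = stab S' \<inter> J"
proof -
  have "coords c S \<inter> {1/3<..<2/3} = coords c S' \<inter> {1/3<..<2/3}"
    using assms(3) by (auto simp: coords_def)
  then show ?thesis using stab_inside assms by simp
qed

lemma stab_finite: "finite S \<Longrightarrow> finite (stab S)"
  unfolding stab_def ins_def using card_gaps(1)[OF finite_coords coords_sub] by simp

text \<open>A point outside the middle third is neither moved by the operator nor does it influence
  the result inside. This lets the operators commute with forgetting the point closest to a
  vertex.\<close>

lemma stab_remove: assumes "finite S" "z \<notin> J" shows "stab (S - {z}) = stab S - {z}"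
proof -
  have 1: "stab (S - {z}) \<inter> J = stab S \<inter> J" by (rule stab_inside_cong) (use assms in auto)
  have 2: "stab (S - {z}) - J = stab S - J - {z}"
    unfolding stab_outside[OF assms(1)] stab_outside[OF finite_Diff[OF assms(1)]] by blast
  have 3: "P = Q - {z}" if "P \<inter> K = Q \<inter> K" "P - K = Q - K - {z}" "z \<notin> K" for P Q K :: "'a set"
    using that by blast
  show ?thesis by (rule 3[OF 1 2 assms(2)])
qed

lemma stab_continuous:
  assumes C: "\<And>S. S \<in> C \<Longrightarrow> S \<in> topspace (uconf k X) \<Longrightarrow> stab S \<in> C'"
  shows "continuous_map (subtopology (uconf k X) C) (subtopology (uconf (Suc k) X) C') stab"
proof -
  have "homotopic_with (\<lambda>_. True) (subtopology (uconf k X) C) (subtopology (uconf (Suc k) X) UNIV) (ins c squeeze) (ins c squeeze)"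
    by (rule homotopic_ins[where T="{0<..<1}"]) (auto simp: inj between_squeeze spread_squeeze)
  then have "continuous_map (subtopology (uconf k X) C) (uconf (Suc k) X) stab"
    unfolding stab_def using homotopic_with_imp_continuous_maps by auto
  then show ?thesis using C by (auto simp: continuous_map_in_subtopology)
qed

text \<open>With the end \<open>c 0\<close> unoccupied, new points may be placed anywhere in
  \<open>{0..<1}\<close>. Left ends of gaps and the squeezed positions are both rules of this kind,
  and the first one just adds \<open>c 0\<close>.\<close>

lemma homotopic_stab_0:
  assumes C: "\<And>S. S \<in> C \<Longrightarrow> c 0 \<notin> S" and C': "\<And>S S'. S \<in> C \<Longrightarrow> S \<in> topspace (uconf k X) \<Longrightarrow> S' \<subseteq> S \<union> c ` {0..<1} \<Longrightarrow> S' \<in> C'"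
  shows "homotopic_with (\<lambda>_. True) (subtopology (uconf k X) C) (subtopology (uconf (Suc k) X) C') (insert (c 0)) stab"
proof -
  have T: "inj_on c {0..<1}"
    using inj ends(1) by (auto simp: inj_on_def) (metis greaterThanLessThan_iff image_eqI less_eq_real_def)+
  have "homotopic_with (\<lambda>_. True) (subtopology (uconf k X) C) (subtopology (uconf (Suc k) X) C') (ins c (\<lambda>a b. a)) stab"
    unfolding stab_def
  proof (rule homotopic_ins[OF T])
    fix S assume S: "S \<in> C" "S \<in> topspace (uconf k X)"
    show "c t \<notin> S - c ` {0<..<1}" if "t \<in> {0..<1}" for t
      using C[OF S(1)] that by (cases "t = 0") auto
    have "a \<in> {0..<1}" if "(a, b) \<in> gaps (coords c S)" for a b
      using gaps_D(1,4)[OF that coords_sub] by simp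
    moreover have "a < a'" if "(a, b) \<in> gaps (coords c S)" "b \<le> a'" for a b a'
      using gaps_D(2)[OF that(1) coords_sub] that(2) by simp
    ultimately show "spread (\<lambda>a b. a) {0..<1} (coords c S)" unfolding spread_def by blast
    show "spread squeeze {0..<1} (coords c S)" by (rule spread_squeeze) auto
    show "ins c w S \<in> C'" if "spread w {0..<1} (coords c S)" for w
      by (rule C'[OF S]) (use that in \<open>force simp: ins_def spread_def\<close>)
  qed (auto simp: between_fst between_squeeze)
  then show ?thesis
    by (rule homotopic_with_eq) (auto simp: topspace_uconf ins_fst)
qed

lemma homotopic_stab_1:
  assumes C: "\<And>S. S \<in> C \<Longrightarrow> c 1 \<notin> S" and C': "\<And>S S'. S \<in> C \<Longrightarrow> S \<in> topspace (uconf k X) \<Longrightarrow> S' \<subseteq> S \<union> c ` {0<..1} \<Longrightarrow> S' \<in> C'"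
  shows "homotopic_with (\<lambda>_. True) (subtopology (uconf k X) C) (subtopology (uconf (Suc k) X) C') (insert (c 1)) stab"
proof -
  have T: "inj_on c {0<..1}"
    using inj ends(2) by (auto simp: inj_on_def) (metis greaterThanLessThan_iff image_eqI less_eq_real_def)+
  have "homotopic_with (\<lambda>_. True) (subtopology (uconf k X) C) (subtopology (uconf (Suc k) X) C') (ins c (\<lambda>a b. b)) stab"
    unfolding stab_def
  proof (rule homotopic_ins[OF T])
    fix S assume S: "S \<in> C" "S \<in> topspace (uconf k X)"
    show "c t \<notin> S - c ` {0<..<1}" if "t \<in> {0<..1}" for t
      using C[OF S(1)] that by (cases "t = 1") auto
    have "b \<in> {0<..1}" if "(a, b) \<in> gaps (coords c S)" for a b
      using gaps_D(3,5)[OF that coords_sub] by simp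
    moreover have "b < b'" if "(a', b') \<in> gaps (coords c S)" "b \<le> a'" for b a' b'
      using gaps_D(2)[OF that(1) coords_sub] that(2) by simp
    ultimately show "spread (\<lambda>a b. b) {0<..1} (coords c S)" unfolding spread_def by blast
    show "spread squeeze {0<..1} (coords c S)" by (rule spread_squeeze) auto
    show "ins c w S \<in> C'" if "spread w {0<..1} (coords c S)" for w
      by (rule C'[OF S]) (use that in \<open>force simp: ins_def spread_def\<close>)
  qed (auto simp: between_snd between_squeeze)
  then show ?thesis
    by (rule homotopic_with_eq) (auto simp: topspace_uconf ins_snd)
qed

text \<open>Restricted to a single configuration, because the position \<open>t\<close> must be
  unoccupied. This is enough for 0-simplices, where it shows that any point on an edge can be added
  by the operator of that edge.\<close>

lemma homotopic_stab_point:
  assumes S: "S \<in> topspace (uconf k X)" and t: "0 < t" "t < 1" "c t \<notin> S"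
    and C': "\<And>S'. S' \<subseteq> S \<union> c ` {0<..<1} \<Longrightarrow> S' \<in> C'"
  shows "homotopic_with (\<lambda>_. True) (subtopology (uconf k X) {S}) (subtopology (uconf (Suc k) X) C') (insert (c t)) stab"
proof -
  have "homotopic_with (\<lambda>_. True) (subtopology (uconf k X) {S}) (subtopology (uconf (Suc k) X) C') (ins c (\<lambda>a b. max a (min b t))) stab"
    unfolding stab_def
  proof (rule homotopic_ins[OF inj])
    fix S' assume S': "S' \<in> {S}"
    show "spread squeeze {0<..<1} (coords c S')" by (rule spread_squeeze) auto
    have tA: "t \<notin> coords c S" using t by (simp add: coords_def)
    have "max a (min b t) \<in> {0<..<1}" if "(a, b) \<in> gaps (coords c S)" for a b
      using gaps_D(1-5)[OF that coords_sub] t by (auto simp: max_def min_def)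
    moreover have "max a (min b t) < max a' (min b' t)" if "(a, b) \<in> gaps (coords c S)" "(a', b') \<in> gaps (coords c S)" "b \<le> a'" for a b a' b'
    proof -
      note g = gaps_D[OF that(1) coords_sub] and g' = gaps_D[OF that(2) coords_sub]
      \<comment> \<open>Two gaps could receive the same position only if \<open>t\<close> were their
        common end, which is excluded because \<open>t\<close> is unoccupied.\<close>
      have "b \<noteq> t" using g(7) g'(4) that(3) tA by auto
      then show ?thesis using g(2) g'(2) that(3) by (auto simp: max_def min_def)
    qed
    ultimately show "spread (\<lambda>a b. max a (min b t)) {0<..<1} (coords c S')" using S' by (auto simp: spread_def)
    show "ins c w S' \<in> C'" if "spread w {0<..<1} (coords c S')" for w
    proof -
      have "ins c w S \<subseteq> S \<union> c ` {0<..<1}" using that S' by (force simp: ins_def spread_def)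
      then show ?thesis using C' S' by simp
    qed
  qed (auto simp: between_toward between_squeeze)
  then show ?thesis
    by (rule homotopic_with_eq) (use t in \<open>auto simp: topspace_uconf coords_def ins_toward\<close>)
qed

end

section \<open>Torsion in the homology of unordered configuration spaces\<close>

lemma permuted_iff:
  assumes "x \<in> topspace (ordered_config k X)" "y \<in> topspace (ordered_config k X)"
  shows "perm_orbit k x = perm_orbit k y \<longleftrightarrow> x ` {..<k} = y ` {..<k}"
proof
  have self: "z \<in> perm_orbit k z" for z :: "nat \<Rightarrow> 'a"
    unfolding perm_orbit_def using permutes_id[of "{..<k}"] by (metis (mono_tags, lifting) comp_id mem_Collect_eq)
  assume "perm_orbit k x = perm_orbit k y"
  then obtain \<sigma> where s: "\<sigma> permutes {..<k}" "x = y \<circ> \<sigma>" using self[of x] unfolding perm_orbit_def by blast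
  then show "x ` {..<k} = y ` {..<k}" by (metis image_comp permutes_image)
next
  have x: "inj_on x {..<k}" "\<And>a. a \<notin> {..<k} \<Longrightarrow> x a = undefined" and y: "inj_on y {..<k}" "\<And>a. a \<notin> {..<k} \<Longrightarrow> y a = undefined"
    using assms unfolding topspace_ordered_config by (auto simp: PiE_def extensional_def)
  assume e: "x ` {..<k} = y ` {..<k}"
  have "bij_betw (\<lambda>a. inv_into {..<k} y (x a)) {..<k} {..<k}"
    using bij_betw_trans[of x "{..<k}" "x ` {..<k}" "inv_into {..<k} y" "{..<k}"] x(1) y(1) e
    by (simp add: bij_betw_imageI bij_betw_inv_into o_def)
  define \<sigma> where "\<sigma> a = (if a \<in> {..<k} then inv_into {..<k} y (x a) else a)" for a
  have "bij_betw \<sigma> {..<k} {..<k}"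
    using \<open>bij_betw (\<lambda>a. inv_into {..<k} y (x a)) {..<k} {..<k}\<close> by (rule bij_betw_cong[THEN iffD1, rotated]) (simp add: \<sigma>_def)
  then have \<sigma>: "\<sigma> permutes {..<k}" by (rule bij_imp_permutes) (simp add: \<sigma>_def)
  have xy: "x = y \<circ> \<sigma>"
  proof
    fix a show "x a = (y \<circ> \<sigma>) a"
    proof (cases "a \<in> {..<k}")
      case True
      then have "x a \<in> y ` {..<k}" using e by blast
      then show ?thesis using True by (simp add: \<sigma>_def f_inv_into_f)
    next
      case False
      then show ?thesis using x(2) y(2) by (simp add: \<sigma>_def)
    qed
  qed
  have "perm_orbit k (y \<circ> \<sigma>) \<subseteq> perm_orbit k y" if "\<sigma> permutes {..<k}" for \<sigma> and y :: "nat \<Rightarrow> 'a"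
  proof
    fix z assume "z \<in> perm_orbit k (y \<circ> \<sigma>)"
    then obtain \<tau> where "\<tau> permutes {..<k}" "z = y \<circ> (\<sigma> \<circ> \<tau>)" unfolding perm_orbit_def by (auto simp: o_assoc)
    then show "z \<in> perm_orbit k y" unfolding perm_orbit_def using permutes_compose[OF _ that] by blast
  qed
  from this[OF \<sigma>, of y] this[OF permutes_inv[OF \<sigma>], of x] show "perm_orbit k x = perm_orbit k y"
    unfolding xy using permutes_inv_o[OF \<sigma>] by (simp add: o_assoc[symmetric] subset_antisym)
qed

text \<open>Both spaces are quotients of \<open>ordered_config\<close>, and two orderings have the
  same orbit iff they have the same image.\<close>

lemma homeomorphic_uconf: "unordered_config k X homeomorphic_space uconf k X"
proof -
  let ?f = "\<lambda>O'. (\<Union>x\<in>O'. x ` {..<k})"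
  have f: "?f (perm_orbit k x) = x ` {..<k}" for x :: "nat \<Rightarrow> 'a"
  proof -
    have "(x \<circ> \<sigma>) ` {..<k} = x ` {..<k}" if "\<sigma> permutes {..<k}" for \<sigma>
      using that by (metis image_comp permutes_image)
    moreover have "x \<in> perm_orbit k x" unfolding perm_orbit_def using permutes_id[of "{..<k}"] by (metis (mono_tags, lifting) comp_id mem_Collect_eq)
    ultimately show ?thesis unfolding perm_orbit_def by blast
  qed
  note q = quotient_map_quotient_topology[of "ordered_config k X" "perm_orbit k", folded unordered_config_def]
  have qf: "quotient_map (ordered_config k X) (uconf k X) (?f \<circ> perm_orbit k)"
    using quotient_uconf[of k X] by (rule quotient_map_eq) (simp add: f)
  have "continuous_map (unordered_config k X) (uconf k X) ?f"
    using continuous_compose_quotient_map_eq[OF q, of "uconf k X" ?f] quotient_imp_continuous_map[OF qf] by blast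
  then have "quotient_map (unordered_config k X) (uconf k X) ?f"
    using quotient_map_from_composition[OF quotient_imp_continuous_map[OF q] _ qf] by blast
  moreover have "inj_on ?f (topspace (unordered_config k X))"
  proof (rule inj_onI)
    fix O1 O2 assume O: "O1 \<in> topspace (unordered_config k X)" "O2 \<in> topspace (unordered_config k X)" "?f O1 = ?f O2"
    obtain x y where xy: "x \<in> topspace (ordered_config k X)" "O1 = perm_orbit k x" "y \<in> topspace (ordered_config k X)" "O2 = perm_orbit k y"
      using O(1,2) unfolding unordered_config_def topspace_quotient_topology by blast
    then show "O1 = O2" using O(3) permuted_iff[OF xy(1,3)] f by metis
  qed
  ultimately show ?thesis by (metis homeomorphic_map_def homeomorphic_map_imp_homeomorphic_space)
qed

lemma torsion_part_eq:
  assumes "group G" "prime p" shows "torsion_part p G = {x \<in> carrier G. \<exists>n. x [^]\<^bsub>G\<^esub> (p ^ n :: nat) = \<one>\<^bsub>G\<^esub>}"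
proof -
  have "(\<exists>n. group.ord G x = p ^ n) \<longleftrightarrow> (\<exists>n. x [^]\<^bsub>G\<^esub> (p ^ n :: nat) = \<one>\<^bsub>G\<^esub>)" if "x \<in> carrier G" for x
    unfolding group.pow_eq_id[OF assms(1) that] using divides_primepow_nat[OF assms(2)] by (metis dvd_refl)
  then show ?thesis unfolding torsion_part_def by blast
qed

lemma torsion_part_iso:
  assumes "group G" "group G'" "G \<cong> G'" "prime p"
  shows "card (torsion_part p G) = card (torsion_part p G')"
proof -
  obtain f where f: "f \<in> iso G G'" using assms(3) by (auto simp: is_iso_def)
  then have h: "group_hom G G' f" using assms by (auto simp: group_hom_def group_hom_axioms_def iso_def)
  have b: "bij_betw f (carrier G) (carrier G')" using f by (simp add: iso_def)
  have one: "f x = \<one>\<^bsub>G'\<^esub> \<longleftrightarrow> x = \<one>\<^bsub>G\<^esub>" if "x \<in> carrier G" for x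
  proof -
    have "f \<one>\<^bsub>G\<^esub> = \<one>\<^bsub>G'\<^esub>" using group_hom.hom_one[OF h] .
    then show ?thesis using that inj_onD[OF bij_betw_imp_inj_on[OF b], of x "\<one>\<^bsub>G\<^esub>"] group.is_monoid[OF assms(1)] monoid.one_closed by metis
  qed
  have iff: "f x \<in> torsion_part p G' \<longleftrightarrow> x \<in> torsion_part p G" if x: "x \<in> carrier G" for x
  proof -
    have "f x [^]\<^bsub>G'\<^esub> (m::nat) = \<one>\<^bsub>G'\<^esub> \<longleftrightarrow> x [^]\<^bsub>G\<^esub> m = \<one>\<^bsub>G\<^esub>" for m
      using group_hom.hom_nat_pow[OF h x, of m] one[of "x [^]\<^bsub>G\<^esub> m"] x monoid.nat_pow_closed[OF group.is_monoid[OF assms(1)] x, of m] by simp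
    moreover have "f x \<in> carrier G'" using b x by (auto simp: bij_betw_def)
    ultimately show ?thesis using x unfolding torsion_part_eq[OF assms(1,4)] torsion_part_eq[OF assms(2,4)] by simp
  qed
  have sub: "torsion_part p G \<subseteq> carrier G" "torsion_part p G' \<subseteq> carrier G'" by (auto simp: torsion_part_def)
  have "f ` torsion_part p G = torsion_part p G'"
  proof
    show "f ` torsion_part p G \<subseteq> torsion_part p G'" using iff sub by blast
    show "torsion_part p G' \<subseteq> f ` torsion_part p G"
    proof
      fix y assume y: "y \<in> torsion_part p G'"
      then obtain x where "x \<in> carrier G" "y = f x" using b sub(2) by (auto simp: bij_betw_def)
      then show "y \<in> f ` torsion_part p G" using iff y by blast
    qed
  qed
  then show ?thesis using card_image[of f "torsion_part p G"] inj_on_subset[OF bij_betw_imp_inj_on[OF b] sub(1)] by simp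
qed

lemma pow_relcycle_group: "c [^]\<^bsub>relcycle_group n X S\<^esub> (m::nat) = frag_cmul (int m) c"
  by (induction m) (simp_all add: frag_cmul_distrib add.commute)

definition pcyc :: "nat \<Rightarrow> nat \<Rightarrow> (nat \<Rightarrow> 's topology) \<Rightarrow> 's set \<Rightarrow> nat \<Rightarrow> 's chain set" where
  "pcyc p n X A k = {x \<in> cyc n X A k. \<exists>m. frag_cmul (int p ^ m) x \<in> bdy n X A k}"

lemma card_torsion_homology:
  fixes X :: "nat \<Rightarrow> 's topology"
  assumes p: "prime p"
  shows "card (torsion_part p (homology_group (int n) (X k))) = card (quo (pcyc p n X UNIV k) (bdy n X UNIV k))"
proof -
  let ?R = "relcycle_group n (X k) {}" and ?B = "singular_relboundary_set n (X k) {}"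
  let ?G = "homology_group (int n) (X k)"
  let ?h = "homologous_rel_set n (X k) {}"
  have h: "?h \<in> hom ?R ?G"
    using normal.r_coset_hom_Mod[OF normal_subgroup_singular_relboundary_relcycle[of n "X k" "{}"]]
    unfolding right_coset_singular_relboundary nontrivial_relative_homology_group .
  then have gh: "group_hom ?R ?G ?h" by (simp add: group_hom_def group_hom_axioms_def)
  have one: "?h c = \<one>\<^bsub>?G\<^esub> \<longleftrightarrow> singular_relboundary n (X k) {} c" for c
  proof -
    have "?h 0 = \<one>\<^bsub>?G\<^esub>" using group_hom.hom_one[OF gh] by simp
    then have "?h c = \<one>\<^bsub>?G\<^esub> \<longleftrightarrow> ?h c = ?h 0" by simp
    also have "\<dots> \<longleftrightarrow> homologous_rel n (X k) {} c 0" by (simp add: homologous_rel_set_eq)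
    finally show ?thesis by (simp add: homologous_rel_def)
  qed
  have pw: "?h c [^]\<^bsub>?G\<^esub> (p ^ m) = \<one>\<^bsub>?G\<^esub> \<longleftrightarrow> frag_cmul (int p ^ m) c \<in> bdy n X UNIV k"
    if "singular_relcycle n (X k) {} c" for c m
    using group_hom.hom_nat_pow[OF gh, of c "p ^ m"] that one[of "frag_cmul (int p ^ m) c"]
    by (simp add: pow_relcycle_group bdy_def)
  have "torsion_part p ?G = ?h ` pcyc p n X UNIV k"
    unfolding torsion_part_eq[OF group_relative_homology_group p] carrier_relative_homology_group pcyc_def cyc_def
    using pw by auto
  moreover have "\<exists>f. bij_betw f (?h ` pcyc p n X UNIV k) (adcoset (bdy n X UNIV k) ` pcyc p n X UNIV k)"
  proof (rule card_image_cong_kernel)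
    fix x y
    have as: "asub (bdy n X UNIV k)" unfolding bdy_def by (rule asub_relboundary)
    show "?h x = ?h y \<longleftrightarrow> adcoset (bdy n X UNIV k) x = adcoset (bdy n X UNIV k) y"
      unfolding adcoset_eq_iff[OF as] homologous_rel_set_eq by (simp add: homologous_rel_def bdy_def)
  qed
  ultimately show ?thesis unfolding quo_def using bij_betw_same_card by metis
qed

lemma card_torsion_unordered_config:
  assumes "prime p"
  shows "card (torsion_part p (homology_group (int n) (unordered_config k X)))
    = card (quo (pcyc p n (\<lambda>k. uconf k X) UNIV k) (bdy n (\<lambda>k. uconf k X) UNIV k))"
  using card_torsion_homology[OF assms, of n "\<lambda>k. uconf k X" k]
  by (subst torsion_part_iso[OF group_relative_homology_group group_relative_homology_group
        homeomorphic_space_imp_isomorphic_homology_groups[OF homeomorphic_uconf] assms])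

section \<open>Configurations on a graph\<close>

text \<open>A graph with chosen characteristic maps. Injectivity on the open interval stands for an
  embedding: openness of the edges is derived from compactness in \<open>open_edge\<close>. This
  keeps the conditions on the glued edge in \<open>merge\<close> short.\<close>

locale cw =
  fixes \<Gamma> :: "'a topology" and V :: "'a set" and E :: "'a set set" and c :: "'a set \<Rightarrow> real \<Rightarrow> 'a"
  assumes haus: "Hausdorff_space \<Gamma>" and finV: "finite V" and finE: "finite E" and VT: "V \<subseteq> topspace \<Gamma>"
    and EU: "\<Union>E = topspace \<Gamma> - V" and disj: "\<And>e e'. e \<in> E \<Longrightarrow> e' \<in> E \<Longrightarrow> e \<noteq> e' \<Longrightarrow> e \<inter> e' = {}"
    and cont: "\<And>e. e \<in> E \<Longrightarrow> continuous_map (top_of_set {0..1}) \<Gamma> (c e)"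
    and c0: "\<And>e. e \<in> E \<Longrightarrow> c e 0 \<in> V" and c1: "\<And>e. e \<in> E \<Longrightarrow> c e 1 \<in> V"
    and inj: "\<And>e. e \<in> E \<Longrightarrow> inj_on (c e) {0<..<1}" and im: "\<And>e. e \<in> E \<Longrightarrow> c e ` {0<..<1} = e"
begin

lemma c_in: "e \<in> E \<Longrightarrow> 0 < t \<Longrightarrow> t < 1 \<Longrightarrow> c e t \<in> e"
  using im[of e] by force

lemma edge_V: "e \<in> E \<Longrightarrow> e \<inter> V = {}"
  using EU by blast

lemma c_notV: "e \<in> E \<Longrightarrow> 0 < t \<Longrightarrow> t < 1 \<Longrightarrow> c e t \<notin> V"
  using c_in edge_V by blast

lemma c_top: "e \<in> E \<Longrightarrow> 0 \<le> t \<Longrightarrow> t \<le> 1 \<Longrightarrow> c e t \<in> topspace \<Gamma>"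
  using continuous_map_image_subset_topspace[OF cont, of e] by (metis atLeastAtMost_iff image_subset_iff topspace_euclidean_subtopology)

lemma c_V_iff: "e \<in> E \<Longrightarrow> 0 \<le> t \<Longrightarrow> t \<le> 1 \<Longrightarrow> c e t \<in> V \<longleftrightarrow> t = 0 \<or> t = 1"
  using c_notV[of e t] c0 c1 by force

lemma c_eq: assumes "e \<in> E" "e' \<in> E" "0 < t" "t < 1" "0 \<le> s" "s \<le> 1" "c e t = c e' s" shows "e = e' \<and> t = s"
proof -
  have "c e' s \<notin> V" using c_notV[OF assms(1,3,4)] assms(7) by simp
  then have s: "0 < s" "s < 1" using c_V_iff[OF assms(2,5,6)] assms(5,6) by auto
  have "e = e'" using c_in[OF assms(1,3,4)] c_in[OF assms(2) s] assms(7) disj[OF assms(1,2)] by auto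
  then show ?thesis using inj_onD[OF inj[OF assms(1)], of t s] assms s by auto
qed

lemma point_cases:
  assumes "p \<in> topspace \<Gamma>" obtains "p \<in> V" | e t where "e \<in> E" "0 < t" "t < 1" "p = c e t"
proof (cases "p \<in> V")
  case False
  then obtain e where e: "e \<in> E" "p \<in> e" using EU assms by blast
  then have "p \<in> c e ` {0<..<1}" using im by blast
  then show ?thesis using that(2) e by auto
qed (rule that(1))

text \<open>This is the weak topology: closed parts of the finitely many edges have compact images,
  which are closed in a Hausdorff space, and the remaining vertices are finite in number.\<close>

lemma closed_by_edges:
  assumes S: "S \<subseteq> topspace \<Gamma>" and cl: "\<And>e. e \<in> E \<Longrightarrow> closed {t \<in> {0..1}. c e t \<in> S}"
  shows "closedin \<Gamma> S"
proof -
  have "S = (S \<inter> V) \<union> (\<Union>e\<in>E. c e ` {t \<in> {0..1}. c e t \<in> S})" (is "_ = ?R")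
  proof
    show "S \<subseteq> ?R"
    proof
      fix p assume p: "p \<in> S"
      from S p have "p \<in> topspace \<Gamma>" by blast
      then show "p \<in> ?R" by (cases rule: point_cases) (use p in force)+
    qed
  qed auto
  moreover have "closedin \<Gamma> (S \<inter> V)"
    using finV VT by (intro closedin_Hausdorff_finite[OF haus]) auto
  moreover have "closedin \<Gamma> (\<Union>e\<in>E. c e ` {t \<in> {0..1}. c e t \<in> S})"
  proof (rule closedin_Union)
    fix K assume "K \<in> (\<lambda>e. c e ` {t \<in> {0..1}. c e t \<in> S}) ` E"
    then obtain e where e: "e \<in> E" "K = c e ` {t \<in> {0..1}. c e t \<in> S}" by blast
    have "compact ({0..1} \<inter> {t \<in> {0..1}. c e t \<in> S})"
      by (rule compact_Int_closed[OF compact_Icc cl[OF e(1)]])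
    moreover have "{0..1} \<inter> {t \<in> {0..1}. c e t \<in> S} = {t \<in> {0..1}. c e t \<in> S}" by blast
    ultimately have "compact {t \<in> {0..1}. c e t \<in> S}" by (simp only:)
    then have "compactin (top_of_set {0..1}) {t \<in> {0..1}. c e t \<in> S}" by (auto simp: compactin_subtopology)
    then show "closedin \<Gamma> K" unfolding e(2) using image_compactin[OF _ cont[OF e(1)]] compactin_imp_closedin[OF haus] by blast
  qed (use finE in auto)
  ultimately show ?thesis using closedin_Un[of \<Gamma> "S \<inter> V" "\<Union>e\<in>E. c e ` {t \<in> {0..1}. c e t \<in> S}"] by (simp only:)
qed

lemma continuous_by_edges:
  fixes f :: "'a \<Rightarrow> real"
  assumes "\<And>e. e \<in> E \<Longrightarrow> continuous_on {0..1} (\<lambda>t. f (c e t))" shows "continuous_map \<Gamma> euclideanreal f"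
  unfolding continuous_map_closedin
proof (intro conjI ballI allI impI)
  fix C :: "real set" assume C: "closedin euclideanreal C"
  show "closedin \<Gamma> {x \<in> topspace \<Gamma>. f x \<in> C}"
  proof (rule closed_by_edges)
    fix e assume e: "e \<in> E"
    have "{t \<in> {0..1}. c e t \<in> {x \<in> topspace \<Gamma>. f x \<in> C}} = {0..1} \<inter> (\<lambda>t. f (c e t)) -` C"
      using c_top[OF e] by auto
    then show "closed {t \<in> {0..1}. c e t \<in> {x \<in> topspace \<Gamma>. f x \<in> C}}"
      using continuous_closed_preimage[OF assms[OF e] closed_atLeastAtMost] C by simp
  qed auto
qed auto

lemma open_edge: assumes "e \<in> E" shows "openin \<Gamma> e"
proof -
  have "closedin \<Gamma> (topspace \<Gamma> - e)"
  proof (rule closed_by_edges)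
    fix e' assume e': "e' \<in> E"
    have "{t \<in> {0..1}. c e' t \<in> topspace \<Gamma> - e} = (if e' = e then {0, 1} else {0..1})"
    proof -
      have "c e' t \<in> topspace \<Gamma> - e \<longleftrightarrow> e' \<noteq> e \<or> t = 0 \<or> t = 1" if t: "0 \<le> t" "t \<le> 1" for t
      proof (cases "t = 0 \<or> t = 1")
        case True
        then have "c e' t \<in> V" using c0 c1 e' by auto
        then show ?thesis using True edge_V[OF assms] VT by blast
      next
        case False
        then have "c e' t \<in> e'" using t by (intro c_in[OF e']) auto
        then show ?thesis using False disj[OF assms e'] c_top[OF e' t] by auto
      qed
      then have "t \<in> {t \<in> {0..1}. c e' t \<in> topspace \<Gamma> - e} \<longleftrightarrow> t \<in> (if e' = e then {0, 1} else {0..1})" for t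
        by (cases "0 \<le> t \<and> t \<le> 1") auto
      then show ?thesis by blast
    qed
    then show "closed {t \<in> {0..1}. c e' t \<in> topspace \<Gamma> - e}" by simp
  qed auto
  moreover have "e \<subseteq> topspace \<Gamma>" using EU assms by blast
  ultimately show ?thesis by (simp add: openin_closedin_eq)
qed

lemma arc: assumes "e \<in> E" shows "arc \<Gamma> (c e)"
proof
  show "c e 0 \<notin> c e ` {0<..<1}" "c e 1 \<notin> c e ` {0<..<1}"
    unfolding im[OF assms] using c0[OF assms] c1[OF assms] edge_V[OF assms] by auto
  show "openin \<Gamma> (c e ` {0<..<1})" unfolding im[OF assms] by (rule open_edge[OF assms])
qed (use haus cont inj assms in auto)

lemma open_minus: "W \<subseteq> V \<Longrightarrow> openin \<Gamma> (topspace \<Gamma> - W)"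
  using finite_subset[OF _ finV, of W] VT by (intro openin_diff closedin_Hausdorff_finite[OF haus]) auto

section \<open>Half-edges and the distance from a vertex\<close>

definition crd :: "'a \<Rightarrow> 'a set \<times> real" where
  "crd p = (THE (e, t). e \<in> E \<and> 0 < t \<and> t < 1 \<and> p = c e t)"

lemma crd: assumes "e \<in> E" "0 < t" "t < 1" shows "crd (c e t) = (e, t)"
  unfolding crd_def
proof (rule the_equality)
  show "(case (e, t) of (e', s) \<Rightarrow> e' \<in> E \<and> 0 < s \<and> s < 1 \<and> c e t = c e' s)" using assms by simp
  show "q = (e, t)" if "case q of (e', s) \<Rightarrow> e' \<in> E \<and> 0 < s \<and> s < 1 \<and> c e t = c e' s" for q
  proof (cases q)
    case (Pair e' s)
    then have "e' \<in> E" "0 < s" "s < 1" "c e t = c e' s" using that by auto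
    then show ?thesis using c_eq[OF assms(1) \<open>e' \<in> E\<close> assms(2,3), of s] Pair by simp
  qed
qed

definition hc :: "'a set \<times> bool \<Rightarrow> real \<Rightarrow> 'a" where
  "hc h t = c (fst h) (if snd h then 1 - t else t)"

text \<open>The Boolean tells from which end the edge is traversed, so a loop has two halves at its
  vertex.\<close>

definition halves :: "'a \<Rightarrow> ('a set \<times> bool) set" where
  "halves v = {h \<in> E \<times> UNIV. hc h 0 = v}"

definition edges_at :: "'a \<Rightarrow> 'a set set" where
  "edges_at v = {e \<in> E. c e 0 = v \<or> c e 1 = v}"

lemma halvesI: "h \<in> halves v \<Longrightarrow> fst h \<in> E" "h \<in> halves v \<Longrightarrow> hc h 0 = v"
  by (auto simp: halves_def)

lemma finite_halves: "finite (halves v)"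
  unfolding halves_def by (rule finite_subset[of _ "E \<times> UNIV"]) (use finE in auto)

lemma edges_at_halves: "edges_at v = fst ` halves v"
proof
  show "edges_at v \<subseteq> fst ` halves v"
  proof
    fix e assume "e \<in> edges_at v"
    then have "(e, False) \<in> halves v \<or> (e, True) \<in> halves v" by (auto simp: edges_at_def halves_def hc_def)
    then show "e \<in> fst ` halves v" by force
  qed
qed (auto simp: edges_at_def halves_def hc_def)

text \<open>The distance along the edges at \<open>v\<close>, cut off at 1/3. The cut-off makes it
  constant on the middle thirds, where the operators act, and on all other vertices, while the two
  halves of a loop stay apart.\<close>

definition dst :: "'a \<Rightarrow> 'a \<Rightarrow> real" where
  "dst v p = (if p \<in> V then if p = v then 0 else 1/3 else
     (case crd p of (e, t) \<Rightarrow> min (1/3) (min (if c e 0 = v then t else 1/3) (if c e 1 = v then 1 - t else 1/3))))"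

lemma dst_c: assumes "e \<in> E" "0 \<le> t" "t \<le> 1"
  shows "dst v (c e t) = min (1/3) (min (if c e 0 = v then t else 1/3) (if c e 1 = v then 1 - t else 1/3))"
proof -
  consider "t = 0" | "t = 1" | "0 < t" "t < 1" using assms by linarith
  then show ?thesis
  proof cases
    case 3 then show ?thesis using assms c_notV[of e t] crd[of e t] by (simp add: dst_def)
  qed (use assms c0[of e] c1[of e] in \<open>auto simp: dst_def\<close>)
qed

lemma dst_continuous: "continuous_map \<Gamma> euclideanreal (dst v)"
proof (rule continuous_by_edges)
  fix e assume e: "e \<in> E"
  have "continuous_on {0..1} (\<lambda>t::real. min (1/3) (min (if c e 0 = v then t else 1/3) (if c e 1 = v then 1 - t else 1/3)))"
    by (cases "c e 0 = v"; cases "c e 1 = v") (auto intro!: continuous_intros)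
  then show "continuous_on {0..1} (\<lambda>t. dst v (c e t))"
    by (rule continuous_on_eq) (simp add: dst_c[OF e])
qed

lemma dst_self: "v \<in> V \<Longrightarrow> dst v v = 0"
  by (simp add: dst_def)

lemma dst_pos: assumes "p \<in> topspace \<Gamma>" "p \<noteq> v" shows "0 < dst v p"
  using assms(1)
proof (cases rule: point_cases)
  case (2 e t) then show ?thesis using dst_c[of e t v] by auto
qed (use assms in \<open>simp add: dst_def\<close>)

lemma dst_mid: assumes "e \<in> E" "1/3 \<le> t" "t \<le> 2/3" shows "dst v (c e t) = 1/3"
  using assms dst_c[of e t v] by auto

lemma dst_hc: assumes h: "h \<in> halves v" and t: "0 \<le> t" "t \<le> 1/3" shows "dst v (hc h t) = t"
proof -
  obtain e b where hb: "h = (e, b)" by force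
  have e: "e \<in> E" using h hb by (auto simp: halves_def)
  have v: "(if b then c e 1 else c e 0) = v" using h hb by (auto simp: halves_def hc_def)
  show ?thesis unfolding hb hc_def using dst_c[OF e, of "if b then 1 - t else t" v] v t by (cases b) auto
qed

lemma hc_inj: assumes h: "h \<in> halves v" "h' \<in> halves v" and t: "0 < t" "t < 1/2" "0 \<le> s" "s < 1/2" and eq: "hc h t = hc h' s"
  shows "h = h' \<and> t = s"
proof -
  obtain e b e' b' where hb: "h = (e, b)" "h' = (e', b')" by force
  have "e \<in> E" "e' \<in> E" using h hb by (auto simp: halves_def)
  from c_eq[OF this, of "if b then 1 - t else t" "if b' then 1 - s else s"] show ?thesis
    using eq t hb by (cases b; cases b') (auto simp: hc_def)
qed

lemma hc_in: "h \<in> halves v \<Longrightarrow> 0 < t \<Longrightarrow> t < 1 \<Longrightarrow> hc h t \<in> fst h"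
  using c_in[of "fst h" "if snd h then 1 - t else t"] by (auto simp: hc_def halves_def)

lemma hc_top: "h \<in> halves v \<Longrightarrow> 0 \<le> t \<Longrightarrow> t \<le> 1 \<Longrightarrow> hc h t \<in> topspace \<Gamma>"
  using c_top[of "fst h" "if snd h then 1 - t else t"] by (auto simp: hc_def halves_def)

lemma hc_cont: assumes "h \<in> halves v" shows "continuous_map (top_of_set {0..1}) \<Gamma> (hc h)"
proof -
  have "continuous_map (top_of_set {0..1}) (top_of_set {0..1}) (\<lambda>t::real. if snd h then 1 - t else t)"
    by (cases "snd h") (auto simp: continuous_map_in_subtopology intro!: continuous_intros)
  from continuous_map_compose[OF this cont[OF halvesI(1)[OF assms]]] show ?thesis
    by (simp add: hc_def[abs_def] o_def)
qed

lemma hc_image: "hc h ` A = c (fst h) ` (if snd h then (\<lambda>t. 1 - t) ` A else A)"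
  by (auto simp: hc_def image_image)

lemma hc_closed: assumes "h \<in> halves v" "0 \<le> a" "b \<le> 1" shows "closedin \<Gamma> (hc h ` {a..b})"
proof -
  have "compactin (top_of_set {0..1}) {a..b}" using assms by (auto simp: compactin_subtopology)
  then show ?thesis using image_compactin[OF _ hc_cont[OF assms(1)]] compactin_imp_closedin[OF haus] by blast
qed

lemma hc_open: assumes "h \<in> halves v" "0 \<le> a" "b \<le> 1" shows "openin \<Gamma> (hc h ` {a<..<b})"
proof -
  have e: "fst h \<in> E" using assms by (auto simp: halves_def)
  have "(\<lambda>t. 1 - t) ` {a<..<b} = {1 - b<..<1 - a}" for a b :: real by (auto simp: image_iff intro!: bexI[of _ "1 - _"])
  then show ?thesis unfolding hc_image using arc.open_image[OF arc[OF e]] assms by auto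
qed

lemma dst_star: assumes v: "v \<in> V" shows "{p \<in> topspace \<Gamma>. dst v p < 1/3} = insert v (\<Union>h\<in>halves v. hc h ` {0..<1/3})"
proof
  show "{p \<in> topspace \<Gamma>. dst v p < 1/3} \<subseteq> insert v (\<Union>h\<in>halves v. hc h ` {0..<1/3})"
  proof (rule ccontr)
    assume "\<not> ?thesis"
    then obtain p where p: "p \<in> topspace \<Gamma>" "dst v p < 1/3" "p \<notin> (\<Union>h\<in>halves v. hc h ` {0..<1/3})" "p \<noteq> v" by blast
    from p(1) show False
    proof (cases rule: point_cases)
      case 1 then show ?thesis using p by (auto simp: dst_def split: if_splits)
    next
      case (2 e t)
      have no: "hc h s \<noteq> p" if "h \<in> halves v" "0 \<le> s" "s < 1/3" for h s using p(3) that by force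
      have "c e 0 = v \<and> t < 1/3 \<or> c e 1 = v \<and> 1 - t < 1/3"
        using p(2) 2 dst_c[of e t v] by (auto split: if_splits)
      then show ?thesis
      proof
        assume a: "c e 0 = v \<and> t < 1/3"
        then have "(e, False) \<in> halves v" using 2 by (auto simp: halves_def hc_def)
        from no[OF this, of t] show ?thesis using a 2 by (simp add: hc_def)
      next
        assume a: "c e 1 = v \<and> 1 - t < 1/3"
        then have "(e, True) \<in> halves v" using 2 by (auto simp: halves_def hc_def)
        from no[OF this, of "1 - t"] show ?thesis using a 2 by (simp add: hc_def)
      qed
    qed
  qed
  show "insert v (\<Union>h\<in>halves v. hc h ` {0..<1/3}) \<subseteq> {p \<in> topspace \<Gamma>. dst v p < 1/3}"
  proof
    fix p assume "p \<in> insert v (\<Union>h\<in>halves v. hc h ` {0..<1/3})"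
    then consider "p = v" | h t where "h \<in> halves v" "0 \<le> t" "t < 1/3" "p = hc h t" by auto
    then show "p \<in> {p \<in> topspace \<Gamma>. dst v p < 1/3}"
    proof cases
      case 1 then show ?thesis using v VT by (simp add: dst_self subset_iff)
    next
      case 2 then show ?thesis using dst_hc[of h v t] hc_top[of h v t] by simp
    qed
  qed
qed

end

text \<open>A map is supported in \<open>J\<close> if it changes nothing outside and its result
  inside depends on the inside alone. Two maps with disjoint supports then agree in either order on
  \<open>J\<close>, on \<open>K\<close> and elsewhere.\<close>

lemma supported_commute:
  fixes f g :: "'a set \<Rightarrow> 'a set"
  assumes f: "\<And>S. finite S \<Longrightarrow> f S - J = S - J" "\<And>S S'. finite S \<Longrightarrow> finite S' \<Longrightarrow> S \<inter> J = S' \<inter> J \<Longrightarrow> f S \<inter> J = f S' \<inter> J"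
    and g: "\<And>S. finite S \<Longrightarrow> g S - K = S - K" "\<And>S S'. finite S \<Longrightarrow> finite S' \<Longrightarrow> S \<inter> K = S' \<inter> K \<Longrightarrow> g S \<inter> K = g S' \<inter> K"
    and fin: "\<And>S. finite S \<Longrightarrow> finite (f S)" "\<And>S. finite S \<Longrightarrow> finite (g S)" and JK: "J \<inter> K = {}" and S: "finite S"
  shows "f (g S) = g (f S)"
proof -
  have gJ: "g T \<inter> J = T \<inter> J" if "finite T" for T using g(1)[OF that] JK by blast
  have fK: "f T \<inter> K = T \<inter> K" if "finite T" for T using f(1)[OF that] JK by blast
  have "f (g S) \<inter> J = f S \<inter> J" by (rule f(2)[OF fin(2)[OF S] S gJ[OF S]])
  moreover have "g (f S) \<inter> J = f S \<inter> J" by (rule gJ[OF fin(1)[OF S]])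
  moreover have "g (f S) \<inter> K = g S \<inter> K" by (rule g(2)[OF fin(1)[OF S] S fK[OF S]])
  moreover have "f (g S) \<inter> K = g S \<inter> K" by (rule fK[OF fin(2)[OF S]])
  moreover have "f (g S) - J - K = S - J - K" using f(1)[OF fin(2)[OF S]] g(1)[OF S] by blast
  moreover have "g (f S) - J - K = S - J - K" using g(1)[OF fin(1)[OF S]] f(1)[OF S] by blast
  ultimately show ?thesis by blast
qed

lemma (in arc) stab_sub: "stab S \<subseteq> S \<union> c ` {0<..<1}"
proof -
  have "spread squeeze {0<..<1} (coords c S)" by (rule spread_squeeze) auto
  then show ?thesis unfolding stab_def ins_def spread_def by force
qed

section \<open>The operators of a graph, and the neighbourhood of a vertex\<close>

context cw
begin

abbreviation F :: "'a set \<Rightarrow> 'a set \<Rightarrow> 'a set" where "F e \<equiv> arc.stab (c e)"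

abbreviation UC :: "nat \<Rightarrow> 'a set topology" where "UC \<equiv> \<lambda>k. uconf k \<Gamma>"

definition cf :: "'a set \<Rightarrow> 'a set set" where "cf W = {S. S \<subseteq> topspace \<Gamma> - W}"

lemma UC_finite: "S \<in> topspace (UC k) \<Longrightarrow> finite S" and UC_sub: "S \<in> topspace (UC k) \<Longrightarrow> S \<subseteq> topspace \<Gamma>"
  by (auto simp: topspace_uconf)

lemma F_sub: "e \<in> E \<Longrightarrow> F e S \<subseteq> S \<union> e"
  using arc.stab_sub[OF arc] im by metis

lemma F_cf: assumes "e \<in> E" "W \<subseteq> V" "S \<in> cf W" shows "F e S \<in> cf W"
proof -
  have "e \<subseteq> topspace \<Gamma> - W" using edge_V[OF assms(1)] EU assms(1,2) by blast
  then show ?thesis using F_sub[OF assms(1), of S] assms(3) by (auto simp: cf_def)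
qed

lemma acts_cf: "W \<subseteq> V \<Longrightarrow> acts E F UC (cf W)"
  unfolding acts_def using arc.stab_continuous[OF arc F_cf] by blast

lemma F_commute:
  assumes "e \<in> E" "e' \<in> E" "finite S" shows "F e (F e' S) = F e' (F e S)"
proof (cases "e = e'")
  case False
  have "c e ` {1/3<..<2/3} \<subseteq> e" if "e \<in> E" for e using im[OF that] by force
  then have J: "c e ` {1/3<..<2/3} \<inter> c e' ` {1/3<..<2/3} = {}" using disj[OF assms(1,2) False] assms(1,2) by blast
  note a = arc[OF assms(1)] and a' = arc[OF assms(2)]
  show ?thesis
    by (rule supported_commute[where f="F e" and g="F e'", OF arc.stab_outside(1)[OF a] arc.stab_inside_cong[OF a]
          arc.stab_outside(1)[OF a'] arc.stab_inside_cong[OF a'] arc.stab_finite[OF a] arc.stab_finite[OF a'] J assms(3)])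
qed simp

abbreviation (input) "Nv v W \<equiv> umin (topspace \<Gamma> - W) (dst v) (1/3)"

lemma minimizer: assumes "W \<subseteq> V" shows "minimizer \<Gamma> (topspace \<Gamma> - W) (dst v) (1/3)"
  by unfold_locales (use haus open_minus[OF assms] continuous_map_from_subtopology[OF dst_continuous] in auto)

text \<open>On the middle third the distance is 1/3, larger than that of the closest point. So the
  operator neither touches this point nor creates a competitor, and it commutes with forgetting
  it.\<close>

lemma F_near:
  assumes e: "e \<in> E" and W: "W \<subseteq> V" and S: "finite S" "S \<in> Nv v W"
  shows "F e S \<in> Nv v W" "minpt (dst v) (F e S) = minpt (dst v) S" "rmin (dst v) (F e S) = F e (rmin (dst v) S)"
proof -
  note a = arc[OF e]
  let ?J = "c e ` {1/3<..<2/3}" and ?z = "minpt (dst v) S"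
  note z = umin_minpt[OF S(2)]
  have Jd: "dst v p = 1/3" if "p \<in> ?J" for p using that dst_mid[OF e] by auto
  have zJ: "?z \<notin> ?J" using Jd z(3) by force
  have out: "F e S - ?J = S - ?J" by (rule arc.stab_outside(1)[OF a S(1)])
  have zF: "?z \<in> F e S" using z(1) zJ out by blast
  have lt: "dst v ?z < dst v y" if "y \<in> F e S" "y \<noteq> ?z" for y
  proof (cases "y \<in> ?J")
    case True
    from Jd[OF this] z(3) show ?thesis by (simp only:)
  next
    case False
    then have "y \<in> S" using out that(1) by blast
    then show ?thesis using z(4) that(2) by blast
  qed
  have "S \<in> cf W" using S(2) by (auto simp: umin_def cf_def)
  then have "F e S \<subseteq> topspace \<Gamma> - W" using F_cf[OF e W] by (auto simp: cf_def)
  then show "F e S \<in> Nv v W" using uminI[of "F e S" "topspace \<Gamma> - W" ?z "dst v" "1/3"] zF z(3) lt by blast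
  show m: "minpt (dst v) (F e S) = ?z" by (rule minpt_eq[OF zF]) (use lt in auto)
  show "rmin (dst v) (F e S) = F e (rmin (dst v) S)"
    unfolding rmin_def m using arc.stab_remove[OF a S(1) zJ] by simp
qed

lemma hc_leg:
  assumes "h \<in> halves v" "W \<subseteq> V" "v \<in> V - W"
  shows "continuous_map (top_of_set {0..<1/3}) (subtopology \<Gamma> (topspace \<Gamma> - W)) (hc h)"
  unfolding continuous_map_in_subtopology
proof
  show "continuous_map (top_of_set {0..<1/3}) \<Gamma> (hc h)"
    by (rule continuous_map_from_subtopology_mono[OF hc_cont[OF assms(1)]]) auto
  have "hc h t \<notin> W" if "0 \<le> t" "t < 1/3" for t
  proof (cases "t = 0")
    case True then show ?thesis using halvesI(2)[OF assms(1)] assms(3) by simp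
  next
    case False
    then have "hc h t \<in> fst h" using that by (intro hc_in[OF assms(1)]) auto
    then show ?thesis using edge_V[OF halvesI(1)[OF assms(1)]] assms(2) by blast
  qed
  then show "hc h \<in> topspace (top_of_set {0..<1/3}) \<rightarrow> topspace \<Gamma> - W"
    using hc_top[OF assms(1)] by auto
qed

context
  fixes W :: "'a set" and v :: 'a
  assumes W: "W \<subseteq> V" and v: "v \<in> V - W"
begin

interpretation M: minimizer \<Gamma> "topspace \<Gamma> - W" "dst v" "1/3"
  by (rule minimizer[OF W])

lemma pos_cf: "M.pos = cf (insert v W)"
proof -
  have "S \<subseteq> topspace \<Gamma> - W \<and> (\<forall>p\<in>S. 0 < dst v p) \<longleftrightarrow> S \<subseteq> topspace \<Gamma> - insert v W" for S
  proof
    assume "S \<subseteq> topspace \<Gamma> - W \<and> (\<forall>p\<in>S. 0 < dst v p)"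
    moreover have "\<not> 0 < dst v v" using dst_self v by simp
    ultimately show "S \<subseteq> topspace \<Gamma> - insert v W" by blast
  qed (use dst_pos in blast)
  then show ?thesis unfolding M.pos_def cf_def by simp
qed

lemma N_cf: "Nv v W \<inter> cf (insert v W) = {S \<in> Nv v W. \<forall>p\<in>S. 0 < dst v p}"
  unfolding pos_cf[symmetric] M.pos_def by (auto simp: umin_def)

lemma hc_leg':
  assumes "h \<in> halves v"
  shows "continuous_map (top_of_set {0<..<1/3}) (subtopology \<Gamma> (topspace \<Gamma> - W)) (hc h)"
  by (rule continuous_map_from_subtopology_mono[OF hc_leg[OF assms W v]]) auto

lemma dst_hc': "h \<in> halves v \<Longrightarrow> 0 < t \<Longrightarrow> t < 1/3 \<Longrightarrow> dst v (hc h t) = t"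
  by (rule dst_hc) auto

lemma star:
  assumes "halves v \<noteq> {}"
  shows "{p \<in> topspace \<Gamma> - W. dst v p < 1/3} = (\<Union>h\<in>halves v. hc h ` {0..<1/3})"
proof -
  obtain h where h: "h \<in> halves v" using assms by blast
  have "v \<in> hc h ` {0..<1/3}" using halvesI(2)[OF h] by (intro image_eqI[of _ _ 0]) auto
  then have "v \<in> (\<Union>h\<in>halves v. hc h ` {0..<1/3})" using h by blast
  then have s: "{p \<in> topspace \<Gamma>. dst v p < 1/3} = (\<Union>h\<in>halves v. hc h ` {0..<1/3})"
    using dst_star[of v] v by (simp add: insert_absorb)
  have "dst v w = 1/3" if "w \<in> W" for w using that W v by (auto simp: dst_def)
  then have "{p \<in> topspace \<Gamma> - W. dst v p < 1/3} = {p \<in> topspace \<Gamma>. dst v p < 1/3}" by force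
  then show ?thesis unfolding s .
qed

lemma star_pos:
  assumes "p \<in> topspace \<Gamma>" "0 < dst v p" "dst v p < 1/3"
  shows "\<exists>h\<in>halves v. p \<in> hc h ` {0<..<1/3}"
proof -
  have "p \<noteq> v" using assms(2) dst_self v by auto
  moreover have "p \<in> insert v (\<Union>h\<in>halves v. hc h ` {0..<1/3})"
    using dst_star[of v] v assms by blast
  ultimately obtain h t where h: "h \<in> halves v" "p = hc h t" "0 \<le> t" "t < 1/3" by auto
  then have "t = dst v p" using dst_hc[OF h(1), of t] by simp
  then have "p \<in> hc h ` {0<..<1/3}" using h assms(2) by auto
  then show ?thesis using h(1) by blast
qed

text \<open>The sets cover because a configuration that contains \<open>v\<close> has
  \<open>v\<close> as its closest point. A half-edge at \<open>v\<close> is needed as the leg along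
  which the closest point is pushed off \<open>v\<close>.\<close>

lemma collar:
  assumes h: "h \<in> halves v"
  shows "collar E F UC (cf W) (cf (insert v W)) (Nv v W) (M.addpt (hc h) \<circ> rmin (dst v))"
proof
  let ?r = "M.addpt (hc h) \<circ> rmin (dst v)"
  show "acts E F UC (cf W)" by (rule acts_cf[OF W])
  show "F e s \<in> cf (insert v W)" if "e \<in> E" "s \<in> cf (insert v W)" for e s
    by (rule F_cf) (use that W v in auto)
  show "F e s \<in> Nv v W" if "e \<in> E" "s \<in> topspace (UC k)" "s \<in> Nv v W" for e k s
    by (rule F_near(1)[OF that(1) W UC_finite[OF that(2)] that(3)])
  show "Nv v W \<subseteq> cf W" by (auto simp: umin_def cf_def)
  show "cf (insert v W) \<subseteq> cf W" by (auto simp: cf_def)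
  show "cf W \<subseteq> Nv v W \<union> cf (insert v W)"
  proof
    fix S assume S: "S \<in> cf W"
    show "S \<in> Nv v W \<union> cf (insert v W)"
    proof (cases "v \<in> S")
      case True
      have "S \<in> Nv v W"
        by (rule uminI[OF _ True]) (use S True v dst_self[of v] dst_pos[of _ v] in \<open>auto simp: cf_def\<close>)
      then show ?thesis ..
    qed (use S in \<open>auto simp: cf_def\<close>)
  qed
  show "openin (subtopology (UC k) (cf W)) (topspace (UC k) \<inter> Nv v W)" for k
  proof -
    have "topspace (UC k) \<inter> Nv v W = (topspace (UC k) \<inter> Nv v W) \<inter> cf W" by (auto simp: umin_def cf_def)
    then show ?thesis using openin_subtopology_Int[OF M.open_umin[of k], of "cf W"] by (simp only:)
  qed
  show "openin (subtopology (UC k) (cf W)) (topspace (UC k) \<inter> cf (insert v W))" for k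
  proof -
    have "openin (UC k) {S \<in> topspace (UC k). S \<subseteq> topspace \<Gamma> - insert v W}"
      by (rule openin_uconf_subset[OF open_minus]) (use W v in auto)
    then show ?thesis by (simp add: openin_subtopology) (auto simp: cf_def)
  qed
  \<comment> \<open>The empty configuration has no closest point, so there is nothing in weight 0,
    and \<open>homotopic_star\<close> covers the weights \<open>Suc k\<close>.\<close>
  have ne: "subtopology (UC 0) (Nv v W) = trivial_topology"
    unfolding null_topspace_iff_trivial[symmetric] by (auto simp: topspace_uconf umin_def)
  have star': "continuous_map (subtopology (UC (Suc k)) (Nv v W)) (subtopology (UC (Suc k)) {S \<in> Nv v W. \<forall>p\<in>S. 0 < dst v p}) ?r
    \<and> homotopic_with (\<lambda>_. True) (subtopology (UC (Suc k)) (Nv v W)) (subtopology (UC (Suc k)) (Nv v W)) id ?r" for k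
  proof (rule M.homotopic_star[where H="halves v" and c=hc and v=v and ?h0.0=h])
    show "continuous_map (top_of_set {0..<1 / 3}) (subtopology \<Gamma> (topspace \<Gamma> - W)) (hc h)" if "h \<in> halves v" for h
      by (rule hc_leg[OF that W v])
    show "dst v (hc h t) = t" if "h \<in> halves v" "0 \<le> t" "t < 1/3" for h t using dst_hc that by simp
    show "hc h 0 = v" if "h \<in> halves v" for h using halvesI(2)[OF that] .
    show "h = h'" if "h \<in> halves v" "h' \<in> halves v" "0 < t" "t < 1/3" "hc h t = hc h' t" for h h' t
      using hc_inj[OF that(1,2), of t t] that by simp
    show "{p \<in> topspace \<Gamma> - W. dst v p < 1 / 3} = (\<Union>h\<in>halves v. hc h ` {0..<1 / 3})" by (rule star) (use h in blast)
    show "closedin (subtopology \<Gamma> {p \<in> topspace \<Gamma> - W. dst v p < 1 / 3}) (hc h ` {0..<1 / 3})" if h: "h \<in> halves v" for h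
    proof -
      have "hc h ` {0..<1/3} = {p \<in> topspace \<Gamma> - W. dst v p < 1 / 3} \<inter> hc h ` {0..1/3}"
      proof
        show "hc h ` {0..<1/3} \<subseteq> {p \<in> topspace \<Gamma> - W. dst v p < 1 / 3} \<inter> hc h ` {0..1/3}"
          using star h by fastforce
        show "{p \<in> topspace \<Gamma> - W. dst v p < 1 / 3} \<inter> hc h ` {0..1/3} \<subseteq> hc h ` {0..<1/3}"
        proof
          fix p assume p: "p \<in> {p \<in> topspace \<Gamma> - W. dst v p < 1 / 3} \<inter> hc h ` {0..1/3}"
          then obtain t where t: "p = hc h t" "0 \<le> t" "t \<le> 1/3" by auto
          then have "t < 1/3" using p dst_hc[OF h, of t] by simp
          then show "p \<in> hc h ` {0..<1/3}" using t by simp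
        qed
      qed
      then show ?thesis using hc_closed[OF h, of 0 "1/3"] by (auto simp: closedin_subtopology)
    qed
  qed (use h finite_halves in auto)
  show "continuous_map (subtopology (UC k) (Nv v W)) (subtopology (UC k) (Nv v W \<inter> cf (insert v W))) ?r" for k
    unfolding N_cf
  proof (cases k)
    case 0
    show "continuous_map (subtopology (UC k) (Nv v W)) (subtopology (UC k) {S \<in> Nv v W. \<forall>p\<in>S. 0 < dst v p}) ?r"
      using ne 0 by simp
  qed (use star' in simp)
  show "homotopic_with (\<lambda>_. True) (subtopology (UC k) (Nv v W)) (subtopology (UC k) (Nv v W)) id ?r" for k
  proof (cases k)
    case 0
    then show ?thesis using ne by (simp add: homotopic_on_emptyI)
  qed (use star' in simp)
qed

text \<open>When \<open>v\<close> is unoccupied, the closest point lies on exactly one half-edge at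
  \<open>v\<close>; forgetting it leaves a configuration that again avoids \<open>v\<close>.\<close>

lemma leaves:
  "leaves E F UC (Nv v W \<inter> cf (insert v W)) (halves v) (\<lambda>h. M.leg (hc h)) (cf (insert v W)) (rmin (dst v)) (\<lambda>h. M.addpt (hc h))"
proof -
  have actD: "acts E F UC (cf (insert v W))" by (rule acts_cf) (use W v in auto)
  have near: "F e s \<in> Nv v W \<inter> cf (insert v W)" if "e \<in> E" "s \<in> topspace (UC k)" "s \<in> Nv v W \<inter> cf (insert v W)" for e k s
    using F_near(1)[OF that(1) W UC_finite[OF that(2)]] F_cf[OF that(1), of "insert v W" s] that(3) W v by blast
  have leg: "M.leg (hc h) = {S \<in> Nv v W. minpt (dst v) S \<in> hc h ` {0<..<1/3}}" if "h \<in> halves v" for h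
    by (rule M.leg_def)
  have mp: "minpt (dst v) (F e s) = minpt (dst v) s" "rmin (dst v) (F e s) = F e (rmin (dst v) s)" "F e s \<in> Nv v W"
    if "e \<in> E" "s \<in> topspace (UC k)" "s \<in> Nv v W" for e k s
    using F_near[OF that(1) W UC_finite[OF that(2)] that(3)] by auto
  have inj: "h = h'" if "h \<in> halves v" "h' \<in> halves v" "0 < t" "t < 1/3" "0 < t'" "t' < 1/3" "hc h t = hc h' t'" for h h' t t'
    using hc_inj[OF that(1,2), of t t'] that by simp
  have pos: "0 < dst v p" if "p \<in> S" "S \<in> cf (insert v W)" for p S
    using that pos_cf unfolding M.pos_def by blast
  show ?thesis
  proof
    show "acts E F UC (Nv v W \<inter> cf (insert v W))" by (rule acts_subset[OF actD]) (use near in auto)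
    show "acts E F UC (cf (insert v W))" by (rule actD)
    show "F e s \<in> M.leg (hc h)" if "h \<in> halves v" "e \<in> E" "s \<in> topspace (UC k)" "s \<in> M.leg (hc h)" for h e k s
      using that mp[OF that(2,3)] by (simp add: leg)
    show "finite (halves v)" by (rule finite_halves)
    show "M.leg (hc h) \<subseteq> Nv v W \<inter> cf (insert v W)" if "h \<in> halves v" for h
    proof
      fix S assume S: "S \<in> M.leg (hc h)"
      then have N: "S \<in> Nv v W" and m: "0 < dst v (minpt (dst v) S)" using dst_hc'[OF that] by (auto simp: leg[OF that])
      have "0 < dst v p" if "p \<in> S" for p using umin_minpt(4)[OF N that] m by (cases "p = minpt (dst v) S") auto
      then have "S \<in> {S \<in> Nv v W. \<forall>p\<in>S. 0 < dst v p}" using N by blast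
      then show "S \<in> Nv v W \<inter> cf (insert v W)" unfolding N_cf .
    qed
    show "topspace (UC k) \<inter> (Nv v W \<inter> cf (insert v W)) \<subseteq> (\<Union>h\<in>halves v. M.leg (hc h))" for k
    proof
      fix S assume S: "S \<in> topspace (UC k) \<inter> (Nv v W \<inter> cf (insert v W))"
      then have N: "S \<in> Nv v W" by blast
      note m = umin_minpt[OF N]
      have "0 < dst v (minpt (dst v) S)" using pos[OF m(1)] S by blast
      then obtain h where "h \<in> halves v" "minpt (dst v) S \<in> hc h ` {0<..<1/3}"
        using star_pos[of "minpt (dst v) S"] m by blast
      then show "S \<in> (\<Union>h\<in>halves v. M.leg (hc h))" using N leg by blast
    qed
    show "M.leg (hc h) \<inter> M.leg (hc h') = {}" if "h \<in> halves v" "h' \<in> halves v" "h \<noteq> h'" for h h'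
      using inj[OF that(1,2)] that(3) unfolding leg[OF that(1)] leg[OF that(2)] by fastforce
    show "openin (subtopology (UC k) (Nv v W \<inter> cf (insert v W))) (topspace (UC k) \<inter> M.leg (hc h))" if h: "h \<in> halves v" for k h
    proof -
      let ?T = "subtopology (UC k) (Nv v W \<inter> cf (insert v W))"
      have "continuous_map ?T (subtopology \<Gamma> (topspace \<Gamma> - W)) (minpt (dst v))"
        by (rule M.continuous_minpt'(1)) auto
      then have "continuous_map ?T \<Gamma> (minpt (dst v))" by (rule continuous_map_into_fulltopology)
      then have "openin ?T {S \<in> topspace ?T. minpt (dst v) S \<in> hc h ` {0<..<1/3}}"
        by (rule openin_continuous_map_preimage) (rule hc_open[OF h], auto)
      moreover have "{S \<in> topspace ?T. minpt (dst v) S \<in> hc h ` {0<..<1/3}} = topspace (UC k) \<inter> M.leg (hc h)"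
      proof -
        have "S \<in> cf (insert v W)" if "S \<in> Nv v W" "minpt (dst v) S \<in> hc h ` {0<..<1/3}" for S
        proof -
          have m: "0 < dst v (minpt (dst v) S)" using dst_hc'[OF h] that(2) by auto
          have "0 < dst v p" if "p \<in> S" for p using umin_minpt(4)[OF \<open>S \<in> Nv v W\<close> that] m by (cases "p = minpt (dst v) S") auto
          then have "S \<in> {S \<in> Nv v W. \<forall>p\<in>S. 0 < dst v p}" using that(1) by blast
          then show ?thesis unfolding N_cf[symmetric] by blast
        qed
        then show ?thesis unfolding leg[OF h] by auto
      qed
      ultimately show ?thesis by simp
    qed
    show "topspace (UC 0) \<inter> (Nv v W \<inter> cf (insert v W)) = {}" by (auto simp: topspace_uconf umin_def)
    show "rmin (dst v) (F e s) = F e (rmin (dst v) s)"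
      if "e \<in> E" "s \<in> topspace (UC k)" "s \<in> Nv v W \<inter> cf (insert v W)" for e k s
      using mp(2)[OF that(1,2)] that(3) by blast
    fix k h assume h: "h \<in> halves v"
    show "continuous_map (subtopology (UC (Suc k)) (M.leg (hc h))) (subtopology (UC k) (cf (insert v W))) (rmin (dst v))"
      using M.rmin_leg[OF hc_leg'[OF h] dst_hc'[OF h]] unfolding pos_cf .
    show "continuous_map (subtopology (UC k) (cf (insert v W))) (subtopology (UC (Suc k)) (M.leg (hc h))) (M.addpt (hc h))"
      using M.addpt_leg[OF hc_leg'[OF h] dst_hc'[OF h]] unfolding pos_cf .
    show "homotopic_with (\<lambda>_. True) (subtopology (UC (Suc k)) (M.leg (hc h))) (subtopology (UC (Suc k)) (M.leg (hc h))) id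
       (M.addpt (hc h) \<circ> rmin (dst v))"
      using M.homotopic_leg[OF hc_leg'[OF h] dst_hc'[OF h]] .
  qed
qed

end

end

section \<open>Operators at a common vertex, and configurations in the open edges\<close>

context cw
begin

lemma edges_at_V: "edges_at v \<subseteq> E" by (auto simp: edges_at_def)

text \<open>The added point travels from \<open>v\<close> into the edge. It starts at
  \<open>v\<close>, so the homotopy takes place among configurations that avoid \<open>W\<close>,
  although it is defined for those that avoid \<open>v\<close> as well.\<close>

lemma homotopic_insert_F:
  assumes e: "e \<in> edges_at v" and W: "W \<subseteq> V" "v \<in> V - W"
  shows "homotopic_with (\<lambda>_. True) (subtopology (UC k) (cf (insert v W))) (subtopology (UC (Suc k)) (cf W)) (insert v) (F e)"
proof -
  have eE: "e \<in> E" using e by (simp add: edges_at_def)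
  have eW: "e \<subseteq> topspace \<Gamma> - W" using edge_V[OF eE] EU eE W(1) by blast
  have vW: "v \<in> topspace \<Gamma> - W" using W VT by blast
  have split: "c e ` {0..<1} = insert (c e 0) e" "c e ` {0<..1} = insert (c e 1) e"
  proof -
    have "{0..<1::real} = insert 0 {0<..<1}" "{0<..1::real} = insert 1 {0<..<1}" by auto
    then show "c e ` {0..<1} = insert (c e 0) e" "c e ` {0<..1} = insert (c e 1) e" using im[OF eE] by simp_all
  qed
  have no: "v \<notin> S" if "S \<in> cf (insert v W)" for S using that by (auto simp: cf_def)
  have cfW: "S' \<in> cf W" if "S \<in> cf (insert v W)" "S' \<subseteq> S \<union> insert v e" for S S'
    using that eW vW by (auto simp: cf_def)
  consider "c e 0 = v" | "c e 1 = v" using e by (auto simp: edges_at_def)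
  then show ?thesis
  proof cases
    case 1
    show ?thesis using arc.homotopic_stab_0[OF arc[OF eE], of "cf (insert v W)" k "cf W"] no cfW
      unfolding split 1 by blast
  next
    case 2
    show ?thesis using arc.homotopic_stab_1[OF arc[OF eE], of "cf (insert v W)" k "cf W"] no cfW
      unfolding split 2 by blast
  qed
qed

lemma homotopic_F:
  assumes "e \<in> edges_at v" "e' \<in> edges_at v" "W \<subseteq> V" "v \<in> V - W"
  shows "homotopic_with (\<lambda>_. True) (subtopology (UC k) (cf (insert v W))) (subtopology (UC (Suc k)) (cf W)) (F e) (F e')"
  using homotopic_with_trans[OF homotopic_with_symD[OF homotopic_insert_F[OF assms(1,3,4)]] homotopic_insert_F[OF assms(2,3,4)]] .

text \<open>The value 1 off \<open>e\<close> is the bound \<rho> with which this function is used.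
  Thus every point on \<open>e\<close> counts as closer than any point off it, and the first point
  on \<open>e\<close> is the unique minimum.\<close>

definition ecrd :: "'a set \<Rightarrow> 'a \<Rightarrow> real" where
  "ecrd e p = (if p \<in> e then snd (crd p) else 1)"

lemma ecrd_c: "e \<in> E \<Longrightarrow> 0 < t \<Longrightarrow> t < 1 \<Longrightarrow> ecrd e (c e t) = t"
  using c_in[of e t] crd[of e t] by (simp add: ecrd_def)

lemma minimizer_edge:
  assumes e: "e \<in> E" and E': "E' \<subseteq> E" "e \<notin> E'"
  shows "minimizer \<Gamma> ((e \<union> \<Union>E')) (ecrd e) 1"
proof
  have op: "openin \<Gamma> (\<Union>A)" if "A \<subseteq> E" for A using that open_edge by (intro openin_Union) auto
  show o: "openin \<Gamma> (e \<union> \<Union>E')" by (rule openin_Un[OF open_edge[OF e] op[OF E'(1)]])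
  have dis: "e \<inter> \<Union>E' = {}" using disj[OF e] E' by blast
  show "continuous_map (subtopology \<Gamma> ((e \<union> \<Union>E'))) euclideanreal (ecrd e)"
    unfolding continuous_map_def
  proof (intro conjI allI impI)
    fix U :: "real set" assume "openin euclideanreal U"
    then have U: "open U" by simp
    let ?Y = "(e \<union> \<Union>E')"
    have tY: "topspace (subtopology \<Gamma> ?Y) = ?Y" using openin_subset[OF o] by auto
    have "{x \<in> ?Y. ecrd e x \<in> U} = c e ` ({0<..<1} \<inter> U) \<union> (if 1 \<in> U then \<Union>E' else {})" (is "?L = ?R")
    proof (rule Set.set_eqI)
      fix p
      show "p \<in> ?L \<longleftrightarrow> p \<in> ?R"
      proof (cases "p \<in> e")
        case True
        then obtain t where t: "p = c e t" "0 < t" "t < 1" using im[OF e] by fastforce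
        have "p \<in> c e ` ({0<..<1} \<inter> U) \<longleftrightarrow> t \<in> U"
        proof
          assume "p \<in> c e ` ({0<..<1} \<inter> U)"
          then obtain s where "c e t = c e s" "0 < s" "s < 1" "s \<in> U" using t by auto
          then show "t \<in> U" using inj_onD[OF inj[OF e], of t s] t by simp
        qed (use t in auto)
        then show ?thesis using True dis ecrd_c[OF e t(2,3)] t(1) by auto
      next
        case False
        have "c e ` ({0<..<1} \<inter> U) \<subseteq> e" using im[OF e] by blast
        then have "p \<notin> c e ` ({0<..<1} \<inter> U)" using False by blast
        then show ?thesis using False by (simp add: ecrd_def)
      qed
    qed
    moreover have "openin \<Gamma> (c e ` ({0<..<1} \<inter> U))"
    proof (subst openin_subopen, intro ballI)
      fix p assume "p \<in> c e ` ({0<..<1} \<inter> U)"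
      then obtain t where t: "p = c e t" "t \<in> {0<..<1} \<inter> U" by blast
      obtain a b where ab: "t \<in> {a<..<b}" "{a<..<b} \<subseteq> {0<..<1} \<inter> U"
      proof -
        have "open ({0<..<1} \<inter> U)" using U by (intro open_Int) auto
        then obtain \<epsilon> where "0 < \<epsilon>" "ball t \<epsilon> \<subseteq> {0<..<1} \<inter> U" using t(2) openE by blast
        then show ?thesis using that[of "t - \<epsilon>" "t + \<epsilon>"] by (simp add: ball_eq_greaterThanLessThan)
      qed
      then have "{max a 0<..<min b 1} = {a<..<b}" by auto
      then have "openin \<Gamma> (c e ` {a<..<b})" using arc.open_image[OF arc[OF e], of "max a 0" "min b 1"] by simp
      moreover have "p \<in> c e ` {a<..<b}" using t(1) ab(1) by blast
      moreover have "c e ` {a<..<b} \<subseteq> c e ` ({0<..<1} \<inter> U)" by (rule image_mono[OF ab(2)])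
      ultimately show "\<exists>T. openin \<Gamma> T \<and> p \<in> T \<and> T \<subseteq> c e ` ({0<..<1} \<inter> U)" by blast
    qed
    moreover have "openin \<Gamma> (if 1 \<in> U then \<Union>E' else {})" using op[OF E'(1)] by simp
    ultimately have "openin \<Gamma> {x \<in> ?Y. ecrd e x \<in> U}" by (simp add: openin_Un)
    then show "openin (subtopology \<Gamma> ?Y) {x \<in> topspace (subtopology \<Gamma> ?Y). ecrd e x \<in> U}"
      unfolding tY using openin_open_subtopology[OF o] by blast
  qed auto
qed (use haus in auto)

text \<open>A form of contractibility of the components, by induction on the edges and on the
  weight. If \<open>e\<close> is occupied, forgetting its first point is undone up to homotopy and
  lowers the weight; if \<open>e\<close> is empty, the configuration lies on fewer edges. These two
  cases are separated by open sets.\<close>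

lemma cyc_open_edges:
  assumes n: "0 < n" and E': "E' \<subseteq> E" shows "cyc n UC {S. S \<subseteq> \<Union>E'} k \<subseteq> bdy n UC {S. S \<subseteq> \<Union>E'} k"
  using finite_subset[OF E' finE] E'
proof (induction E' arbitrary: k rule: finite_induct)
  case empty
  have "topspace (subtopology (UC k) {S. S \<subseteq> {}}) \<subseteq> {{}}" by auto
  then consider "topspace (subtopology (UC k) {S. S \<subseteq> {}}) = {}" | "topspace (subtopology (UC k) {S. S \<subseteq> {}}) = {{}}" by blast
  then show ?case
  proof cases
    case 1
    then show ?thesis unfolding cyc_def bdy_def using singular_chain_empty[OF 1] by (auto simp: singular_cycle)
  next
    case 2
    then show ?thesis unfolding cyc_def bdy_def using singular_boundary_set_eq_cycle_singleton[OF 2, of n] n by auto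
  qed
next
  case (insert e E')
  have e: "e \<in> E" and E'E: "E' \<subseteq> E" using insert.prems by auto
  let ?Y = "(e \<union> \<Union>E')"
  let ?P = "{S. S \<subseteq> ?Y}"
  interpret M: minimizer \<Gamma> ?Y "ecrd e" 1 by (rule minimizer_edge[OF e E'E insert.hyps(2)])
  have dis: "e \<inter> \<Union>E' = {}" using disj[OF e] E'E insert.hyps(2) by blast
  have ec: "\<exists>t. 0 < t \<and> t < 1 \<and> p = c e t \<and> ecrd e p = t" if "p \<in> e" for p
    using that im[OF e] ecrd_c[OF e] by fastforce
  \<comment> \<open>The coordinate is positive everywhere, since the open edge has no centre; so
    after forgetting the first point all configurations in the open edges occur.\<close>
  have pos: "M.pos = ?P"
  proof -
    have "0 < ecrd e p" for p using ec[of p] by (cases "p \<in> e") (auto simp: ecrd_def)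
    then show ?thesis by (simp add: M.pos_def)
  qed
  have c': "continuous_map (top_of_set {0<..<1}) (subtopology \<Gamma> ?Y) (c e)"
    unfolding continuous_map_in_subtopology
  proof
    show "continuous_map (top_of_set {0<..<1}) \<Gamma> (c e)"
      by (rule continuous_map_from_subtopology_mono[OF cont[OF e]]) auto
    show "c e \<in> topspace (top_of_set {0<..<1}) \<rightarrow> e \<union> \<Union>E'" using c_in[OF e] by simp
  qed
  let ?C = "{S \<in> ?P. S \<inter> e \<noteq> {}}"
  have leg: "S \<in> M.leg (c e) \<longleftrightarrow> S \<in> ?C" if S: "finite S" for S
  proof
    assume "S \<in> M.leg (c e)"
    then show "S \<in> ?C" using umin_minpt(1)[of S ?Y "ecrd e" 1] unfolding M.leg_def im[OF e] by (auto simp: umin_def)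
  next
    assume S': "S \<in> ?C"
    have ne: "S \<inter> e \<noteq> {}" "finite (S \<inter> e)" using S S' by auto
    obtain z where z: "z \<in> S \<inter> e" "\<And>y. y \<in> S \<inter> e \<Longrightarrow> ecrd e z \<le> ecrd e y"
      using ex_min_if_finite[of "ecrd e ` (S \<inter> e)"] ne by (metis (no_types, lifting) arg_min_if_finite(1) arg_min_least)
    have lt: "ecrd e z < ecrd e y" if y: "y \<in> S" "y \<noteq> z" for y
    proof (cases "y \<in> e")
      case True
      then have "ecrd e z \<noteq> ecrd e y" using ec[of y] ec[of z] z(1) y(2) by auto
      then show ?thesis using z(2)[of y] True y by auto
    next
      case False
      then show ?thesis using ec[of z] z(1) by (auto simp: ecrd_def)
    qed
    have zS: "z \<in> S" using z by blast
    have z1: "ecrd e z < 1" using ec[of z] z(1) by auto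
    have "S \<in> M.N" using uminI[of S ?Y z "ecrd e" 1] S' zS z1 lt by blast
    moreover have "minpt (ecrd e) S = z" by (rule minpt_eq[OF zS]) (use lt in auto)
    ultimately show "S \<in> M.leg (c e)" unfolding M.leg_def im[OF e] using z(1) by blast
  qed
  have top: "subtopology (UC k) (M.leg (c e)) = subtopology (UC k) ?C" for k
  proof -
    have "topspace (UC k) \<inter> M.leg (c e) = topspace (UC k) \<inter> ?C" using leg UC_finite by blast
    then show ?thesis using subtopology_restrict[of "UC k" "M.leg (c e)"] subtopology_restrict[of "UC k" ?C] by (simp only:)
  qed
  have "cyc n UC ?P k \<subseteq> bdy n UC ?P k" for k
  proof (induction k rule: nat_less_induct)
    fix k
    assume "\<forall>j<k. cyc n UC ?P j \<subseteq> bdy n UC ?P j"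
    then have IH: "cyc n UC ?P j \<subseteq> bdy n UC ?P j" if "k = Suc j" for j using that by blast
    have C: "cyc n UC ?C k \<subseteq> bdy n UC ?C k"
    proof (cases k)
      case 0
      have t: "topspace (subtopology (UC k) ?C) = {}" using 0 by (auto simp: topspace_uconf)
      then show ?thesis unfolding cyc_def bdy_def using singular_chain_empty[OF t] by (auto simp: singular_cycle)
    next
      case (Suc j)
      show ?thesis
      proof
        fix x assume x: "x \<in> cyc n UC ?C k"
        have xc: "singular_relcycle n (subtopology (UC k) ?C) {} x" using x by (simp add: cyc_def)
        have r: "continuous_map (subtopology (UC k) ?C) (subtopology (UC j) ?P) (rmin (ecrd e))"
          using M.rmin_leg[OF c' ecrd_c[OF e], of j] unfolding pos top Suc .
        have a: "continuous_map (subtopology (UC j) ?P) (subtopology (UC k) ?C) (M.addpt (c e))"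
          using M.addpt_leg[OF c' ecrd_c[OF e], of j] unfolding pos top Suc .
        have "chain_map n (rmin (ecrd e)) x \<in> cyc n UC ?P j"
          unfolding cyc_def using singular_relcycle_chain_map[OF xc r] by simp
        then have "chain_map n (rmin (ecrd e)) x \<in> bdy n UC ?P j" using IH[OF Suc] by blast
        then have "chain_map n (M.addpt (c e)) (chain_map n (rmin (ecrd e)) x) \<in> bdy n UC ?C k"
          unfolding bdy_def using singular_relboundary_chain_map[OF _ a] by simp
        then have 1: "chain_map n (M.addpt (c e) \<circ> rmin (ecrd e)) x \<in> bdy n UC ?C k"
          by (simp add: chain_map_compose)
        have "chain_map n id x - chain_map n (M.addpt (c e) \<circ> rmin (ecrd e)) x \<in> bdy n UC ?C k"
          by (rule homotopic_cyc[OF _ x]) (use M.homotopic_leg[OF c' ecrd_c[OF e], of j] in \<open>unfold top Suc\<close>)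
        moreover have "chain_map n id x = x" by (rule chain_map_id_gen[OF cyc_imp_chain[OF x]]) simp
        moreover have "asub (bdy n UC ?C k)" unfolding bdy_def by (rule asub_relboundary)
        ultimately have "(x - chain_map n (M.addpt (c e) \<circ> rmin (ecrd e)) x) + chain_map n (M.addpt (c e) \<circ> rmin (ecrd e)) x \<in> bdy n UC ?C k"
          using 1 by (intro asub_add) (simp_all only:)
        then show "x \<in> bdy n UC ?C k" by (simp only: diff_add_cancel)
      qed
    qed
    \<comment> \<open>The piece \<open>True\<close> consists of the configurations that occupy
      \<open>e\<close>, the piece \<open>False\<close> of those that leave it empty.\<close>
    define A where "A b = (if b then ?C else {S. S \<subseteq> \<Union>E'})" for b
    interpret s: split_space "subtopology (UC k) ?P" "UNIV :: bool set" A
    proof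
      show "topspace (subtopology (UC k) ?P) \<subseteq> (\<Union>h\<in>UNIV. A h)"
      proof
        fix S assume "S \<in> topspace (subtopology (UC k) ?P)"
        then have "S \<subseteq> e \<union> \<Union>E'" by simp
        then have "S \<in> A (S \<inter> e \<noteq> {})" unfolding A_def by (cases "S \<inter> e = {}") auto
        then show "S \<in> (\<Union>h\<in>UNIV. A h)" by blast
      qed
      show "A h \<inter> A h' = {}" if "h \<noteq> h'" for h h' using that dis by (auto simp: A_def)
      show "openin (subtopology (UC k) ?P) (topspace (subtopology (UC k) ?P) \<inter> A h)" for h
      proof -
        have "openin (UC k) {S \<in> topspace (UC k). S \<inter> e \<noteq> {}}" "openin (UC k) {S \<in> topspace (UC k). S \<subseteq> \<Union>E'}"
          using openin_uconf_meet[OF open_edge[OF e]] openin_uconf_subset[OF openin_Union[of E']] open_edge E'E by blast+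
        then have "openin (UC k) {S \<in> topspace (UC k). if h then S \<inter> e \<noteq> {} else S \<subseteq> \<Union>E'}" by (cases h) auto
        moreover have "topspace (subtopology (UC k) ?P) \<inter> A h = {S \<in> topspace (UC k). if h then S \<inter> e \<noteq> {} else S \<subseteq> \<Union>E'} \<inter> ?P"
          by (cases h) (auto simp: A_def)
        ultimately show ?thesis using openin_subtopology_Int[of "UC k" "{S \<in> topspace (UC k). if h then S \<inter> e \<noteq> {} else S \<subseteq> \<Union>E'}" ?P] by (simp only:)
      qed
    qed auto
    have subA: "A h \<subseteq> ?P" for h by (cases h) (auto simp: A_def)
    have subt: "subtopology (subtopology (UC k) ?P) (A h) = subtopology (UC k) (A h)" for h
      using subA[of h] by (simp add: subtopology_subtopology inf_absorb2)
    show "cyc n UC ?P k \<subseteq> bdy n UC ?P k"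
    proof
      fix x assume x: "x \<in> cyc n UC ?P k"
      have sc: "singular_chain n (subtopology (UC k) ?P) x" using x by (rule cyc_imp_chain)
      have "rst n (A h) x \<in> bdy n UC ?P k" for h
      proof -
        have "chain_boundary n (rst n (A h) x) = rst (n - Suc 0) (A h) 0"
          using s.rst_boundary[OF UNIV_I sc] x by (simp add: cyc_def singular_cycle)
        then have cy: "rst n (A h) x \<in> cyc n UC (A h) k"
          using s.rst_chain[OF sc, of h] addf_0[OF addf_rst] unfolding subt by (simp add: cyc_def singular_cycle)
        have "cyc n UC (A h) k \<subseteq> bdy n UC (A h) k" using C insert.IH[OF E'E, of k] by (cases h) (auto simp: A_def)
        then show ?thesis using cy bdy_mono[OF subA] by blast
      qed
      from asub_add[OF asub_relboundary[of n "subtopology (UC k) ?P" "{}"] this[of False, unfolded bdy_def] this[of True, unfolded bdy_def]]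
      have "(\<Sum>h\<in>UNIV. rst n (A h) x) \<in> bdy n UC ?P k"
        unfolding UNIV_bool bdy_def by simp
      then show "x \<in> bdy n UC ?P k" unfolding s.rst_sum[OF sc] .
    qed
  qed
  then show ?case by simp
qed

end

lemma submod_pcyc:
  fixes X :: "nat \<Rightarrow> 's topology"
  assumes "acts E F X A" shows "submod (opr n F) E (pcyc p n X A)"
proof (rule submodI)
  note c = submod_cyc[OF assms, of n] and b = submod_bdy[OF assms, of n]
  fix k
  have asc: "asub (cyc n X A k)" and asb: "asub (bdy n X A k)" using submod_asub c b by blast+
  have up: "frag_cmul (int p ^ (m + l)) x \<in> bdy n X A k" if "frag_cmul (int p ^ m) x \<in> bdy n X A k" for m l x
  proof -
    have "frag_cmul (int p ^ l) (frag_cmul (int p ^ m) x) \<in> bdy n X A k" using asub_cmul[OF asb that] .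
    then show ?thesis by (simp add: power_add mult.commute)
  qed
  have cmul_diff: "frag_cmul z (x - y) = frag_cmul z x - frag_cmul z y" for z and x y :: "'s chain"
    by (rule poly_mapping_eqI) (simp add: lookup_minus algebra_simps)
  show "asub (pcyc p n X A k)"
    unfolding asub_def
  proof (intro conjI ballI)
    show "0 \<in> pcyc p n X A k" unfolding pcyc_def using asub_0[OF asc] asub_0[OF asb] by simp
    fix x y assume "x \<in> pcyc p n X A k" "y \<in> pcyc p n X A k"
    then obtain m l where x: "x \<in> cyc n X A k" "frag_cmul (int p ^ m) x \<in> bdy n X A k"
      and y: "y \<in> cyc n X A k" "frag_cmul (int p ^ l) y \<in> bdy n X A k" unfolding pcyc_def by blast
    have "frag_cmul (int p ^ (m + l)) x - frag_cmul (int p ^ (m + l)) y \<in> bdy n X A k"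
      using asub_diff[OF asb up[OF x(2), of l] up[OF y(2), of m]] by (simp add: add.commute)
    then have "frag_cmul (int p ^ (m + l)) (x - y) \<in> bdy n X A k" unfolding cmul_diff .
    then show "x - y \<in> pcyc p n X A k" unfolding pcyc_def using asub_diff[OF asc x(1) y(1)] by blast
  qed
  fix e x assume e: "e \<in> E" and "x \<in> pcyc p n X A k"
  then obtain m where x: "x \<in> cyc n X A k" "frag_cmul (int p ^ m) x \<in> bdy n X A k" unfolding pcyc_def by blast
  have "opr n F e x \<in> cyc n X A (Suc k)" "opr n F e (frag_cmul (int p ^ m) x) \<in> bdy n X A (Suc k)"
    using submod_act[OF c e x(1)] submod_act[OF b e x(2)] .
  then show "opr n F e x \<in> pcyc p n X A (Suc k)" unfolding pcyc_def by auto
qed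

section \<open>The homology modules of a graph and their torsion\<close>

context cw
begin

lemma cf_V: "cf V = {S. S \<subseteq> \<Union>E}"
  unfolding cf_def EU ..

text \<open>A 0-simplex is a configuration on the open edges. Remove one of its points; the rest is
  generated by induction, and by \<open>homotopic_stab_point\<close> the operator of the edge puts
  the point back up to a boundary. The generator is the empty configuration.\<close>

lemma cyc_0_generated:
  assumes "x \<in> cyc 0 UC (cf V) k"
  shows "mgen (opr 0 F) (bdy 0 UC (cf V)) (frag_of (restrict (\<lambda>_. {}) (standard_simplex 0))) E k x"
proof -
  let ?G = "mgen (opr 0 F) (bdy 0 UC (cf V)) (frag_of (restrict (\<lambda>_. {}) (standard_simplex 0))) E"
  define pt :: "'a set \<Rightarrow> (nat \<Rightarrow> real) \<Rightarrow> 'a set" where "pt S = restrict (\<lambda>_. S) (standard_simplex 0)" for S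
  have map: "chain_map 0 f (frag_of (pt S)) = frag_of (pt (f S))" for f S
  proof -
    have "restrict (f \<circ> restrict (\<lambda>_. S) A) A = restrict (\<lambda>_. f S) A" for A :: "(nat \<Rightarrow> real) set"
      by (rule restrict_ext) simp
    then show ?thesis by (simp add: simplex_map_def pt_def)
  qed
  have pts: "?G k (frag_of (pt S))" if "S \<in> topspace (UC k)" "S \<in> cf V" for S k
    using that
  proof (induction k arbitrary: S)
    case 0
    then have "S = {}" by (auto simp: topspace_uconf)
    then show ?case unfolding pt_def by (simp add: mgen_gen)
  next
    case (Suc k)
    have S: "S \<subseteq> \<Union>E" "finite S" "card S = Suc k" using Suc.prems by (auto simp: topspace_uconf cf_V)
    then obtain p where p: "p \<in> S" by (metis card.empty ex_in_conv nat.distinct(1))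
    then obtain e where e: "e \<in> E" "p \<in> e" using S by blast
    then obtain t where t: "0 < t" "t < 1" "p = c e t" using im[OF e(1)] by fastforce
    let ?S = "S - {p}"
    have S': "?S \<in> topspace (UC k)" "?S \<in> cf V" using S p Suc.prems by (auto simp: topspace_uconf cf_V)
    have h: "homotopic_with (\<lambda>_. True) (subtopology (UC k) {?S}) (subtopology (UC (Suc k)) (cf V)) (insert (c e t)) (F e)"
    proof (rule arc.homotopic_stab_point[OF arc[OF e(1)] S'(1) t(1,2)])
      show "c e t \<notin> ?S" using t by simp
      show "T \<in> cf V" if "T \<subseteq> ?S \<union> c e ` {0<..<1}" for T
        using that S'(2) e(1) unfolding im[OF e(1)] cf_V by blast
    qed
    have s: "frag_of (pt ?S) \<in> cyc 0 UC {?S} k"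
    proof -
      have "singular_simplex 0 (subtopology (UC k) {?S}) (pt ?S)"
        unfolding singular_simplex_def pt_def using S'(1)
        by (auto intro!: continuous_map_eq[OF continuous_map_const[THEN iffD2]] simp: continuous_map_const)
      then show ?thesis by (simp add: cyc_def singular_cycle singular_chain_of chain_boundary_def)
    qed
    have "frag_of (pt (F e ?S)) - frag_of (pt S) \<in> bdy 0 UC (cf V) (Suc k)"
      using homotopic_cyc[OF homotopic_with_symD[OF h] s] t(3) p by (simp only: map insert_Diff)
    then have 1: "?G (Suc k) (frag_of (pt (F e ?S)) - frag_of (pt S))"
      by (rule mgen_base[where B="bdy 0 UC (cf V)"])
    have 2: "?G (Suc k) (frag_of (pt (F e ?S)))"
      using mgen_act[OF Suc.IH[OF S'] e(1)] by (simp only: map)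
    have 3: "x - (x - y) = y" for x y :: "'a set chain" by simp
    show ?case using mgen_diff[OF 2 1] unfolding 3 .
  qed
  have "singular_chain 0 (subtopology (UC k) (cf V)) x" by (rule cyc_imp_chain[OF assms])
  then have "Poly_Mapping.keys x \<subseteq> singular_simplex_set 0 (subtopology (UC k) (cf V))" by (simp add: singular_chain_def)
  then show ?thesis
  proof (induction x rule: frag_induction)
    case zero
    have "asub (bdy 0 UC (cf V) k)" unfolding bdy_def by (rule asub_relboundary)
    then show ?case by (intro mgen_base asub_0)
  next
    case (one f)
    then have f: "singular_simplex 0 (subtopology (UC k) (cf V)) f" by simp
    define a :: "nat \<Rightarrow> real" where "a = (\<lambda>j. if j = 0 then 1 else 0)"
    have a: "standard_simplex 0 = {a}" unfolding a_def by (rule standard_simplex_0)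
    have "f \<in> extensional {a}" using f unfolding singular_simplex_def a by blast
    then have fpt: "f = pt (f a)" unfolding pt_def a by (intro extensionalityI[of f "{a}"]) auto
    have "f ` topspace (subtopology (powertop_real UNIV) {a}) \<subseteq> topspace (subtopology (UC k) (cf V))"
      using f unfolding singular_simplex_def a by (intro continuous_map_image_subset_topspace) blast
    then have "f a \<in> topspace (UC k) \<and> f a \<in> cf V" by simp
    then have "?G k (frag_of (pt (f a)))" using pts by blast
    then show ?case unfolding fpt[symmetric] .
  next
    case (diff a b) show ?case by (rule mgen_diff[OF diff])
  qed
qed

lemma opr_commute:
  assumes "e \<in> E" "e' \<in> E" "x \<in> cyc n UC A k"
  shows "opr n F e' (opr n F e x) = opr n F e (opr n F e' x)"
  by (rule opr_comm[where X=UC, OF cyc_imp_chain[OF assms(3)]]) (rule F_commute[OF assms(2,1) UC_finite])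

lemma noeth_base: "noeth (opr n F) E (cyc n UC (cf V)) (bdy n UC (cf V))"
proof (cases "n = 0")
  case False
  then have "cyc n UC (cf V) \<le> bdy n UC (cf V)" unfolding cf_V using cyc_open_edges[of n E] by (simp add: le_fun_def)
  then show ?thesis by (intro noeth_mono[OF noeth_refl order_refl])
next
  case True
  let ?g = "frag_of (restrict (\<lambda>_. {}) (standard_simplex 0)) :: 'a set chain"
  have acts: "acts E F UC (cf V)" by (rule acts_cf) simp
  have g: "?g \<in> cyc 0 UC (cf V) 0"
  proof -
    have "singular_simplex 0 (subtopology (UC 0) (cf V)) (restrict (\<lambda>_. {}) (standard_simplex 0))"
      unfolding singular_simplex_def
      by (auto intro!: continuous_map_eq[OF continuous_map_const[THEN iffD2]] simp: topspace_uconf cf_def)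
    then show ?thesis by (simp add: cyc_def singular_cycle singular_chain_of chain_boundary_def)
  qed
  have "noeth (opr 0 F) E (\<lambda>k. Collect (mgen (opr 0 F) (bdy 0 UC (cf V)) ?g E k)) (bdy 0 UC (cf V))"
  proof (rule noeth_cyclic[OF finE addf_chain_map submod_cyc[OF acts] submod_bdy[OF acts] bdy_le_cyc g])
    show "opr 0 F e' (opr 0 F e x) = opr 0 F e (opr 0 F e' x)" if "e \<in> E" "e' \<in> E" "x \<in> cyc 0 UC (cf V) k" for e e' k x
      by (rule opr_commute[OF that])
  qed
  then show ?thesis unfolding True by (rule noeth_mono[OF _ order_refl]) (use cyc_0_generated in \<open>auto simp: le_fun_def\<close>)
qed

context
  assumes ends: "\<And>v. v \<in> V \<Longrightarrow> edges_at v \<noteq> {}"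
begin

lemma noeth_cf: assumes "W \<subseteq> V" shows "noeth (opr n F) E (cyc n UC (cf W)) (bdy n UC (cf W))"
  using assms
proof (induction "card (V - W)" arbitrary: W n rule: less_induct)
  case less
  show ?case
  proof (cases "W = V")
    case False
    then obtain v where v: "v \<in> V - W" using less.prems by blast
    let ?W = "insert v W"
    have W: "?W \<subseteq> V" using v less.prems by blast
    have lt: "card (V - ?W) < card (V - W)" using v finV by (intro psubset_card_mono) auto
    \<comment> \<open>The hypothesis \<open>ends\<close> enters here: at an isolated vertex the
      closest point could not be pushed off.\<close>
    obtain h where h: "h \<in> halves v" using ends[of v] v edges_at_halves[of v] by auto
    have "noeth (opr (n - Suc 0) F) E (cyc (n - Suc 0) UC (Nv v W \<inter> cf ?W)) (bdy (n - Suc 0) UC (Nv v W \<inter> cf ?W))"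
      by (rule leaves.noeth_leaves[OF leaves[OF less.prems v] less.hyps[OF lt W]])
    then show ?thesis by (rule collar.noeth_collar[OF collar[OF less.prems v h] less.hyps[OF lt W]])
  qed (use noeth_base in simp)
qed

text \<open>The list is taken apart at its end because \<open>torskill_collar\<close> appends its
  pair, and \<open>pk\<close> applies the last pair last. So the last vertex of the list is the
  first one to be avoided.\<close>

lemma torskill_cf:
  assumes "W \<subseteq> V" "distinct ws" "set ws \<subseteq> V - W" "along edges_at ws qs"
  shows "torskill (length ws) F UC (cf W) qs"
  using assms
proof (induction ws arbitrary: W qs rule: rev_induct)
  case Nil
  then show ?case by (simp add: torskill_0)
next
  case (snoc v ws)
  then obtain qs' q where q: "qs = qs' @ [q]" "along edges_at ws qs'" "fst q \<in> edges_at v \<and> snd q \<in> edges_at v"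
    by (auto simp: list_all2_append1 list_all2_Cons1 case_prod_unfold)
  obtain e e' where ee: "q = (e, e')" "e \<in> edges_at v" "e' \<in> edges_at v" using q(3) by (cases q) auto
  have v: "v \<in> V - W" using snoc.prems by simp
  let ?W = "insert v W"
  obtain h where h: "h \<in> halves v" using ends[of v] v edges_at_halves[of v] by auto
  have "torskill (length ws) F UC (cf ?W) qs'"
    by (rule snoc.IH) (use snoc.prems q(2) in auto)
  then have "torskill (length ws) F UC (Nv v W \<inter> cf ?W) qs'"
    by (rule leaves.torskill_leaves[OF leaves[OF snoc.prems(1) v] q(2) edges_at_V])
  from collar.torskill_collar[OF collar[OF snoc.prems(1) v h] q(2) edges_at_V this _ _ homotopic_F[OF ee(2,3) snoc.prems(1) v]]
  show ?case using ee edges_at_V[of v] unfolding q(1) by auto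
qed

text \<open>Separates the algebra from the combinatorics of the graph: \<open>few\<close> asks for
  \<open>d\<close> edges that represent all edges once edges sharing a vertex of \<open>U\<close>
  are identified.\<close>

theorem card_torsion_polynomial:
  assumes p: "prime p" and Vs: "Vs \<subseteq> V"
    and few: "\<And>U. U \<subseteq> Vs \<Longrightarrow> card (Vs - U) < n \<Longrightarrow>
       \<exists>R\<subseteq>E. card R \<le> d \<and> (\<forall>e\<in>E. \<exists>r\<in>R. (e, r) \<in> (\<Union>u\<in>U. edges_at u \<times> edges_at u)\<^sup>*)"
  shows "\<exists>g. polyev d g \<and> (\<forall>k. card (torsion_part p (homology_group (int n) (unordered_config k \<Gamma>))) = p ^ g k)"
proof -
  let ?T = "pcyc p n UC (cf {})" and ?B = "bdy n UC (cf {})"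
  have acts: "acts E F UC (cf {})" by (rule acts_cf) simp
  note T = submod_pcyc[OF acts, of n p] and B = submod_bdy[OF acts, of n]
  have TC: "?T \<le> cyc n UC (cf {})" by (auto simp: pcyc_def le_fun_def)
  have BT: "?B \<le> ?T"
  proof (rule le_funI, rule subsetI)
    fix k x assume x: "x \<in> ?B k"
    have "frag_cmul (int p ^ 0) x \<in> ?B k" using x by simp
    then show "x \<in> ?T k" unfolding pcyc_def using le_gradedD[OF bdy_le_cyc x] by blast
  qed
  have noe: "noeth (opr n F) E ?T ?B" by (rule noeth_mono[OF noeth_cf[of "{}" n] order_refl TC]) simp
  have tors: "\<exists>m. frag_cmul (int p ^ m) x \<in> ?B k" if "x \<in> ?T k" for k x using that by (simp add: pcyc_def)
  have comm: "opr n F e' (opr n F e x) = opr n F e (opr n F e' x)" if "e \<in> E" "e' \<in> E" "x \<in> ?T k" for e e' k x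
    by (rule opr_commute[OF that(1,2) le_gradedD[OF TC that(3)]])
  have "polyev d (\<lambda>k. ell p (?T k) (?B k))"
  proof (rule polyev_of_killed[OF finE p addf_chain_map T B BT noe _ tors finite_subset[OF Vs finV] edges_at_V _ few])
    show "opr n F e' (opr n F e x) = opr n F e (opr n F e' x)" if "e \<in> E" "e' \<in> E" "x \<in> ?T k" for e e' k x
      by (rule comm[OF that])
    show "killed (opr n F) edges_at ws ?T ?B" if ws: "distinct ws" "set ws \<subseteq> Vs" "length ws = n" for ws
      unfolding killed_def
    proof (intro allI ballI impI)
      fix qs k x assume x: "x \<in> ?T k" and qs: "along edges_at ws qs"
      have "torskill n F UC (cf {}) qs" using torskill_cf[of "{}" ws qs] ws qs Vs by auto
      moreover obtain m where "frag_cmul (int p ^ m) x \<in> ?B k" using tors[OF x] by blast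
      moreover have "int p ^ m \<noteq> 0" using prime_gt_0_nat[OF p] by simp
      ultimately have "pk (opr n F) qs x \<in> ?B (k + length qs)"
        using le_gradedD[OF TC x] unfolding torskill_def by blast
      then show "pk (opr n F) qs x \<in> ?B (k + length ws)" using qs by (simp add: list_all2_lengthD)
    qed
  qed
  moreover have "card (torsion_part p (homology_group (int n) (unordered_config k \<Gamma>))) = p ^ ell p (?T k) (?B k)" for k
  proof -
    \<comment> \<open>Avoiding no vertex is no restriction, but \<open>cf {}\<close> and
      \<open>UNIV\<close> differ as sets.\<close>
    have t: "subtopology (UC k) (cf {}) = subtopology (UC k) UNIV" for k
      using subtopology_restrict[of "UC k" "cf {}"] UC_sub[of _ k] by (simp add: cf_def inf_absorb1 subset_iff)
    have eq: "?T k = pcyc p n UC UNIV k" "?B k = bdy n UC UNIV k" unfolding pcyc_def cyc_def bdy_def t by (rule refl)+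
    have "ppow p (?T k) (?B k)" by (rule noeth_imp_ppow[OF p T B BT noe tors])
    then show ?thesis using card_torsion_unordered_config[OF p, of n k \<Gamma>] card_quo unfolding eq by metis
  qed
  ultimately show ?thesis by blast
qed

end

end

section \<open>Valence\<close>

lemma connectedin_clopen:
  assumes "connectedin X C" "closedin X T" "openin X T" "C \<inter> T \<noteq> {}" shows "C \<subseteq> T"
proof (rule ccontr)
  assume n: "\<not> C \<subseteq> T"
  have C: "C \<subseteq> topspace X" using connectedin_subset_topspace[OF assms(1)] .
  have "openin X (topspace X - T)" using assms(2) by blast
  moreover have "C \<subseteq> T \<union> (topspace X - T)" "T \<inter> (topspace X - T) \<inter> C = {}" "(topspace X - T) \<inter> C \<noteq> {}" "T \<inter> C \<noteq> {}"
    using C n assms(4) by blast+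
  ultimately show False using assms(1,3) unfolding connectedin by blast
qed

lemma connected_components_of_partition:
  assumes cover: "topspace Y \<subseteq> (\<Union>h\<in>H. A h)" and dis: "\<And>h h'. h \<in> H \<Longrightarrow> h' \<in> H \<Longrightarrow> h \<noteq> h' \<Longrightarrow> A h \<inter> A h' = {}"
    and op: "\<And>h. h \<in> H \<Longrightarrow> openin Y (A h)" and con: "\<And>h. h \<in> H \<Longrightarrow> connectedin Y (A h)"
    and ne: "\<And>h. h \<in> H \<Longrightarrow> A h \<noteq> {}"
  shows "connected_components_of Y = A ` H"
proof -
  have sub: "A h \<subseteq> topspace Y" if "h \<in> H" for h using openin_subset[OF op[OF that]] .
  have clo: "closedin Y (A h)" if h: "h \<in> H" for h
  proof -
    have "topspace Y - A h = (\<Union>h'\<in>H - {h}. A h')"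
    proof
      show "topspace Y - A h \<subseteq> (\<Union>h'\<in>H - {h}. A h')" using cover by blast
      show "(\<Union>h'\<in>H - {h}. A h') \<subseteq> topspace Y - A h" using dis[OF h] sub by blast
    qed
    moreover have "openin Y (\<Union>h'\<in>H - {h}. A h')" using op by (intro openin_Union) auto
    ultimately show ?thesis using sub[OF h] by (simp add: closedin_def)
  qed
  have comp: "connected_component_of_set Y x = A h" if h: "h \<in> H" and x: "x \<in> A h" for h x
  proof
    show "A h \<subseteq> connected_component_of_set Y x" by (rule connected_component_of_maximal[OF con[OF h] x])
    have "x \<in> topspace Y" using sub[OF h] x by blast
    then have "x \<in> connected_component_of_set Y x" by (simp add: connected_component_of_refl)
    then show "connected_component_of_set Y x \<subseteq> A h"
      using connectedin_clopen[OF connectedin_connected_component_of clo[OF h] op[OF h]] x by blast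
  qed
  show ?thesis
  proof
    show "connected_components_of Y \<subseteq> A ` H"
      unfolding connected_components_of_def using comp cover by blast
    show "A ` H \<subseteq> connected_components_of Y"
    proof
      fix C assume "C \<in> A ` H"
      then obtain h x where "h \<in> H" "C = A h" "x \<in> A h" using ne by blast
      then show "C \<in> connected_components_of Y"
        unfolding connected_components_of_def using comp sub by blast
    qed
  qed
qed

context cw
begin

lemma dst_star':
  assumes v: "v \<in> V" and r: "0 < r" "r \<le> 1/3"
  shows "{p \<in> topspace \<Gamma>. dst v p < r} = insert v (\<Union>h\<in>halves v. hc h ` {0..<r})"
proof
  show "{p \<in> topspace \<Gamma>. dst v p < r} \<subseteq> insert v (\<Union>h\<in>halves v. hc h ` {0..<r})"
  proof
    fix p assume p: "p \<in> {p \<in> topspace \<Gamma>. dst v p < r}"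
    then have "p \<in> {p \<in> topspace \<Gamma>. dst v p < 1/3}" using r(2) by simp
    then have "p \<in> insert v (\<Union>h\<in>halves v. hc h ` {0..<1/3})" by (simp only: dst_star[OF v])
    then consider "p = v" | h t where "h \<in> halves v" "0 \<le> t" "t < 1/3" "p = hc h t" by auto
    then show "p \<in> insert v (\<Union>h\<in>halves v. hc h ` {0..<r})"
    proof cases
      case 2
      then have "t < r" using dst_hc[of h v t] p by simp
      then have "p \<in> hc h ` {0..<r}" using 2 by simp
      then show ?thesis using 2(1) by blast
    qed simp
  qed
  show "insert v (\<Union>h\<in>halves v. hc h ` {0..<r}) \<subseteq> {p \<in> topspace \<Gamma>. dst v p < r}"
  proof
    fix p assume "p \<in> insert v (\<Union>h\<in>halves v. hc h ` {0..<r})"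
    then consider "p = v" | h t where "h \<in> halves v" "0 \<le> t" "t < r" "p = hc h t" by auto
    then show "p \<in> {p \<in> topspace \<Gamma>. dst v p < r}"
    proof cases
      case 1 then show ?thesis using v VT r by (simp add: dst_self subset_iff)
    next
      case 2 then show ?thesis using dst_hc[of h v t] hc_top[of h v t] r by simp
    qed
  qed
qed

lemma open_star: "openin \<Gamma> {p \<in> topspace \<Gamma>. dst v p < r}"
  using openin_continuous_map_preimage[OF dst_continuous[of v], of "{..<r}"] by simp

lemma hc_connected: assumes "h \<in> halves v" "connected T" "T \<subseteq> {0..1}" shows "connectedin \<Gamma> (hc h ` T)"
  by (rule connectedin_continuous_map_image[OF hc_cont[OF assms(1)]]) (use assms in \<open>simp add: connectedin_subtopology\<close>)

lemma connected_star:
  assumes v: "v \<in> V" and r: "0 < r" "r \<le> 1/3" shows "connectedin \<Gamma> {p \<in> topspace \<Gamma>. dst v p < r}"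
proof -
  have "{p \<in> topspace \<Gamma>. dst v p < r} = \<Union>(insert {v} ((\<lambda>h. hc h ` {0..<r}) ` halves v))"
    unfolding dst_star'[OF assms] by auto
  moreover have "connectedin \<Gamma> (\<Union>(insert {v} ((\<lambda>h. hc h ` {0..<r}) ` halves v)))"
  proof (rule connectedin_Union)
    show "connectedin \<Gamma> S" if "S \<in> insert {v} ((\<lambda>h. hc h ` {0..<r}) ` halves v)" for S
    proof -
      have "connectedin \<Gamma> {v}" using v VT by auto
      moreover have "connectedin \<Gamma> (hc h ` {0..<r})" if "h \<in> halves v" for h
        by (rule hc_connected[OF that]) (use r in auto)
      ultimately show ?thesis using that by blast
    qed
    have "v \<in> hc h ` {0..<r}" if "h \<in> halves v" for h
      using halvesI(2)[OF that] r by (intro image_eqI[of _ _ 0]) auto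
    then show "\<Inter>(insert {v} ((\<lambda>h. hc h ` {0..<r}) ` halves v)) \<noteq> {}" by blast
  qed
  ultimately show ?thesis by (simp only:)
qed

text \<open>For any connected \<open>U\<close> in the star, the trace on each half-edge is an
  interval that starts at the centre. Hence the number of components off \<open>v\<close> does not
  depend on \<open>U\<close>.\<close>

lemma components_star:
  assumes v: "v \<in> V" and U: "openin \<Gamma> U" "connectedin \<Gamma> U" "v \<in> U" "U \<subseteq> {p \<in> topspace \<Gamma>. dst v p < 1/3}"
  shows "card (connected_components_of (subtopology \<Gamma> (U - {v}))) = card (halves v)"
proof -
  let ?A = "\<lambda>h. U \<inter> hc h ` {0<..<1/3}"
  have vA: "v \<notin> hc h ` {0<..<1/3}" if "h \<in> halves v" for h
    using dst_hc[OF that] dst_self[OF v] by force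
  have dis: "?A h \<inter> ?A h' = {}" if "h \<in> halves v" "h' \<in> halves v" "h \<noteq> h'" for h h'
  proof -
    have "hc h t \<noteq> hc h' t'" if "0 < t" "t < 1/3" "0 < t'" "t' < 1/3" for t t'
      using hc_inj[OF \<open>h \<in> halves v\<close> \<open>h' \<in> halves v\<close>, of t t'] that \<open>h \<noteq> h'\<close> by auto
    then show ?thesis by fastforce
  qed
  have ne: "?A h \<noteq> {}" if h: "h \<in> halves v" for h
  proof -
    have "openin (top_of_set {0..1}) {t \<in> {0..1}. hc h t \<in> U}"
      using openin_continuous_map_preimage[OF hc_cont[OF h] U(1)] by simp
    moreover have "0 \<in> {t \<in> {0..1}. hc h t \<in> U}" using halvesI(2)[OF h] U(3) by simp
    ultimately obtain \<epsilon> where \<epsilon>: "0 < \<epsilon>" "\<forall>t\<in>{0..1}. dist t 0 < \<epsilon> \<longrightarrow> t \<in> {t \<in> {0..1}. hc h t \<in> U}"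
      unfolding openin_euclidean_subtopology_iff by meson
    have "hc h (min (\<epsilon>/2) (1/4)) \<in> U" using \<epsilon> by (auto simp: dist_real_def)
    then have "hc h (min (\<epsilon>/2) (1/4)) \<in> ?A h" using \<epsilon>(1) by auto
    then show ?thesis by blast
  qed
  have con: "connectedin \<Gamma> (?A h)" if h: "h \<in> halves v" for h
  proof -
    define T where "T = {t \<in> {0<..<1/3}. hc h t \<in> U}"
    \<comment> \<open>A missing point \<open>t\<close> below \<open>s\<close> would separate
      \<open>U\<close> into the part beyond \<open>t\<close> on this half-edge and the rest, which
      contains \<open>v\<close>.\<close>
    have down: "t \<in> T" if s: "s \<in> T" and t: "0 < t" "t < s" for s t
    proof (rule ccontr)
      assume "t \<notin> T"
      then have tU: "hc h t \<notin> U" using s t by (auto simp: T_def)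
      let ?P = "hc h ` {t<..<1/3}" and ?Q = "topspace \<Gamma> - hc h ` {t..1/3}"
      have "openin \<Gamma> ?P" by (rule hc_open[OF h]) (use t in auto)
      moreover have "openin \<Gamma> ?Q" using hc_closed[OF h, of t "1/3"] t by (intro openin_diff) auto
      moreover have "U \<subseteq> ?P \<union> ?Q"
      proof
        fix p assume p: "p \<in> U"
        then have pt: "p \<in> topspace \<Gamma>" "dst v p < 1/3" using U(4) by auto
        show "p \<in> ?P \<union> ?Q"
        proof (cases "p \<in> hc h ` {t..1/3}")
          case True
          then obtain r where r: "p = hc h r" "t \<le> r" "r \<le> 1/3" by auto
          then have "r \<noteq> t" "r \<noteq> 1/3" using p tU pt(2) dst_hc[OF h, of r] t by auto
          then show ?thesis using r by simp
        qed (use pt in blast)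
      qed
      moreover have "?P \<inter> ?Q \<inter> U = {}" by auto
      moreover have "hc h s \<in> ?P \<inter> U" using s t by (auto simp: T_def)
      moreover have "v \<in> ?Q \<inter> U"
      proof -
        have "v \<notin> hc h ` {t..1/3}" using dst_hc[OF h] dst_self[OF v] t by force
        then show ?thesis using U(3) v VT by blast
      qed
      ultimately show False using U(2) unfolding connectedin by blast
    qed
    have "is_interval T" unfolding is_interval_1
    proof (intro ballI allI impI, elim conjE)
      fix a b x assume ab: "a \<in> T" "b \<in> T" "a \<le> x" "x \<le> b"
      show "x \<in> T"
      proof (cases "x = b")
        case False
        then show ?thesis using down[OF ab(2), of x] ab by (auto simp: T_def)
      qed (use ab in simp)
    qed
    then have "connected T" by (simp add: is_interval_connected)
    moreover have "T \<subseteq> {0..1}" by (auto simp: T_def)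
    moreover have "?A h = hc h ` T" by (auto simp: T_def)
    ultimately show ?thesis using hc_connected[OF h] by simp
  qed
  have "connected_components_of (subtopology \<Gamma> (U - {v})) = ?A ` halves v"
  proof (rule connected_components_of_partition)
    show "topspace (subtopology \<Gamma> (U - {v})) \<subseteq> (\<Union>h\<in>halves v. ?A h)"
    proof
      fix p assume p: "p \<in> topspace (subtopology \<Gamma> (U - {v}))"
      then have pU: "p \<in> U" "p \<noteq> v" by auto
      then have "p \<in> insert v (\<Union>h\<in>halves v. hc h ` {0..<1/3})" using U(4) unfolding dst_star[OF v] by blast
      then obtain h t where h: "h \<in> halves v" "p = hc h t" "0 \<le> t" "t < 1/3" using pU by auto
      then have "t \<noteq> 0" using halvesI(2)[OF h(1)] pU by auto
      then have "p \<in> ?A h" using h pU by simp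
      then show "p \<in> (\<Union>h\<in>halves v. ?A h)" using h(1) by blast
    qed
    fix h assume h: "h \<in> halves v"
    have sub: "?A h \<subseteq> U - {v}" using vA[OF h] by blast
    have "openin \<Gamma> (?A h)" by (intro openin_Int U(1) hc_open[OF h]) auto
    then show "openin (subtopology \<Gamma> (U - {v})) (?A h)" using openin_subtopology_Int[of \<Gamma> "?A h" "U - {v}"] sub by (simp add: Int_absorb2)
    show "connectedin (subtopology \<Gamma> (U - {v})) (?A h)" using con[OF h] sub by (simp add: connectedin_subtopology)
    show "?A h \<noteq> {}" by (rule ne[OF h])
  qed (rule dis)
  moreover have "inj_on ?A (halves v)"
  proof (rule inj_onI)
    show "h = h'" if "h \<in> halves v" "h' \<in> halves v" "?A h = ?A h'" for h h'
      using dis[OF that(1,2)] ne[OF that(1)] that(3) by (metis Int_absorb)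
  qed
  ultimately show ?thesis by (simp add: card_image)
qed

text \<open>There are finitely many half-edges, so the radii obtained on each of them have a
  positive minimum.\<close>

lemma small_star:
  assumes v: "v \<in> V" and N: "openin \<Gamma> N" "v \<in> N"
  obtains r where "0 < r" "r \<le> 1/3" "{p \<in> topspace \<Gamma>. dst v p < r} \<subseteq> N"
proof -
  have "\<exists>r>0. \<forall>t. 0 \<le> t \<and> t < r \<and> t \<le> 1 \<longrightarrow> hc h t \<in> N" if h: "h \<in> halves v" for h
  proof -
    have "openin (top_of_set {0..1}) {t \<in> {0..1}. hc h t \<in> N}"
      using openin_continuous_map_preimage[OF hc_cont[OF h] N(1)] by simp
    moreover have "0 \<in> {t \<in> {0..1}. hc h t \<in> N}" using halvesI(2)[OF h] N(2) by simp
    ultimately obtain \<epsilon> where \<epsilon>: "0 < \<epsilon>" "\<forall>t\<in>{0..1}. dist t 0 < \<epsilon> \<longrightarrow> t \<in> {t \<in> {0..1}. hc h t \<in> N}"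
      unfolding openin_euclidean_subtopology_iff by meson
    then show ?thesis by (intro exI[of _ \<epsilon>]) (auto simp: dist_real_def)
  qed
  then obtain r where r: "\<And>h. h \<in> halves v \<Longrightarrow> 0 < r h" "\<And>h t. h \<in> halves v \<Longrightarrow> 0 \<le> t \<Longrightarrow> t < r h \<Longrightarrow> t \<le> 1 \<Longrightarrow> hc h t \<in> N"
    by metis
  define \<rho> where "\<rho> = Min (insert (1/3) (r ` halves v))"
  have f: "finite (insert (1/3) (r ` halves v))" using finite_halves by simp
  have le: "\<rho> \<le> x" if "x \<in> insert (1/3) (r ` halves v)" for x unfolding \<rho>_def using Min_le[OF f that] .
  have "0 < \<rho>" unfolding \<rho>_def using f r(1) by (simp add: Min_gr_iff)
  then have \<rho>: "0 < \<rho>" "\<rho> \<le> 1/3" "\<And>h. h \<in> halves v \<Longrightarrow> \<rho> \<le> r h"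
    using le[OF insertI1] le[OF insertI2[OF imageI]] by simp_all
  have "{p \<in> topspace \<Gamma>. dst v p < \<rho>} \<subseteq> N"
    unfolding dst_star'[OF v \<rho>(1,2)]
  proof
    fix p assume "p \<in> insert v (\<Union>h\<in>halves v. hc h ` {0..<\<rho>})"
    then consider "p = v" | h t where "h \<in> halves v" "0 \<le> t" "t < \<rho>" "p = hc h t" by auto
    then show "p \<in> N"
    proof cases
      case 2
      then show ?thesis using r(2)[of h t] \<rho>(2) \<rho>(3)[of h] by simp
    qed (use N in simp)
  qed
  then show ?thesis using that \<rho> by blast
qed

text \<open>The star of radius 1/3 witnesses existence. For uniqueness, every competing
  neighbourhood contains a smaller star, which is connected and yields the same count.\<close>

lemma valence_eq: assumes v: "v \<in> V" shows "valence \<Gamma> v = card (halves v)"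
  unfolding valence_def
proof (rule the_equality)
  let ?S = "{p \<in> topspace \<Gamma>. dst v p < 1/3}"
  have vS: "v \<in> ?S" using v VT by (auto simp: dst_self)
  show "\<exists>N. openin \<Gamma> N \<and> v \<in> N \<and> (\<forall>U. openin \<Gamma> U \<and> connectedin \<Gamma> U \<and> v \<in> U \<and> U \<subseteq> N \<longrightarrow>
      card (connected_components_of (subtopology \<Gamma> (U - {v}))) = card (halves v))"
  proof (intro exI[of _ ?S] conjI allI impI)
    show "card (connected_components_of (subtopology \<Gamma> (U - {v}))) = card (halves v)"
      if "openin \<Gamma> U \<and> connectedin \<Gamma> U \<and> v \<in> U \<and> U \<subseteq> ?S" for U
      using components_star[OF v] that by blast
  qed (rule open_star vS)+
  fix d assume "\<exists>N. openin \<Gamma> N \<and> v \<in> N \<and> (\<forall>U. openin \<Gamma> U \<and> connectedin \<Gamma> U \<and> v \<in> U \<and> U \<subseteq> N \<longrightarrow>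
      card (connected_components_of (subtopology \<Gamma> (U - {v}))) = d)"
  then obtain N where N: "openin \<Gamma> N" "v \<in> N"
    "\<And>U. openin \<Gamma> U \<Longrightarrow> connectedin \<Gamma> U \<Longrightarrow> v \<in> U \<Longrightarrow> U \<subseteq> N \<Longrightarrow> card (connected_components_of (subtopology \<Gamma> (U - {v}))) = d"
    by blast
  \<comment> \<open>This star is an admissible \<open>U\<close> both for the given \<open>N\<close>
    and for \<open>components_star\<close>, so it forces \<open>d\<close>.\<close>
  obtain r where r: "0 < r" "r \<le> 1/3" "{p \<in> topspace \<Gamma>. dst v p < r} \<subseteq> N" by (rule small_star[OF v N(1,2)])
  let ?U = "{p \<in> topspace \<Gamma>. dst v p < r}"
  have U: "openin \<Gamma> ?U" "connectedin \<Gamma> ?U" "v \<in> ?U" "?U \<subseteq> ?S"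
    using open_star connected_star[OF v r(1,2)] v VT r by (auto simp: dst_self)
  show "d = card (halves v)" using N(3)[OF U(1-3) r(3)] components_star[OF v U] by simp
qed

end

section \<open>Removing bivalent vertices\<close>

context cw
begin

lemma clopen_by_edges:
  assumes K: "K \<subseteq> topspace \<Gamma>" and e: "\<And>e. e \<in> E \<Longrightarrow> (\<forall>t\<in>{0..1}. c e t \<in> K) \<or> (\<forall>t\<in>{0..1}. c e t \<notin> K)"
  shows "openin \<Gamma> K" "closedin \<Gamma> K"
proof -
  have cl: "closed {t \<in> {0..1}. c e t \<in> K} \<and> closed {t \<in> {0..1}. c e t \<in> topspace \<Gamma> - K}" if "e \<in> E" for e
    using e[OF that]
  proof
    assume a: "\<forall>t\<in>{0..1}. c e t \<in> K"
    then have "{t \<in> {0..1}. c e t \<in> K} = {0..1}" "{t \<in> {0..1}. c e t \<in> topspace \<Gamma> - K} = {}" by auto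
    then show ?thesis by (simp only: closed_atLeastAtMost closed_empty simp_thms)
  next
    assume a: "\<forall>t\<in>{0..1}. c e t \<notin> K"
    then have "{t \<in> {0..1}. c e t \<in> K} = {}" "{t \<in> {0..1}. c e t \<in> topspace \<Gamma> - K} = {0..1}" using c_top[OF that] by auto
    then show ?thesis by (simp only: closed_atLeastAtMost closed_empty simp_thms)
  qed
  show "closedin \<Gamma> K" by (rule closed_by_edges[OF K]) (use cl in blast)
  have "closedin \<Gamma> (topspace \<Gamma> - K)" by (rule closed_by_edges) (use cl in blast)+
  then show "openin \<Gamma> K" using K by (simp add: openin_closedin_eq)
qed

lemma connected_clopen:
  assumes "connected_space \<Gamma>" "K \<subseteq> topspace \<Gamma>" "K \<noteq> {}"
    "\<And>e. e \<in> E \<Longrightarrow> (\<forall>t\<in>{0..1}. c e t \<in> K) \<or> (\<forall>t\<in>{0..1}. c e t \<notin> K)"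
  shows "K = topspace \<Gamma>"
  using clopen_by_edges[OF assms(2,4)] assms(1,3) unfolding connected_space_clopen_in by blast

lemma edge_point: "e \<in> E \<Longrightarrow> e' \<in> E \<Longrightarrow> 0 < t \<Longrightarrow> t < 1 \<Longrightarrow> c e t \<in> e' \<longleftrightarrow> e = e'"
  using c_in[of e t] disj[of e e'] by blast

text \<open>The two edges at \<open>v\<close> are glued through \<open>v\<close> to a single one.
  That they are different edges ensures that the new edge is an arc whose ends are vertices other
  than \<open>v\<close>.\<close>

lemma merge:
  assumes v: "v \<in> V" and h: "halves v = {h1, h2}" "fst h1 \<noteq> fst h2"
  shows "\<exists>E' c'. cw \<Gamma> (V - {v}) E' c'"
proof -
  have h12: "h1 \<in> halves v" "h2 \<in> halves v" using h by auto
  let ?e1 = "fst h1" and ?e2 = "fst h2"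
  have eE: "?e1 \<in> E" "?e2 \<in> E" using halvesI(1) h12 by auto
  define e0 where "e0 = insert v (?e1 \<union> ?e2)"
  let ?E = "insert e0 (E - {?e1, ?e2})"
  \<comment> \<open>Runs along the first half-edge towards \<open>v\<close>, reaches
    \<open>v\<close> at 1/2, and leaves along the second.\<close>
  define g where "g t = (if t \<le> 1/2 then hc h1 (1 - 2 * t) else hc h2 (2 * t - 1))" for t :: real
  define c' where "c' e = (if e = e0 then g else c e)" for e
  have v0: "hc h1 0 = v" "hc h2 0 = v" using halvesI(2) h12 by auto
  have vE: "v \<notin> e" if "e \<in> E" for e using edge_V[OF that] v by blast
  \<comment> \<open>If the far end were \<open>v\<close>, the reversed half-edge would also start at
    \<open>v\<close>, hence be one of \<open>h1\<close> and \<open>h2\<close>, against the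
    assumption that these lie on different edges.\<close>
  have far: "hc h 1 \<in> V - {v}" if "h \<in> {h1, h2}" for h
  proof -
    obtain e b where eb: "h = (e, b)" by force
    have e: "e \<in> E" using eb eE that by auto
    have "hc h 1 = hc (e, \<not> b) 0" using eb by (simp add: hc_def)
    moreover have "hc (e, \<not> b) 0 \<in> V" using c0[OF e] c1[OF e] by (simp add: hc_def)
    moreover have "hc (e, \<not> b) 0 \<noteq> v"
    proof
      assume "hc (e, \<not> b) 0 = v"
      then have "(e, \<not> b) \<in> {h1, h2}" using e h(1) by (auto simp: halves_def)
      then show False using that eb h(2) by auto
    qed
    ultimately show ?thesis by simp
  qed
  have hin: "hc h t \<in> fst h" if "h \<in> {h1, h2}" "0 < t" "t < 1" for h t
    using hc_in[of h v t] that h12 by auto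
  have g_half: "g (1/2) = v" by (simp add: g_def v0)
  have g_left: "g ((1 - t) / 2) = hc h1 t" and g_right: "g ((1 + t) / 2) = hc h2 t" if "0 < t" for t
  proof -
    have "1 - 2 * ((1 - t) / 2) = t" "2 * ((1 + t) / 2) - 1 = t" by (simp_all add: field_simps)
    then show "g ((1 - t) / 2) = hc h1 t" "g ((1 + t) / 2) = hc h2 t" using that by (simp_all only: g_def) auto
  qed
  have g_cont: "continuous_map (top_of_set {0..1}) \<Gamma> g"
    unfolding g_def
  proof (rule continuous_map_cases_le)
    have *: "continuous_map (subtopology (top_of_set {0..1}) A) \<Gamma> (\<lambda>t. hc h (f t))"
      if "h \<in> halves v" "continuous_on UNIV f" "\<And>t. t \<in> {0..1} \<inter> A \<Longrightarrow> f t \<in> {0..1}" for h f and A :: "real set"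
    proof -
      have "continuous_map (subtopology (top_of_set {0..1}) A) (top_of_set {0..1}) f"
        using that(2,3) by (auto simp: continuous_map_in_subtopology subtopology_subtopology intro: continuous_on_subset)
      from continuous_map_compose[OF this hc_cont[OF that(1)]] show ?thesis by (simp add: o_def)
    qed
    show "continuous_map (subtopology (top_of_set {0..1}) {x \<in> topspace (top_of_set {0..1}). x \<le> 1/2}) \<Gamma> (\<lambda>t. hc h1 (1 - 2 * t))"
      by (rule *[OF h12(1)]) (auto intro!: continuous_intros)
    show "continuous_map (subtopology (top_of_set {0..1}) {x \<in> topspace (top_of_set {0..1}). 1/2 \<le> x}) \<Gamma> (\<lambda>t. hc h2 (2 * t - 1))"
      by (rule *[OF h12(2)]) (auto intro!: continuous_intros)
    show "hc h1 (1 - 2 * t) = hc h2 (2 * t - 1)" if "t = 1/2" for t unfolding that using v0 by simp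
  qed auto
  have g_im: "g ` {0<..<1} = e0"
    unfolding e0_def
  proof
    show "g ` {0<..<1} \<subseteq> insert v (?e1 \<union> ?e2)"
    proof
      fix p assume "p \<in> g ` {0<..<1}"
      then obtain t where t: "p = g t" "0 < t" "t < 1" by auto
      consider "t < 1/2" | "t = 1/2" | "1/2 < t" by linarith
      then show "p \<in> insert v (?e1 \<union> ?e2)"
      proof cases
        case 2 then show ?thesis unfolding t(1) 2 g_half by simp
      qed (use t hin[of h1 "1 - 2 * t"] hin[of h2 "2 * t - 1"] in \<open>auto simp: g_def\<close>)
    qed
    have ex: "\<exists>t. 0 < t \<and> t < 1 \<and> p = hc h t" if hp: "h \<in> {h1, h2}" "p \<in> fst h" for h p
    proof -
      have "fst h \<in> E" using hp(1) eE by auto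
      then have "p \<in> c (fst h) ` {0<..<1}" using im[of "fst h"] hp(2) by simp
      then obtain t where t: "0 < t" "t < 1" "p = c (fst h) t" by auto
      then show ?thesis by (intro exI[of _ "if snd h then 1 - t else t"]) (auto simp: hc_def)
    qed
    show "insert v (?e1 \<union> ?e2) \<subseteq> g ` {0<..<1}"
    proof
      fix p assume "p \<in> insert v (?e1 \<union> ?e2)"
      then consider "p = v" | "p \<in> ?e1" | "p \<in> ?e2" by blast
      then show "p \<in> g ` {0<..<1}"
      proof cases
        case 1
        then show ?thesis using g_half by (intro image_eqI[of _ _ "1/2"]) auto
      next
        case 2
        then obtain t where "0 < t" "t < 1" "p = hc h1 t" using ex[of h1 p] by auto
        then show ?thesis using g_left[of t] by (intro image_eqI[of _ _ "(1 - t) / 2"]) auto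
      next
        case 3
        then obtain t where "0 < t" "t < 1" "p = hc h2 t" using ex[of h2 p] by auto
        then show ?thesis using g_right[of t] by (intro image_eqI[of _ _ "(1 + t) / 2"]) auto
      qed
    qed
  qed
  have hinj: "t = s" if "h \<in> {h1, h2}" "0 < t" "t < 1" "0 < s" "s < 1" "hc h t = hc h s" for h t s
  proof -
    have "fst h \<in> E" using that(1) eE by auto
    from c_eq[OF this this, of "if snd h then 1 - t else t" "if snd h then 1 - s else s"] show ?thesis
      using that by (auto simp: hc_def split: if_splits)
  qed
  have e12: "?e1 \<inter> ?e2 = {}" by (rule disj[OF eE h(2)])
  have g_inj: "inj_on g {0<..<1}"
  proof (rule linorder_inj_onI)
    fix t s :: real assume ts: "t < s" "t \<in> {0<..<1}" "s \<in> {0<..<1}"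
    show "g t \<noteq> g s"
    proof
      assume eq: "g t = g s"
      consider "s < 1/2" | "1/2 < t" | "t < 1/2" "1/2 < s" | "t = 1/2" "1/2 < s" | "t < 1/2" "s = 1/2" using ts by linarith
      then show False
      proof cases
        case 1 then show ?thesis using hinj[of h1 "1 - 2 * t" "1 - 2 * s"] ts eq by (simp add: g_def)
      next
        case 2 then show ?thesis using hinj[of h2 "2 * t - 1" "2 * s - 1"] ts eq by (simp add: g_def)
      next
        case 3 then show ?thesis using hin[of h1 "1 - 2 * t"] hin[of h2 "2 * s - 1"] ts eq e12 by (auto simp: g_def)
      next
        case 4
        then have "g s \<in> fst h2" using hin[of h2 "2 * s - 1"] ts by (simp add: g_def)
        then show ?thesis using eq 4(1) g_half vE[OF eE(2)] by simp
      next
        case 5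
        then have "g t \<in> fst h1" using hin[of h1 "1 - 2 * t"] ts by (simp add: g_def)
        then show ?thesis using eq 5(2) g_half vE[OF eE(1)] by simp
      qed
    qed
  qed (simp add: linear)
  have c': "P e (c' e)" if "P e0 g" "\<And>e. e \<in> E - {?e1, ?e2} \<Longrightarrow> P e (c e)" "e \<in> ?E" for P e
  proof (cases "e = e0")
    case False
    then have "e \<in> E - {?e1, ?e2}" using that(3) by blast
    then show ?thesis using that(2) False by (simp add: c'_def)
  qed (use that(1) in \<open>simp add: c'_def\<close>)
  have "cw \<Gamma> (V - {v}) ?E c'"
  proof
    have "\<Union>?E = insert v (\<Union>E)" unfolding e0_def using eE by blast
    also have "\<dots> = topspace \<Gamma> - (V - {v})" unfolding EU using v VT by blast
    finally show "\<Union>?E = topspace \<Gamma> - (V - {v})" .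
    have old: "e \<inter> e0 = {}" if "e \<in> E - {?e1, ?e2}" for e
      using that disj[of e ?e1] disj[of e ?e2] eE vE[of e] unfolding e0_def by blast
    show "e \<inter> e' = {}" if e: "e \<in> ?E" "e' \<in> ?E" "e \<noteq> e'" for e e'
    proof -
      consider "e = e0" "e' \<in> E - {?e1, ?e2}" | "e' = e0" "e \<in> E - {?e1, ?e2}" | "e \<in> E" "e' \<in> E" using e by blast
      then show ?thesis
      proof cases
        case 1 show ?thesis unfolding 1(1) using old[OF 1(2)] by (simp only: Int_commute)
      next
        case 2 show ?thesis unfolding 2(1) using old[OF 2(2)] .
      next
        case 3 show ?thesis by (rule disj[OF 3 e(3)])
      qed
    qed
    fix e assume e: "e \<in> ?E"
    show "continuous_map (top_of_set {0..1}) \<Gamma> (c' e)"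
      by (rule c'[of "\<lambda>_ c. continuous_map (top_of_set {0..1}) \<Gamma> c", OF g_cont _ e]) (use cont in blast)
    show "inj_on (c' e) {0<..<1}" by (rule c'[of "\<lambda>_ c. inj_on c {0<..<1}", OF g_inj _ e]) (use inj in blast)
    show "c' e ` {0<..<1} = e" by (rule c'[of "\<lambda>e c. c ` {0<..<1} = e", OF g_im _ e]) (use im in blast)
    have old_end: "c e 0 \<in> V - {v}" "c e 1 \<in> V - {v}" if "e \<in> E - {?e1, ?e2}" for e
    proof -
      have "(e, False) \<notin> halves v" "(e, True) \<notin> halves v" using that unfolding h(1) by auto
      then have "c e 0 \<noteq> v \<and> c e 1 \<noteq> v" using that by (auto simp: halves_def hc_def)
      then show "c e 0 \<in> V - {v}" "c e 1 \<in> V - {v}" using that c0[of e] c1[of e] by blast+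
    qed
    have new_end: "g 0 \<in> V - {v}" "g 1 \<in> V - {v}" using far[of h1] far[of h2] by (simp_all add: g_def)
    show "c' e 0 \<in> V - {v}" by (rule c'[of "\<lambda>_ c. c 0 \<in> V - {v}", OF new_end(1) old_end(1) e])
    show "c' e 1 \<in> V - {v}" by (rule c'[of "\<lambda>_ c. c 1 \<in> V - {v}", OF new_end(2) old_end(2) e])
  qed (use haus finV finE VT in auto)
  then show ?thesis by blast
qed

text \<open>If both half-edges at \<open>v\<close> belong to one loop, this loop is open and closed,
  hence everything.\<close>

lemma circle:
  assumes con: "connected_space \<Gamma>" and v: "v \<in> V" and h: "halves v = {h1, h2}" "h1 \<noteq> h2" "fst h1 = fst h2"
  shows "V = {v}"
proof -
  let ?e = "fst h1"
  have e: "?e \<in> E" using halvesI(1)[of h1 v] h by simp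
  obtain b b' where hb: "h1 = (?e, b)" "h2 = (?e, b')" using h(3) by (metis prod.collapse)
  have "b \<noteq> b'"
  proof
    assume "b = b'"
    then have "(?e, b) = (?e, b')" by simp
    from h(2) trans[OF trans[OF hb(1) this] hb(2)[symmetric]] show False by (rule notE)
  qed
  then have "{b, b'} = {False, True}" by auto
  then have "Pair ?e ` {b, b'} = Pair ?e ` {False, True}" by (rule arg_cong)
  moreover have "Pair ?e ` {b, b'} = halves v" unfolding h(1) using hb by (simp only: image_insert image_empty)
  ultimately have hv: "halves v = {(?e, False), (?e, True)}" by simp
  have "(?e, False) \<in> halves v" "(?e, True) \<in> halves v" unfolding hv by simp_all
  then have ends: "c ?e 0 = v" "c ?e 1 = v" unfolding halves_def hc_def by simp_all
  have "insert v ?e = topspace \<Gamma>"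
  proof (rule connected_clopen[OF con])
    show "insert v ?e \<subseteq> topspace \<Gamma>" using v VT EU e by blast
    fix e' assume e': "e' \<in> E"
    show "(\<forall>t\<in>{0..1}. c e' t \<in> insert v ?e) \<or> (\<forall>t\<in>{0..1}. c e' t \<notin> insert v ?e)"
    proof (cases "e' = ?e")
      case True
      have "c ?e t \<in> insert v ?e" if "0 \<le> t" "t \<le> 1" for t
        using that ends c_in[OF e, of t] by (cases "t = 0 \<or> t = 1") auto
      then show ?thesis using True by auto
    next
      case False
      then have "(e', False) \<notin> halves v" "(e', True) \<notin> halves v" using hv by auto
      then have n: "c e' 0 \<noteq> v" "c e' 1 \<noteq> v" using e' by (auto simp: halves_def hc_def)
      have "c e' t \<notin> insert v ?e" if "0 \<le> t" "t \<le> 1" for t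
      proof (cases "t = 0 \<or> t = 1")
        case True
        then have "c e' t \<in> V" "c e' t \<noteq> v" using n c0[OF e'] c1[OF e'] by auto
        then show ?thesis using edge_V[OF e] by auto
      next
        case f: False
        then show ?thesis using that edge_point[OF e' e, of t] False c_notV[OF e', of t] v by auto
      qed
      then show ?thesis by auto
    qed
  qed simp
  then show ?thesis using VT v edge_V[OF e] by blast
qed

end

text \<open>The valence depends on the topology and not on the cell structure, so merging edges
  leaves the essential vertices as they are. The circle, whose last bivalent vertex cannot be
  removed, is excluded by the essential vertex \<open>w\<close>.\<close>

lemma no_bivalent:
  assumes "cw \<Gamma> V E c" "connected_space \<Gamma>" "w \<in> V" "3 \<le> valence \<Gamma> w"
  shows "\<exists>V' E' c'. cw \<Gamma> V' E' c' \<and> (\<forall>v\<in>V'. valence \<Gamma> v \<noteq> 2) \<and> {v \<in> V'. 3 \<le> valence \<Gamma> v} = {v \<in> V. 3 \<le> valence \<Gamma> v}"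
  using assms
proof (induction "card V" arbitrary: V E c rule: less_induct)
  case less
  interpret cw \<Gamma> V E c by (rule less.prems(1))
  show ?case
  proof (cases "\<forall>v\<in>V. valence \<Gamma> v \<noteq> 2")
    case True then show ?thesis using less.prems(1) by blast
  next
    case False
    then obtain v where v: "v \<in> V" "valence \<Gamma> v = 2" by blast
    then obtain h1 h2 where h: "halves v = {h1, h2}" "h1 \<noteq> h2" using valence_eq[OF v(1)] by (auto simp: card_2_iff)
    have ne: "fst h1 \<noteq> fst h2" using circle[OF less.prems(2) v(1) h] less.prems(3,4) v(2) by auto
    obtain E' c' where cw': "cw \<Gamma> (V - {v}) E' c'" using merge[OF v(1) h(1) ne] by blast
    have lt: "card (V - {v}) < card V" using v(1) finV by (meson card_Diff1_less)
    have w: "w \<in> V - {v}" using less.prems(3,4) v(2) by auto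
    have "{u \<in> V - {v}. 3 \<le> valence \<Gamma> u} = {u \<in> V. 3 \<le> valence \<Gamma> u}" using v(2) by auto
    then show ?thesis using less.hyps[OF lt cw' less.prems(2) w less.prems(4)] by simp
  qed
qed

section \<open>Counting components\<close>

text \<open>The equivalence relation on edges generated by sharing a vertex of \<open>U\<close>; on
  the quotients in the filtration, operators of linked edges coincide.\<close>

definition linked :: "('v \<Rightarrow> 'e set) \<Rightarrow> 'v set \<Rightarrow> ('e \<times> 'e) set" where
  "linked inc U = (\<Union>u\<in>U. inc u \<times> inc u)\<^sup>*"

lemma linked_step: "u \<in> U \<Longrightarrow> e \<in> inc u \<Longrightarrow> e' \<in> inc u \<Longrightarrow> (e, e') \<in> linked inc U"
  unfolding linked_def by (rule r_into_rtrancl) blast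

lemma linked_refl: "(e, e) \<in> linked inc U"
  by (simp add: linked_def)

lemma linked_trans: "(e, e') \<in> linked inc U \<Longrightarrow> (e', e'') \<in> linked inc U \<Longrightarrow> (e, e'') \<in> linked inc U"
  unfolding linked_def by (rule rtrancl_trans)

lemma linked_mono: "U \<subseteq> U' \<Longrightarrow> linked inc U \<subseteq> linked inc U'"
  unfolding linked_def by (rule rtrancl_mono) blast

lemma linked_sym: "(e, e') \<in> linked inc U \<Longrightarrow> (e', e) \<in> linked inc U"
proof -
  have "sym (\<Union>u\<in>U. inc u \<times> inc u)" by (auto simp: sym_def)
  then show "(e, e') \<in> linked inc U \<Longrightarrow> (e', e) \<in> linked inc U"
    unfolding linked_def using sym_rtrancl by (metis symD)
qed

lemma linked_isolated:
  assumes "(g, f) \<in> linked inc U" "\<And>u. u \<in> U \<Longrightarrow> f \<notin> inc u" shows "g = f"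
  using assms(1) unfolding linked_def by (cases rule: rtranclE) (use assms(2) in auto)

context cw
begin

lemma edges_at_ends: "e \<in> E \<Longrightarrow> e \<in> edges_at (c e 0)" "e \<in> E \<Longrightarrow> e \<in> edges_at (c e 1)"
  by (auto simp: edges_at_def)

context
  fixes Vs :: "'a set"
  assumes con: "connected_space \<Gamma>" and Vs: "Vs \<subseteq> V"
    and ends: "\<And>v. v \<in> V \<Longrightarrow> edges_at v \<noteq> {}"
    and leafs: "\<And>v e e'. v \<in> V - Vs \<Longrightarrow> e \<in> edges_at v \<Longrightarrow> e' \<in> edges_at v \<Longrightarrow> e = e'"
begin

text \<open>The part of the complement of \<open>W\<close> that can be reached from
  \<open>e\<close>. Vertices outside \<open>Vs\<close> have one edge only, so links through
  \<open>Vs - W\<close> already give everything.\<close>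

definition clus :: "'a set \<Rightarrow> 'a set \<Rightarrow> 'a set" where
  "clus W e = \<Union>{e' \<in> E. (e, e') \<in> linked edges_at (Vs - W)} \<union>
     {v \<in> V - W. \<exists>e'\<in>edges_at v. (e, e') \<in> linked edges_at (Vs - W)}"

lemma clus_edge:
  assumes e': "e' \<in> E" and t: "0 < t" "t < 1"
  shows "c e' t \<in> clus W e \<longleftrightarrow> (e, e') \<in> linked edges_at (Vs - W)"
proof -
  have "c e' t \<in> e'' \<longleftrightarrow> e' = e''" if "e'' \<in> E" for e'' by (rule edge_point[OF e' that t])
  then show ?thesis unfolding clus_def using c_notV[OF e' t] e' by blast
qed

lemma clus_vertex:
  assumes v: "v \<in> V" and e': "e' \<in> edges_at v"
  shows "v \<in> clus W e \<longleftrightarrow> v \<notin> W \<and> (e, e') \<in> linked edges_at (Vs - W)"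
proof -
  have "v \<notin> e''" if "e'' \<in> E" for e'' using edge_V[OF that] v by blast
  then have "v \<in> clus W e \<longleftrightarrow> v \<notin> W \<and> (\<exists>e''\<in>edges_at v. (e, e'') \<in> linked edges_at (Vs - W))"
    unfolding clus_def using v by blast
  moreover have "(e, e') \<in> linked edges_at (Vs - W)"
    if "v \<notin> W" "e'' \<in> edges_at v" "(e, e'') \<in> linked edges_at (Vs - W)" for e''
  proof (cases "v \<in> Vs")
    case True
    then have "v \<in> Vs - W" using that(1) by blast
    from linked_step[of v "Vs - W" e'' edges_at e', OF this that(2) e'] show ?thesis
      by (rule linked_trans[OF that(3)])
  next
    case False
    then show ?thesis using leafs[OF _ that(2) e'] v that(3) by blast
  qed
  ultimately show ?thesis using e' by blast
qed

lemma clus_end: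
  assumes e': "e' \<in> E" and t: "t = 0 \<or> t = 1"
  shows "c e' t \<in> clus W e \<longleftrightarrow> c e' t \<notin> W \<and> (e, e') \<in> linked edges_at (Vs - W)"
  using clus_vertex[of "c e' t" e' W e] t c0[OF e'] c1[OF e'] edges_at_ends[OF e'] by auto

text \<open>Checked edge by edge: a linked edge lies in the cluster except possibly for ends in
  \<open>W\<close>, and any other edge misses it entirely.\<close>

lemma clus_clopen:
  assumes W: "W \<subseteq> Vs"
  shows "openin (subtopology \<Gamma> (topspace \<Gamma> - W)) (clus W e)" "closedin (subtopology \<Gamma> (topspace \<Gamma> - W)) (clus W e)"
proof -
  let ?L = "linked edges_at (Vs - W)"
  have WV: "W \<subseteq> V" using W Vs by blast
  have sub: "clus W e \<subseteq> topspace \<Gamma> - W"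
  proof -
    have "e' \<subseteq> topspace \<Gamma> - W" if "e' \<in> E" for e' using EU edge_V[OF that] WV that by blast
    then show ?thesis unfolding clus_def using VT by blast
  qed
  have "closedin \<Gamma> (topspace \<Gamma> - clus W e)"
  proof (rule closed_by_edges)
    fix e' assume e': "e' \<in> E"
    show "closed {t \<in> {0..1}. c e' t \<in> topspace \<Gamma> - clus W e}"
    proof (cases "(e, e') \<in> ?L")
      case True
      have "{t \<in> {0..1}. c e' t \<in> topspace \<Gamma> - clus W e} \<subseteq> {0, 1}"
        using clus_edge[OF e', of _ W e] True by (force simp: less_le)
      then show ?thesis by (meson finite.emptyI finite.insertI finite_imp_closed finite_subset)
    next
      case False
      have "c e' t \<in> topspace \<Gamma> - clus W e" if "t \<in> {0..1}" for t
      proof (cases "t = 0 \<or> t = 1")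
        case True then show ?thesis using clus_end[OF e' True] False c_top[OF e', of t] that by auto
      next
        case f: False then show ?thesis using clus_edge[OF e', of t W e] False c_top[OF e', of t] that by auto
      qed
      then have "{t \<in> {0..1}. c e' t \<in> topspace \<Gamma> - clus W e} = {0..1}" by blast
      then show ?thesis by (simp only: closed_atLeastAtMost)
    qed
  qed blast
  then have op: "openin \<Gamma> (clus W e)" using sub by (metis Diff_subset openin_closedin_eq order_trans)
  show "openin (subtopology \<Gamma> (topspace \<Gamma> - W)) (clus W e)"
    using openin_subtopology_Int[OF op, of "topspace \<Gamma> - W"] sub by (simp add: Int_absorb2)
  have cl: "closedin \<Gamma> (clus W e \<union> W)"
  proof (rule closed_by_edges)
    show "clus W e \<union> W \<subseteq> topspace \<Gamma>" using sub WV VT by blast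
    fix e' assume e': "e' \<in> E"
    show "closed {t \<in> {0..1}. c e' t \<in> clus W e \<union> W}"
    proof (cases "(e, e') \<in> ?L")
      case True
      have "c e' t \<in> clus W e \<union> W" if "t \<in> {0..1}" for t
      proof (cases "t = 0 \<or> t = 1")
        case t: True then show ?thesis using clus_end[OF e' t] True by auto
      next
        case False then show ?thesis using clus_edge[OF e', of t W e] True that by auto
      qed
      then have "{t \<in> {0..1}. c e' t \<in> clus W e \<union> W} = {0..1}" by blast
      then show ?thesis by (simp only: closed_atLeastAtMost)
    next
      case False
      have "t = 0 \<or> t = 1" if "t \<in> {0..1}" "c e' t \<in> clus W e \<union> W" for t
      proof (rule ccontr)
        assume "\<not> (t = 0 \<or> t = 1)"
        then have t: "0 < t" "t < 1" using that(1) by auto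
        then show False using clus_edge[OF e' t] False that(2) c_notV[OF e' t] WV by blast
      qed
      then have "{t \<in> {0..1}. c e' t \<in> clus W e \<union> W} \<subseteq> {0, 1}" by blast
      then show ?thesis by (meson finite.emptyI finite.insertI finite_imp_closed finite_subset)
    qed
  qed
  have "(clus W e \<union> W) \<inter> (topspace \<Gamma> - W) = clus W e" using sub by blast
  then show "closedin (subtopology \<Gamma> (topspace \<Gamma> - W)) (clus W e)"
    using cl unfolding closedin_subtopology by metis
qed

text \<open>Edges whose midpoints lie in the same component are linked, because clusters are open
  and closed. Every component contains such a midpoint, so choosing one edge for each component
  gives enough representatives.\<close>

lemma representatives:
  assumes W: "W \<subseteq> Vs"
  obtains R where "R \<subseteq> E" "card R \<le> num_components_compl \<Gamma> W"
    "\<And>e. e \<in> E \<Longrightarrow> \<exists>r\<in>R. (e, r) \<in> linked edges_at (Vs - W)"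
proof -
  let ?Y = "subtopology \<Gamma> (topspace \<Gamma> - W)"
  define comp where "comp e = connected_component_of_set ?Y (c e (1/2))" for e
  have WV: "W \<subseteq> V" using W Vs by blast
  have eW: "e \<subseteq> topspace \<Gamma> - W" if "e \<in> E" for e using EU edge_V[OF that] WV that by blast
  have mid: "c e (1/2) \<in> topspace ?Y" if "e \<in> E" for e using c_in[OF that, of "1/2"] eW[OF that] by auto
  have same: "(e, e') \<in> linked edges_at (Vs - W)" if e: "e \<in> E" "e' \<in> E" "comp e = comp e'" for e e'
  proof -
    have me: "c e (1/2) \<in> clus W e" using clus_edge[OF e(1), of "1/2" W e] linked_refl by simp
    have "c e (1/2) \<in> comp e" unfolding comp_def using mid[OF e(1)] by (simp add: connected_component_of_refl)
    then have "comp e \<subseteq> clus W e" unfolding comp_def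
      by (intro connectedin_clopen[OF connectedin_connected_component_of clus_clopen(2,1)[OF W]]) (use me in auto)
    moreover have "c e' (1/2) \<in> comp e" 
    proof -
      have "c e' (1/2) \<in> comp e'" unfolding comp_def using mid[OF e(2)] by (simp add: connected_component_of_refl)
      then show ?thesis by (simp only: e(3))
    qed
    ultimately show ?thesis using clus_edge[OF e(2), of "1/2" W e] by auto
  qed
  have cover: "connected_components_of ?Y \<subseteq> comp ` E"
  proof
    fix C assume "C \<in> connected_components_of ?Y"
    then obtain p where p: "p \<in> topspace ?Y" "C = connected_component_of_set ?Y p" unfolding connected_components_of_def by blast
    have join: "C = comp e" if "connectedin \<Gamma> T" "T \<subseteq> topspace \<Gamma> - W" "p \<in> T" "c e (1/2) \<in> T" for T e
    proof -
      have "connectedin ?Y T" using that(1,2) by (simp add: connectedin_subtopology)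
      then have "connected_component_of ?Y p (c e (1/2))" using that(3,4) unfolding connected_component_of_def by blast
      then show ?thesis unfolding p(2) comp_def by (metis connected_component_of_equiv)
    qed
    from p(1) have "p \<in> topspace \<Gamma>" by simp
    then show "C \<in> comp ` E"
    proof (cases rule: point_cases)
      case 1
      then obtain h where h: "h \<in> halves p" using ends edges_at_halves by blast
      have e: "fst h \<in> E" by (rule halvesI(1)[OF h])
      let ?T = "hc h ` {0..1/2}"
      have "connectedin \<Gamma> ?T" by (rule hc_connected[OF h]) auto
      moreover have "?T \<subseteq> topspace \<Gamma> - W"
      proof
        fix q assume "q \<in> ?T"
        then obtain t where t: "q = hc h t" "0 \<le> t" "t \<le> 1/2" by auto
        show "q \<in> topspace \<Gamma> - W"
        proof (cases "t = 0")
          case True then show ?thesis using t(1) halvesI(2)[OF h] p(1) by simp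
        next
          case False then show ?thesis using hc_in[OF h, of t] t eW[OF e] by auto
        qed
      qed
      moreover have "p \<in> ?T" using halvesI(2)[OF h] by (intro image_eqI[of _ _ 0]) auto
      moreover have "c (fst h) (1/2) \<in> ?T" by (intro image_eqI[of _ _ "1/2"]) (auto simp: hc_def)
      ultimately have "C = comp (fst h)" by (rule join)
      then show ?thesis using e by blast
    next
      case (2 e t)
      have "connectedin \<Gamma> (c e ` {0<..<1})"
        by (rule connectedin_continuous_map_image[OF cont[OF 2(1)]]) (auto simp: connectedin_subtopology)
      then have ce: "connectedin \<Gamma> e" using im[OF 2(1)] by simp
      have "p \<in> e" "c e (1/2) \<in> e" using c_in[OF 2(1), of t] c_in[OF 2(1), of "1/2"] 2 by simp_all
      then have "C = comp e" by (rule join[OF ce eW[OF 2(1)]])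
      then show ?thesis using 2(1) by blast
    qed
  qed
  have "comp ` E \<subseteq> connected_components_of ?Y" unfolding comp_def connected_components_of_def using mid by blast
  then have num: "num_components_compl \<Gamma> W = card (comp ` E)" unfolding num_components_compl_def using cover by (simp add: subset_antisym)
  define R where "R = inv_into E comp ` comp ` E"
  show ?thesis
  proof
    show "R \<subseteq> E" unfolding R_def by (auto intro: inv_into_into)
    show "card R \<le> num_components_compl \<Gamma> W" unfolding R_def num by (rule card_image_le) (use finE in simp)
    fix e assume e: "e \<in> E"
    let ?r = "inv_into E comp (comp e)"
    have "?r \<in> E" "comp ?r = comp e" using inv_into_into[of "comp e" comp E] f_inv_into_f[of "comp e" comp E] e by simp_all
    then have "(e, ?r) \<in> linked edges_at (Vs - W)" using same[OF e, of ?r] by simp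
    then show "\<exists>r\<in>R. (e, r) \<in> linked edges_at (Vs - W)" unfolding R_def using e by blast
  qed
qed

text \<open>Otherwise \<open>W\<close>, with the edges at it and the outer ends of these edges,
  would be open and closed without being everything.\<close>

lemma crossing_edge:
  assumes W: "W \<subseteq> Vs" "W \<noteq> {}" "W \<noteq> Vs"
  shows "\<exists>w\<in>W. \<exists>u\<in>Vs - W. \<exists>f. f \<in> edges_at u \<and> f \<in> edges_at w"
proof (rule ccontr)
  assume "\<not> ?thesis"
  then have no: "\<not> (f \<in> edges_at u \<and> f \<in> edges_at w)" if "w \<in> W" "u \<in> Vs - W" for f u w
    using that by blast
  define D where "D = {e \<in> E. c e 0 \<in> W \<or> c e 1 \<in> W}"
  \<comment> \<open>The vertices outside \<open>Vs\<close> that are included are the leaves at the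
    far ends of edges from \<open>W\<close>.\<close>
  define K where "K = W \<union> \<Union>D \<union> {v \<in> V - Vs. \<exists>e\<in>D. e \<in> edges_at v}"
  have WV: "W \<subseteq> V" using W Vs by blast
  have DE: "D \<subseteq> E" by (auto simp: D_def)
  have "K = topspace \<Gamma>"
  proof (rule connected_clopen[OF con])
    show "K \<subseteq> topspace \<Gamma>" unfolding K_def using WV VT EU DE by blast
    show "K \<noteq> {}" unfolding K_def using W by blast
    fix e assume e: "e \<in> E"
    have inner: "c e t \<in> K \<longleftrightarrow> e \<in> D" if "0 < t" "t < 1" for t
    proof -
      have "c e t \<in> e' \<longleftrightarrow> e = e'" if "e' \<in> E" for e' by (rule edge_point[OF e that \<open>0 < t\<close> \<open>t < 1\<close>])
      then show ?thesis unfolding K_def using c_notV[OF e that] WV DE by blast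
    qed
    have outer: "c e t \<in> K \<longleftrightarrow> e \<in> D" if "t = 0 \<or> t = 1" for t
    proof -
      have v: "c e t \<in> V" "e \<in> edges_at (c e t)" using that c0[OF e] c1[OF e] edges_at_ends[OF e] by auto
      have ne: "c e t \<notin> e'" if "e' \<in> E" for e' using edge_V[OF that] v(1) by blast
      show ?thesis
      proof
        assume "c e t \<in> K"
        then consider "c e t \<in> W" | e' where "c e t \<in> V - Vs" "e' \<in> D" "e' \<in> edges_at (c e t)"
          unfolding K_def using ne DE by blast
        then show "e \<in> D"
        proof cases
          case 1 then show ?thesis using that e by (auto simp: D_def)
        next
          case 2 then show ?thesis using leafs[OF 2(1) 2(3) v(2)] by simp
        qed
      next
        assume eD: "e \<in> D"
        then obtain w where w: "w \<in> W" "e \<in> edges_at w" using e edges_at_ends[OF e] by (auto simp: D_def)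
        have "c e t \<notin> Vs - W" using no[OF w(1), of "c e t" e] w(2) v(2) by blast
        then show "c e t \<in> K" unfolding K_def using v eD by blast
      qed
    qed
    have "c e t \<in> K \<longleftrightarrow> e \<in> D" if "t \<in> {0..1}" for t
      using inner[of t] outer[of t] that by (cases "t = 0 \<or> t = 1") auto
    then show "(\<forall>t\<in>{0..1}. c e t \<in> K) \<or> (\<forall>t\<in>{0..1}. c e t \<notin> K)" by blast
  qed
  moreover obtain u where u: "u \<in> Vs - W" using W by blast
  moreover have "u \<notin> e" if "e \<in> E" for e using edge_V[OF that] u Vs by blast
  ultimately show False using VT Vs DE unfolding K_def by blast
qed

lemma few_classes:
  assumes ess: "\<And>v. v \<in> Vs \<Longrightarrow> 3 \<le> card (halves v)" and i: "i \<le> card Vs"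
    and bound: "\<And>W. W \<subseteq> Vs \<Longrightarrow> card W = i \<Longrightarrow> num_components_compl \<Gamma> W \<le> d" and d: "1 < d"
    and U: "U \<subseteq> Vs" "card (Vs - U) < i"
  shows "\<exists>R\<subseteq>E. card R \<le> d - 1 \<and> (\<forall>e\<in>E. \<exists>r\<in>R. (e, r) \<in> linked edges_at U)"
proof -
  let ?W = "Vs - U"
  have finVs: "finite Vs" using finite_subset[OF Vs finV] .
  have WU: "Vs - ?W = U" using U by blast
  show ?thesis
  proof (cases "?W = {}")
    case True
    obtain R where R: "R \<subseteq> E" "card R \<le> num_components_compl \<Gamma> ?W" "\<And>e. e \<in> E \<Longrightarrow> \<exists>r\<in>R. (e, r) \<in> linked edges_at (Vs - ?W)"
      by (rule representatives[of ?W]) auto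
    have "connected_components_of \<Gamma> \<subseteq> {topspace \<Gamma>}"
      using con connected_components_of_subset_sing by blast
    then have "num_components_compl \<Gamma> ?W \<le> 1" unfolding True num_components_compl_def
      using card_mono[of "{topspace \<Gamma>}"] by simp
    then have "card R \<le> d - 1" using R(2) d by simp
    then show ?thesis using R unfolding WU by blast
  next
    case False
    have "?W \<noteq> Vs" using i U by auto
    then obtain f u w where f: "w \<in> ?W" "u \<in> Vs - ?W" "f \<in> edges_at u" "f \<in> edges_at w"
      using crossing_edge[OF Diff_subset False] by blast
    have fE: "f \<in> E" using f(3) edges_at_V by blast
    have uU: "u \<in> U" and uw: "u \<noteq> w" using f by auto
    \<comment> \<open>Fewer than \<open>i\<close> vertices leave room for \<open>u\<close>; the set
      is then filled up to exactly \<open>i\<close> vertices, for which the bound \<open>d\<close>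
      is known.\<close>
    have "card (insert u ?W) \<le> i" using U(2) finVs f(2) by simp
    then obtain W' where W': "insert u ?W \<subseteq> W'" "W' \<subseteq> Vs" "card W' = i"
      using exists_subset_between[of "insert u ?W" i Vs] i finVs uU U(1) by auto
    obtain R where R: "R \<subseteq> E" "card R \<le> num_components_compl \<Gamma> W'" "\<And>e. e \<in> E \<Longrightarrow> \<exists>r\<in>R. (e, r) \<in> linked edges_at (Vs - W')"
      by (rule representatives[OF W'(2)]) auto
    have finR: "finite R" using finite_subset[OF R(1) finE] .
    have ends_f: "{c f 0, c f 1} = {u, w}" using f(3,4) uw by (auto simp: edges_at_def)
    have iso: "f \<notin> edges_at v" if "v \<in> Vs - W'" for v
    proof
      assume "f \<in> edges_at v"
      then have "v \<in> {c f 0, c f 1}" by (auto simp: edges_at_def)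
      then show False using that W'(1) f(1) unfolding ends_f by blast
    qed
    have mono: "linked edges_at (Vs - W') \<subseteq> linked edges_at U" by (rule linked_mono) (use W' in blast)
    \<comment> \<open>The edge \<open>f\<close> joins \<open>u\<close> to a different vertex, so it
      accounts for one half-edge at \<open>u\<close> only, and an essential vertex has at least
      three.\<close>
    obtain g where g: "g \<in> edges_at u" "g \<noteq> f"
    proof (rule ccontr)
      assume "\<not> thesis"
      then have "edges_at u \<subseteq> {f}" using that by blast
      then have sub: "halves u \<subseteq> {(f, False), (f, True)}" unfolding edges_at_halves by force
      have "(f, False) \<notin> halves u \<or> (f, True) \<notin> halves u" using ends_f uw by (auto simp: halves_def hc_def)
      then have "halves u \<subseteq> {(f, True)} \<or> halves u \<subseteq> {(f, False)}" using sub by blast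
      then have "card (halves u) \<le> 1" using card_mono[of "{(f, True)}" "halves u"] card_mono[of "{(f, False)}" "halves u"] by auto
      then show False using ess[of u] f(2) by simp
    qed
    \<comment> \<open>Both ends of \<open>f\<close> are removed, so it is linked to no other edge
      and has to represent itself.\<close>
    have fR: "f \<in> R"
    proof -
      obtain r where r: "r \<in> R" "(f, r) \<in> linked edges_at (Vs - W')" using R(3)[OF fE] by blast
      have "r = f" by (rule linked_isolated[OF linked_sym[OF r(2)] iso])
      then show ?thesis using r(1) by simp
    qed
    \<comment> \<open>An edge represented by \<open>f\<close> passes over to the representative of
      \<open>g\<close>: the edges \<open>f\<close> and \<open>g\<close> are linked through
      \<open>u\<close>, which belongs to \<open>U\<close>.\<close>
    have "\<exists>r\<in>R - {f}. (e, r) \<in> linked edges_at U" if e: "e \<in> E" for e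
    proof -
      obtain r where r: "r \<in> R" "(e, r) \<in> linked edges_at (Vs - W')" using R(3)[OF e] by blast
      show ?thesis
      proof (cases "r = f")
        case False then show ?thesis using r mono by blast
      next
        case True
        have gE: "g \<in> E" using g(1) edges_at_V by blast
        obtain r' where r': "r' \<in> R" "(g, r') \<in> linked edges_at (Vs - W')" using R(3)[OF gE] by blast
        have "r' \<noteq> f" using linked_isolated[of g f edges_at "Vs - W'"] r'(2) iso g(2) by blast
        moreover have "(e, r') \<in> linked edges_at U"
        proof -
          have "(e, f) \<in> linked edges_at U" using r(2) True mono by blast
          moreover have "(f, g) \<in> linked edges_at U" by (rule linked_step[of u U f edges_at g, OF uU f(3) g(1)])
          moreover have "(g, r') \<in> linked edges_at U" using r'(2) mono by blast
          ultimately show ?thesis by (meson linked_trans)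
        qed
        ultimately show ?thesis using r'(1) by blast
      qed
    qed
    moreover have "card (R - {f}) \<le> d - 1" using R(2) bound[OF W'(2,3)] fR finR by simp
    ultimately show ?thesis using R(1) by (intro exI[of _ "R - {f}"]) blast
  qed
qed

end

end

section \<open>Choice of characteristic maps, and the polynomial for the torsion of a graph\<close>

lemma graph_cw:
  assumes "graph \<Gamma> V E" shows "\<exists>c. cw \<Gamma> V E c"
proof -
  have "\<forall>e\<in>E. \<exists>c :: real \<Rightarrow> 'a. continuous_map (top_of_set {0..1}) \<Gamma> c \<and> c 0 \<in> V \<and> c 1 \<in> V \<and>
      embedding_map (top_of_set {0<..<1}) \<Gamma> c \<and> c ` {0<..<1} = e"
    using assms unfolding graph_def by blast
  from bchoice[OF this] obtain c :: "'a set \<Rightarrow> real \<Rightarrow> 'a" where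
    "\<forall>e\<in>E. continuous_map (top_of_set {0..1}) \<Gamma> (c e) \<and> c e 0 \<in> V \<and> c e 1 \<in> V \<and>
      embedding_map (top_of_set {0<..<1}) \<Gamma> (c e) \<and> c e ` {0<..<1} = e" ..
  note c = bspec[OF this]
  have "cw \<Gamma> V E c"
  proof
    show "e \<inter> e' = {}" if "e \<in> E" "e' \<in> E" "e \<noteq> e'" for e e'
      using assms that unfolding graph_def disjoint_def by blast
    show "inj_on (c e) {0<..<1}" if "e \<in> E" for e
      using c[OF that] unfolding embedding_map_def by (metis homeomorphic_imp_injective_map topspace_euclidean_subtopology)
  qed (use assms c in \<open>auto simp: graph_def\<close>)
  then show ?thesis by blast
qed

text \<open>A vertex without edges is open and closed, hence the whole space, in contradiction to
  \<open>w\<close>.\<close>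

lemma (in cw) edges_at_nonempty:
  assumes con: "connected_space \<Gamma>" and w: "w \<in> V" "halves w \<noteq> {}" and v: "v \<in> V"
  shows "edges_at v \<noteq> {}"
proof
  assume e: "edges_at v = {}"
  have "{v} = topspace \<Gamma>"
  proof (rule connected_clopen[OF con])
    show "{v} \<subseteq> topspace \<Gamma>" using v VT by blast
    fix f assume f: "f \<in> E"
    have "c f t \<noteq> v" if "t \<in> {0..1}" for t
    proof (cases "t = 0 \<or> t = 1")
      case True then show ?thesis using e edges_at_ends[OF f] by auto
    next
      case False then show ?thesis using c_notV[OF f, of t] v that by auto
    qed
    then show "(\<forall>t\<in>{0..1}. c f t \<in> {v}) \<or> (\<forall>t\<in>{0..1}. c f t \<notin> {v})" by blast
  qed simp
  then have "w = v" using w(1) VT by blast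
  then show False using w(2) e edges_at_halves[of v] by simp
qed

theorem corollary1p5:
  fixes \<Gamma> :: "'a topology" and V :: "'a set" and E :: "'a set set" and i p :: nat
  assumes "graph \<Gamma> V E"
    and "connected_space \<Gamma>"
    and "essential_vertices \<Gamma> V \<noteq> {}"
    and "max_components_compl \<Gamma> V i > 1"
    and "prime p"
  shows "\<exists>f :: rat poly. degree f < max_components_compl \<Gamma> V i - 1 \<and>
           (\<forall>\<^sub>F k in sequentially.
              real (card (torsion_part p (homology_group (int i) (unordered_config k \<Gamma>)))) =
              real p powr real_of_rat (poly f (of_nat k)))"
proof -
  let ?Vs = "essential_vertices \<Gamma> V" and ?d = "max_components_compl \<Gamma> V i"
  obtain c0 where "cw \<Gamma> V E c0" using graph_cw[OF assms(1)] by blast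
  moreover obtain w where w: "w \<in> V" "3 \<le> valence \<Gamma> w" using assms(3) by (auto simp: essential_vertices_def)
  \<comment> \<open>Passing to a cell structure without bivalent vertices: the operators on the two
    sides of such a vertex would otherwise be counted separately, although the edges belong to the
    same component.\<close>
  ultimately have "\<exists>V' E' c. cw \<Gamma> V' E' c \<and> (\<forall>v\<in>V'. valence \<Gamma> v \<noteq> 2) \<and> {v \<in> V'. 3 \<le> valence \<Gamma> v} = ?Vs"
    unfolding essential_vertices_def by (intro no_bivalent[OF _ assms(2)])
  then obtain V' E' c where cw: "cw \<Gamma> V' E' c" and two: "\<And>v. v \<in> V' \<Longrightarrow> valence \<Gamma> v \<noteq> 2"
    and Vs: "{v \<in> V'. 3 \<le> valence \<Gamma> v} = ?Vs"
    by blast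
  interpret cw \<Gamma> V' E' c by (rule cw)
  have VsV: "?Vs \<subseteq> V'" unfolding Vs[symmetric] by blast
  have ess: "3 \<le> card (halves v)" if "v \<in> ?Vs" for v using that valence_eq[of v] unfolding Vs[symmetric] by auto
  have w': "w \<in> ?Vs" using w by (simp add: essential_vertices_def)
  have ends: "edges_at v \<noteq> {}" if "v \<in> V'" for v
    
  proof (rule edges_at_nonempty[OF assms(2) _ _ that])
    show "w \<in> V'" using w' VsV by blast
    show "halves w \<noteq> {}" using ess[OF w'] by auto
  qed
  \<comment> \<open>With valence 2 removed, a vertex that is not essential has at most one
    half-edge.\<close>
  have leafs: "e = e'" if v: "v \<in> V' - ?Vs" and e: "e \<in> edges_at v" "e' \<in> edges_at v" for v e e'
  proof -
    have "v \<in> V'" using v by blast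
    then have "card (halves v) \<noteq> 2" "\<not> 3 \<le> card (halves v)"
      using v two[of v] valence_eq[of v] unfolding Vs[symmetric] by auto
    then have "card (halves v) \<le> Suc 0" by linarith
    then have "h = h'" if "h \<in> halves v" "h' \<in> halves v" for h h'
      using that unfolding card_le_Suc0_iff_eq[OF finite_halves] by (elim ballE) auto
    then show ?thesis using e unfolding edges_at_halves by blast
  qed
  have finVs: "finite ?Vs" by (rule finite_subset[OF VsV finV])
  let ?N = "{num_components_compl \<Gamma> W | W. W \<subseteq> ?Vs \<and> finite W \<and> card W = i}"
  have "?N \<subseteq> num_components_compl \<Gamma> ` Pow ?Vs" by blast
  then have finN: "finite ?N" using finVs by (meson finite_Pow_iff finite_imageI finite_subset)
  have bound: "num_components_compl \<Gamma> W \<le> ?d" if "W \<subseteq> ?Vs" "card W = i" for W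
    unfolding max_components_compl_def
  proof (rule cSup_upper)
    show "num_components_compl \<Gamma> W \<in> ?N" using that finite_subset[OF that(1) finVs] by blast
    show "bdd_above ?N" by (rule bdd_above_finite[OF finN])
  qed
  \<comment> \<open>The supremum of the empty set is 0, so the assumption that the maximum exceeds 1
    guarantees at least \<open>i\<close> essential vertices.\<close>
  have "?N \<noteq> {}" using assms(4) unfolding max_components_compl_def by (metis Sup_nat_empty not_one_less_zero)
  then obtain W0 where "W0 \<subseteq> ?Vs" "card W0 = i" by blast
  then have i: "i \<le> card ?Vs" using card_mono[OF finVs] by blast
  have few: "\<exists>R\<subseteq>E'. card R \<le> ?d - 1 \<and> (\<forall>e\<in>E'. \<exists>r\<in>R. (e, r) \<in> (\<Union>u\<in>U. edges_at u \<times> edges_at u)\<^sup>*)"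
    if "U \<subseteq> ?Vs" "card (?Vs - U) < i" for U
    using few_classes[OF assms(2) VsV ends leafs ess i bound assms(4) that] unfolding linked_def .
  obtain g where g: "polyev (?d - 1) g"
    "\<And>k. card (torsion_part p (homology_group (int i) (unordered_config k \<Gamma>))) = p ^ g k"
    using card_torsion_polynomial[OF ends assms(5) VsV few] by blast
  obtain f :: "rat poly" where f: "f = 0 \<or> degree f < ?d - 1" "\<forall>\<^sub>F k in sequentially. of_nat (g k) = poly f (of_nat k)"
    using g(1) unfolding polyev_def by blast
  \<comment> \<open>The zero polynomial has degree 0, which is admissible because \<open>?d\<close>
    exceeds 1.\<close>
  have "degree f < ?d - 1" using f(1) assms(4) by auto
  moreover have "\<forall>\<^sub>F k in sequentially. real (card (torsion_part p (homology_group (int i) (unordered_config k \<Gamma>))))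
      = real p powr real_of_rat (poly f (of_nat k))"
    using f(2)
  proof (rule eventually_mono)
    fix k assume "of_nat (g k) = poly f (of_nat k)"
    then have "real_of_rat (poly f (of_nat k)) = real (g k)" by (metis of_rat_of_nat_eq)
    then show "real (card (torsion_part p (homology_group (int i) (unordered_config k \<Gamma>)))) = real p powr real_of_rat (poly f (of_nat k))"
      using prime_gt_0_nat[OF assms(5)] by (simp add: g(2) powr_realpow)
  qed
  ultimately show ?thesis by blast
qed

end
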